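(* Let $\mathcal{C}$ be a non-unital C$^*$-algebra and let $J$ be a skew-symmetric linear transformation on $\mathbb{R}^n$. Then $\mathcal{B}_J^{\mathcal{C}}(\mathbb{R}^n)$ is an Arens-Michael $*$-algebra.
   Context: $\mathbb{N}=\{0,1,2,\dots\}$. For a C$^*$-algebra $\mathcal{C}$, $\mathcal{B}^{\mathcal{C}}(\mathbb{R}^n)$ is the space of smooth functions $f\colon\mathbb{R}^n\to\mathcal{C}$ which are bounded together with all their partial derivatives; it is a Fréchet space with the norms $\|f\|_{\mathcal{B}^{\mathcal{C}},m}=\max_{|\alpha|\leqslant m}\sup_{x\in\mathbb{R}^n}\|\partial^\alpha f(x)\|_{\mathcal{C}}$, $m\in\mathbb{N}$. $\mathcal{B}_J^{\mathcal{C}}(\mathbb{R}^n)$ is this Fréchet space with pointwise involution and Rieffel's deformed product $(f_1\times_J f_2)(x):=\int_{\mathbb{R}^n}\int_{\mathbb{R}^n}f_1(x+Ju)\,f_2(x+v)\,e^{2\pi i u\cdot v}\,dv\,du$, an oscillatory integral: $\int\int F(u,v)e^{2\pi i u\cdot v}dv\,du:=\lim_{m\to\infty}\int\int\phi(u/m,v/m)F(u,v)e^{2\pi i u\cdot v}dv\,du$ for any compactly supported smooth $\phi$ equal to $1$ near $0$. It is a Fréchet $*$-algebra, i.e. a $*$-algebra that is a metrizable complete locally convex space with continuous product and involution. A $*$-seminorm is a vector space seminorm $p$ with $p(b^* )=p(b)$; it is submultiplicative if $p(ab)\leqslant p(a)p(b)$. An Arens-Michael $*$-algebra is here a Fréchet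 $*$-algebra whose topology can be generated by a family of submultiplicative $*$-seminorms. *)

theory Defs
  imports "HOL-Analysis.Analysis"
begin

section \<open>C*-algebras\<close>

text \<open>Neither \<open>real_normed_algebra\<close> nor this class has a unit element among its operations:
  unital and non-unital C*-algebras are both covered.\<close>

class cstar_algebra = real_normed_algebra + banach +
  fixes scaleC :: "complex \<Rightarrow> 'a \<Rightarrow> 'a"  (infixr "*\<^sub>C" 75)
    and star :: "'a \<Rightarrow> 'a"
  assumes scaleC_add_right: "c *\<^sub>C (a + b) = c *\<^sub>C a + c *\<^sub>C b"
    and scaleC_add_left: "(c + d) *\<^sub>C a = c *\<^sub>C a + d *\<^sub>C a"
    and scaleC_scaleC: "c *\<^sub>C d *\<^sub>C a = (c * d) *\<^sub>C a"
    and scaleC_of_real: "complex_of_real r *\<^sub>C a = r *\<^sub>R a"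
    and scaleC_mult_left: "(c *\<^sub>C a) * b = c *\<^sub>C (a * b)"
    and scaleC_mult_right: "a * (c *\<^sub>C b) = c *\<^sub>C (a * b)"
    and norm_scaleC: "norm (c *\<^sub>C a) = cmod c * norm a"
    and star_add: "star (a + b) = star a + star b"
    and star_scaleC: "star (c *\<^sub>C a) = cnj c *\<^sub>C star a"
    and star_mult: "star (a * b) = star b * star a"
    and star_star: "star (star a) = a"
    and cstar_identity: "norm (star a * a) = (norm a)\<^sup>2"


section \<open>Arens-Michael *-algebras\<close>

locale star_algebra =
  fixes A :: "'a set"
    and zero :: "'a"
    and add :: "'a \<Rightarrow> 'a \<Rightarrow> 'a"
    and smul :: "complex \<Rightarrow> 'a \<Rightarrow> 'a"
    and mult :: "'a \<Rightarrow> 'a \<Rightarrow> 'a"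
    and invol :: "'a \<Rightarrow> 'a"
  assumes zero_closed: "zero \<in> A"
    and add_closed: "\<lbrakk>x \<in> A; y \<in> A\<rbrakk> \<Longrightarrow> add x y \<in> A"
    and smul_closed: "x \<in> A \<Longrightarrow> smul c x \<in> A"
    and mult_closed: "\<lbrakk>x \<in> A; y \<in> A\<rbrakk> \<Longrightarrow> mult x y \<in> A"
    and invol_closed: "x \<in> A \<Longrightarrow> invol x \<in> A"
    and add_assoc: "\<lbrakk>x \<in> A; y \<in> A; z \<in> A\<rbrakk> \<Longrightarrow> add (add x y) z = add x (add y z)"
    and add_commute: "\<lbrakk>x \<in> A; y \<in> A\<rbrakk> \<Longrightarrow> add x y = add y x"
    and add_zero: "x \<in> A \<Longrightarrow> add x zero = x"
    and add_inverse: "x \<in> A \<Longrightarrow> \<exists>y\<in>A. add x y = zero"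
    and smul_add: "\<lbrakk>x \<in> A; y \<in> A\<rbrakk> \<Longrightarrow> smul c (add x y) = add (smul c x) (smul c y)"
    and add_smul: "x \<in> A \<Longrightarrow> smul (c + d) x = add (smul c x) (smul d x)"
    and smul_smul: "x \<in> A \<Longrightarrow> smul c (smul d x) = smul (c * d) x"
    and smul_one: "x \<in> A \<Longrightarrow> smul 1 x = x"
    and mult_assoc: "\<lbrakk>x \<in> A; y \<in> A; z \<in> A\<rbrakk> \<Longrightarrow> mult (mult x y) z = mult x (mult y z)"
    and mult_add_left: "\<lbrakk>x \<in> A; y \<in> A; z \<in> A\<rbrakk> \<Longrightarrow> mult (add x y) z = add (mult x z) (mult y z)"
    and mult_add_right: "\<lbrakk>x \<in> A; y \<in> A; z \<in> A\<rbrakk> \<Longrightarrow> mult x (add y z) = add (mult x y) (mult x z)"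
    and mult_smul_left: "\<lbrakk>x \<in> A; y \<in> A\<rbrakk> \<Longrightarrow> mult (smul c x) y = smul c (mult x y)"
    and mult_smul_right: "\<lbrakk>x \<in> A; y \<in> A\<rbrakk> \<Longrightarrow> mult x (smul c y) = smul c (mult x y)"
    and invol_add: "\<lbrakk>x \<in> A; y \<in> A\<rbrakk> \<Longrightarrow> invol (add x y) = add (invol x) (invol y)"
    and invol_smul: "x \<in> A \<Longrightarrow> invol (smul c x) = smul (cnj c) (invol x)"
    and invol_mult: "\<lbrakk>x \<in> A; y \<in> A\<rbrakk> \<Longrightarrow> invol (mult x y) = mult (invol y) (invol x)"
    and invol_invol: "x \<in> A \<Longrightarrow> invol (invol x) = x"
begin

abbreviation diff :: "'a \<Rightarrow> 'a \<Rightarrow> 'a"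
  where "diff x y \<equiv> add x (smul (-1) y)"

definition convex_subset :: "'a set \<Rightarrow> bool"
  where "convex_subset V \<longleftrightarrow> V \<subseteq> A \<and>
    (\<forall>x\<in>V. \<forall>y\<in>V. \<forall>t::real. 0 \<le> t \<and> t \<le> 1 \<longrightarrow>
      add (smul (of_real (1 - t)) x) (smul (of_real t) y) \<in> V)"

definition is_seminorm :: "('a \<Rightarrow> real) \<Rightarrow> bool"
  where "is_seminorm p \<longleftrightarrow>
    (\<forall>x\<in>A. 0 \<le> p x) \<and>
    (\<forall>x\<in>A. \<forall>y\<in>A. p (add x y) \<le> p x + p y) \<and>
    (\<forall>c. \<forall>x\<in>A. p (smul c x) = cmod c * p x)"

definition is_star_seminorm :: "('a \<Rightarrow> real) \<Rightarrow> bool"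
  where "is_star_seminorm p \<longleftrightarrow> is_seminorm p \<and> (\<forall>x\<in>A. p (invol x) = p x)"

definition submultiplicative :: "('a \<Rightarrow> real) \<Rightarrow> bool"
  where "submultiplicative p \<longleftrightarrow> (\<forall>x\<in>A. \<forall>y\<in>A. p (mult x y) \<le> p x * p y)"

end

text \<open>The set \<open>A\<close> itself is added to the generating family only so that the underlying set of
  the topology is \<open>A\<close> also when \<open>P\<close> is empty.\<close>

definition seminorm_topology ::
    "'a set \<Rightarrow> ('a \<Rightarrow> 'a \<Rightarrow> 'a) \<Rightarrow> (complex \<Rightarrow> 'a \<Rightarrow> 'a) \<Rightarrow> ('a \<Rightarrow> real) set \<Rightarrow> 'a topology"
  where "seminorm_topology A add smul P =
    topology_generated_by
      (insert A {{y \<in> A. p (add y (smul (-1) x)) < e} | p x e. p \<in> P \<and> x \<in> A \<and> 0 < e})"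

text \<open>Completeness can be expressed through Cauchy sequences, in the sense of the uniformity of
  the topological vector space, because the topology is metrizable.\<close>

locale frechet_star_algebra = star_algebra A zero add smul mult invol
  for A :: "'a set" and zero add smul mult invol +
  fixes T :: "'a topology"
  assumes topspace_eq: "topspace T = A"
    and continuous_add: "continuous_map (prod_topology T T) T (\<lambda>(x, y). add x y)"
    and continuous_smul: "continuous_map (prod_topology euclidean T) T (\<lambda>(c, x). smul c x)"
    and continuous_mult: "continuous_map (prod_topology T T) T (\<lambda>(x, y). mult x y)"
    and continuous_invol: "continuous_map T T invol"
    and locally_convex: "\<lbrakk>openin T U; zero \<in> U\<rbrakk> \<Longrightarrow>
      \<exists>V W. openin T W \<and> zero \<in> W \<and> W \<subseteq> V \<and> V \<subseteq> U \<and> convex_subset V"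
    and metrizable: "metrizable_space T"
    and complete: "\<lbrakk>\<And>k. \<sigma> k \<in> A;
        \<And>U. \<lbrakk>openin T U; zero \<in> U\<rbrakk> \<Longrightarrow> \<exists>N::nat. \<forall>k\<ge>N. \<forall>l\<ge>N. diff (\<sigma> k) (\<sigma> l) \<in> U\<rbrakk> \<Longrightarrow>
      \<exists>x\<in>A. limitin T \<sigma> x sequentially"

locale arens_michael_star_algebra = frechet_star_algebra A zero add smul mult invol T
  for A :: "'a set" and zero add smul mult invol T +
  assumes generated_by_submultiplicative_star_seminorms:
    "\<exists>P. (\<forall>p\<in>P. is_star_seminorm p \<and> submultiplicative p) \<and> T = seminorm_topology A add smul P"


section \<open>Smooth bounded functions\<close>

text \<open>\<open>partial_derivs [b\<^sub>1, \<dots>, b\<^sub>k] f\<close> is the iterated partial derivative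
  of \<open>f\<close> in the coordinate directions \<open>b\<^sub>1, \<dots>, b\<^sub>k \<in> Basis\<close>. For smooth \<open>f\<close> it does not depend on
  the order of the list, so that lists of length \<open>k\<close> represent the multi-indices \<open>\<alpha>\<close> with
  \<open>\<bar>\<alpha>\<bar> = k\<close>.\<close>

primrec partial_derivs ::
    "'a::euclidean_space list \<Rightarrow> ('a \<Rightarrow> 'b::real_normed_vector) \<Rightarrow> 'a \<Rightarrow> 'b"
  where
    "partial_derivs [] f = f"
  | "partial_derivs (b # bs) f = (\<lambda>x. frechet_derivative (partial_derivs bs f) (at x) b)"

definition smooth :: "('a::euclidean_space \<Rightarrow> 'b::real_normed_vector) \<Rightarrow> bool"
  where "smooth f \<longleftrightarrow>
    (\<forall>bs. set bs \<subseteq> Basis \<longrightarrow> partial_derivs bs f differentiable_on UNIV)"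

definition bdd_smooth :: "('a::euclidean_space \<Rightarrow> 'b::real_normed_vector) set"
  where "bdd_smooth =
    {f. smooth f \<and> (\<forall>bs. set bs \<subseteq> Basis \<longrightarrow> bounded (range (partial_derivs bs f)))}"

definition bdd_smooth_norm :: "nat \<Rightarrow> ('a::euclidean_space \<Rightarrow> 'b::real_normed_vector) \<Rightarrow> real"
  where "bdd_smooth_norm m f =
    Max ((\<lambda>bs. SUP x. norm (partial_derivs bs f x)) ` {bs. set bs \<subseteq> Basis \<and> length bs \<le> m})"

definition bdd_smooth_topology :: "('a::euclidean_space \<Rightarrow> 'c::cstar_algebra) topology"
  where "bdd_smooth_topology =
    seminorm_topology bdd_smooth (\<lambda>f g x. f x + g x) (\<lambda>c f x. c *\<^sub>C f x) (range bdd_smooth_norm)"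


section \<open>Rieffel's deformed product\<close>

definition cutoff :: "('a::euclidean_space \<Rightarrow> complex) \<Rightarrow> bool"
  where "cutoff \<phi> \<longleftrightarrow>
    smooth \<phi> \<and> compact (closure {z. \<phi> z \<noteq> 0}) \<and> (\<forall>\<^sub>F z in nhds 0. \<phi> z = 1)"

definition has_osc_integral ::
    "('a::euclidean_space \<Rightarrow> 'a \<Rightarrow> 'c::cstar_algebra) \<Rightarrow> 'c \<Rightarrow> bool"
  where "has_osc_integral F I \<longleftrightarrow>
    (\<forall>\<phi>. cutoff \<phi> \<longrightarrow>
      (\<lambda>m. integral UNIV (\<lambda>u. integral UNIV (\<lambda>v.
          (\<phi> (u /\<^sub>R real m, v /\<^sub>R real m) * exp (2 * pi * \<i> * (u \<bullet> v))) *\<^sub>C F u v)))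
        \<longlonglongrightarrow> I)"

definition osc_integral :: "('a::euclidean_space \<Rightarrow> 'a \<Rightarrow> 'c::cstar_algebra) \<Rightarrow> 'c"
  where "osc_integral F = (THE I. has_osc_integral F I)"

definition rieffel_prod ::
    "('a::euclidean_space \<Rightarrow> 'a) \<Rightarrow> ('a \<Rightarrow> 'c::cstar_algebra) \<Rightarrow> ('a \<Rightarrow> 'c) \<Rightarrow> 'a \<Rightarrow> 'c"
  where "rieffel_prod J f g x = osc_integral (\<lambda>u v. f (x + J u) * g (x + v))"

end

theory Submission
  imports Defs
begin

text \<open>Write \<open>L f\<close> for left multiplication by \<open>f\<close> in the deformed algebra. On a suitable Banach space
  of functions containing the bounded smooth ones, here the Wiener amalgam space normed by the local
  Fourier coefficients, \<open>L f\<close> is bounded, with norm dominated by finitely many derivatives of \<open>f\<close>: it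
  maps each atom of a Gabor expansion to a function whose coefficients decay fast away from
  those of the atom. The operator norm of \<open>L\<close>, made symmetric under the involution, is submultiplicative
  since the product is associative, and it dominates the supremum norm. Partial derivatives are
  derivations of the deformed product, so that adding the values on derivatives preserves
  submultiplicativity (the cross terms only help) and yields a generating family of seminorms.

  Associativity and the compatibility with the involution hold by computation for
  trigonometric polynomials with coefficients in the C*-algebra. These are dense for pointwise
  convergence with bounded derivatives, a mode of convergence under which the oscillatory integral
  is continuous.\<close>

section \<open>Functions with bounded derivatives\<close>

text \<open>The direct estimate of the deformed product spends derivatives of both factors, so by
  itself it bounds \<open>L f\<close> in none of the norms \<open>bdd_smooth_norm m\<close>. The
  amalgam norm avoids the loss in the second factor: its atoms are a fixed tile times a plane wave,
  and a plane wave in the second factor merely translates the first factor and passes outside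
  (\<open>tp_pw_right\<close>). Translations leave bounds on derivatives alone, hence the estimate
  of an atom is uniform in its frequency and only derivatives of \<open>f\<close> are spent. With no
  unit in the C*-algebra, \<open>L f\<close> cannot be tested on the constant function 1; the norm
  of \<open>f\<close> itself is therefore put into the supremum that defines \<open>opn\<close>.
  Trigonometric polynomials are not dense in the Frechet topology, as their uniform limits are
  almost periodic; this is why a weaker mode of convergence is used for the algebraic identities.
  Oscillatory integrals are handled as absolutely convergent lattice sums over a smooth partition of
  unity, so that their estimates and limits are those of series.\<close>

definition pd :: "'a::euclidean_space \<Rightarrow> ('a \<Rightarrow> 'b::real_normed_vector) \<Rightarrow> 'a \<Rightarrow> 'b"
  where "pd b f x = frechet_derivative f (at x) b"

text \<open>One constant bounds all orders up to \<open>m\<close>, which keeps inductions on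
  \<open>m\<close> short. Bounds are asked only on \<open>X\<close>, differentiability everywhere,
  so that \<open>X\<close> can be a cube or a single point. The recursion peels off the innermost
  derivative: rules for one derivative extend to all orders by induction with \<open>f\<close>
  generalised.\<close>

primrec bder :: "'a::euclidean_space set \<Rightarrow> nat \<Rightarrow> real \<Rightarrow> ('a \<Rightarrow> 'b::real_normed_vector) \<Rightarrow> bool"
  where
    "bder X 0 M f \<longleftrightarrow> (\<forall>x. f differentiable at x) \<and> (\<forall>x\<in>X. norm (f x) \<le> M)"
  | "bder X (Suc m) M f \<longleftrightarrow> (\<forall>x. f differentiable at x) \<and> (\<forall>x\<in>X. norm (f x) \<le> M) \<and>
       (\<forall>b\<in>Basis. bder X m M (pd b f))"

lemma bder_differentiable: "bder X m M f \<Longrightarrow> f differentiable at x"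
  by (cases m) auto

lemma bder_bound: "bder X m M f \<Longrightarrow> x \<in> X \<Longrightarrow> norm (f x) \<le> M"
  by (cases m) auto

lemma bder_nonneg: "bder UNIV m M f \<Longrightarrow> 0 \<le> M"
  using bder_bound[of UNIV m M f undefined] norm_ge_zero order_trans by blast

lemma bder_pd: "bder X (Suc m) M f \<Longrightarrow> b \<in> Basis \<Longrightarrow> bder X m M (pd b f)"
  by simp

lemma bder_SucI:
  assumes "\<And>x. f differentiable at x" "\<And>x. x \<in> X \<Longrightarrow> norm (f x) \<le> M"
    and "\<And>b. b \<in> Basis \<Longrightarrow> bder X m M (pd b f)"
  shows "bder X (Suc m) M f"
  using assms by auto

lemma bder_mono:
  assumes "bder X m M f" "X' \<subseteq> X" "m' \<le> m" "M \<le> M'"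
  shows "bder X' m' M' f"
  using assms
proof (induction m' arbitrary: m f)
  case 0
  then show ?case
    using bder_bound[OF 0(1)] bder_differentiable[OF 0(1)] by fastforce
next
  case (Suc m')
  then obtain m1 where m: "m = Suc m1" "m' \<le> m1" by (cases m) auto
  show ?case
  proof (rule bder_SucI)
    show "f differentiable at x" for x using bder_differentiable[OF Suc.prems(1)] .
    show "norm (f x) \<le> M'" if "x \<in> X'" for x
      using bder_bound[OF Suc.prems(1), of x] that Suc.prems by auto
    show "bder X' m' M' (pd b f)" if "b \<in> Basis" for b
      using Suc.IH[of m1 "pd b f"] Suc.prems m that by auto
  qed
qed

lemma bder_subset: "bder X m M f \<Longrightarrow> X' \<subseteq> X \<Longrightarrow> bder X' m M f"
  by (rule bder_mono) auto

lemma bder_le: "bder X m M f \<Longrightarrow> M \<le> M' \<Longrightarrow> bder X m M' f"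
  by (rule bder_mono) auto

lemma bder_max: "bder X m M f \<Longrightarrow> bder X m (max N M) f"
  by (rule bder_le) auto

lemma bder_less: "bder X m M f \<Longrightarrow> m' \<le> m \<Longrightarrow> bder X m' M f"
  by (rule bder_mono) auto

lemma bder_UN: "bder (\<Union>i\<in>I. X i) m M f \<longleftrightarrow> (\<forall>i\<in>I. bder (X i) m M f)" if "I \<noteq> {}"
  using that by (induction m arbitrary: f) auto

text \<open>Reduces a global bound to bounds at single points, where constants varying with the
  point, such as multiples of \<open>wt (x - a)\<close>, can be summed first.\<close>

lemma bder_pointwise: "bder UNIV m M f \<longleftrightarrow> (\<forall>x. bder {x} m M f)"
  using bder_UN[of UNIV "\<lambda>x. {x}" m M f] by simp

lemma pd_eqI: "(f has_derivative f') (at x) \<Longrightarrow> pd b f x = f' b"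
  unfolding pd_def by (simp add: frechet_derivative_at[symmetric])

lemma bder_has_derivative:
  assumes "bder X m M f"
  shows "(f has_derivative (\<lambda>h. \<Sum>b\<in>Basis. (h \<bullet> b) *\<^sub>R pd b f x)) (at x)"
proof -
  have d: "(f has_derivative frechet_derivative f (at x)) (at x)"
    using bder_differentiable[OF assms] frechet_derivative_works by blast
  interpret bounded_linear "frechet_derivative f (at x)"
    by (rule has_derivative_bounded_linear[OF d])
  have "frechet_derivative f (at x) = (\<lambda>h. \<Sum>b\<in>Basis. (h \<bullet> b) *\<^sub>R pd b f x)"
  proof
    fix h :: 'a
    have "frechet_derivative f (at x) h = frechet_derivative f (at x) (\<Sum>b\<in>Basis. (h \<bullet> b) *\<^sub>R b)"
      by (simp add: euclidean_representation)
    also have "\<dots> = (\<Sum>b\<in>Basis. (h \<bullet> b) *\<^sub>R pd b f x)"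
      by (simp add: sum scaleR pd_def)
    finally show "frechet_derivative f (at x) h = (\<Sum>b\<in>Basis. (h \<bullet> b) *\<^sub>R pd b f x)" .
  qed
  with d show ?thesis by simp
qed

lemma bder_continuous_on: "bder X m M f \<Longrightarrow> continuous_on S f"
  using bder_has_derivative[of X m M f]
  by (meson continuous_at_imp_continuous_on has_derivative_continuous)

lemma bder_bounded_linear:
  fixes f :: "'a::euclidean_space \<Rightarrow> 'b::real_normed_vector" and L :: "'b \<Rightarrow> 'c::real_normed_vector"
  assumes L: "bounded_linear L" and K: "\<And>y. norm (L y) \<le> K * norm y" and "0 \<le> K"
    and f: "bder X m M f"
  shows "bder X m (K * M) (\<lambda>x. L (f x))"
    and "\<And>b. pd b (\<lambda>x. L (f x)) = (\<lambda>x. L (pd b f x))"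
proof -
  have pdL: "pd b (\<lambda>x. L (g x)) = (\<lambda>x. L (pd b g x))" if "bder X k M g" for b k and g :: "'a \<Rightarrow> 'b"
  proof
    fix x
    have "(g has_derivative frechet_derivative g (at x)) (at x)"
      using bder_differentiable[OF that] frechet_derivative_works by blast
    from pd_eqI[OF bounded_linear.has_derivative[OF L this]]
    show "pd b (\<lambda>x. L (g x)) x = L (pd b g x)" by (simp add: pd_def)
  qed
  have d: "(\<lambda>x. L (g x)) differentiable at x" if "bder X k M g" for x k and g :: "'a \<Rightarrow> 'b"
    using bounded_linear.has_derivative[OF L bder_has_derivative[OF that]]
    unfolding differentiable_def by blast
  have n: "norm (L (g x)) \<le> K * M" if "bder X k M g" "x \<in> X" for x k and g :: "'a \<Rightarrow> 'b"
    using K[of "g x"] bder_bound[OF that] \<open>0 \<le> K\<close> by (meson mult_left_mono order_trans)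
  show "bder X m (K * M) (\<lambda>x. L (f x))"
    using f
  proof (induction m arbitrary: f)
    case 0
    with d[OF 0] n[OF 0] show ?case by auto
  next
    case (Suc m)
    with d[OF Suc.prems] n[OF Suc.prems] pdL[OF Suc.prems] show ?case
      by (intro bder_SucI) auto
  qed
  show "\<And>b. pd b (\<lambda>x. L (f x)) = (\<lambda>x. L (pd b f x))"
    using pdL f by blast
qed

lemma pd_add:
  assumes "f differentiable at x" "g differentiable at x"
  shows "pd b (\<lambda>x. f x + g x) x = pd b f x + pd b g x"
  using pd_eqI[OF has_derivative_add, of f _ x g] assms[unfolded frechet_derivative_works]
  by (fastforce simp: pd_def)

lemma bder_add:
  assumes "bder X m M f" "bder X m M' g"
  shows "bder X m (M + M') (\<lambda>x. f x + g x)"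
  using assms
proof (induction m arbitrary: f g)
  case 0
  then show ?case by (auto intro: norm_triangle_mono)
next
  case (Suc m)
  have "pd b (\<lambda>x. f x + g x) = (\<lambda>x. pd b f x + pd b g x)" for b
    using Suc.prems pd_add by fastforce
  with Suc show ?case by (intro bder_SucI) (auto intro: norm_triangle_mono)
qed

lemma bder_const:
  fixes X :: "'a::euclidean_space set" and c :: "'b::real_normed_vector"
  shows "bder X m (norm c) (\<lambda>x. c)"
proof (induction m arbitrary: c)
  case (Suc m)
  have "pd b (\<lambda>x. c) = (\<lambda>x. 0)" for b :: 'a using pd_eqI has_derivative_const by fastforce
  moreover have "bder X m (norm c) (\<lambda>x. 0::'b)"
    using Suc[of 0] by (rule bder_le) auto
  ultimately show ?case by (intro bder_SucI) auto
qed auto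

lemma bder_zero: "0 \<le> M \<Longrightarrow> bder X m M (\<lambda>x. 0)"
  using bder_const[of X m 0] bder_le by fastforce

lemma bder_scaleR:
  "bder X m M f \<Longrightarrow> bder X m (\<bar>c\<bar> * M) (\<lambda>x. c *\<^sub>R f x)"
  by (rule bder_bounded_linear(1)) (auto intro: bounded_linear_scaleR_right)

lemma bder_minus: "bder X m M f \<Longrightarrow> bder X m M (\<lambda>x. - f x)"
  using bder_scaleR[of X m M f "-1"] by simp

lemma bder_diff: "bder X m M f \<Longrightarrow> bder X m M' g \<Longrightarrow> bder X m (M + M') (\<lambda>x. f x - g x)"
  using bder_add[OF _ bder_minus] by fastforce

lemma bder_sum:
  assumes "finite I" "\<And>i. i \<in> I \<Longrightarrow> bder X m (M i) (f i)"
  shows "bder X m (\<Sum>i\<in>I. M i) (\<lambda>x. \<Sum>i\<in>I. f i x)"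
  using assms
  by (induction I rule: finite_induct) (auto simp: bder_zero bder_add)

lemma pd_bilinear:
  assumes B: "bounded_bilinear pr" and "f differentiable at x" "g differentiable at x"
  shows "pd b (\<lambda>x. pr (f x) (g x)) x = pr (f x) (pd b g x) + pr (pd b f x) (g x)"
  using pd_eqI[OF bounded_bilinear.FDERIV[OF B assms(2,3)[unfolded frechet_derivative_works]]]
  by (simp add: pd_def)

text \<open>By the Leibniz rule a derivative of order \<open>m\<close> expands into at most
  \<open>2 ^ m\<close> terms: both summands of the product rule satisfy the induction hypothesis
  with unchanged constants, so each order doubles the bound.\<close>

lemma bder_bilinear:
  fixes f :: "'a::euclidean_space \<Rightarrow> 'b::real_normed_vector" and g :: "'a \<Rightarrow> 'c::real_normed_vector"
  assumes B: "bounded_bilinear pr" and K: "\<And>x y. norm (pr x y) \<le> K * norm x * norm y" "0 \<le> K"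
    and "bder X m M f" "bder X m M' g"
  shows "bder X m (2 ^ m * K * M * M') (\<lambda>x. pr (f x) (g x))"
  using assms(4,5)
proof (induction m arbitrary: f g)
  case 0
  show ?case
  proof (simp, intro conjI allI ballI)
    fix x show "(\<lambda>x. pr (f x) (g x)) differentiable at x"
      using bounded_bilinear.FDERIV[OF B bder_has_derivative[OF 0(1)] bder_has_derivative[OF 0(2)]]
      unfolding differentiable_def by blast
  next
    fix x assume "x \<in> X"
    then have n: "norm (f x) \<le> M" "norm (g x) \<le> M'" using 0 by auto
    have "0 \<le> M" using n norm_ge_zero order_trans by blast
    then have "K * norm (f x) * norm (g x) \<le> K * M * M'"
      using n K(2) by (intro mult_mono) auto
    then show "norm (pr (f x) (g x)) \<le> K * M * M'" using K(1) order_trans by blast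
  qed
next
  case (Suc m)
  have p: "pd b (\<lambda>x. pr (f x) (g x)) = (\<lambda>x. pr (f x) (pd b g x) + pr (pd b f x) (g x))" for b
    using pd_bilinear[OF B] Suc.prems by fastforce
  show ?case
  proof (rule bder_SucI)
    fix x show "(\<lambda>x. pr (f x) (g x)) differentiable at x"
      using bounded_bilinear.FDERIV[OF B bder_has_derivative[OF Suc.prems(1)] bder_has_derivative[OF Suc.prems(2)]]
      unfolding differentiable_def by blast
  next
    fix x assume x: "x \<in> X"
    then have n: "norm (f x) \<le> M" "norm (g x) \<le> M'" using Suc.prems by auto
    have nn: "0 \<le> M" "0 \<le> M'" using n norm_ge_zero order_trans by blast+
    have "0 \<le> M" using n norm_ge_zero order_trans by blast
    then have "K * norm (f x) * norm (g x) \<le> K * M * M'"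
      using n K(2) by (intro mult_mono) auto
    also have "\<dots> \<le> 2 ^ Suc m * (K * M * M')"
    proof -
      have "1 * (K * M * M') \<le> 2 ^ Suc m * (K * M * M')"
        using nn K(2) by (intro mult_right_mono one_le_power) auto
      then show ?thesis by simp
    qed
    finally show "norm (pr (f x) (g x)) \<le> 2 ^ Suc m * K * M * M'" using K(1) order_trans
      by (metis mult.assoc)
  next
    fix b :: 'a assume "b \<in> Basis"
    then have "bder X m (2 ^ m * K * M * M' + 2 ^ m * K * M * M')
        (\<lambda>x. pr (f x) (pd b g x) + pr (pd b f x) (g x))"
      using Suc.prems bder_less[OF Suc.prems(1)] bder_less[OF Suc.prems(2)]
      by (intro bder_add Suc.IH) auto
    then show "bder X m (2 ^ Suc m * K * M * M') (pd b (\<lambda>x. pr (f x) (g x)))"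
      by (simp add: p algebra_simps)
  qed
qed

section \<open>Affine substitutions and increments\<close>

lemma pd_affine:
  fixes A :: "'z::euclidean_space \<Rightarrow> 'a::euclidean_space"
  assumes "bder X m M f" "linear A"
  shows "pd b (\<lambda>z. f (p + A z)) = (\<lambda>z. \<Sum>c\<in>Basis. (A b \<bullet> c) *\<^sub>R pd c f (p + A z))"
    "(\<lambda>z. f (p + A z)) differentiable at z"
proof -
  have d: "((\<lambda>z. f (p + A z)) has_derivative (\<lambda>h. \<Sum>c\<in>Basis. (A h \<bullet> c) *\<^sub>R pd c f (p + A z))) (at z)" for z
  proof -
    have "((\<lambda>z. p + A z) has_derivative A) (at z)"
      using assms(2) by (auto intro!: derivative_eq_intros linear_imp_has_derivative)
    from has_derivative_compose[OF this bder_has_derivative[OF assms(1)]] show ?thesis .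
  qed
  show "pd b (\<lambda>z. f (p + A z)) = (\<lambda>z. \<Sum>c\<in>Basis. (A b \<bullet> c) *\<^sub>R pd c f (p + A z))"
    using pd_eqI[OF d] by blast
  show "(\<lambda>z. f (p + A z)) differentiable at z" using d unfolding differentiable_def by blast
qed

text \<open>Each partial derivative of the composite is a combination of composed partial
  derivatives of \<open>f\<close> whose coefficients have total size at most \<open>R\<close>; every
  order therefore costs one factor \<open>R\<close>.\<close>

lemma bder_affine:
  fixes A :: "'z::euclidean_space \<Rightarrow> 'a::euclidean_space"
  assumes A: "linear A" and R: "\<And>b. b \<in> Basis \<Longrightarrow> (\<Sum>c\<in>Basis. \<bar>A b \<bullet> c\<bar>) \<le> R" "1 \<le> R"
    and "bder X m M f" and Y: "\<And>z. z \<in> Y \<Longrightarrow> p + A z \<in> X"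
  shows "bder Y m (R ^ m * M) (\<lambda>z. f (p + A z))"
  using assms(4)
proof (induction m arbitrary: f)
  case 0
  then show ?case using pd_affine(2)[OF 0 A] bder_bound[OF 0 Y] by auto
next
  case (Suc m)
  show ?case
  proof (rule bder_SucI)
    show "(\<lambda>z. f (p + A z)) differentiable at z" for z using pd_affine(2)[OF Suc.prems A] .
  next
    fix z assume "z \<in> Y"
    then have n: "norm (f (p + A z)) \<le> M" using bder_bound[OF Suc.prems Y] by blast
    then have "0 \<le> M" using norm_ge_zero order_trans by blast
    then have "1 * M \<le> R ^ Suc m * M" using R(2) by (intro mult_right_mono one_le_power) auto
    with n show "norm (f (p + A z)) \<le> R ^ Suc m * M" by linarith
  next
    fix b :: 'z assume b: "b \<in> Basis"
    show "bder Y m (R ^ Suc m * M) (pd b (\<lambda>z. f (p + A z)))"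
    \<comment> \<open>Without a point of \<open>Y\<close> the number \<open>M\<close> may be
      negative, and the comparison with \<open>R ^ Suc m * M\<close> would fail; but then every
      constant is a bound.\<close>
    proof (cases "Y = {}")
      case True
      have "bder Y m (\<Sum>c\<in>Basis. \<bar>A b \<bullet> c\<bar> * (R ^ m * M)) (pd b (\<lambda>z. f (p + A z)))"
        unfolding pd_affine(1)[OF Suc.prems A]
        using Suc.prems by (intro bder_sum bder_scaleR Suc.IH) auto
      moreover have "bder {} m M1 g \<Longrightarrow> bder {} m M2 g" for M1 M2 and g :: "'z \<Rightarrow> 'b"
        by (induction m arbitrary: g) auto
      ultimately show ?thesis using True by blast
    next
      case False
      then obtain z where "z \<in> Y" by auto
      then have "norm (f (p + A z)) \<le> M" using bder_bound[OF Suc.prems Y] by blast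
      then have M: "0 \<le> M" using norm_ge_zero order_trans by blast
      have "bder Y m (\<Sum>c\<in>Basis. \<bar>A b \<bullet> c\<bar> * (R ^ m * M)) (pd b (\<lambda>z. f (p + A z)))"
        unfolding pd_affine(1)[OF Suc.prems A]
        using Suc.prems by (intro bder_sum bder_scaleR Suc.IH) auto
      moreover have "(\<Sum>c\<in>Basis. \<bar>A b \<bullet> c\<bar> * (R ^ m * M)) \<le> R ^ Suc m * M"
        using mult_right_mono[OF R(1)[OF b], of "R ^ m * M"] M R(2)
        by (simp add: sum_distrib_right mult.assoc)
      ultimately show ?thesis using bder_le by blast
    qed
  qed
qed

lemma bder_translate:
  assumes "bder X m M f" "\<And>z. z \<in> Y \<Longrightarrow> z + p \<in> X"
  shows "bder Y m M (\<lambda>z. f (z + p))"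
proof -
  have "(\<Sum>c\<in>Basis. \<bar>b \<bullet> c\<bar>) \<le> 1" if "b \<in> Basis" for b :: 'a
  proof -
    have "(\<Sum>c\<in>Basis. \<bar>b \<bullet> c\<bar>) = (\<Sum>c\<in>Basis. if c = b then 1 else 0)"
      using that by (intro sum.cong) (auto simp: inner_Basis)
    then show ?thesis using that by (simp add: sum.delta)
  qed
  from bder_affine[OF linear_id this order_refl assms(1), of Y p] assms(2)
  show ?thesis by (simp add: add.commute)
qed

lemma linear_Basis_bound:
  fixes A :: "'z::euclidean_space \<Rightarrow> 'a::euclidean_space"
  obtains R where "1 \<le> R" "\<And>b. b \<in> Basis \<Longrightarrow> (\<Sum>c\<in>Basis. \<bar>A b \<bullet> c\<bar>) \<le> R"
proof
  let ?R = "1 + (\<Sum>b\<in>Basis. \<Sum>c\<in>Basis. \<bar>A b \<bullet> c\<bar>)"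
  show "1 \<le> ?R" by (simp add: sum_nonneg)
  fix b :: 'z assume "b \<in> Basis"
  then have "(\<Sum>c\<in>Basis. \<bar>A b \<bullet> c\<bar>) \<le> (\<Sum>b\<in>Basis. \<Sum>c\<in>Basis. \<bar>A b \<bullet> c\<bar>)"
    by (intro member_le_sum) (auto intro: sum_nonneg)
  then show "(\<Sum>c\<in>Basis. \<bar>A b \<bullet> c\<bar>) \<le> ?R" by simp
qed

lemma pd_translate: 
  assumes "bder X m M f"
  shows "pd b (\<lambda>z. f (z + p)) = (\<lambda>z. pd b f (z + p))"
proof
  fix z
  have "((\<lambda>z. z + p) has_derivative (\<lambda>h. h)) (at z)" by (auto intro!: derivative_eq_intros)
  from has_derivative_compose[OF this bder_differentiable[OF assms, unfolded frechet_derivative_works]]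
  have "((\<lambda>z. f (z + p)) has_derivative frechet_derivative f (at (z + p))) (at z)" .
  from pd_eqI[OF this] show "pd b (\<lambda>z. f (z + p)) z = pd b f (z + p)" by (simp add: pd_def)
qed

lemma bder_lipschitz:
  fixes f :: "'a::euclidean_space \<Rightarrow> 'b::real_normed_vector"
  assumes "bder UNIV (Suc m) M f"
  shows "norm (f x - f y) \<le> real DIM('a) * M * norm (x - y)"
proof (rule differentiable_bound[where f' = "\<lambda>x h. \<Sum>b\<in>Basis. (h \<bullet> b) *\<^sub>R pd b f x" and S = UNIV])
  show "(f has_derivative (\<lambda>h. \<Sum>b\<in>Basis. (h \<bullet> b) *\<^sub>R pd b f x)) (at x within UNIV)" for x
    using bder_has_derivative[OF assms] .
  have M: "norm (pd b f x) \<le> M" if "b \<in> Basis" for b x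
    using bder_bound[OF bder_pd[OF assms that], of x] by simp
  show "onorm (\<lambda>h. \<Sum>b\<in>Basis. (h \<bullet> b) *\<^sub>R pd b f x) \<le> real DIM('a) * M" for x
  proof (rule onorm_le)
    fix h :: 'a
    have "norm (\<Sum>b\<in>Basis. (h \<bullet> b) *\<^sub>R pd b f x) \<le> (\<Sum>b\<in>(Basis::'a set). norm h * M)"
      using M by (intro sum_norm_le) (auto intro!: mult_mono Basis_le_norm)
    then show "norm (\<Sum>b\<in>Basis. (h \<bullet> b) *\<^sub>R pd b f x) \<le> real DIM('a) * M * norm h"
      by (simp add: mult_ac)
  qed
qed auto

text \<open>The mean value inequality for \<open>f\<close> and its derivatives, at the price of one
  order. Difference quotients thus have bounds independent of the increment, as \<open>sconv\<close>
  requires.\<close>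

lemma bder_increment:
  fixes f :: "'a::euclidean_space \<Rightarrow> 'b::real_normed_vector"
  assumes "bder UNIV (Suc m) M f"
  shows "bder UNIV m (real DIM('a) * M * norm h) (\<lambda>x. f (x + h) - f x)"
  using assms
proof (induction m arbitrary: f)
  case 0
  then show ?case
    using bder_lipschitz[OF 0, of "x + h" x for x] bder_translate[OF 0, of UNIV h] by fastforce
next
  case (Suc m)
  have t: "bder UNIV (Suc (Suc m)) M (\<lambda>x. f (x + h))"
    by (rule bder_translate[OF Suc.prems]) auto
  show ?case
  proof (rule bder_SucI)
    show "(\<lambda>x. f (x + h) - f x) differentiable at x" for x
      using bder_differentiable[OF t] bder_differentiable[OF Suc.prems] by (rule differentiable_diff)
    show "norm (f (x + h) - f x) \<le> real DIM('a) * M * norm h" for x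
      using bder_lipschitz[OF Suc.prems, of "x + h" x] by simp
    fix b :: 'a assume b: "b \<in> Basis"
    have "pd b (\<lambda>x. f (x + h) - f x) = (\<lambda>x. pd b f (x + h) - pd b f x)"
      using pd_translate[OF Suc.prems, of b h]
        pd_add[OF bder_differentiable[OF t] bder_differentiable[OF bder_minus[OF Suc.prems]], of b]
        bder_bounded_linear(2)[OF bounded_linear_minus[OF bounded_linear_ident] _ _ Suc.prems, of 1 b]
      by (auto simp: fun_eq_iff)
    moreover have "bder UNIV (Suc m) M (pd b f)" using Suc.prems b by (rule bder_pd)
    ultimately show "bder UNIV m (real DIM('a) * M * norm h) (pd b (\<lambda>x. f (x + h) - f x))"
      using Suc.IH by metis
  qed
qed

section \<open>The Frechet space in terms of \<open>bder\<close>\<close>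

lemma bder_iff_partial_derivs:
  "bder X m M f \<longleftrightarrow> (\<forall>bs. set bs \<subseteq> Basis \<and> length bs \<le> m \<longrightarrow>
     (\<forall>x. partial_derivs bs f differentiable at x) \<and> (\<forall>x\<in>X. norm (partial_derivs bs f x) \<le> M))"
proof (induction m arbitrary: f)
  case (Suc m)
  \<comment> \<open>\<open>partial_derivs\<close> puts the head of the list outermost, whereas
    \<open>bder\<close> peels off the innermost derivative, which is the last element of the
    list.\<close>
  have app: "partial_derivs (bs @ [b]) f = partial_derivs bs (pd b f)" for bs b
    by (induction bs) (simp_all add: pd_def[abs_def])
  show ?case (is "_ \<longleftrightarrow> (\<forall>bs. ?P bs)")
  proof safe
    fix bs assume *: "bder X (Suc m) M f" "set bs \<subseteq> (Basis::'a set)" "length bs \<le> Suc m"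
    show "partial_derivs bs f differentiable at x" for x
      using * app Suc.IH by (cases bs rule: rev_cases) auto
    show "norm (partial_derivs bs f x) \<le> M" if "x \<in> X" for x
      using * app Suc.IH that by (cases bs rule: rev_cases) auto
  next
    assume *: "\<forall>bs. ?P bs"
    show "bder X (Suc m) M f"
    proof (rule bder_SucI)
      show "f differentiable at x" for x using *[rule_format, of "[]"] by auto
      show "norm (f x) \<le> M" if "x \<in> X" for x using *[rule_format, of "[]"] that by auto
      fix b :: 'a assume b: "b \<in> Basis"
      show "bder X m M (pd b f)" unfolding Suc.IH app[symmetric]
        using * b by auto
    qed
  qed
qed auto

lemma bdd_smooth_iff: "f \<in> bdd_smooth \<longleftrightarrow> (\<forall>m. \<exists>M. bder UNIV m M f)"
proof safe
  fix m assume f: "f \<in> bdd_smooth"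
  have fin: "finite {bs::'a list. set bs \<subseteq> Basis \<and> length bs \<le> m}"
    by (rule finite_lists_length_le) simp
  have "\<exists>M. \<forall>x. norm (partial_derivs bs f x) \<le> M" if "set bs \<subseteq> Basis" for bs
    using f that unfolding bdd_smooth_def bounded_iff by auto
  then obtain M where M: "\<And>bs x. set bs \<subseteq> Basis \<Longrightarrow> norm (partial_derivs bs f x) \<le> M bs"
    by metis
  have "norm (partial_derivs bs f x) \<le> (\<Sum>bs | set bs \<subseteq> Basis \<and> length bs \<le> m. M bs)"
    if "set bs \<subseteq> Basis \<and> length bs \<le> m" for bs x
  proof -
    have "M bs \<le> (\<Sum>bs | set bs \<subseteq> Basis \<and> length bs \<le> m. M bs)"
      using that fin by (intro member_le_sum) (auto intro: order_trans[OF norm_ge_zero M])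
    then show ?thesis using M[of bs x] that by auto
  qed
  moreover have "partial_derivs bs f differentiable at x" if "set bs \<subseteq> Basis" for bs x
    using f that unfolding bdd_smooth_def smooth_def differentiable_on_def by auto
  ultimately show "\<exists>M. bder UNIV m M f" unfolding bder_iff_partial_derivs by blast
next
  assume *: "\<forall>m. \<exists>M. bder UNIV m M f"
  show "f \<in> bdd_smooth"
    unfolding bdd_smooth_def smooth_def differentiable_on_def bounded_iff
  proof (intro CollectI conjI allI impI ballI)
    fix bs :: "'a list" assume bs: "set bs \<subseteq> Basis"
    obtain M where M: "bder UNIV (length bs) M f" using * by blast
    then have D: "partial_derivs bs f differentiable at x" "norm (partial_derivs bs f x) \<le> M" for x
      using bs unfolding bder_iff_partial_derivs by auto
    show "partial_derivs bs f differentiable at x" for x using D by blast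
    show "\<exists>a. \<forall>y\<in>range (partial_derivs bs f). norm y \<le> a" using D by blast
  qed
qed

lemma bdd_smoothE:
  assumes "f \<in> bdd_smooth" obtains M where "bder UNIV m M f"
  using assms bdd_smooth_iff by blast

text \<open>Turns inequalities for the Frechet norms into statements about \<open>bder\<close> and
  back, so that the maximum and supremum in their definition need not be touched again.\<close>

lemma bder_bdd_smooth_norm:
  assumes f: "f \<in> bdd_smooth"
  shows "bder UNIV m M f \<longleftrightarrow> bdd_smooth_norm m f \<le> M"
proof -
  have fin: "finite {bs::'a list. set bs \<subseteq> Basis \<and> length bs \<le> m}"
    by (rule finite_lists_length_le) simp
  have ne: "{bs::'a list. set bs \<subseteq> Basis \<and> length bs \<le> m} \<noteq> {}" by (auto intro!: exI[of _ "[]"])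
  have d: "partial_derivs bs f differentiable at x" if "set bs \<subseteq> Basis" for bs x
    using f that unfolding bdd_smooth_def smooth_def differentiable_on_def by auto
  have bdd: "bdd_above (range (\<lambda>x. norm (partial_derivs bs f x)))" if bs: "set bs \<subseteq> Basis" for bs
  proof -
    have "bounded (range (partial_derivs bs f))" using f bs unfolding bdd_smooth_def by simp
    then obtain a where "\<forall>y\<in>range (partial_derivs bs f). norm y \<le> a" unfolding bounded_iff by blast
    then show ?thesis by (intro bdd_aboveI[of _ a]) auto
  qed
  have "bdd_smooth_norm m f \<le> M \<longleftrightarrow>
    (\<forall>bs. set bs \<subseteq> Basis \<and> length bs \<le> m \<longrightarrow> (SUP x. norm (partial_derivs bs f x)) \<le> M)"
    unfolding bdd_smooth_norm_def using fin ne by (subst Max_le_iff) auto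
  also have "\<dots> \<longleftrightarrow> (\<forall>bs. set bs \<subseteq> Basis \<and> length bs \<le> m \<longrightarrow> (\<forall>x. norm (partial_derivs bs f x) \<le> M))"
    using bdd by (auto simp: cSUP_le_iff)
  finally show ?thesis unfolding bder_iff_partial_derivs using d by auto
qed

lemma bdd_smooth_differentiable: "f \<in> bdd_smooth \<Longrightarrow> f differentiable at x"
  by (erule bdd_smoothE[of f 0]) (rule bder_differentiable)

lemma bdd_smooth_continuous_on: "f \<in> bdd_smooth \<Longrightarrow> continuous_on S f"
  by (erule bdd_smoothE[of f 0]) (rule bder_continuous_on)

lemma bdd_smooth_bounded:
  assumes "f \<in> bdd_smooth" obtains M where "\<And>x. norm (f x) \<le> M"
proof -
  obtain M where "bder UNIV 0 M f" using assms by (rule bdd_smoothE)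
  then show ?thesis using that[of M] by simp
qed

lemma bdd_smooth_const: "(\<lambda>x. c) \<in> bdd_smooth"
  unfolding bdd_smooth_iff by (intro allI exI) (rule bder_const)

lemma bdd_smooth_compose2:
  assumes "f \<in> bdd_smooth" "g \<in> bdd_smooth"
    and "\<And>m M M'. bder UNIV m M f \<Longrightarrow> bder UNIV m M' g \<Longrightarrow> bder UNIV m (N m M M') h"
  shows "h \<in> bdd_smooth"
  unfolding bdd_smooth_iff
proof
  fix m
  obtain M M' where "bder UNIV m M f" "bder UNIV m M' g"
    using assms(1,2) by (auto elim!: bdd_smoothE)
  from assms(3)[OF this] show "\<exists>M. bder UNIV m M h" ..
qed

lemma bdd_smooth_add: "f \<in> bdd_smooth \<Longrightarrow> g \<in> bdd_smooth \<Longrightarrow> (\<lambda>x. f x + g x) \<in> bdd_smooth"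
  by (erule (1) bdd_smooth_compose2) (erule (1) bder_add)

lemma bdd_smooth_diff: "f \<in> bdd_smooth \<Longrightarrow> g \<in> bdd_smooth \<Longrightarrow> (\<lambda>x. f x - g x) \<in> bdd_smooth"
  by (erule (1) bdd_smooth_compose2) (erule (1) bder_diff)

lemma bdd_smooth_minus: "f \<in> bdd_smooth \<Longrightarrow> (\<lambda>x. - f x) \<in> bdd_smooth"
  using bdd_smooth_diff[OF bdd_smooth_const[of 0], of f] by simp

lemma bdd_smooth_sum:
  "(\<And>i. i \<in> I \<Longrightarrow> f i \<in> bdd_smooth) \<Longrightarrow> (\<lambda>x. \<Sum>i\<in>I. f i x) \<in> bdd_smooth"
  by (induction I rule: infinite_finite_induct) (auto simp: bdd_smooth_const bdd_smooth_add)

lemma bdd_smooth_bilinear: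
  assumes B: "bounded_bilinear pr" and "f \<in> bdd_smooth" "g \<in> bdd_smooth"
  shows "(\<lambda>x. pr (f x) (g x)) \<in> bdd_smooth"
proof -
  obtain K where "0 \<le> K" and K: "\<And>x y. norm (pr x y) \<le> norm x * norm y * K"
    using bounded_bilinear.nonneg_bounded[OF B] by blast
  then have "\<And>x y. norm (pr x y) \<le> K * norm x * norm y" by (simp add: mult_ac)
  note bl = bder_bilinear[OF B this \<open>0 \<le> K\<close>]
  show ?thesis by (rule bdd_smooth_compose2[OF assms(2,3)]) (rule bl)
qed

lemmas bdd_smooth_mult = bdd_smooth_bilinear[OF bounded_bilinear_mult]

lemma bdd_smooth_bounded_linear:
  assumes L: "bounded_linear L" and "f \<in> bdd_smooth"
  shows "(\<lambda>x. L (f x)) \<in> bdd_smooth"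
proof -
  obtain K where "0 \<le> K" and K: "\<And>x. norm (L x) \<le> norm x * K"
    using bounded_linear.nonneg_bounded[OF L] by blast
  then have "\<And>x. norm (L x) \<le> K * norm x" by (simp add: mult_ac)
  note bl = bder_bounded_linear(1)[OF L this \<open>0 \<le> K\<close>]
  show ?thesis by (rule bdd_smooth_compose2[OF assms(2,2)]) (rule bl)
qed

lemma bdd_smooth_prod:
  fixes f :: "'i \<Rightarrow> 'a::euclidean_space \<Rightarrow> 'b::{real_normed_algebra, comm_monoid_mult}"
  shows "(\<And>i. i \<in> I \<Longrightarrow> f i \<in> bdd_smooth) \<Longrightarrow> (\<lambda>x. \<Prod>i\<in>I. f i x) \<in> bdd_smooth"
  by (induction I rule: infinite_finite_induct) (auto simp: bdd_smooth_const bdd_smooth_mult)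

lemma bdd_smooth_affine:
  assumes "linear A" "f \<in> bdd_smooth"
  shows "(\<lambda>z. f (p + A z)) \<in> bdd_smooth"
proof -
  obtain R where "1 \<le> R" "\<And>b. b \<in> Basis \<Longrightarrow> (\<Sum>c\<in>Basis. \<bar>A b \<bullet> c\<bar>) \<le> R"
    by (rule linear_Basis_bound[where A = A]) blast
  note bl = bder_affine[OF assms(1) this(2,1), of UNIV _ _ f UNIV p]
  show ?thesis by (rule bdd_smooth_compose2[OF assms(2,2)]) (rule bl; simp)
qed

lemma bdd_smooth_linear: "linear A \<Longrightarrow> f \<in> bdd_smooth \<Longrightarrow> (\<lambda>z. f (A z)) \<in> bdd_smooth"
  using bdd_smooth_affine[of A f 0] by simp

lemma bdd_smooth_translate: "f \<in> bdd_smooth \<Longrightarrow> (\<lambda>z. f (z + p)) \<in> bdd_smooth"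
  using bdd_smooth_affine[OF linear_id, of f p] by (simp add: add.commute)

lemma bdd_smooth_pd: "f \<in> bdd_smooth \<Longrightarrow> b \<in> Basis \<Longrightarrow> pd b f \<in> bdd_smooth"
  unfolding bdd_smooth_iff by (metis bder.simps(2))

text \<open>A derivative of the inverse is, up to sign, the product of the inverse, a derivative of
  \<open>f\<close> and the inverse again, so a bound of order \<open>m\<close> for the inverse
  yields one of order \<open>Suc m\<close>.\<close>

lemma bdd_smooth_inverse:
  fixes f :: "'a::euclidean_space \<Rightarrow> real"
  assumes f: "f \<in> bdd_smooth" and c: "0 < c" "\<And>x. c \<le> f x"
  shows "(\<lambda>x. inverse (f x)) \<in> bdd_smooth"
proof -
  have nz: "f x \<noteq> 0" for x using c(2)[of x] c(1) by auto
  have d: "((\<lambda>x. inverse (f x)) has_derivative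
      (\<lambda>h. - (inverse (f x) * frechet_derivative f (at x) h * inverse (f x)))) (at x)" for x
    by (rule Deriv.has_derivative_inverse[OF nz
          bdd_smooth_differentiable[OF f, of x, unfolded frechet_derivative_works]])
  have dd: "(\<lambda>x. inverse (f x)) differentiable at x" for x
    using d unfolding differentiable_def by blast
  have n: "norm (inverse (f x)) \<le> inverse c" for x
    using c(2)[of x] c(1) by (simp add: le_imp_inverse_le)
  have p: "pd b (\<lambda>x. inverse (f x)) = (\<lambda>x. - (inverse (f x) * pd b f x * inverse (f x)))" for b
    using pd_eqI[OF d] by (simp add: pd_def fun_eq_iff)
  have "\<exists>M. bder UNIV m M (\<lambda>x. inverse (f x))" for m
  proof (induction m)
    case 0
    with dd n show ?case by auto
  next
    case (Suc m)
    then obtain M where M: "bder UNIV m M (\<lambda>x. inverse (f x))" by blast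
    obtain M' where M': "bder UNIV (Suc m) M' f" using f bdd_smoothE by blast
    have mult: "bder UNIV m (2 ^ m * 1 * A * B) (\<lambda>x. u x * v x)"
      if "bder UNIV m A u" "bder UNIV m B v" for A B and u v :: "'a \<Rightarrow> real"
      by (rule bder_bilinear[OF bounded_bilinear_mult _ _ that]) (auto simp: abs_mult)
    have "bder UNIV m (2 ^ m * 1 * (2 ^ m * 1 * M * M') * M) (pd b (\<lambda>x. inverse (f x)))"
      if "b \<in> Basis" for b
      unfolding p using that M' by (intro bder_minus mult M bder_pd)
    then have "bder UNIV (Suc m) (max (inverse c) (2 ^ m * 1 * (2 ^ m * 1 * M * M') * M)) (\<lambda>x. inverse (f x))"
      using dd n by (intro bder_SucI) (auto simp: le_max_iff_disj bder_max)
    then show ?case ..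
  qed
  then show ?thesis unfolding bdd_smooth_iff by blast
qed

section \<open>Plane waves, bump functions and lattice sums\<close>

definition pw :: "'a::euclidean_space \<Rightarrow> 'a \<Rightarrow> complex"
  where "pw p x = cis (2 * pi * (p \<bullet> x))"

lemma norm_pw [simp]: "cmod (pw p x) = 1"
  by (simp add: pw_def)

lemma pw_0 [simp]: "pw 0 x = 1" "pw p 0 = 1"
  by (simp_all add: pw_def)

lemma pw_add: "pw p (x + y) = pw p x * pw p y" "pw (p + q) x = pw p x * pw q x"
  by (simp_all add: pw_def cis_mult algebra_simps inner_add_left inner_add_right)

lemma pw_minus: "pw (- p) x = cnj (pw p x)" "pw p (- x) = cnj (pw p x)"
  by (simp_all add: pw_def cis_cnj)

lemma pw_diff: "pw p (x - y) = pw p x * cnj (pw p y)" "pw (p - q) x = pw p x * cnj (pw q x)"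
  using pw_add(1)[of p x "- y"] pw_add(2)[of p "- q" x] by (simp_all add: pw_minus)

lemma pw_has_derivative:
  "(pw p has_derivative (\<lambda>h. 2 * pi * \<i> * (p \<bullet> h) * pw p x)) (at x)"
proof -
  have "((\<lambda>x. 2 * pi * (p \<bullet> x)) has_derivative (\<lambda>h. 2 * pi * (p \<bullet> h))) (at x)"
    by (auto intro!: derivative_eq_intros)
  from has_derivative_cis[OF this] show ?thesis
    by (simp add: pw_def[abs_def] scaleR_conv_of_real mult_ac)
qed

lemma pd_pw: "pd b (pw p) = (\<lambda>x. 2 * pi * \<i> * (p \<bullet> b) * pw p x)"
  using pd_eqI[OF pw_has_derivative] by blast

lemma bder_pw:
  fixes p :: "'a::euclidean_space"
  shows "bder X m ((1 + 2 * pi * norm p) ^ m) (pw p)"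
proof (induction m)
  case (Suc m)
  show ?case
  proof (rule bder_SucI)
    show "pw p differentiable at x" for x using pw_has_derivative unfolding differentiable_def by blast
    show "cmod (pw p x) \<le> (1 + 2 * pi * norm p) ^ Suc m" for x
      unfolding norm_pw by (rule one_le_power) simp
    fix b :: 'a assume b: "b \<in> Basis"
    have "bder X m (cmod (2 * pi * \<i> * (p \<bullet> b)) * (1 + 2 * pi * norm p) ^ m) (pd b (pw p))"
      unfolding pd_pw by (rule bder_bounded_linear(1)[OF bounded_linear_mult_right _ _ Suc]) (auto simp: norm_mult)
    moreover have "cmod (2 * pi * \<i> * (p \<bullet> b)) \<le> 1 + 2 * pi * norm p"
    proof -
      have "cmod (2 * pi * \<i> * (p \<bullet> b)) = 2 * pi * \<bar>p \<bullet> b\<bar>" by (simp add: norm_mult abs_mult)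
      also have "\<dots> \<le> 2 * pi * norm p" using Basis_le_norm[OF b, of p] by (intro mult_left_mono) auto
      finally show ?thesis by linarith
    qed
    ultimately show "bder X m ((1 + 2 * pi * norm p) ^ Suc m) (pd b (pw p))"
      by (elim bder_le) (auto intro!: mult_right_mono)
  qed
qed (auto simp: pw_has_derivative intro!: differentiableI[OF pw_has_derivative])

lemma bdd_smooth_pw: "pw p \<in> bdd_smooth"
  unfolding bdd_smooth_iff using bder_pw by blast

subsection \<open>Bump functions\<close>

text \<open>\<open>flat 1\<close> is the classical smooth function \<open>exp (- (1 / x))\<close>
  extended by 0. The polynomial factor closes the family under differentiation: with t = 1/x, the
  derivative of p(t) exp(-t) with respect to x is t^2 (p - p')(t) exp(-t).\<close>

definition flat :: "real poly \<Rightarrow> real \<Rightarrow> real"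
  where "flat p x = (if 0 < x then poly p (1 / x) * exp (- (1 / x)) else 0)"

lemma poly_exp_bounded:
  fixes p :: "real poly"
  obtains C where "0 \<le> C" "\<And>t. 0 < t \<Longrightarrow> \<bar>poly p t\<bar> * exp (- t) \<le> C"
proof
  \<comment> \<open>From \<open>t / k \<le> exp (t / k)\<close>, raised to the power
    \<open>k\<close>.\<close>
  have pow: "t ^ k * exp (- t) \<le> real k ^ k" if "0 < t" for t :: real and k
  proof (cases "k = 0")
    case False
    have "(t / k) ^ k \<le> exp (t / k) ^ k"
      using that exp_ge_add_one_self[of "t / k"] by (intro power_mono) (linarith, simp)
    also have "\<dots> = exp t" using False by (simp flip: exp_of_nat_mult)
    finally have "t ^ k / real k ^ k \<le> exp t" by (simp only: power_divide)
    then have "t ^ k \<le> exp t * real k ^ k" using False by (simp add: pos_divide_le_eq)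
    then have "t ^ k * exp (- t) \<le> (exp t * real k ^ k) * exp (- t)" by (intro mult_right_mono) auto
    also have "\<dots> = real k ^ k" by (simp add: exp_minus)
    finally show ?thesis .
  qed (use that in auto)
  show "0 \<le> (\<Sum>i\<le>degree p. \<bar>coeff p i\<bar> * real i ^ i)" by (intro sum_nonneg) auto
  fix t :: real assume t: "0 < t"
  have "\<bar>poly p t\<bar> * exp (- t) \<le> (\<Sum>i\<le>degree p. \<bar>coeff p i * t ^ i\<bar>) * exp (- t)"
    unfolding poly_altdef by (intro mult_right_mono sum_abs) auto
  also have "\<dots> = (\<Sum>i\<le>degree p. \<bar>coeff p i\<bar> * (t ^ i * exp (- t)))"
    using t unfolding sum_distrib_right by (intro sum.cong refl) (simp add: abs_mult)
  also have "\<dots> \<le> (\<Sum>i\<le>degree p. \<bar>coeff p i\<bar> * real i ^ i)"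
    using t by (intro sum_mono mult_left_mono pow) auto
  finally show "\<bar>poly p t\<bar> * exp (- t) \<le> (\<Sum>i\<le>degree p. \<bar>coeff p i\<bar> * real i ^ i)" .
qed

lemma flat_bounded: obtains C where "0 \<le> C" "\<And>x. \<bar>flat p x\<bar> \<le> C"
proof -
  obtain C where "0 \<le> C" "\<And>t. 0 < t \<Longrightarrow> \<bar>poly p t\<bar> * exp (- t) \<le> C"
    by (rule poly_exp_bounded[of p]) blast
  then show ?thesis using that[of C] by (auto simp: flat_def abs_mult)
qed

definition flat_deriv :: "real poly \<Rightarrow> real poly"
  where "flat_deriv p = pCons 0 (pCons 0 (p - pderiv p))"

lemma flat_has_derivative: "(flat p has_real_derivative flat (flat_deriv p) x) (at x)"
proof -
  consider "0 < x" | "x < 0" | "x = 0" by linarith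
  then show ?thesis
  proof cases
    case 1
    have inv: "((\<lambda>x. 1 / x) has_real_derivative - (1 / x\<^sup>2)) (at x)"
      using 1 by (auto intro!: derivative_eq_intros simp: power2_eq_square)
    have "((\<lambda>x. poly p (1 / x) * exp (- (1 / x))) has_real_derivative
        poly (pderiv p) (1 / x) * - (1 / x\<^sup>2) * exp (- (1 / x)) +
        (exp (- (1 / x)) * - (- (1 / x\<^sup>2))) * poly p (1 / x)) (at x)"
      by (intro DERIV_mult DERIV_chain2[OF poly_DERIV inv] DERIV_chain2[OF DERIV_exp DERIV_minus[OF inv]])
    moreover have "poly (pderiv p) (1 / x) * - (1 / x\<^sup>2) * exp (- (1 / x)) +
        (exp (- (1 / x)) * - (- (1 / x\<^sup>2))) * poly p (1 / x) = flat (flat_deriv p) x"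
      using 1 by (simp add: flat_def flat_deriv_def power2_eq_square algebra_simps diff_divide_distrib)
    ultimately have "((\<lambda>x. poly p (1 / x) * exp (- (1 / x))) has_real_derivative flat (flat_deriv p) x) (at x)"
      by simp
    then show ?thesis
      by (rule has_field_derivative_transform_within_open[where S = "{0<..}"]) (use 1 in \<open>simp_all add: flat_def\<close>)
  next
    case 2
    have "((\<lambda>x. 0) has_real_derivative flat (flat_deriv p) x) (at x)"
      using 2 by (simp add: flat_def)
    then show ?thesis
      by (rule has_field_derivative_transform_within_open[where S = "{..<0}"]) (use 2 in \<open>simp_all add: flat_def\<close>)
  next
    case 3
    \<comment> \<open>With the polynomial multiplied by the square of its variable, the quotient
      \<open>flat p y / y\<close> is \<open>y\<close> times a bounded function for positive
      \<open>y\<close>; so the difference quotient at 0 is at most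
      \<open>C * \<bar>y\<bar>\<close>.\<close>
    obtain C where C: "\<And>x. \<bar>flat (pCons 0 (pCons 0 p)) x\<bar> \<le> C" by (rule flat_bounded) blast
    have b: "\<bar>flat p y / y\<bar> \<le> C * \<bar>y\<bar>" for y
    proof (cases "0 < y")
      case True
      then have "flat p y / y = flat (pCons 0 (pCons 0 p)) y * y" by (simp add: flat_def field_simps)
      then show ?thesis using mult_right_mono[OF C, of "\<bar>y\<bar>" y] by (simp add: abs_mult)
    next
      case False
      then have "flat p y = 0" by (simp add: flat_def)
      moreover have "0 \<le> C * \<bar>y\<bar>" using order_trans[OF abs_ge_zero C[of 0]] by simp
      ultimately show ?thesis by simp
    qed
    have "(\<lambda>y. C * \<bar>y\<bar>) \<midarrow>0\<rightarrow> C * \<bar>0\<bar>" by (intro tendsto_intros)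
    then have lim: "(\<lambda>y. C * \<bar>y\<bar>) \<midarrow>0\<rightarrow> 0" by simp
    have "(\<lambda>y. flat p y / y) \<midarrow>0\<rightarrow> 0"
      by (rule Lim_null_comparison[OF always_eventually[OF allI] lim]) (simp only: real_norm_def b)
    then show ?thesis using 3 by (simp add: DERIV_def flat_def)
  qed
qed

lemma flat_bdd_smooth: "flat p \<in> bdd_smooth"
proof -
  have d: "(flat p has_derivative (\<lambda>h. flat (flat_deriv p) x * h)) (at x)" for p x
    using flat_has_derivative by (simp add: has_field_derivative_def)
  have "\<exists>M. bder UNIV m M (flat p)" for m
  proof (induction m arbitrary: p)
    case 0
    obtain C where "\<And>x. \<bar>flat p x\<bar> \<le> C" by (rule flat_bounded) blast
    then show ?case using differentiableI[OF d] by auto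
  next
    case (Suc m)
    obtain C where C: "\<And>x. \<bar>flat p x\<bar> \<le> C" by (rule flat_bounded) blast
    obtain M where M: "bder UNIV m M (flat (flat_deriv p))" using Suc by blast
    have "pd 1 (flat p) = flat (flat_deriv p)" using pd_eqI[OF d] by (simp add: fun_eq_iff)
    then have "bder UNIV (Suc m) (max C M) (flat p)"
      using C M differentiableI[OF d] by (intro bder_SucI) (auto simp: le_max_iff_disj bder_max)
    then show ?case ..
  qed
  then show ?thesis unfolding bdd_smooth_iff by blast
qed

definition smooth_step :: "real \<Rightarrow> real"
  where "smooth_step x = flat 1 x / (flat 1 x + flat 1 (1 - x))"

lemma smooth_step_0: "x \<le> 0 \<Longrightarrow> smooth_step x = 0"
  by (simp add: smooth_step_def flat_def)

lemma smooth_step_1: "1 \<le> x \<Longrightarrow> smooth_step x = 1"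
  by (simp add: smooth_step_def flat_def)

lemma smooth_step_bdd_smooth: "smooth_step \<in> bdd_smooth"
proof -
  have "(\<lambda>x. flat 1 (1 + - x)) \<in> bdd_smooth"
    by (rule bdd_smooth_affine[OF _ flat_bdd_smooth]) (rule linear_compose_neg, rule linear_id[unfolded id_def])
  then have s: "(\<lambda>x. flat 1 x + flat 1 (1 - x)) \<in> bdd_smooth"
    by (intro bdd_smooth_add flat_bdd_smooth) simp
  \<comment> \<open>The denominator of \<open>smooth_step\<close> stays away from 0: one of
    \<open>x\<close> and \<open>1 - x\<close> is at least 1/2, and there \<open>flat 1\<close> is at
    least \<open>exp (- 2)\<close>.\<close>
  have e: "exp (- 2) \<le> flat 1 x" if "1 / 2 \<le> x" for x :: real
    using that by (simp add: flat_def field_simps)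
  have nn: "0 \<le> flat 1 x" for x :: real by (simp add: flat_def)
  have "exp (- 2) \<le> flat 1 x + flat 1 (1 - x)" for x :: real
  proof (cases "1 / 2 \<le> x")
    case True
    then show ?thesis using e[of x] nn[of "1 - x"] by linarith
  next
    case False
    then show ?thesis using e[of "1 - x"] nn[of x] by linarith
  qed
  from bdd_smooth_mult[OF flat_bdd_smooth bdd_smooth_inverse[OF s _ this], of 1] show ?thesis
    by (simp add: smooth_step_def[abs_def] divide_inverse)
qed

definition cube :: "real \<Rightarrow> 'a::euclidean_space set"
  where "cube c = cbox (- (c *\<^sub>R \<Sum>Basis)) (c *\<^sub>R \<Sum>Basis)"

lemma mem_cube: "z \<in> cube c \<longleftrightarrow> (\<forall>b\<in>Basis. \<bar>z \<bullet> b\<bar> \<le> c)"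
  by (auto simp: cube_def mem_box abs_le_iff)

lemma compact_cube: "compact (cube c)"
  by (simp add: cube_def)

lemma compact_subset_cube:
  assumes "bounded S" obtains n :: nat where "S \<subseteq> cube (real n)"
proof -
  obtain B where B: "\<And>x. x \<in> S \<Longrightarrow> norm x \<le> B" using assms bounded_iff by blast
  obtain n :: nat where "B \<le> n" using real_arch_simple by blast
  then have "S \<subseteq> cube (real n)"
    unfolding subset_iff mem_cube using B Basis_le_norm by (meson order_trans)
  then show ?thesis ..
qed

text \<open>The integer translates of \<open>tile\<close> form a partition of unity, because the sum
  telescopes in every coordinate; \<open>window\<close> equals 1 on its support.\<close>

definition tile :: "'a::euclidean_space \<Rightarrow> complex"
  where "tile z = (\<Prod>b\<in>Basis. of_real (smooth_step (z \<bullet> b + 1) - smooth_step (z \<bullet> b)))"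

definition window :: "'a::euclidean_space \<Rightarrow> complex"
  where "window z = (\<Prod>b\<in>Basis. of_real (smooth_step (2 + z \<bullet> b) * smooth_step (2 - z \<bullet> b)))"

lemma tile_eq_0: "z \<notin> cube 1 \<Longrightarrow> tile z = 0"
proof -
  assume "z \<notin> cube 1"
  then obtain b where b: "b \<in> Basis" "1 < \<bar>z \<bullet> b\<bar>" by (auto simp: mem_cube not_le)
  then have "smooth_step (z \<bullet> b + 1) - smooth_step (z \<bullet> b) = 0"
    by (cases "0 \<le> z \<bullet> b") (auto simp: smooth_step_0 smooth_step_1)
  then show ?thesis using b unfolding tile_def by (auto intro!: prod_zero)
qed

lemma window_eq_0: "z \<in> Basis \<Longrightarrow> 2 \<le> \<bar>x \<bullet> z\<bar> \<Longrightarrow> window x = 0"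
  unfolding window_def
  by (rule prod_zero[OF finite_Basis], rule bexI[of _ z])
    (cases "0 \<le> x \<bullet> z"; auto simp: smooth_step_0)

lemma window_outside: "x \<notin> cube 2 \<Longrightarrow> window x = 0"
  by (auto simp: mem_cube not_le intro!: window_eq_0 less_imp_le)

lemma window_eq_1: 
  assumes "x \<in> cube 1" shows "window x = 1"
  unfolding window_def
proof (rule prod.neutral, rule ballI)
  fix b :: 'a assume "b \<in> Basis"
  with assms have "\<bar>x \<bullet> b\<bar> \<le> 1" by (simp add: mem_cube)
  then show "complex_of_real (smooth_step (2 + x \<bullet> b) * smooth_step (2 - x \<bullet> b)) = 1"
    by (simp add: smooth_step_1 abs_le_iff)
qed

lemma bdd_smooth_coordinate:
  fixes g :: "real \<Rightarrow> real"
  assumes "g \<in> bdd_smooth"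
  shows "(\<lambda>z::'a::euclidean_space. complex_of_real (g (p + c * (z \<bullet> b)))) \<in> bdd_smooth"
proof -
  have "linear (\<lambda>z::'a. c * (z \<bullet> b))"
    by (auto intro!: linearI simp: inner_add_left algebra_simps)
  from bdd_smooth_affine[OF this assms] show ?thesis
    by (intro bdd_smooth_bounded_linear[OF bounded_linear_of_real])
qed

lemma tile_bdd_smooth: "tile \<in> bdd_smooth"
proof -
  have "(\<lambda>z. complex_of_real (smooth_step (1 + 1 * (z \<bullet> b))) - of_real (smooth_step (0 + 1 * (z \<bullet> b)))) \<in> bdd_smooth"
    for b :: 'a
    by (intro bdd_smooth_diff bdd_smooth_coordinate smooth_step_bdd_smooth)
  then show ?thesis unfolding tile_def[abs_def]
    by (intro bdd_smooth_prod) (simp add: add.commute)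
qed

lemma window_bdd_smooth: "window \<in> bdd_smooth"
proof -
  have "(\<lambda>z. complex_of_real (smooth_step (2 + 1 * (z \<bullet> b))) * of_real (smooth_step (2 + (-1) * (z \<bullet> b)))) \<in> bdd_smooth"
    for b :: 'a
    by (intro bdd_smooth_mult bdd_smooth_coordinate smooth_step_bdd_smooth)
  then show ?thesis unfolding window_def[abs_def]
    by (intro bdd_smooth_prod) simp
qed

subsection \<open>Sums over the integer lattice\<close>

definition lattice :: "'a::euclidean_space set"
  where "lattice = {x. \<forall>b\<in>Basis. x \<bullet> b \<in> \<int>}"

definition lattice_box :: "nat \<Rightarrow> 'a::euclidean_space set"
  where "lattice_box R = lattice \<inter> cube (real R)"

lemma lattice_add: "x \<in> lattice \<Longrightarrow> y \<in> lattice \<Longrightarrow> x + y \<in> lattice"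
  by (auto simp: lattice_def inner_add_left)

lemma lattice_diff: "x \<in> lattice \<Longrightarrow> y \<in> lattice \<Longrightarrow> x - y \<in> lattice"
  by (auto simp: lattice_def inner_diff_left)

lemma lattice_0 [simp]: "0 \<in> lattice"
  by (simp add: lattice_def)

lemma lattice_box_bij:
  "bij_betw (\<lambda>g. \<Sum>b\<in>Basis. of_int (g b) *\<^sub>R b) (PiE Basis (\<lambda>_. {- int R..int R})) (lattice_box R :: 'a::euclidean_space set)"
  (is "bij_betw ?F ?A ?B")
proof (rule bij_betwI[where g = "\<lambda>x. \<lambda>b\<in>Basis. \<lfloor>x \<bullet> b\<rfloor>"])
  have F: "?F g \<bullet> b = of_int (g b)" if "b \<in> Basis" for g :: "'a \<Rightarrow> int" and b
    using that by (simp add: inner_sum_left inner_Basis if_distrib sum.delta cong: if_cong)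
  show "?F \<in> ?A \<rightarrow> ?B"
  proof
    fix g assume g: "g \<in> ?A"
    have "\<bar>of_int (g b)\<bar> \<le> real R" if "b \<in> Basis" for b
    proof -
      have "\<bar>g b\<bar> \<le> int R" using PiE_mem[OF g that] by auto
      then have "real_of_int \<bar>g b\<bar> \<le> real_of_int (int R)" by (simp only: of_int_le_iff)
      then show ?thesis by simp
    qed
    then show "?F g \<in> ?B"
      unfolding lattice_box_def lattice_def mem_cube Int_iff mem_Collect_eq using F by simp
  qed
  show "(\<lambda>x. \<lambda>b\<in>Basis. \<lfloor>x \<bullet> b\<rfloor>) \<in> ?B \<rightarrow> ?A"
  proof
    fix x :: 'a assume x: "x \<in> ?B"
    have "\<lfloor>x \<bullet> b\<rfloor> \<in> {- int R..int R}" if "b \<in> Basis" for b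
    proof -
      have "\<bar>x \<bullet> b\<bar> \<le> real R" using x that by (simp add: lattice_box_def mem_cube)
      then show ?thesis by (simp add: abs_le_iff le_floor_iff floor_le_iff)
    qed
    then show "(\<lambda>b\<in>Basis. \<lfloor>x \<bullet> b\<rfloor>) \<in> ?A" by (intro restrict_PiE_iff[THEN iffD2]) blast
  qed
  show "(\<lambda>b\<in>Basis. \<lfloor>?F g \<bullet> b\<rfloor>) = g" if "g \<in> ?A" for g
  proof
    show "(\<lambda>b\<in>Basis. \<lfloor>?F g \<bullet> b\<rfloor>) b = g b" for b
      using F[of b g] PiE_arb[OF that, of b] by (cases "b \<in> Basis") simp_all
  qed
  show "?F (\<lambda>b\<in>Basis. \<lfloor>x \<bullet> b\<rfloor>) = x" if "x \<in> ?B" for x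
  proof (rule euclidean_eqI)
    fix b :: 'a assume b: "b \<in> Basis"
    then have "of_int \<lfloor>x \<bullet> b\<rfloor> = x \<bullet> b"
      using that unfolding lattice_box_def lattice_def by simp
    with F[OF b, of "\<lambda>b\<in>Basis. \<lfloor>x \<bullet> b\<rfloor>"] b
    show "?F (\<lambda>b\<in>Basis. \<lfloor>x \<bullet> b\<rfloor>) \<bullet> b = x \<bullet> b" by simp
  qed
qed

lemma finite_lattice_box [simp]: "finite (lattice_box R)"
  using bij_betw_finite[OF lattice_box_bij] by (simp add: finite_PiE)

lemma cube_mono: "c \<le> c' \<Longrightarrow> cube c \<subseteq> cube c'"
  unfolding subset_iff mem_cube by (meson order_trans)

lemma lattice_box_mono: "R \<le> R' \<Longrightarrow> lattice_box R \<subseteq> lattice_box R'"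
  unfolding lattice_box_def by (intro Int_mono order_refl cube_mono) simp

lemma lattice_finite_subset_box:
  assumes "finite T" "T \<subseteq> lattice" obtains R where "T \<subseteq> lattice_box R"
proof -
  obtain R where "T \<subseteq> cube (real R)"
    using compact_subset_cube[OF finite_imp_bounded[OF assms(1)]] .
  with assms(2) have "T \<subseteq> lattice_box R" by (simp add: lattice_box_def)
  then show ?thesis by (rule that)
qed

text \<open>The distributive law: lattice sums of functions that factor over the coordinates reduce
  to sums over an interval of integers.\<close>

lemma sum_prod_lattice_box:
  fixes h :: "'a::euclidean_space \<Rightarrow> real \<Rightarrow> 'b::comm_semiring_1"
  shows "(\<Sum>a\<in>lattice_box R. \<Prod>b\<in>Basis. h b (a \<bullet> b)) = (\<Prod>b\<in>Basis. \<Sum>j\<in>{- int R..int R}. h b (of_int j))"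
proof -
  have F: "(\<Sum>b\<in>Basis. of_int (g b) *\<^sub>R b) \<bullet> b = of_int (g b)" if "b \<in> Basis" for g :: "'a \<Rightarrow> int" and b
    using that by (simp add: inner_sum_left inner_Basis if_distrib sum.delta cong: if_cong)
  have "(\<Sum>a\<in>lattice_box R. \<Prod>b\<in>Basis. h b (a \<bullet> b)) =
    (\<Sum>g\<in>PiE Basis (\<lambda>_. {- int R..int R}). \<Prod>b\<in>Basis. h b (of_int (g b)))"
    by (subst sum.reindex_bij_betw[OF lattice_box_bij, symmetric]) (simp add: F)
  also have "\<dots> = (\<Prod>b\<in>Basis. \<Sum>j\<in>{- int R..int R}. h b (of_int j))"
    by (rule prod_sum_PiE[symmetric]) auto
  finally show ?thesis .
qed

lemma sum_tile_lattice_box: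
  assumes "z \<in> cube (real R)"
  shows "(\<Sum>a\<in>lattice_box R. tile (z - a)) = 1"
proof -
  have tele: "(\<Sum>j\<in>{- int R..int R}. smooth_step (t - of_int j + 1) - smooth_step (t - of_int j)) =
      smooth_step (t + R + 1) - smooth_step (t - R)" for t
  proof (induction R)
    case (Suc R)
    have "{- int (Suc R)..int (Suc R)} = insert (int (Suc R)) (insert (- int (Suc R)) {- int R..int R})"
      by auto
    with Suc show ?case by (simp add: algebra_simps)
  qed simp
  have "(\<Sum>a\<in>lattice_box R. tile (z - a)) =
    (\<Sum>a\<in>lattice_box R. \<Prod>b\<in>Basis. of_real (smooth_step (z \<bullet> b - a \<bullet> b + 1) - smooth_step (z \<bullet> b - a \<bullet> b)))"
    by (simp add: tile_def inner_diff_left)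
  also have "\<dots> = (\<Prod>b\<in>Basis. \<Sum>j\<in>{- int R..int R}. of_real (smooth_step (z \<bullet> b - of_int j + 1) - smooth_step (z \<bullet> b - of_int j)))"
    by (rule sum_prod_lattice_box)
  also have "\<dots> = (\<Prod>b\<in>(Basis::'a set). 1)"
  proof (rule prod.cong[OF refl])
    fix b :: 'a assume "b \<in> Basis"
    then have "\<bar>z \<bullet> b\<bar> \<le> R" using assms by (simp add: mem_cube)
    \<comment> \<open>The two ends left over by telescoping lie at or beyond 1 and at or below 0,
      where the step is constant.\<close>
    then have "smooth_step (z \<bullet> b + R + 1) - smooth_step (z \<bullet> b - R) = 1"
      by (simp add: smooth_step_0 smooth_step_1 abs_le_iff)
    then show "(\<Sum>j\<in>{- int R..int R}. complex_of_real (smooth_step (z \<bullet> b - of_int j + 1) - smooth_step (z \<bullet> b - of_int j))) = 1"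
      by (metis (no_types, lifting) of_real_1 of_real_sum sum.cong tele)
  qed
  finally show ?thesis by simp
qed

text \<open>A product of one-dimensional weights instead of a power of 1 + |a|^2: lattice sums then
  factor over the coordinates, and integration by parts gains each factor from two derivatives in
  one coordinate.\<close>

definition wt :: "'a::euclidean_space \<Rightarrow> real"
  where "wt a = (\<Prod>b\<in>Basis. 1 / (1 + (a \<bullet> b)\<^sup>2))"

lemma wt_pos: "0 < wt a"
  unfolding wt_def by (intro prod_pos) (auto simp: add_pos_nonneg)

lemma wt_nonneg [simp]: "0 \<le> wt a"
  using wt_pos less_imp_le by blast

lemma wt_le_1: "wt a \<le> 1"
  unfolding wt_def by (intro prod_le_1) (auto simp: add_pos_nonneg)

lemma wt_minus: "wt (- a) = wt a"
  by (simp add: wt_def)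

text \<open>A Peetre type inequality: since (u - v)^2 \<le> 2 u^2 + 2 v^2, moving a coordinate by at
  most \<open>c\<close> changes its factor by at most \<open>2 + 2 * c\<^sup>2\<close>.\<close>

lemma wt_shift:
  fixes a x :: "'a::euclidean_space"
  assumes "x \<in> cube c"
  shows "wt (a + x) \<le> (2 + 2 * c\<^sup>2) ^ DIM('a) * wt a"
proof -
  have "(\<Prod>b\<in>Basis. 1 / (1 + ((a + x) \<bullet> b)\<^sup>2)) \<le> (\<Prod>b\<in>(Basis::'a set). (2 + 2 * c\<^sup>2) * (1 / (1 + (a \<bullet> b)\<^sup>2)))"
  proof (rule prod_mono, intro conjI)
    fix b :: 'a assume "b \<in> Basis"
    then have "\<bar>x \<bullet> b\<bar> \<le> \<bar>c\<bar>" using assms by (force simp: mem_cube)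
    then have f: "(x \<bullet> b)\<^sup>2 \<le> c\<^sup>2" by (metis abs_le_square_iff)
    define u v where "u = a \<bullet> b + x \<bullet> b" and "v = x \<bullet> b"
    have "0 \<le> (u + v)\<^sup>2" by simp
    then have "(u - v)\<^sup>2 \<le> 2 * u\<^sup>2 + 2 * v\<^sup>2" by (simp add: power2_sum power2_diff)
    moreover have "(2 + 2 * c\<^sup>2) * (1 + u\<^sup>2) = 2 + 2 * u\<^sup>2 + 2 * c\<^sup>2 + 2 * (c\<^sup>2 * u\<^sup>2)"
      by (simp add: algebra_simps)
    moreover have "0 \<le> c\<^sup>2 * u\<^sup>2" by simp
    ultimately have "1 + (u - v)\<^sup>2 \<le> (2 + 2 * c\<^sup>2) * (1 + u\<^sup>2)"
      using f unfolding v_def[symmetric] by linarith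
    then have "1 / (1 + u\<^sup>2) \<le> (2 + 2 * c\<^sup>2) * (1 / (1 + (u - v)\<^sup>2))"
      by (simp add: field_simps add_pos_nonneg)
    then show "1 / (1 + ((a + x) \<bullet> b)\<^sup>2) \<le> (2 + 2 * c\<^sup>2) * (1 / (1 + (a \<bullet> b)\<^sup>2))"
      by (simp add: u_def v_def inner_add_left)
  qed simp
  also have "\<dots> = (2 + 2 * c\<^sup>2) ^ DIM('a) * wt a"
    unfolding wt_def prod.distrib by simp
  finally show ?thesis by (simp add: wt_def)
qed

lemma sum_wt_lattice:
  fixes T :: "'a::euclidean_space set"
  assumes "finite T" "T \<subseteq> lattice"
  shows "(\<Sum>a\<in>T. wt a) \<le> 5 ^ DIM('a)"
proof -
  obtain R where R: "T \<subseteq> lattice_box R" using lattice_finite_subset_box[OF assms] .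
  \<comment> \<open>The correction \<open>4 / (real R + 1)\<close> makes the induction work: the
    increment \<open>2 / (1 + (real R + 1)\<^sup>2)\<close> is at most the difference of consecutive
    corrections. At \<open>R = 0\<close> equality holds.\<close>
  have one: "(\<Sum>j\<in>{- int R..int R}. 1 / (1 + (of_int j)\<^sup>2)) \<le> 5 - 4 / (real R + 1)" for R
  proof (induction R)
    case (Suc R)
    have "{- int (Suc R)..int (Suc R)} = insert (int (Suc R)) (insert (- int (Suc R)) {- int R..int R})"
      by auto
    then have "(\<Sum>j\<in>{- int (Suc R)..int (Suc R)}. 1 / (1 + (of_int j)\<^sup>2)) =
        2 / (1 + (real R + 1)\<^sup>2) + (\<Sum>j\<in>{- int R..int R}. 1 / (1 + (of_int j)\<^sup>2))"
      by (simp add: power2_eq_square algebra_simps)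
    also have "\<dots> \<le> 2 / (1 + (real R + 1)\<^sup>2) + (5 - 4 / (real R + 1))" using Suc by simp
    also have "2 / (1 + (real R + 1)\<^sup>2) \<le> 4 / ((real R + 1) * (real R + 2))"
    proof -
      have "(real R + 1) * (real R + 2) \<le> 2 * (1 + (real R + 1)\<^sup>2)"
        by (simp add: power2_eq_square algebra_simps)
      then show ?thesis by (simp add: field_simps add_pos_nonneg)
    qed
    also have "4 / ((real R + 1) * (real R + 2)) = 4 / (real R + 1) - 4 / (real R + 2)"
      by (simp add: field_simps)
    finally show ?case by (simp add: add.commute)
  qed simp
  have "(\<Sum>a\<in>T. wt a) \<le> (\<Sum>a\<in>(lattice_box R::'a set). wt a)"
    by (intro sum_mono2 R) auto
  also have "\<dots> = (\<Prod>b\<in>(Basis::'a set). \<Sum>j\<in>{- int R..int R}. 1 / (1 + (of_int j)\<^sup>2))"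
    unfolding wt_def by (rule sum_prod_lattice_box)
  also have "\<dots> \<le> (\<Prod>b\<in>(Basis::'a set). 5)"
  proof (intro prod_mono conjI sum_nonneg)
    show "(\<Sum>j\<in>{- int R..int R}. 1 / (1 + (of_int j)\<^sup>2)) \<le> (5::real)"
      using one[of R] divide_nonneg_nonneg[of 4 "real R + 1"] by linarith
  qed auto
  finally show ?thesis by simp
qed

text \<open>\<open>x\<close> is a lattice point, which only moves the summation set within the
  lattice, plus a vector of \<open>cube 1\<close>, which costs \<open>4 ^ DIM('a)\<close> by
  \<open>wt_shift\<close>; hence 20 = 4 * 5.\<close>

lemma sum_wt_lattice_shift:
  fixes T :: "'a::euclidean_space set"
  assumes "finite T" "T \<subseteq> lattice"
  shows "(\<Sum>a\<in>T. wt (a + x)) \<le> 20 ^ DIM('a)"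
proof -
  define i where "i = (\<Sum>b\<in>Basis. of_int \<lfloor>x \<bullet> b\<rfloor> *\<^sub>R b)"
  have i: "i \<bullet> b = of_int \<lfloor>x \<bullet> b\<rfloor>" if "b \<in> Basis" for b
    using that by (simp add: i_def inner_sum_left inner_Basis if_distrib sum.delta cong: if_cong)
  have il: "i \<in> lattice" by (simp add: lattice_def i)
  have "\<bar>x \<bullet> b - of_int \<lfloor>x \<bullet> b\<rfloor>\<bar> \<le> 1" for b by linarith
  then have c: "x - i \<in> cube 1" by (simp add: mem_cube inner_diff_left i)
  have "(\<Sum>a\<in>T. wt (a + x)) \<le> (\<Sum>a\<in>T. 4 ^ DIM('a) * wt (a + i))"
    using wt_shift[OF c, of "a + i" for a] by (intro sum_mono) (simp add: algebra_simps)
  also have "\<dots> = 4 ^ DIM('a) * (\<Sum>a\<in>(\<lambda>a. a + i) ` T. wt a)"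
    by (simp add: sum_distrib_left sum.reindex inj_on_def)
  also have "\<dots> \<le> 4 ^ DIM('a) * 5 ^ DIM('a)"
    using assms il by (intro mult_left_mono sum_wt_lattice) (auto intro: lattice_add)
  finally show ?thesis by (simp flip: power_mult_distrib)
qed

lemma wt_summable: "wt summable_on lattice"
proof (rule nonneg_bdd_above_summable_on)
  show "bdd_above (sum wt ` {F. F \<subseteq> lattice \<and> finite F})"
    using sum_wt_lattice by (auto intro!: bdd_aboveI)
qed simp

text \<open>Dominated convergence for unordered sums: off a finite \<open>F\<close> the majorant
  sums to less than \<open>r / 3\<close>, and on \<open>F\<close> the convergence is that of a
  finite sum.\<close>

lemma infsum_tendsto_dominated:
  fixes f :: "nat \<Rightarrow> 'i \<Rightarrow> 'b::banach"
  assumes g: "g summable_on A" and fg: "\<And>n i. i \<in> A \<Longrightarrow> norm (f n i) \<le> g i"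
    and lim: "\<And>i. i \<in> A \<Longrightarrow> (\<lambda>n. f n i) \<longlonglongrightarrow> h i"
  shows "(\<lambda>n. infsum (f n) A) \<longlonglongrightarrow> infsum h A"
proof (rule LIMSEQ_I)
  fix r :: real assume r: "0 < r"
  have g0: "0 \<le> g i" if "i \<in> A" for i using fg[OF that] norm_ge_zero order_trans by blast
  have hg: "norm (h i) \<le> g i" if "i \<in> A" for i
    using LIMSEQ_le_const2[OF tendsto_norm[OF lim[OF that]]] fg[OF that] by blast
  have sum: "u summable_on A'" if "\<And>i. i \<in> A \<Longrightarrow> norm (u i) \<le> g i" "A' \<subseteq> A" for u :: "'i \<Rightarrow> 'b" and A'
  proof -
    have "(\<lambda>i. norm (u i)) summable_on A"
      by (rule summable_on_comparison_test[OF g]) (use that in auto)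
    then show ?thesis using abs_summable_summable summable_on_subset_banach that(2) by blast
  qed
  obtain F where F: "finite F" "F \<subseteq> A" and Ft: "infsum g (A - F) < r / 3"
  proof -
    have "(sum g \<longlongrightarrow> infsum g A) (finite_subsets_at_top A)" using g by (rule infsum_tendsto)
    then have "\<forall>\<^sub>F F in finite_subsets_at_top A. dist (sum g F) (infsum g A) < r / 3"
      using r by (intro tendstoD) auto
    then obtain F where F: "finite F" "F \<subseteq> A" "dist (sum g F) (infsum g A) < r / 3"
      by (auto simp: eventually_finite_subsets_at_top)
    have "infsum g (A - F) = infsum g A - sum g F"
      using g F by (subst infsum_Diff) (auto intro: summable_on_subset_banach)
    moreover have "infsum g A - sum g F < r / 3" using F(3) unfolding dist_real_def by linarith
    ultimately show ?thesis using F that[of F] by simp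
  qed
  have tail: "norm (infsum u (A - F)) < r / 3" if "\<And>i. i \<in> A \<Longrightarrow> norm (u i) \<le> g i" for u :: "'i \<Rightarrow> 'b"
  proof -
    have "norm (infsum u (A - F)) \<le> infsum g (A - F)"
    proof (rule norm_infsum_le[OF has_sum_infsum has_sum_infsum])
      show "u summable_on A - F" by (rule sum) (use that in auto)
      show "g summable_on A - F" by (rule summable_on_subset_banach[OF g]) auto
    qed (use that in auto)
    with Ft show ?thesis by linarith
  qed
  have split: "infsum u A = sum u F + infsum u (A - F)" if "\<And>i. i \<in> A \<Longrightarrow> norm (u i) \<le> g i" for u :: "'i \<Rightarrow> 'b"
  proof -
    have "infsum u (A - F) = infsum u A - infsum u F"
      using F sum[OF that] by (intro infsum_Diff) auto
    then show ?thesis using F by simp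
  qed
  have "(\<lambda>n. sum (f n) F) \<longlonglongrightarrow> sum h F" using lim F by (intro tendsto_sum) auto
  then obtain N where N: "\<And>n. n \<ge> N \<Longrightarrow> norm (sum (f n) F - sum h F) < r / 3"
    using LIMSEQ_D[of _ _ "r / 3"] r by (metis zero_less_divide_iff zero_less_numeral)
  show "\<exists>N. \<forall>n\<ge>N. norm (infsum (f n) A - infsum h A) < r"
  proof (intro exI allI impI)
    fix n assume "N \<le> n"
    have "infsum (f n) A - infsum h A = (sum (f n) F - sum h F) + (infsum (f n) (A - F) - infsum h (A - F))"
      using split[OF fg] split[OF hg] by simp
    then have "norm (infsum (f n) A - infsum h A) \<le> norm (sum (f n) F - sum h F)
        + (norm (infsum (f n) (A - F)) + norm (infsum h (A - F)))"
      by (simp only: order_trans[OF norm_triangle_ineq add_left_mono[OF norm_triangle_ineq4]])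
    then show "norm (infsum (f n) A - infsum h A) < r"
      using N[OF \<open>N \<le> n\<close>] tail[of "f n", OF fg] tail[of h, OF hg] by linarith
  qed
qed

section \<open>Integration by parts against oscillating factors\<close>

text \<open>The C*-identity gives \<open>(norm b)\<^sup>2 \<le> norm (star b) * norm b\<close>; the
  opposite inequality is the same one for \<open>star b\<close>.\<close>

lemma norm_star [simp]: "norm (star a) = norm (a :: 'c::cstar_algebra)"
proof -
  have le: "norm b \<le> norm (star b)" for b :: 'c
  proof (cases "b = 0")
    case False
    have "norm b * norm b \<le> norm (star b) * norm b"
      using cstar_identity[of b] norm_mult_ineq[of "star b" b] by (simp add: power2_eq_square)
    then show ?thesis using False by simp
  qed simp
  show ?thesis using le[of a] le[of "star a"] by (simp add: star_star)
qed

lemma bounded_linear_star: "bounded_linear (star :: 'c::cstar_algebra \<Rightarrow> 'c)"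
proof (rule bounded_linear_intro[where K = 1])
  show "star (r *\<^sub>R x) = r *\<^sub>R star x" for r and x :: 'c
    using star_scaleC[of "of_real r" x] by (simp add: scaleC_of_real)
qed (auto simp: star_add)

lemma bounded_bilinear_scaleC: "bounded_bilinear ((*\<^sub>C) :: complex \<Rightarrow> 'c::cstar_algebra \<Rightarrow> 'c)"
proof
  show "(r *\<^sub>R a) *\<^sub>C b = r *\<^sub>R (a *\<^sub>C b)" for r a and b :: 'c
    by (simp add: scaleR_conv_of_real scaleC_scaleC[symmetric] scaleC_of_real)
  show "a *\<^sub>C (r *\<^sub>R b) = r *\<^sub>R (a *\<^sub>C b)" for r a and b :: 'c
    by (simp add: scaleC_scaleC mult.commute flip: scaleC_of_real)
  show "\<exists>K. \<forall>a (b::'c). norm (a *\<^sub>C b) \<le> norm a * norm b * K"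
    by (intro exI[of _ 1]) (simp add: norm_scaleC)
qed (simp_all add: scaleC_add_left scaleC_add_right)

interpretation scaleC: bounded_bilinear "(*\<^sub>C) :: complex \<Rightarrow> 'c::cstar_algebra \<Rightarrow> 'c"
  by (rule bounded_bilinear_scaleC)

lemma scaleC_one [simp]: "1 *\<^sub>C a = (a :: 'c::cstar_algebra)"
  using scaleC_of_real[of 1 a] by simp

lemma scaleC_uminus_one: "(- 1) *\<^sub>C a = - (a :: 'c::cstar_algebra)"
  using scaleC.minus_left[of 1 a] by simp

lemmas bdd_smooth_scaleC = bdd_smooth_bilinear[OF bounded_bilinear_scaleC]

lemma bder_scaleC:
  "bder X m M f \<Longrightarrow> bder X m M' g \<Longrightarrow> bder X m (2 ^ m * M * M') (\<lambda>x. f x *\<^sub>C (g x :: 'c::cstar_algebra))"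
  using bder_bilinear[OF bounded_bilinear_scaleC, of 1 X m M f M' g] by (simp add: norm_scaleC)

lemma bder_scaleC_const:
  "bder X m M f \<Longrightarrow> bder X m (cmod c * M) (\<lambda>x. c *\<^sub>C (f x :: 'c::cstar_algebra))"
  by (rule bder_bounded_linear(1)[OF scaleC.bounded_linear_right]) (auto simp: norm_scaleC)

lemma pd_scaleC_const:
  assumes "bder X m M f"
  shows "pd b (\<lambda>x. c *\<^sub>C (f x :: 'c::cstar_algebra)) = (\<lambda>x. c *\<^sub>C pd b f x)"
  by (rule bder_bounded_linear(2)[OF scaleC.bounded_linear_right _ _ assms, of c "cmod c"])
    (auto simp: norm_scaleC)

lemma bder_star: "bder X m M f \<Longrightarrow> bder X m M (\<lambda>x. star (f x :: 'c::cstar_algebra))"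
  using bder_bounded_linear(1)[OF bounded_linear_star, of 1 X m M f] by simp

lemma bder_algebra_mult:
  "bder X m M f \<Longrightarrow> bder X m M' g \<Longrightarrow> bder X m (2 ^ m * M * M') (\<lambda>x. f x * (g x :: 'c::real_normed_algebra))"
  using bder_bilinear[OF bounded_bilinear_mult, of 1 X m M f M' g] by (simp add: norm_mult_ineq)

subsection \<open>Compactly supported functions\<close>

definition supp_cube :: "real \<Rightarrow> ('a::euclidean_space \<Rightarrow> 'b::zero) \<Rightarrow> bool"
  where "supp_cube R f \<longleftrightarrow> (\<forall>z. z \<notin> cube R \<longrightarrow> f z = 0)"

lemma supp_cubeD: "supp_cube R f \<Longrightarrow> z \<notin> cube R \<Longrightarrow> f z = 0"
  by (simp add: supp_cube_def)

lemma supp_cube_mono: "supp_cube R f \<Longrightarrow> R \<le> R' \<Longrightarrow> supp_cube R' f"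
  using cube_mono[of R R'] unfolding supp_cube_def by blast

lemma supp_cube_translate:
  fixes f :: "'a::euclidean_space \<Rightarrow> 'b::zero"
  assumes "supp_cube R f" obtains R' where "supp_cube R' (\<lambda>z. f (z + p))"
proof -
  have "supp_cube (R + norm p) (\<lambda>z. f (z + p))"
    unfolding supp_cube_def
  proof (intro allI impI)
    fix z :: 'a assume "z \<notin> cube (R + norm p)"
    then obtain b where b: "b \<in> Basis" "R + norm p < \<bar>z \<bullet> b\<bar>" by (auto simp: mem_cube not_le)
    then have "R < \<bar>(z + p) \<bullet> b\<bar>"
      using Basis_le_norm[OF b(1), of p] by (simp add: inner_add_left)
    then have "z + p \<notin> cube R" using b(1) by (force simp: mem_cube not_le)
    then show "f (z + p) = 0" using assms supp_cubeD by blast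
  qed
  then show ?thesis by (rule that)
qed

lemma integral_UNIV_cbox:
  fixes G :: "'a::euclidean_space \<Rightarrow> 'b::banach"
  assumes "\<And>z. z \<notin> cbox p q \<Longrightarrow> G z = 0"
  shows "integral UNIV G = integral (cbox p q) G"
proof -
  have "G = (\<lambda>z. if z \<in> cbox p q then G z else 0)" using assms by auto
  then show ?thesis using integral_restrict_UNIV[of "cbox p q" G] by simp
qed

lemma integral_UNIV_cube:
  fixes G :: "'a::euclidean_space \<Rightarrow> 'b::banach"
  assumes "supp_cube R G"
  shows "integral UNIV G = integral (cube R) G"
  using integral_UNIV_cbox[of _ _ G] supp_cubeD[OF assms] unfolding cube_def by blast

lemma integrable_cube:
  fixes G :: "'a::euclidean_space \<Rightarrow> 'b::banach"
  assumes "continuous_on (cube R) G"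
  shows "G integrable_on cube R"
  using assms integrable_continuous unfolding cube_def by blast

lemma integrable_supp_cube:
  fixes G :: "'a::euclidean_space \<Rightarrow> 'b::banach"
  assumes "continuous_on UNIV G" "supp_cube R G"
  shows "G integrable_on UNIV"
  by (rule integrable_on_superset[OF integrable_cube[of R G]])
    (use assms in \<open>auto simp: supp_cube_def intro: continuous_on_subset\<close>)

lemma norm_integral_cube_le:
  fixes G :: "'a::euclidean_space \<Rightarrow> 'b::banach"
  assumes "continuous_on (cube R) G" "\<And>z. z \<in> cube R \<Longrightarrow> norm (G z) \<le> B" "0 \<le> B"
  shows "norm (integral (cube R) G) \<le> B * measure lborel (cube R :: 'a set)"
  using has_integral_bound[OF assms(3) integrable_integral[OF integrable_cube[OF assms(1)], unfolded cube_def]]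
    assms(2) unfolding cube_def by blast

lemma integral_UNIV_translate:
  fixes G :: "'a::euclidean_space \<Rightarrow> 'b::banach"
  assumes "supp_cube R G"
  shows "integral UNIV (\<lambda>z. G (z + p)) = integral UNIV G"
proof -
  define l h where "l = - (R *\<^sub>R (\<Sum>Basis::'a))" and "h = R *\<^sub>R (\<Sum>Basis::'a)"
  have 1: "integral UNIV G = integral (cbox l h) G"
    using integral_UNIV_cube[OF assms] by (simp add: cube_def l_def h_def)
  have "G (z + p) = 0" if "z \<notin> cbox (l - p) (h - p)" for z
  proof -
    have "z + p \<notin> cube R" using that by (auto simp: cube_def l_def h_def mem_box inner_diff_left inner_add_left algebra_simps)
    then show ?thesis using supp_cubeD[OF assms] by blast
  qed
  then have "integral UNIV (\<lambda>z. G (z + p)) = integral (cbox (l - p) (h - p)) (\<lambda>z. G (z + p))"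
    by (rule integral_UNIV_cbox)
  also have "\<dots> = integral (cbox l h) G" by (rule integral_shift_cbox)
  finally show ?thesis using 1 by simp
qed

lemma pd_supp_cube:
  fixes f :: "'a::euclidean_space \<Rightarrow> 'b::real_normed_vector"
  assumes "supp_cube R f" shows "supp_cube R (pd b f)"
  unfolding supp_cube_def
proof (intro allI impI)
  fix z :: 'a assume z: "z \<notin> cube R"
  have "open (- cube R :: 'a set)" using compact_cube compact_imp_closed by blast
  then have "(f has_derivative (\<lambda>h. 0)) (at z)"
    using z supp_cubeD[OF assms]
    by (intro has_derivative_transform_within_open[OF has_derivative_const[of 0]]) auto
  from pd_eqI[OF this] show "pd b f z = 0" .
qed

lemma bder_supp_cube:
  assumes "bder (cube R) m M f" "supp_cube R f" "0 \<le> M"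
  shows "bder UNIV m M f"
  using assms
proof (induction m arbitrary: f)
  case 0
  then show ?case unfolding bder.simps(1) supp_cube_def by (metis UNIV_I norm_zero)
next
  case (Suc m)
  show ?case
  proof (rule bder_SucI)
    show "f differentiable at x" for x using bder_differentiable[OF Suc.prems(1)] .
    show "norm (f x) \<le> M" for x
      using bder_bound[OF Suc.prems(1), of x] supp_cubeD[OF Suc.prems(2), of x] Suc.prems(3) by fastforce
    show "bder UNIV m M (pd b f)" if "b \<in> Basis" for b
      using Suc.IH[OF bder_pd[OF Suc.prems(1) that] pd_supp_cube[OF Suc.prems(2)] Suc.prems(3)] .
  qed
qed

text \<open>The oscillating factors have unbounded derivatives and do not lie in
  \<open>bdd_smooth\<close>. They are bounded with all derivatives on every cube, which suffices
  once a compactly supported factor is present (\<open>loc_bdd_supp_cube\<close>).\<close>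

definition loc_bdd :: "('a::euclidean_space \<Rightarrow> 'b::real_normed_vector) \<Rightarrow> bool"
  where "loc_bdd f \<longleftrightarrow> (\<forall>R m. \<exists>M. bder (cube R) m M f)"

lemma loc_bddE: assumes "loc_bdd f" obtains M where "0 \<le> M" "bder (cube R) m M f"
proof -
  obtain M where "bder (cube R) m M f" using assms unfolding loc_bdd_def by blast
  from bder_max[OF this, of 0] show ?thesis using that[of "max 0 M"] by simp
qed

lemma bdd_smooth_loc_bdd: "f \<in> bdd_smooth \<Longrightarrow> loc_bdd f"
  unfolding loc_bdd_def by (meson bdd_smoothE bder_subset subset_UNIV)

lemma loc_bdd_supp_cube: 
  assumes "loc_bdd f" "supp_cube R f"
  shows "f \<in> bdd_smooth"
  unfolding bdd_smooth_iff
proof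
  fix m
  obtain M where "0 \<le> M" "bder (cube R) m M f" using assms(1) by (rule loc_bddE)
  from bder_supp_cube[OF this(2) assms(2) this(1)] show "\<exists>M. bder UNIV m M f" ..
qed

lemma loc_bdd_bilinear:
  assumes B: "bounded_bilinear pr" and "loc_bdd f" "loc_bdd g"
  shows "loc_bdd (\<lambda>x. pr (f x) (g x))"
proof -
  obtain K where K0: "0 \<le> K" and K: "\<And>x y. norm (pr x y) \<le> norm x * norm y * K"
    using bounded_bilinear.nonneg_bounded[OF B] by blast
  then have K: "\<And>x y. norm (pr x y) \<le> K * norm x * norm y" by (simp add: mult_ac)
  show ?thesis unfolding loc_bdd_def
  proof (intro allI)
    fix R m
    obtain M M' where "bder (cube R) m M f" "bder (cube R) m M' g" using assms by (auto elim!: loc_bddE)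
    from bder_bilinear[OF B K K0 this] show "\<exists>M. bder (cube R) m M (\<lambda>x. pr (f x) (g x))" ..
  qed
qed

lemma loc_bdd_of_real_linear:
  fixes A :: "'a::euclidean_space \<Rightarrow> real"
  assumes A: "linear A"
  shows "loc_bdd (\<lambda>z. complex_of_real (c + A z))"
  unfolding loc_bdd_def
proof (intro allI)
  fix R m
  have d: "((\<lambda>z. complex_of_real (c + A z)) has_derivative (\<lambda>h. complex_of_real (A h))) (at z)" for z
  proof -
    have "((\<lambda>z. c + A z) has_derivative (\<lambda>h. 0 + A h)) (at z)"
      by (rule has_derivative_add[OF has_derivative_const linear_imp_has_derivative[OF A]])
    from bounded_linear.has_derivative[OF bounded_linear_of_real this] show ?thesis by simp
  qed
  have "continuous_on (cube R) (\<lambda>z. complex_of_real (c + A z))"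
    using d has_derivative_continuous continuous_at_imp_continuous_on by blast
  then have "bounded ((\<lambda>z. complex_of_real (c + A z)) ` cube R)"
    using compact_cube compact_continuous_image compact_imp_bounded by blast
  then obtain B where B: "\<And>z. z \<in> cube R \<Longrightarrow> norm (complex_of_real (c + A z)) \<le> B"
    unfolding bounded_iff by blast
  show "\<exists>M. bder (cube R) m M (\<lambda>z. complex_of_real (c + A z))"
  proof (cases m)
    case 0
    then show ?thesis using B differentiableI[OF d] by auto
  next
    case (Suc k)
    define M where "M = max B (\<Sum>b\<in>Basis. \<bar>A b\<bar>)"
    have "bder (cube R) (Suc k) M (\<lambda>z. complex_of_real (c + A z))"
    proof (rule bder_SucI)
      show "(\<lambda>z. complex_of_real (c + A z)) differentiable at x" for x using differentiableI[OF d] .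
      show "norm (complex_of_real (c + A x)) \<le> M" if "x \<in> cube R" for x
        using B[OF that] by (simp add: M_def)
      fix b :: 'a assume b: "b \<in> Basis"
      have "pd b (\<lambda>z. complex_of_real (c + A z)) = (\<lambda>z. of_real (A b))"
        using pd_eqI[OF d] by (simp add: fun_eq_iff)
      moreover have "norm (complex_of_real (A b)) \<le> M"
        using member_le_sum[OF b, of "\<lambda>b. \<bar>A b\<bar>"] by (simp add: M_def)
      ultimately show "bder (cube R) k M (pd b (\<lambda>z. complex_of_real (c + A z)))"
        using bder_le[OF bder_const[of "cube R" k "complex_of_real (A b)"]] by metis
    qed
    then show ?thesis using Suc by blast
  qed
qed

lemma bdd_smooth_scaleC_loc:
  fixes F :: "'a::euclidean_space \<Rightarrow> 'c::cstar_algebra"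
  assumes "\<sigma> \<in> bdd_smooth" "supp_cube R \<sigma>" "loc_bdd E" "F \<in> bdd_smooth"
  shows "(\<lambda>z. (\<sigma> z * E z) *\<^sub>C F z) \<in> bdd_smooth" "supp_cube R (\<lambda>z. (\<sigma> z * E z) *\<^sub>C F z)"
proof -
  show s: "supp_cube R (\<lambda>z. (\<sigma> z * E z) *\<^sub>C F z)"
    using assms(2) unfolding supp_cube_def by (simp add: scaleC.zero_left)
  show "(\<lambda>z. (\<sigma> z * E z) *\<^sub>C F z) \<in> bdd_smooth"
    by (intro loc_bdd_supp_cube[OF _ s] loc_bdd_bilinear[OF bounded_bilinear_scaleC]
        loc_bdd_bilinear[OF bounded_bilinear_mult] bdd_smooth_loc_bdd assms)
qed

subsection \<open>Bounded pointwise convergence\<close>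

text \<open>The limit is taken pointwise and nothing is asked of its derivatives; the common
  Lipschitz bound makes the convergence uniform on compact sets. This is weak enough for
  trigonometric polynomials to be dense and strong enough to pass to the limit in oscillatory
  integrals.\<close>

definition sconv :: "(nat \<Rightarrow> 'a::euclidean_space \<Rightarrow> 'b::real_normed_vector) \<Rightarrow> ('a \<Rightarrow> 'b) \<Rightarrow> bool"
  where "sconv fn f \<longleftrightarrow> (\<forall>m. \<exists>M. \<forall>k. bder UNIV m M (fn k)) \<and> (\<forall>x. (\<lambda>k. fn k x) \<longlonglongrightarrow> f x)"

lemma sconvD: "sconv fn f \<Longrightarrow> (\<lambda>k. fn k x) \<longlonglongrightarrow> f x"
  by (simp add: sconv_def)

lemma sconvE: assumes "sconv fn f" obtains M where "\<And>k. bder UNIV m M (fn k)"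
  using assms unfolding sconv_def by blast

lemma sconv_bdd_smooth: "sconv fn f \<Longrightarrow> fn k \<in> bdd_smooth"
  unfolding sconv_def bdd_smooth_iff by blast

lemma sconv_const: "f \<in> bdd_smooth \<Longrightarrow> sconv (\<lambda>_. f) f"
  unfolding sconv_def bdd_smooth_iff by simp

lemma sconv_bilinear:
  assumes B: "bounded_bilinear pr" and f: "sconv fn f" and g: "sconv gn g"
  shows "sconv (\<lambda>k x. pr (fn k x) (gn k x)) (\<lambda>x. pr (f x) (g x))"
proof -
  obtain K where K0: "0 \<le> K" and K: "\<And>x y. norm (pr x y) \<le> norm x * norm y * K"
    using bounded_bilinear.nonneg_bounded[OF B] by blast
  then have K: "\<And>x y. norm (pr x y) \<le> K * norm x * norm y" by (simp add: mult_ac)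
  have "\<exists>M. \<forall>k. bder UNIV m M (\<lambda>x. pr (fn k x) (gn k x))" for m
  proof -
    obtain M M' where "\<And>k. bder UNIV m M (fn k)" "\<And>k. bder UNIV m M' (gn k)"
      using sconvE[OF f, of m] sconvE[OF g, of m] by metis
    then show ?thesis using bder_bilinear[OF B K K0] by blast
  qed
  moreover have "(\<lambda>k. pr (fn k x) (gn k x)) \<longlonglongrightarrow> pr (f x) (g x)" for x
    by (rule bounded_bilinear.tendsto[OF B sconvD[OF f] sconvD[OF g]])
  ultimately show ?thesis unfolding sconv_def by blast
qed

lemma sconv_affine:
  assumes A: "linear A" and f: "sconv fn f"
  shows "sconv (\<lambda>k z. fn k (p + A z)) (\<lambda>z. f (p + A z))"
proof -
  obtain R where R: "1 \<le> R" "\<And>b. b \<in> Basis \<Longrightarrow> (\<Sum>c\<in>Basis. \<bar>A b \<bullet> c\<bar>) \<le> R"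
    by (rule linear_Basis_bound[where A = A]) blast
  have "\<exists>M. \<forall>k. bder UNIV m M (\<lambda>z. fn k (p + A z))" for m
  proof -
    obtain M where M: "\<And>k. bder UNIV m M (fn k)" using sconvE[OF f, of m] by metis
    have "bder UNIV m (R ^ m * M) (\<lambda>z. fn k (p + A z))" for k
      by (rule bder_affine[OF A R(2,1) M]) auto
    then show ?thesis by blast
  qed
  then show ?thesis using sconvD[OF f] unfolding sconv_def by blast
qed

text \<open>As in the Arzela-Ascoli theorem, convergence on a finite net of mesh \<open>d\<close>
  with \<open>L * d = e / 3\<close> spreads to \<open>S\<close> through the common Lipschitz
  constant, which the limit inherits.\<close>

lemma equilipschitz_uniform_limit:
  fixes fn :: "nat \<Rightarrow> 'a::euclidean_space \<Rightarrow> 'b::real_normed_vector"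
  assumes M: "\<And>k. bder UNIV (Suc 0) M (fn k)" and lim: "\<And>x. (\<lambda>k. fn k x) \<longlonglongrightarrow> f x"
    and S: "compact S"
  shows "uniform_limit S fn f sequentially"
proof (rule uniform_limitI)
  fix e :: real assume e: "0 < e"
  define L where "L = real DIM('a) * M + 1"
  have "0 \<le> M" using bder_nonneg[OF M] .
  then have L: "0 < L" by (simp add: L_def add_nonneg_pos)
  have lip: "norm (fn k x - fn k y) \<le> L * norm (x - y)" for k x y
    using bder_lipschitz[OF M, of k x y] mult_right_mono[of "real DIM('a) * M" L "norm (x - y)"]
    by (simp add: L_def)
  have lipf: "norm (f x - f y) \<le> L * norm (x - y)" for x y
    by (rule LIMSEQ_le_const2[OF tendsto_norm[OF tendsto_diff[OF lim lim]]]) (use lip in blast)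
  define d where "d = e / (3 * L)"
  have d: "0 < d" "L * d = e / 3" using e L by (auto simp: d_def)
  obtain D where D: "finite D" "D \<subseteq> S" "S \<subseteq> (\<Union>x\<in>D. ball x d)"
    by (rule compactE_image[OF S, of S "\<lambda>x. ball x d"]) (use d(1) in auto)
  have "\<forall>\<^sub>F k in sequentially. \<forall>x\<in>D. norm (fn k x - f x) < e / 3"
  proof (intro eventually_ball_finite[OF D(1)] ballI)
    fix x show "\<forall>\<^sub>F k in sequentially. norm (fn k x - f x) < e / 3"
      using tendstoD[OF lim, of "e / 3" x] e unfolding dist_norm by simp
  qed
  then show "\<forall>\<^sub>F k in sequentially. \<forall>x\<in>S. dist (fn k x) (f x) < e"
  proof eventually_elim
    case (elim k)
    show ?case
    proof
      fix x assume "x \<in> S"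
      then obtain y where y: "y \<in> D" "norm (y - x) < d" using D(3) by (auto simp: dist_norm)
      have Ld: "L * norm (y - x) < e / 3" using mult_strict_left_mono[OF y(2) L] d(2) by simp
      have "fn k x - f x = - (fn k y - fn k x) + (fn k y - f y) + (f y - f x)" by simp
      then have "norm (fn k x - f x) \<le> norm (fn k y - fn k x) + norm (fn k y - f y) + norm (f y - f x)"
        by (metis norm_minus_cancel norm_triangle_le norm_triangle_ineq add_mono order_refl)
      also have "\<dots> < e"
        using lip[of k y x] lipf[of y x] elim y(1) Ld by fastforce
      finally show "dist (fn k x) (f x) < e" by (simp add: dist_norm)
    qed
  qed
qed

lemma sconv_uniform_limit: "sconv fn f \<Longrightarrow> compact S \<Longrightarrow> uniform_limit S fn f sequentially"
  by (rule sconvE[of fn f "Suc 0"], assumption, rule equilipschitz_uniform_limit) (auto dest: sconvD)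

lemma tendsto_integral_cube:
  fixes fn :: "nat \<Rightarrow> 'a::euclidean_space \<Rightarrow> 'b::banach"
  assumes "uniform_limit (cube R) fn f sequentially" "\<And>n. continuous_on (cube R) (fn n)"
  shows "(\<lambda>n. integral (cube R) (fn n)) \<longlonglongrightarrow> integral (cube R) f"
proof -
  obtain I J where I: "\<And>n. (fn n has_integral I n) (cube R)" "(f has_integral J) (cube R)" "I \<longlonglongrightarrow> J"
    unfolding cube_def
    by (rule uniform_limit_integral_cbox[OF assms[unfolded cube_def]]) auto
  from I(3) show ?thesis unfolding integral_unique[OF I(1)] integral_unique[OF I(2)] .
qed

lemma has_derivative_sequentially:
  assumes "(f has_derivative f') (at x)" "h \<longlonglongrightarrow> 0" "\<And>n. h n \<noteq> 0"
  shows "(\<lambda>n. norm (f (x + h n) - f x - f' (h n)) / norm (h n)) \<longlonglongrightarrow> 0"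
proof -
  have "(\<lambda>k. norm (f (x + k) - f x - f' k) / norm k) \<midarrow>0\<rightarrow> 0"
    using assms(1) by (simp add: has_derivative_at)
  moreover have "filterlim h (at 0) sequentially"
    using assms(2,3) by (intro filterlim_atI) (auto intro: always_eventually)
  ultimately show ?thesis by (rule filterlim_compose)
qed

text \<open>The integral of a derivative is the limit of integrals of difference quotients, which vanish
  by translation invariance.\<close>

lemma integral_pd_eq_0:
  fixes G :: "'a::euclidean_space \<Rightarrow> 'b::banach"
  assumes G: "G \<in> bdd_smooth" "supp_cube R G" and b: "b \<in> Basis"
  shows "integral UNIV (pd b G) = 0"
proof -
  \<comment> \<open>Order 2: one derivative is spent on the difference quotients, the other makes
    them equi-Lipschitz, so that they converge uniformly on a cube.\<close>
  obtain M where M: "bder UNIV 2 M G" using G(1) by (rule bdd_smoothE)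
  define t where "t n = inverse (real (Suc n))" for n
  define D where "D n z = (1 / t n) *\<^sub>R (G (z + t n *\<^sub>R b) - G z)" for n z
  have t: "0 < t n" "t n \<le> 1" for n by (auto simp: t_def inverse_le_1_iff)
  \<comment> \<open>The increments are at most 1, so all translates are supported in one
    cube.\<close>
  have s: "supp_cube (R + 1) (\<lambda>z. G (z + t n *\<^sub>R b))" for n
    unfolding supp_cube_def
  proof (intro allI impI)
    fix z :: 'a assume "z \<notin> cube (R + 1)"
    then obtain c where c: "c \<in> Basis" "R + 1 < \<bar>z \<bullet> c\<bar>" by (auto simp: mem_cube not_le)
    have "\<bar>t n * (b \<bullet> c)\<bar> \<le> 1" using t[of n] b c(1) by (simp add: inner_Basis)
    then have "R < \<bar>(z + t n *\<^sub>R b) \<bullet> c\<bar>" using c(2) by (simp add: inner_add_left)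
    then have "z + t n *\<^sub>R b \<notin> cube R" using c(1) by (force simp: mem_cube not_le)
    then show "G (z + t n *\<^sub>R b) = 0" using G(2) supp_cubeD by blast
  qed
  have s': "supp_cube (R + 1) G" using supp_cube_mono[OF G(2)] by simp
  have sD: "supp_cube (R + 1) (D n)" for n
    using s s' unfolding supp_cube_def D_def by simp
  have bD: "bder UNIV (Suc 0) (real DIM('a) * M) (D n)" for n
  proof -
    have "bder UNIV (Suc 0) (\<bar>1 / t n\<bar> * (real DIM('a) * M * norm (t n *\<^sub>R b))) (D n)"
      unfolding D_def using M by (intro bder_scaleR bder_increment) (simp add: numeral_2_eq_2)
    then show ?thesis using t[of n] b by simp
  qed
  have tl: "t \<longlonglongrightarrow> 0" unfolding t_def[abs_def] by (rule LIMSEQ_inverse_real_of_nat)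
  have lim: "(\<lambda>n. D n z) \<longlonglongrightarrow> pd b G z" for z
  proof -
    have d: "(G has_derivative (\<lambda>h. \<Sum>c\<in>Basis. (h \<bullet> c) *\<^sub>R pd c G z)) (at z)"
      using bder_has_derivative[OF M] .
    have e: "(\<Sum>c\<in>Basis. ((t n *\<^sub>R b) \<bullet> c) *\<^sub>R pd c G z) = t n *\<^sub>R pd b G z" for n
    proof -
      have "(\<Sum>c\<in>Basis. ((t n *\<^sub>R b) \<bullet> c) *\<^sub>R pd c G z) = (\<Sum>c\<in>Basis. if c = b then t n *\<^sub>R pd b G z else 0)"
        using b by (intro sum.cong) (auto simp: inner_Basis)
      then show ?thesis using b by (simp add: sum.delta)
    qed
    have "(\<lambda>n. t n *\<^sub>R b) \<longlonglongrightarrow> 0" using tendsto_scaleR[OF tl tendsto_const[of b]] by simp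
    moreover have "t n *\<^sub>R b \<noteq> 0" for n using t[of n] b nonzero_Basis by fastforce
    ultimately have "(\<lambda>n. norm (G (z + t n *\<^sub>R b) - G z - (\<Sum>c\<in>Basis. ((t n *\<^sub>R b) \<bullet> c) *\<^sub>R pd c G z))
        / norm (t n *\<^sub>R b)) \<longlonglongrightarrow> 0"
      by (rule has_derivative_sequentially[OF d])
    moreover have "norm (G (z + t n *\<^sub>R b) - G z - (\<Sum>c\<in>Basis. ((t n *\<^sub>R b) \<bullet> c) *\<^sub>R pd c G z))
        / norm (t n *\<^sub>R b) = norm (D n z - pd b G z)" for n
    proof -
      have "D n z - pd b G z = (1 / t n) *\<^sub>R (G (z + t n *\<^sub>R b) - G z - t n *\<^sub>R pd b G z)"
        using t[of n] by (simp add: D_def scaleR_diff_right)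
      then show ?thesis unfolding e using t[of n] b by simp
    qed
    ultimately show ?thesis by (simp add: tendsto_norm_zero_iff LIM_zero_iff)
  qed
  have "uniform_limit (cube (R + 1)) D (pd b G) sequentially"
    by (rule equilipschitz_uniform_limit[OF bD lim compact_cube])
  then have "(\<lambda>n. integral (cube (R + 1)) (D n)) \<longlonglongrightarrow> integral (cube (R + 1)) (pd b G)"
    by (rule tendsto_integral_cube) (rule bder_continuous_on[OF bD])
  moreover have "integral (cube (R + 1)) (D n) = 0" for n
  proof -
    have cG: "continuous_on UNIV G" using bder_continuous_on[OF M] .
    have "integral (cube (R + 1)) (D n) = integral UNIV (D n)"
      using integral_UNIV_cube[OF sD] by simp
    also have "\<dots> = (1 / t n) *\<^sub>R (integral UNIV (\<lambda>z. G (z + t n *\<^sub>R b)) - integral UNIV G)"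
    proof -
      have "continuous_on UNIV (\<lambda>z. G (z + t n *\<^sub>R b))"
        by (rule continuous_on_compose2[OF cG]) (auto intro!: continuous_intros)
      from integrable_supp_cube[OF this s] integrable_supp_cube[OF cG s'] show ?thesis unfolding D_def by (simp add: integral_diff)
    qed
    also have "\<dots> = 0" using integral_UNIV_translate[OF G(2)] by simp
    finally show ?thesis .
  qed
  ultimately have "integral (cube (R + 1)) (pd b G) = 0"
    by (simp add: LIMSEQ_const_iff)
  then show ?thesis using integral_UNIV_cube[OF pd_supp_cube[OF s']] by simp
qed

text \<open>Multiplication of the integral by a component of \<open>s\<close> is traded for a change of the window and a
  derivative of \<open>F\<close>; since this holds for every window, it can be iterated without ever dividing by
  that component.\<close>

definition phase_deriv :: "('z::euclidean_space \<Rightarrow> 'z) \<Rightarrow> 'z \<Rightarrow> ('z \<Rightarrow> complex) \<Rightarrow> bool"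
  where "phase_deriv S s E \<longleftrightarrow> (\<forall>z. cmod (E z) = 1) \<and>
    (\<forall>z. (E has_derivative (\<lambda>h. 2 * pi * \<i> * of_real ((s + S z) \<bullet> h) * E z)) (at z))"

lemma phase_deriv_pd:
  "phase_deriv S s E \<Longrightarrow> pd b E = (\<lambda>z. (2 * pi * \<i>) * (of_real (s \<bullet> b + S z \<bullet> b) * E z))"
proof
  fix z assume "phase_deriv S s E"
  then have "(E has_derivative (\<lambda>h. 2 * pi * \<i> * of_real ((s + S z) \<bullet> h) * E z)) (at z)"
    unfolding phase_deriv_def by blast
  from pd_eqI[OF this, of b] show "pd b E z = (2 * pi * \<i>) * (of_real (s \<bullet> b + S z \<bullet> b) * E z)"
    by (simp add: inner_add_left mult.assoc)
qed

lemma linear_inner_comp: "linear S \<Longrightarrow> linear (\<lambda>z. S z \<bullet> b)"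
  by (rule linearI) (simp_all add: linear_add linear_scale inner_add_left)

text \<open>A derivative of \<open>E\<close> is \<open>E\<close> times an affine function, which is
  bounded with all derivatives on each cube; the bounds follow by induction on the order.\<close>

lemma phase_deriv_loc_bdd:
  fixes S :: "'z::euclidean_space \<Rightarrow> 'z"
  assumes S: "linear S" and E: "phase_deriv S s E"
  shows "loc_bdd E"
  unfolding loc_bdd_def
proof
  fix R
  have d: "E differentiable at z" for z
    using E unfolding phase_deriv_def differentiable_def by blast
  show "\<forall>m. \<exists>M. bder (cube R) m M E"
  proof
    fix m show "\<exists>M. bder (cube R) m M E"
    proof (induction m)
      case 0
      show ?case using d E by (auto simp: phase_deriv_def intro!: exI[of _ 1])
    next
      case (Suc m)
      then obtain M where M: "bder (cube R) m M E" by blast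
      have "\<exists>M'. bder (cube R) m M' (pd b E)" if "b \<in> Basis" for b
      proof -
        obtain M1 where M1: "bder (cube R) m M1 (\<lambda>z. complex_of_real (s \<bullet> b + S z \<bullet> b))"
          using loc_bdd_of_real_linear[OF linear_inner_comp[OF S], of "s \<bullet> b" b] unfolding loc_bdd_def by blast
        have "bder (cube R) m (2 ^ m * M1 * M) (\<lambda>z. of_real (s \<bullet> b + S z \<bullet> b) * E z)"
          by (rule bder_algebra_mult[OF M1 M])
        from bder_bounded_linear(1)[OF bounded_linear_mult_right _ _ this, of "2 * pi * \<i>" "cmod (2 * pi * \<i>)"]
        show ?thesis unfolding phase_deriv_pd[OF E] by (auto simp: norm_mult)
      qed
      then obtain M' where M': "\<And>b. b \<in> Basis \<Longrightarrow> bder (cube R) m (M' b) (pd b E)" by metis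
      define N where "N = max 1 (Max (M' ` Basis))"
      have "bder (cube R) (Suc m) N E"
      proof (rule bder_SucI)
        show "E differentiable at x" for x using d .
        show "norm (E x) \<le> N" for x using E by (simp add: phase_deriv_def N_def)
        show "bder (cube R) m N (pd b E)" if "b \<in> Basis" for b
          using M'[OF that] by (rule bder_le) (use that in \<open>auto simp: N_def le_max_iff_disj intro!: Max_ge\<close>)
      qed
      then show ?case ..
    qed
  qed
qed

lemma scaleC_eq_0_iff: "c *\<^sub>C x = 0 \<longleftrightarrow> c = 0 \<or> x = (0 :: 'c::cstar_algebra)"
proof -
  have "norm (c *\<^sub>C x) = 0 \<longleftrightarrow> c = 0 \<or> x = 0" unfolding norm_scaleC by simp
  then show ?thesis by simp
qed

lemma ibp_window:
  fixes S :: "'z::euclidean_space \<Rightarrow> 'z"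
  assumes S: "linear S" and b: "b \<in> Basis" and \<sigma>: "\<sigma> \<in> bdd_smooth" "supp_cube R \<sigma>"
  defines "\<sigma>' \<equiv> \<lambda>z. - (of_real (S z \<bullet> b) * \<sigma> z + pd b \<sigma> z / (2 * pi * \<i>))"
  shows "\<sigma>' \<in> bdd_smooth" "supp_cube R \<sigma>'"
proof -
  have "supp_cube R (\<lambda>z. of_real (S z \<bullet> b) * \<sigma> z)"
    using \<sigma>(2) by (simp add: supp_cube_def)
  moreover have "loc_bdd (\<lambda>z. of_real (S z \<bullet> b) * \<sigma> z)"
    using loc_bdd_bilinear[OF bounded_bilinear_mult loc_bdd_of_real_linear[OF linear_inner_comp[OF S], of 0 b]
        bdd_smooth_loc_bdd[OF \<sigma>(1)]] by simp
  ultimately have ls: "(\<lambda>z. of_real (S z \<bullet> b) * \<sigma> z) \<in> bdd_smooth"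
    using loc_bdd_supp_cube by blast
  have "(\<lambda>z. pd b \<sigma> z * (1 / (2 * pi * \<i>))) \<in> bdd_smooth"
    by (intro bdd_smooth_mult bdd_smooth_pd[OF \<sigma>(1) b] bdd_smooth_const)
  then show "\<sigma>' \<in> bdd_smooth"
    unfolding \<sigma>'_def by (intro bdd_smooth_minus bdd_smooth_add ls) simp
  show "supp_cube R \<sigma>'"
    unfolding supp_cube_def \<sigma>'_def
    using supp_cubeD[OF \<sigma>(2)] supp_cubeD[OF pd_supp_cube[OF \<sigma>(2)]] by simp
qed

text \<open>The integral of the derivative of \<open>\<sigma> * E * F\<close> vanishes. Its terms
  are sorted by the gradient \<open>s + S z\<close> of the phase: the constant
  \<open>s \<bullet> b\<close> is isolated on the left, while the unbounded
  \<open>S z \<bullet> b\<close>, harmless on the support of \<open>\<sigma>\<close>, joins the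
  derivative of \<open>\<sigma>\<close> in the new window \<open>\<sigma>'\<close>.\<close>

lemma ibp_step:
  fixes S :: "'z::euclidean_space \<Rightarrow> 'z" and F :: "'z \<Rightarrow> 'c::cstar_algebra"
  assumes S: "linear S" and E: "phase_deriv S s E" and b: "b \<in> Basis"
    and \<sigma>: "\<sigma> \<in> bdd_smooth" "supp_cube R \<sigma>" and F: "F \<in> bdd_smooth"
  defines "\<sigma>' \<equiv> \<lambda>z. - (of_real (S z \<bullet> b) * \<sigma> z + pd b \<sigma> z / (2 * pi * \<i>))"
    and "F' \<equiv> \<lambda>z. (- 1 / (2 * pi * \<i>)) *\<^sub>C pd b F z"
  shows "of_real (s \<bullet> b) *\<^sub>C integral UNIV (\<lambda>z. (\<sigma> z * E z) *\<^sub>C F z) =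
      integral UNIV (\<lambda>z. (\<sigma>' z * E z) *\<^sub>C F z) + integral UNIV (\<lambda>z. (\<sigma> z * E z) *\<^sub>C F' z)"
    and "\<sigma>' \<in> bdd_smooth" and "supp_cube R \<sigma>'" and "F' \<in> bdd_smooth"
proof -
  have lE: "loc_bdd E" by (rule phase_deriv_loc_bdd[OF S E])
  define c where "c = 2 * pi * \<i>"
  have c: "c \<noteq> 0" by (simp add: c_def)
  note w = ibp_window[OF S b \<sigma>, folded \<sigma>'_def]
  show \<sigma>': "\<sigma>' \<in> bdd_smooth" and s\<sigma>': "supp_cube R \<sigma>'" using w .
  have pF: "pd b F \<in> bdd_smooth" using bdd_smooth_pd[OF F b] .
  show F': "F' \<in> bdd_smooth"
    unfolding F'_def by (intro bdd_smooth_bounded_linear[OF scaleC.bounded_linear_right] pF)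
  define G where "G z = (\<sigma> z * E z) *\<^sub>C F z" for z
  have G: "G \<in> bdd_smooth" "supp_cube R G"
    unfolding G_def using bdd_smooth_scaleC_loc[OF \<sigma> lE F] by auto
  have dE: "E differentiable at z" for z
    using E unfolding phase_deriv_def differentiable_def by blast
  have d\<sigma>: "\<sigma> differentiable at z" for z using bdd_smooth_differentiable[OF \<sigma>(1)] .
  have dF: "F differentiable at z" for z using bdd_smooth_differentiable[OF F] .
  have "pd b G z = (\<sigma> z * E z) *\<^sub>C pd b F z +
      (\<sigma> z * (c * (of_real (s \<bullet> b + S z \<bullet> b) * E z)) + pd b \<sigma> z * E z) *\<^sub>C F z" for z
    unfolding G_def c_def
    using pd_bilinear[OF bounded_bilinear_scaleC, of "\<lambda>z. \<sigma> z * E z" z F b] dF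
      pd_bilinear[OF bounded_bilinear_mult d\<sigma> dE, of b z] d\<sigma> dE
    by (simp add: phase_deriv_pd[OF E] differentiable_mult)
  moreover have "c *\<^sub>C (of_real (s \<bullet> b) *\<^sub>C G z - (\<sigma>' z * E z) *\<^sub>C F z - (\<sigma> z * E z) *\<^sub>C F' z) =
      (\<sigma> z * E z) *\<^sub>C pd b F z +
      (\<sigma> z * (c * (of_real (s \<bullet> b + S z \<bullet> b) * E z)) + pd b \<sigma> z * E z) *\<^sub>C F z" for z
  proof -
    have gen: "c *\<^sub>C (k *\<^sub>C (l *\<^sub>C A) - m *\<^sub>C A - l *\<^sub>C (n *\<^sub>C B)) = (- (c * (l * n))) *\<^sub>C B + (c * (k * l - m)) *\<^sub>C A"
      for k l m n and A B :: 'c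
      by (simp add: scaleC.diff_right scaleC.diff_left scaleC.minus_left scaleC_scaleC right_diff_distrib)
    have 1: "- (c * ((\<sigma> z * E z) * (- 1 / c))) = \<sigma> z * E z" using c by simp
    have 2: "c * (of_real (s \<bullet> b) * (\<sigma> z * E z) - \<sigma>' z * E z) =
        \<sigma> z * (c * (of_real (s \<bullet> b + S z \<bullet> b) * E z)) + pd b \<sigma> z * E z"
      using c unfolding \<sigma>'_def c_def[symmetric] by (simp add: field_simps)
    show ?thesis unfolding G_def F'_def c_def[symmetric] gen 1 2 ..
  qed
  ultimately have pG: "pd b G z = c *\<^sub>C (of_real (s \<bullet> b) *\<^sub>C G z - (\<sigma>' z * E z) *\<^sub>C F z - (\<sigma> z * E z) *\<^sub>C F' z)" for z
    by metis
  have i1: "G integrable_on UNIV"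
    by (rule integrable_supp_cube[OF bdd_smooth_continuous_on[OF G(1)] G(2)])
  have i2: "(\<lambda>z. (\<sigma>' z * E z) *\<^sub>C F z) integrable_on UNIV"
    by (rule integrable_supp_cube[OF bdd_smooth_continuous_on])
      (use bdd_smooth_scaleC_loc[OF \<sigma>' s\<sigma>' lE F] in auto)
  have i3: "(\<lambda>z. (\<sigma> z * E z) *\<^sub>C F' z) integrable_on UNIV"
    by (rule integrable_supp_cube[OF bdd_smooth_continuous_on])
      (use bdd_smooth_scaleC_loc[OF \<sigma> lE F'] in auto)
  have lin: "integral UNIV (\<lambda>z. k *\<^sub>C H z) = k *\<^sub>C integral UNIV H" if "H integrable_on UNIV" for k and H :: "'z \<Rightarrow> 'c"
    using integral_linear[OF that scaleC.bounded_linear_right[of k]] by (simp add: o_def)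
  have i1': "(\<lambda>z. of_real (s \<bullet> b) *\<^sub>C G z) integrable_on UNIV"
    using integrable_linear[OF i1 scaleC.bounded_linear_right] by (simp add: o_def)
  have "0 = integral UNIV (pd b G)" using integral_pd_eq_0[OF G b] by simp
  also have "\<dots> = c *\<^sub>C integral UNIV (\<lambda>z. of_real (s \<bullet> b) *\<^sub>C G z - (\<sigma>' z * E z) *\<^sub>C F z - (\<sigma> z * E z) *\<^sub>C F' z)"
    unfolding pG[abs_def] by (rule lin) (intro integrable_diff i1' i2 i3)
  also have "\<dots> = c *\<^sub>C (of_real (s \<bullet> b) *\<^sub>C integral UNIV G - integral UNIV (\<lambda>z. (\<sigma>' z * E z) *\<^sub>C F z)
      - integral UNIV (\<lambda>z. (\<sigma> z * E z) *\<^sub>C F' z))"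
    using i1 i1' i2 i3 by (simp add: integral_diff integrable_diff lin)
  finally have "c *\<^sub>C (of_real (s \<bullet> b) *\<^sub>C integral UNIV G - integral UNIV (\<lambda>z. (\<sigma>' z * E z) *\<^sub>C F z)
      - integral UNIV (\<lambda>z. (\<sigma> z * E z) *\<^sub>C F' z)) = 0" by simp
  then have "of_real (s \<bullet> b) *\<^sub>C integral UNIV G - integral UNIV (\<lambda>z. (\<sigma>' z * E z) *\<^sub>C F z)
      - integral UNIV (\<lambda>z. (\<sigma> z * E z) *\<^sub>C F' z) = 0"
    unfolding scaleC_eq_0_iff using c by blast
  then show "of_real (s \<bullet> b) *\<^sub>C integral UNIV (\<lambda>z. (\<sigma> z * E z) *\<^sub>C F z) =
      integral UNIV (\<lambda>z. (\<sigma>' z * E z) *\<^sub>C F z) + integral UNIV (\<lambda>z. (\<sigma> z * E z) *\<^sub>C F' z)"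
    by (simp add: G_def[abs_def] algebra_simps)
qed

text \<open>Each list element gains a factor \<open>1 + (s \<bullet> b)\<^sup>2\<close> for two
  derivatives of \<open>F\<close>: the 1 from the induction hypothesis itself, the square from two
  applications of \<open>ibp_step\<close>. These change the window, so the induction ranges over all
  windows.\<close>

lemma ibp_decay_list:
  fixes S :: "'z::euclidean_space \<Rightarrow> 'z"
  assumes S: "linear S" and "set bs \<subseteq> Basis" and "\<sigma> \<in> bdd_smooth" "supp_cube R \<sigma>"
  shows "\<exists>C\<ge>0. \<forall>(F :: 'z \<Rightarrow> 'c::cstar_algebra) M s E. F \<in> bdd_smooth \<and> 0 \<le> M \<and> bder (cube R) (2 * length bs) M F \<and>
      phase_deriv S s E \<longrightarrow>
      (\<Prod>b\<leftarrow>bs. 1 + (s \<bullet> b)\<^sup>2) * norm (integral UNIV (\<lambda>z. (\<sigma> z * E z) *\<^sub>C F z)) \<le> C * M"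
  using assms(2-)
proof (induction bs arbitrary: \<sigma>)
  case Nil
  obtain B where B: "\<And>z. norm (\<sigma> z) \<le> B" using bdd_smooth_bounded[OF Nil(2)] by blast
  then have B0: "0 \<le> B" using norm_ge_zero order_trans by blast
  show ?case
  proof (intro exI[of _ "B * measure lborel (cube R :: 'z set)"] conjI allI impI)
    fix F :: "'z \<Rightarrow> 'c" and M s E
    assume "F \<in> bdd_smooth \<and> 0 \<le> M \<and> bder (cube R) (2 * length ([]::'z list)) M F \<and> phase_deriv S s E"
    then have F: "F \<in> bdd_smooth" "0 \<le> M" "\<And>z. z \<in> cube R \<Longrightarrow> norm (F z) \<le> M" and E: "phase_deriv S s E"
      by auto
    note G = bdd_smooth_scaleC_loc[OF Nil(2,3) phase_deriv_loc_bdd[OF S E] F(1)]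
    have "norm (integral (cube R) (\<lambda>z. (\<sigma> z * E z) *\<^sub>C F z)) \<le> (B * M) * measure lborel (cube R :: 'z set)"
    proof (rule norm_integral_cube_le)
      show "continuous_on (cube R) (\<lambda>z. (\<sigma> z * E z) *\<^sub>C F z)" using bdd_smooth_continuous_on[OF G(1)] .
      fix z :: 'z assume "z \<in> cube R"
      then show "norm ((\<sigma> z * E z) *\<^sub>C F z) \<le> B * M"
        using F(3) B[of z] E B0 by (simp add: norm_scaleC norm_mult phase_deriv_def mult_mono)
    qed (use B0 F in simp)
    then show "(\<Prod>b\<leftarrow>[]. 1 + (s \<bullet> b)\<^sup>2) * norm (integral UNIV (\<lambda>z. (\<sigma> z * E z) *\<^sub>C F z))
        \<le> B * measure lborel (cube R :: 'z set) * M"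
      using integral_UNIV_cube[OF G(2)] by (simp add: mult_ac)
  qed (simp add: B0)
next
  case (Cons b bs)
  define D where "D \<tau> = (\<lambda>z. - (of_real (S z \<bullet> b) * \<tau> z + pd b \<tau> z / (2 * pi * \<i>)))" for \<tau>
  define DF where "DF F = (\<lambda>z. (- 1 / (2 * pi * \<i>)) *\<^sub>C pd b F z)" for F :: "'z \<Rightarrow> 'c"
  have b: "b \<in> Basis" "set bs \<subseteq> Basis" using Cons.prems(1) by auto
  have Dw: "D \<tau> \<in> bdd_smooth" "supp_cube R (D \<tau>)" if "\<tau> \<in> bdd_smooth" "supp_cube R \<tau>" for \<tau>
    using ibp_window[OF S b(1) that] unfolding D_def .
  note w = Cons.prems(2,3) and w1 = Dw[OF Cons.prems(2,3)] and w2 = Dw[OF Dw[OF Cons.prems(2,3)]]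
  let ?P = "\<lambda>\<sigma> C. 0 \<le> C \<and> (\<forall>(F :: 'z \<Rightarrow> 'c) M s E. F \<in> bdd_smooth \<and> 0 \<le> M \<and>
      bder (cube R) (2 * length bs) M F \<and> phase_deriv S s E \<longrightarrow>
      (\<Prod>b\<leftarrow>bs. 1 + (s \<bullet> b)\<^sup>2) * norm (integral UNIV (\<lambda>z. (\<sigma> z * E z) *\<^sub>C F z)) \<le> C * M)"
  obtain C0 where C0: "?P \<sigma> C0" using Cons.IH[OF b(2) w] by blast
  obtain C1 where C1: "?P (D \<sigma>) C1" using Cons.IH[OF b(2) w1] by blast
  obtain C2 where C2: "?P (D (D \<sigma>)) C2" using Cons.IH[OF b(2) w2] by blast
  show ?case
  \<comment> \<open>The first \<open>C0\<close> belongs to the summand 1 of the gained factor; the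
    rest are the four terms of two integrations by parts, with the derivative falling on the window
    twice, once (in two ways) or never.\<close>
  proof (intro exI[of _ "C0 + C2 + 2 * C1 + C0"] conjI allI impI)
    fix F :: "'z \<Rightarrow> 'c" and M s E
    assume "F \<in> bdd_smooth \<and> 0 \<le> M \<and> bder (cube R) (2 * length (b # bs)) M F \<and> phase_deriv S s E"
    then have F: "F \<in> bdd_smooth" and M: "0 \<le> M" and bF: "bder (cube R) (Suc (Suc (2 * length bs))) M F"
      and E: "phase_deriv S s E" by auto
    define T where "T \<tau> H = integral UNIV (\<lambda>z. (\<tau> z * E z) *\<^sub>C H z)" for \<tau> and H :: "'z \<Rightarrow> 'c"
    have step: "of_real (s \<bullet> b) *\<^sub>C T \<tau> H = T (D \<tau>) H + T \<tau> (DF H)"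
      if "\<tau> \<in> bdd_smooth" "supp_cube R \<tau>" "H \<in> bdd_smooth" for \<tau> H
      using ibp_step(1)[OF S E b(1) that] unfolding T_def D_def DF_def .
    have DFs: "DF H \<in> bdd_smooth" if "H \<in> bdd_smooth" for H
      unfolding DF_def by (intro bdd_smooth_bounded_linear[OF scaleC.bounded_linear_right] bdd_smooth_pd that b)
    \<comment> \<open>The factor \<open>1 / (2 * pi)\<close> is below 1, so \<open>M\<close> serves
      unchanged for the modified functions.\<close>
    have DFb: "bder (cube R) k M (DF H)" if "bder (cube R) (Suc k) M H" for k H
    proof -
      have "bder (cube R) k (cmod (- 1 / (2 * pi * \<i>)) * M) (DF H)"
        unfolding DF_def by (rule bder_scaleC_const[OF bder_pd[OF that b(1)]])
      moreover have "cmod (- 1 / (2 * pi * \<i>)) * M \<le> 1 * M"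
        using pi_ge_two by (intro mult_right_mono M) (simp add: norm_divide norm_mult)
      ultimately show ?thesis using bder_le by fastforce
    qed
    note F1 = DFs[OF F] and F2 = DFs[OF DFs[OF F]]
    have b0: "bder (cube R) (2 * length bs) M F" using bder_less[OF bF] by simp
    have b1: "bder (cube R) (2 * length bs) M (DF F)" using bder_less[OF DFb[OF bF]] by simp
    have b2: "bder (cube R) (2 * length bs) M (DF (DF F))" using DFb[OF DFb[OF bF]] .
    define q where "q = (\<Prod>b\<leftarrow>bs. 1 + (s \<bullet> b)\<^sup>2)"
    have q: "0 \<le> q" unfolding q_def by (induction bs) auto
    have "of_real ((s \<bullet> b)\<^sup>2) *\<^sub>C T \<sigma> F = of_real (s \<bullet> b) *\<^sub>C (T (D \<sigma>) F + T \<sigma> (DF F))"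
      using step[OF w F] by (simp add: power2_eq_square flip: scaleC_scaleC)
    also have "\<dots> = T (D (D \<sigma>)) F + T (D \<sigma>) (DF F) + (T (D \<sigma>) (DF F) + T \<sigma> (DF (DF F)))"
      by (simp add: scaleC.add_right step[OF w1 F] step[OF w F1])
    finally have eq: "of_real ((s \<bullet> b)\<^sup>2) *\<^sub>C T \<sigma> F = T (D (D \<sigma>)) F + T (D \<sigma>) (DF F) + (T (D \<sigma>) (DF F) + T \<sigma> (DF (DF F)))" .
    have "(s \<bullet> b)\<^sup>2 * norm (T \<sigma> F) = norm (of_real ((s \<bullet> b)\<^sup>2) *\<^sub>C T \<sigma> F)"
      unfolding norm_scaleC norm_of_real by simp
    also have "\<dots> \<le> norm (T (D (D \<sigma>)) F) + norm (T (D \<sigma>) (DF F)) + (norm (T (D \<sigma>) (DF F)) + norm (T \<sigma> (DF (DF F))))"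
      unfolding eq by (intro norm_triangle_mono order_refl)
    finally have "q * ((s \<bullet> b)\<^sup>2 * norm (T \<sigma> F)) \<le>
        q * (norm (T (D (D \<sigma>)) F) + norm (T (D \<sigma>) (DF F)) + (norm (T (D \<sigma>) (DF F)) + norm (T \<sigma> (DF (DF F)))))"
      by (rule mult_left_mono[OF _ q])
    moreover have "q * norm (T \<sigma> F) \<le> C0 * M" "q * norm (T (D (D \<sigma>)) F) \<le> C2 * M"
      "q * norm (T (D \<sigma>) (DF F)) \<le> C1 * M" "q * norm (T \<sigma> (DF (DF F))) \<le> C0 * M"
      using C0 C1 C2 F F1 F2 M b0 b1 b2 E unfolding q_def T_def by blast+
    ultimately have "q * norm (T \<sigma> F) + q * ((s \<bullet> b)\<^sup>2 * norm (T \<sigma> F)) \<le> (C0 + C2 + 2 * C1 + C0) * M"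
      by (simp add: algebra_simps)
    then show "(\<Prod>b\<leftarrow>b # bs. 1 + (s \<bullet> b)\<^sup>2) * norm (integral UNIV (\<lambda>z. (\<sigma> z * E z) *\<^sub>C F z))
        \<le> (C0 + C2 + 2 * C1 + C0) * M"
      by (simp add: T_def q_def algebra_simps)
  qed (use C0 C1 C2 in auto)
qed

text \<open>The list contains each basis vector \<open>j\<close> times, and the product over it is
  the inverse of \<open>wt s ^ j\<close>. The constant is uniform in \<open>s\<close> and
  \<open>E\<close>, because only the linear part \<open>S\<close> of the gradient of the phase
  enters the windows.\<close>

lemma ibp_decay:
  fixes S :: "'z::euclidean_space \<Rightarrow> 'z"
  assumes S: "linear S" and \<sigma>: "\<sigma> \<in> bdd_smooth" "supp_cube R \<sigma>"
  obtains C where "0 \<le> C"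
    "\<And>(F :: 'z \<Rightarrow> 'c::cstar_algebra) M s E. \<lbrakk>F \<in> bdd_smooth; 0 \<le> M; bder (cube R) (2 * (j * DIM('z))) M F;
      phase_deriv S s E\<rbrakk> \<Longrightarrow> norm (integral UNIV (\<lambda>z. (\<sigma> z * E z) *\<^sub>C F z)) \<le> C * M * wt s ^ j"
proof -
  obtain bs where bs: "set bs = (Basis :: 'z set)" "distinct bs"
    using finite_distinct_list[OF finite_Basis] by blast
  define cs where "cs = concat (replicate j bs)"
  have len: "length cs = j * DIM('z)"
    using distinct_card[OF bs(2)] bs(1) unfolding cs_def by (induction j) auto
  have sub: "set cs \<subseteq> Basis" using bs(1) by (auto simp: cs_def)
  have wt1: "(\<Prod>b\<leftarrow>bs. 1 + (s \<bullet> b)\<^sup>2) * wt s = 1" for s :: 'z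
  proof -
    have "(\<Prod>b\<leftarrow>bs. 1 + (s \<bullet> b)\<^sup>2) = (\<Prod>b\<in>Basis. 1 + (s \<bullet> b)\<^sup>2)"
      using bs by (metis prod.distinct_set_conv_list)
    moreover have "1 + (s \<bullet> b)\<^sup>2 \<noteq> 0" for b by (metis add_pos_nonneg less_irrefl zero_le_power2 zero_less_one)
    ultimately show ?thesis by (simp add: wt_def flip: prod.distrib)
  qed
  have wt: "(\<Prod>b\<leftarrow>cs. 1 + (s \<bullet> b)\<^sup>2) * wt s ^ j = 1" for s :: 'z
  proof -
    have "(\<Prod>b\<leftarrow>cs. 1 + (s \<bullet> b)\<^sup>2) = (\<Prod>b\<leftarrow>bs. 1 + (s \<bullet> b)\<^sup>2) ^ j"
      unfolding cs_def by (induction j) auto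
    then show ?thesis using wt1[of s] by (simp flip: power_mult_distrib)
  qed
  obtain C where C: "0 \<le> C" "\<And>(F :: 'z \<Rightarrow> 'c) M s E. F \<in> bdd_smooth \<and> 0 \<le> M \<and> bder (cube R) (2 * length cs) M F \<and>
      phase_deriv S s E \<Longrightarrow>
      (\<Prod>b\<leftarrow>cs. 1 + (s \<bullet> b)\<^sup>2) * norm (integral UNIV (\<lambda>z. (\<sigma> z * E z) *\<^sub>C F z)) \<le> C * M"
    using ibp_decay_list[OF S sub \<sigma>, where ?'c = 'c] by blast
  show ?thesis
  proof (rule that[OF C(1)])
    fix F :: "'z \<Rightarrow> 'c" and M s E
    assume *: "F \<in> bdd_smooth" "0 \<le> M" "bder (cube R) (2 * (j * DIM('z))) M F" "phase_deriv S s E"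
    let ?I = "norm (integral UNIV (\<lambda>z. (\<sigma> z * E z) *\<^sub>C F z))"
    have "(\<Prod>b\<leftarrow>cs. 1 + (s \<bullet> b)\<^sup>2) * ?I * wt s ^ j \<le> C * M * wt s ^ j"
      using C(2)[of F M s E] * len by (intro mult_right_mono) auto
    moreover have "(\<Prod>b\<leftarrow>cs. 1 + (s \<bullet> b)\<^sup>2) * ?I * wt s ^ j = ((\<Prod>b\<leftarrow>cs. 1 + (s \<bullet> b)\<^sup>2) * wt s ^ j) * ?I"
      by (simp only: mult_ac)
    ultimately show "?I \<le> C * M * wt s ^ j" unfolding wt by simp
  qed
qed

section \<open>The oscillatory integral\<close>

definition osc :: "'a::euclidean_space \<times> 'a \<Rightarrow> complex"
  where "osc z = exp (2 * pi * \<i> * (fst z \<bullet> snd z))"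

lemma osc_cis: "osc z = cis (2 * pi * (fst z \<bullet> snd z))"
  by (simp add: osc_def cis_conv_exp mult_ac)

lemma norm_osc [simp]: "cmod (osc z) = 1"
  by (simp add: osc_cis)

lemma linear_swap: "linear (prod.swap :: 'a::euclidean_space \<times> 'a \<Rightarrow> 'a \<times> 'a)"
  by (rule linearI) auto

text \<open>The phase \<open>u \<bullet> v\<close> is quadratic, so its gradient at
  \<open>a + z\<close> is affine in \<open>z\<close> with linear part \<open>prod.swap\<close> for
  every \<open>a\<close>. One constant of \<open>ibp_decay\<close> therefore serves all
  translates.\<close>

lemma phase_deriv_osc:
  fixes a :: "'a::euclidean_space \<times> 'a"
  shows "phase_deriv prod.swap (prod.swap a) (\<lambda>z. osc (a + z))"
  unfolding phase_deriv_def
proof (intro conjI allI)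
  fix z :: "'a \<times> 'a"
  have "((\<lambda>z. 2 * pi * (fst (a + z) \<bullet> snd (a + z))) has_derivative
      (\<lambda>h. 2 * pi * (fst (a + z) \<bullet> snd h + fst h \<bullet> snd (a + z)))) (at z)"
    by (auto intro!: derivative_eq_intros simp: algebra_simps)
  from has_derivative_cis[OF this]
  show "((\<lambda>z. osc (a + z)) has_derivative
      (\<lambda>h. 2 * pi * \<i> * of_real ((prod.swap a + prod.swap z) \<bullet> h) * osc (a + z))) (at z)"
    by (simp add: osc_cis inner_prod_def scaleR_conv_of_real algebra_simps inner_commute)
qed simp

lemma wt_Pair: "wt (u, v) = wt u * wt v"
proof -
  have "wt (u, v) = (\<Prod>b\<in>(\<lambda>u. (u, 0)) ` Basis \<union> (\<lambda>v. (0, v)) ` Basis. 1 / (1 + ((u, v) \<bullet> b)\<^sup>2))"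
    by (simp add: wt_def Basis_prod_def)
  also have "\<dots> = (\<Prod>b\<in>(\<lambda>u. (u, 0)) ` Basis. 1 / (1 + ((u, v) \<bullet> b)\<^sup>2)) * (\<Prod>b\<in>(\<lambda>v. (0, v)) ` Basis. 1 / (1 + ((u, v) \<bullet> b)\<^sup>2))"
    by (rule prod.union_disjoint) auto
  also have "\<dots> = wt u * wt v"
    by (simp add: wt_def prod.reindex inj_on_def)
  finally show ?thesis .
qed

lemma wt_swap: "wt (prod.swap a) = wt a"
  by (cases a) (simp add: wt_Pair mult.commute)

lemma mem_cube_Pair: "(u, v) \<in> cube R \<longleftrightarrow> u \<in> cube R \<and> v \<in> cube R"
  unfolding mem_cube Basis_prod_def ball_Un by simp

definition oterm :: "('a::euclidean_space \<times> 'a \<Rightarrow> 'c::cstar_algebra) \<Rightarrow> 'a \<times> 'a \<Rightarrow> 'c"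
  where "oterm F a = integral UNIV (\<lambda>z. (tile z * osc (a + z)) *\<^sub>C F (a + z))"

text \<open>The oscillatory integral as a sum over the partition of unity. Each term decays in
  \<open>a\<close> by integration by parts, so the sum converges absolutely and no cutoff enters the
  estimates.\<close>

definition oint :: "('a::euclidean_space \<times> 'a \<Rightarrow> 'c::cstar_algebra) \<Rightarrow> 'c"
  where "oint F = (\<Sum>\<^sub>\<infinity>a\<in>lattice. oterm F a)"

lemma tile_supp: "supp_cube 1 tile"
  by (simp add: supp_cube_def tile_eq_0)

lemma osc_loc_bdd: "loc_bdd (\<lambda>z. osc (a + z))"
  by (rule phase_deriv_loc_bdd[OF linear_swap phase_deriv_osc])

lemma bdd_smooth_shift: "F \<in> bdd_smooth \<Longrightarrow> (\<lambda>z. F (a + z)) \<in> bdd_smooth"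
  using bdd_smooth_translate[of F a] by (simp add: add.commute)

lemma oterm_integrand:
  assumes "F \<in> bdd_smooth"
  shows "(\<lambda>z. (tile z * osc (a + z)) *\<^sub>C F (a + z)) \<in> bdd_smooth"
    "supp_cube 1 (\<lambda>z. (tile z * osc (a + z)) *\<^sub>C F (a + z))"
    "(\<lambda>z. (tile z * osc (a + z)) *\<^sub>C F (a + z)) integrable_on UNIV"
proof -
  show *: "(\<lambda>z. (tile z * osc (a + z)) *\<^sub>C F (a + z)) \<in> bdd_smooth"
    "supp_cube 1 (\<lambda>z. (tile z * osc (a + z)) *\<^sub>C F (a + z))"
    using bdd_smooth_scaleC_loc[OF tile_bdd_smooth tile_supp osc_loc_bdd bdd_smooth_shift[OF assms]] by auto
  show "(\<lambda>z. (tile z * osc (a + z)) *\<^sub>C F (a + z)) integrable_on UNIV"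
    by (rule integrable_supp_cube[OF bdd_smooth_continuous_on[OF *(1)] *(2)])
qed

text \<open>The choice \<open>j = 2\<close> costs \<open>8 * DIM('a)\<close> derivatives, as pairs
  form a space of dimension \<open>2 * DIM('a)\<close>. One power of \<open>wt a\<close> makes the
  sum over the lattice converge, the other is kept for localisation.\<close>

lemma oterm_bound:
  obtains C where "0 \<le> C"
    "\<And>(F :: 'a::euclidean_space \<times> 'a \<Rightarrow> 'c::cstar_algebra) a M. \<lbrakk>F \<in> bdd_smooth; 0 \<le> M;
      bder {z. z - a \<in> cube 1} (8 * DIM('a)) M F\<rbrakk> \<Longrightarrow> norm (oterm F a) \<le> C * M * (wt a)\<^sup>2"
proof -
  obtain C where C: "0 \<le> C"
    "\<And>(F :: 'a \<times> 'a \<Rightarrow> 'c) M s E. \<lbrakk>F \<in> bdd_smooth; 0 \<le> M; bder (cube 1) (2 * (2 * DIM('a \<times> 'a))) M F;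
      phase_deriv prod.swap s E\<rbrakk> \<Longrightarrow> norm (integral UNIV (\<lambda>z. (tile z * E z) *\<^sub>C F z)) \<le> C * M * wt s ^ 2"
    using ibp_decay[OF linear_swap tile_bdd_smooth tile_supp, where j = 2 and ?'c = 'c] by blast
  show ?thesis
  proof (rule that[OF C(1)])
    fix F :: "'a \<times> 'a \<Rightarrow> 'c" and a M
    assume *: "F \<in> bdd_smooth" "0 \<le> M" "bder {z. z - a \<in> cube 1} (8 * DIM('a)) M F"
    have "bder (cube 1) (8 * DIM('a)) M (\<lambda>z. F (z + a))"
      by (rule bder_translate[OF *(3)]) simp
    then have "bder (cube 1) (2 * (2 * DIM('a \<times> 'a))) M (\<lambda>z. F (a + z))"
      by (simp add: add.commute)
    from C(2)[OF bdd_smooth_shift[OF *(1)] *(2) this phase_deriv_osc]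
    show "norm (oterm F a) \<le> C * M * (wt a)\<^sup>2"
      by (simp add: oterm_def wt_swap)
  qed
qed

lemma wt_sq_le: "(wt a)\<^sup>2 \<le> wt a"
  using mult_left_mono[OF wt_le_1 wt_nonneg, of a a] by (simp add: power2_eq_square)

lemma oterm_abs_summable:
  fixes F :: "'a::euclidean_space \<times> 'a \<Rightarrow> 'c::cstar_algebra"
  assumes F: "F \<in> bdd_smooth"
  shows "oterm F abs_summable_on lattice" "oterm F summable_on lattice"
proof -
  obtain C where C: "0 \<le> C" "\<And>(F :: 'a \<times> 'a \<Rightarrow> 'c) a M. \<lbrakk>F \<in> bdd_smooth; 0 \<le> M;
      bder {z. z - a \<in> cube 1} (8 * DIM('a)) M F\<rbrakk> \<Longrightarrow> norm (oterm F a) \<le> C * M * (wt a)\<^sup>2"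
    by (rule oterm_bound[where ?'a = 'a and ?'c = 'c]) blast
  obtain M where M: "bder UNIV (8 * DIM('a)) M F" using F by (rule bdd_smoothE)
  note M0 = bder_nonneg[OF M]
  have b: "norm (oterm F a) \<le> C * M * wt a" for a
    using C(2)[OF F M0 bder_subset[OF M subset_UNIV], of a]
      mult_left_mono[OF wt_sq_le[of a], of "C * M"] C(1) M0 by simp
  show "oterm F abs_summable_on lattice"
    by (rule summable_on_comparison_test[OF summable_on_cmult_right[OF wt_summable, of "C * M"]]) (use b in auto)
  then show "oterm F summable_on lattice" by (rule abs_summable_summable)
qed

lemma norm_infsum_le_bound:
  fixes f :: "'i \<Rightarrow> 'b::banach"
  assumes "f abs_summable_on A" "\<And>T. finite T \<Longrightarrow> T \<subseteq> A \<Longrightarrow> (\<Sum>i\<in>T. norm (f i)) \<le> B"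
  shows "norm (infsum f A) \<le> B"
proof -
  have "infsum (\<lambda>i. norm (f i)) A \<le> B"
    by (rule infsum_le_finite_sums[OF assms])
  then show ?thesis using norm_infsum_bound[OF assms(1)] by linarith
qed

text \<open>The local version gains decay in the position of the support of \<open>F\<close> in the second variable.\<close>

lemma oint_bound_local:
  obtains C where "0 \<le> C"
    "\<And>(F :: 'a::euclidean_space \<times> 'a \<Rightarrow> 'c::cstar_algebra) M v0. \<lbrakk>F \<in> bdd_smooth;
      bder UNIV (8 * DIM('a)) M F; \<And>u v. v - v0 \<notin> cube c \<Longrightarrow> F (u, v) = 0\<rbrakk> \<Longrightarrow> norm (oint F) \<le> C * M * wt v0"
proof -
  obtain C where C: "0 \<le> C" "\<And>(F :: 'a \<times> 'a \<Rightarrow> 'c) a M. \<lbrakk>F \<in> bdd_smooth; 0 \<le> M;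
      bder {z. z - a \<in> cube 1} (8 * DIM('a)) M F\<rbrakk> \<Longrightarrow> norm (oterm F a) \<le> C * M * (wt a)\<^sup>2"
    by (rule oterm_bound[where ?'a = 'a and ?'c = 'c]) blast
  \<comment> \<open>A tile at \<open>a\<close> meeting the support of \<open>F\<close> has
    \<open>snd a - v0\<close> in \<open>cube (c + 1)\<close>, with \<open>c\<close> from the support
    and 1 from the tile. For such \<open>a\<close> one factor \<open>wt a\<close> is traded for
    \<open>D * wt v0\<close>.\<close>
  define D where "D = (2 + 2 * (c + 1)\<^sup>2) ^ DIM('a)"
  have D: "0 \<le> D" by (simp add: D_def)
  show ?thesis
  proof (rule that[of "C * D * 5 ^ DIM('a \<times> 'a)"])
    show "0 \<le> C * D * 5 ^ DIM('a \<times> 'a)" using C D by simp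
    fix F :: "'a \<times> 'a \<Rightarrow> 'c" and M v0
    assume F: "F \<in> bdd_smooth" and M: "bder UNIV (8 * DIM('a)) M F"
      and s: "\<And>u v. v - v0 \<notin> cube c \<Longrightarrow> F (u, v) = 0"
    note M0 = bder_nonneg[OF M]
    have b: "norm (oterm F a) \<le> C * M * D * wt v0 * wt a" for a
    proof (cases "snd a - v0 \<in> cube (c + 1)")
      case True
      have "wt a \<le> 1 * wt (snd a)"
        using mult_right_mono[OF wt_le_1 wt_nonneg, of "fst a" "snd a"] by (cases a) (simp add: wt_Pair)
      also have "\<dots> \<le> D * wt v0" using wt_shift[OF True, of v0] by (simp add: D_def)
      finally have "wt a * wt a \<le> D * wt v0 * wt a" by (intro mult_right_mono) auto
      then have "C * M * (wt a)\<^sup>2 \<le> C * M * (D * wt v0 * wt a)"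
        unfolding power2_eq_square using C M0 by (intro mult_left_mono) auto
      then show ?thesis using C(2)[OF F M0 bder_subset[OF M subset_UNIV], of a] by (simp add: mult_ac)
    next
      case False
      have "(tile z * osc (a + z)) *\<^sub>C F (a + z) = 0" for z
      proof (cases "z \<in> cube 1")
        case True
        have "snd (a + z) - v0 \<notin> cube c"
        proof
          assume "snd (a + z) - v0 \<in> cube c"
          then have "snd a - v0 \<in> cube (c + 1)"
            using True unfolding mem_cube[of "snd a - v0"]
          proof (intro ballI)
            fix b :: 'a assume b: "b \<in> Basis"
            have "\<bar>(snd (a + z) - v0) \<bullet> b\<bar> \<le> c" "\<bar>snd z \<bullet> b\<bar> \<le> 1"
              using b \<open>snd (a + z) - v0 \<in> cube c\<close> True mem_cube_Pair[of "fst z" "snd z" 1] by (auto simp: mem_cube)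
            then show "\<bar>(snd a - v0) \<bullet> b\<bar> \<le> c + 1" by (simp add: inner_diff_left inner_add_left)
          qed
          then show False using False by blast
        qed
        then have "F (a + z) = 0" using s[of "snd (a + z)" "fst (a + z)"] unfolding prod.collapse by blast
        then show ?thesis by (simp add: scaleC.zero_right)
      qed (simp add: tile_eq_0 scaleC.zero_left)
      then have "oterm F a = 0" by (simp add: oterm_def)
      then show ?thesis using C M0 D by simp
    qed
    show "norm (oint F) \<le> C * D * 5 ^ DIM('a \<times> 'a) * M * wt v0"
      unfolding oint_def
    proof (rule norm_infsum_le_bound[OF oterm_abs_summable(1)[OF F]])
      fix T :: "('a \<times> 'a) set" assume T: "finite T" "T \<subseteq> lattice"
      have "(\<Sum>i\<in>T. norm (oterm F i)) \<le> (\<Sum>i\<in>T. C * M * D * wt v0 * wt i)"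
        by (intro sum_mono b)
      also have "\<dots> = C * M * D * wt v0 * (\<Sum>i\<in>T. wt i)" by (simp add: sum_distrib_left)
      also have "\<dots> \<le> C * M * D * wt v0 * 5 ^ DIM('a \<times> 'a)"
        using C D M0 by (intro mult_left_mono sum_wt_lattice T) auto
      finally show "(\<Sum>i\<in>T. norm (oterm F i)) \<le> C * D * 5 ^ DIM('a \<times> 'a) * M * wt v0" by (simp add: mult_ac)
    qed
  qed
qed

lemma oint_bound:
  obtains C where "0 \<le> C"
    "\<And>(F :: 'a::euclidean_space \<times> 'a \<Rightarrow> 'c::cstar_algebra) M. \<lbrakk>F \<in> bdd_smooth;
      bder UNIV (8 * DIM('a)) M F\<rbrakk> \<Longrightarrow> norm (oint F) \<le> C * M"
proof -
  obtain C where C: "0 \<le> C" "\<And>(F :: 'a \<times> 'a \<Rightarrow> 'c) a M. \<lbrakk>F \<in> bdd_smooth; 0 \<le> M;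
      bder {z. z - a \<in> cube 1} (8 * DIM('a)) M F\<rbrakk> \<Longrightarrow> norm (oterm F a) \<le> C * M * (wt a)\<^sup>2"
    by (rule oterm_bound[where ?'a = 'a and ?'c = 'c]) blast
  show ?thesis
  proof (rule that[of "C * 5 ^ DIM('a \<times> 'a)"])
    show "0 \<le> C * 5 ^ DIM('a \<times> 'a)" using C by simp
    fix F :: "'a \<times> 'a \<Rightarrow> 'c" and M
    assume F: "F \<in> bdd_smooth" and M: "bder UNIV (8 * DIM('a)) M F"
    note M0 = bder_nonneg[OF M]
    have b: "norm (oterm F a) \<le> C * M * wt a" for a
      using C(2)[OF F M0 bder_subset[OF M subset_UNIV], of a]
        mult_left_mono[OF wt_sq_le[of a], of "C * M"] C(1) M0 by simp
    show "norm (oint F) \<le> C * 5 ^ DIM('a \<times> 'a) * M"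
      unfolding oint_def
    proof (rule norm_infsum_le_bound[OF oterm_abs_summable(1)[OF F]])
      fix T :: "('a \<times> 'a) set" assume T: "finite T" "T \<subseteq> lattice"
      have "(\<Sum>i\<in>T. norm (oterm F i)) \<le> (\<Sum>i\<in>T. C * M * wt i)"
        by (intro sum_mono b)
      also have "\<dots> = C * M * (\<Sum>i\<in>T. wt i)" by (simp add: sum_distrib_left)
      also have "\<dots> \<le> C * M * 5 ^ DIM('a \<times> 'a)"
        using C M0 by (intro mult_left_mono sum_wt_lattice T) auto
      finally show "(\<Sum>i\<in>T. norm (oterm F i)) \<le> C * 5 ^ DIM('a \<times> 'a) * M" by (simp add: mult_ac)
    qed
  qed
qed

lemma oint_add:
  assumes "F \<in> bdd_smooth" "G \<in> bdd_smooth"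
  shows "oint (\<lambda>z. F z + G z) = oint F + oint G"
proof -
  have "oterm (\<lambda>z. F z + G z) a = oterm F a + oterm G a" for a
    unfolding oterm_def scaleC.add_right
    by (rule integral_add[OF oterm_integrand(3)[OF assms(1)] oterm_integrand(3)[OF assms(2)]])
  then have "oterm (\<lambda>z. F z + G z) = (\<lambda>a. oterm F a + oterm G a)" by (rule ext)
  then show ?thesis unfolding oint_def
    by (simp only: infsum_add[OF oterm_abs_summable(2)[OF assms(1)] oterm_abs_summable(2)[OF assms(2)]])
qed

lemma oint_linear:
  assumes L: "bounded_linear L" "\<And>c x. L (c *\<^sub>C x) = c *\<^sub>C L x" and F: "F \<in> bdd_smooth"
  shows "oint (\<lambda>z. L (F z)) = L (oint F)"
proof -
  have t: "oterm (\<lambda>z. L (F z)) a = L (oterm F a)" for a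
    unfolding oterm_def L(2)[symmetric]
    using integral_linear[OF oterm_integrand(3)[OF F] L(1), of a] by (simp add: o_def)
  have "(oterm F has_sum oint F) lattice"
    unfolding oint_def by (rule has_sum_infsum[OF oterm_abs_summable(2)[OF F]])
  from has_sum_bounded_linear[OF L(1) this]
  have "((\<lambda>a. L (oterm F a)) has_sum L (oint F)) lattice" by (simp add: o_def)
  then show ?thesis unfolding oint_def t by (simp add: infsumI)
qed

lemma oint_scaleC: "F \<in> bdd_smooth \<Longrightarrow> oint (\<lambda>z. c *\<^sub>C F z) = c *\<^sub>C oint F"
  by (rule oint_linear[OF scaleC.bounded_linear_right]) (simp_all add: scaleC_scaleC mult.commute)

lemma oint_sum:
  "(\<And>i. i \<in> I \<Longrightarrow> F i \<in> bdd_smooth) \<Longrightarrow> oint (\<lambda>z. \<Sum>i\<in>I. F i z) = (\<Sum>i\<in>I. oint (F i))"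
proof (induction I rule: infinite_finite_induct)
  case (insert x I)
  then show ?case using oint_add[of "F x" "\<lambda>z. \<Sum>i\<in>I. F i z"] by (simp add: bdd_smooth_sum)
qed (auto simp: oint_def oterm_def scaleC.zero_right)

lemma oint_diff:
  assumes "F \<in> bdd_smooth" "G \<in> bdd_smooth"
  shows "oint (\<lambda>z. F z - G z) = oint F - oint G"
  using oint_add[OF assms(1) bdd_smooth_bounded_linear[OF bounded_linear_minus[OF bounded_linear_ident] assms(2)]]
    oint_linear[OF bounded_linear_minus[OF bounded_linear_ident] _ assms(2)]
  by (simp add: scaleC.minus_right)

text \<open>Dominated convergence over the lattice; each single term converges because its integrand
  converges uniformly on the cube supporting the tile.\<close>

lemma oint_sconv:
  fixes F :: "'a::euclidean_space \<times> 'a \<Rightarrow> 'c::cstar_algebra"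
  assumes Fn: "sconv Fn F" and F: "F \<in> bdd_smooth"
  shows "(\<lambda>n. oint (Fn n)) \<longlonglongrightarrow> oint F"
proof -
  obtain C where C: "0 \<le> C" "\<And>(F :: 'a \<times> 'a \<Rightarrow> 'c) a M. \<lbrakk>F \<in> bdd_smooth; 0 \<le> M;
      bder {z. z - a \<in> cube 1} (8 * DIM('a)) M F\<rbrakk> \<Longrightarrow> norm (oterm F a) \<le> C * M * (wt a)\<^sup>2"
    by (rule oterm_bound[where ?'a = 'a and ?'c = 'c]) blast
  obtain M where M: "\<And>k. bder UNIV (8 * DIM('a)) M (Fn k)" using sconvE[OF Fn, of "8 * DIM('a)"] by metis
  note M0 = bder_nonneg[OF M]
  have Fns: "Fn k \<in> bdd_smooth" for k using sconv_bdd_smooth[OF Fn] .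
  have b: "norm (oterm (Fn k) a) \<le> C * M * wt a" for k a
    using C(2)[where F = "Fn k" and a = a, OF Fns M0 bder_subset[OF M subset_UNIV]]
      mult_left_mono[OF wt_sq_le[of a], of "C * M"] C(1) M0 by simp
  have "(\<lambda>k. oterm (Fn k) a) \<longlonglongrightarrow> oterm F a" for a
  proof -
    have s: "sconv (\<lambda>k z. Fn k (a + z)) (\<lambda>z. F (a + z))"
      using sconv_affine[OF linear_id Fn, of a] by simp
    have "uniform_limit (cube 1) (\<lambda>k z. (tile z * osc (a + z)) *\<^sub>C Fn k (a + z)) (\<lambda>z. (tile z * osc (a + z)) *\<^sub>C F (a + z)) sequentially"
    proof (rule bounded_bilinear.bounded_uniform_limit[OF bounded_bilinear_scaleC uniform_limit_const sconv_uniform_limit[OF s compact_cube]])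
      show "bounded ((\<lambda>z. F (a + z)) ` cube 1)"
        by (rule compact_imp_bounded[OF compact_continuous_image[OF bdd_smooth_continuous_on[OF bdd_smooth_shift[OF F]] compact_cube]])
      obtain B where B: "\<And>z::'a \<times> 'a. cmod (tile z) \<le> B" by (rule bdd_smooth_bounded[OF tile_bdd_smooth]) blast
      show "bounded ((\<lambda>z. tile z * osc (a + z)) ` cube 1)"
      proof (rule boundedI[of _ B])
        fix y assume "y \<in> (\<lambda>z. tile z * osc (a + z)) ` cube 1"
        then obtain z where "y = tile z * osc (a + z)" by blast
        then show "norm y \<le> B" using B[of z] by (simp only: norm_mult norm_osc mult_1_right)
      qed
    qed
    from tendsto_integral_cube[OF this bdd_smooth_continuous_on[OF oterm_integrand(1)[OF Fns]]]
    show ?thesis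
      using integral_UNIV_cube[OF oterm_integrand(2)[OF Fns]] integral_UNIV_cube[OF oterm_integrand(2)[OF F]]
      by (simp add: oterm_def)
  qed
  then show ?thesis unfolding oint_def
    by (intro infsum_tendsto_dominated[where g = "\<lambda>a. C * M * wt a"] summable_on_cmult_right[OF wt_summable] b)
qed

lemma oint_compact:
  fixes F :: "'a::euclidean_space \<times> 'a \<Rightarrow> 'c::cstar_algebra"
  assumes F: "F \<in> bdd_smooth" and s: "supp_cube R F"
  shows "oint F = integral UNIV (\<lambda>z. osc z *\<^sub>C F z)"
proof -
  \<comment> \<open>Tiles meeting \<open>cube R\<close> have their centres in
    \<open>cube (R + 1)\<close>, so only the lattice points of a finite box contribute.\<close>
  obtain N :: nat where N: "R + 1 \<le> real N" using real_arch_simple by blast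
  have t: "oterm F a = integral UNIV (\<lambda>z. tile (z - a) *\<^sub>C (osc z *\<^sub>C F z))" for a
  proof -
    have "oterm F a = integral UNIV (\<lambda>z. (tile (z + - a) * osc (a + (z + - a))) *\<^sub>C F (a + (z + - a)))"
      unfolding oterm_def by (rule integral_UNIV_translate[OF oterm_integrand(2)[OF F], symmetric])
    then show ?thesis by (simp add: scaleC_scaleC)
  qed
  have out: "tile (z - a) *\<^sub>C (osc z *\<^sub>C F z) = 0" if "a \<in> lattice" "a \<notin> lattice_box N" for a z
  proof (rule ccontr)
    assume *: "tile (z - a) *\<^sub>C (osc z *\<^sub>C F z) \<noteq> 0"
    have 1: "z - a \<in> cube 1"
    proof (rule ccontr)
      assume "z - a \<notin> cube 1"
      then show False using * tile_eq_0[of "z - a"] by (simp add: scaleC.zero_left)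
    qed
    have 2: "z \<in> cube R"
    proof (rule ccontr)
      assume "z \<notin> cube R"
      then show False using * supp_cubeD[OF s, of z] by (simp add: scaleC.zero_right)
    qed
    have "\<bar>a \<bullet> b\<bar> \<le> N" if "b \<in> Basis" for b
    proof -
      have "\<bar>(z - a) \<bullet> b\<bar> \<le> 1" "\<bar>z \<bullet> b\<bar> \<le> R" using 1 2 that by (auto simp: mem_cube)
      then show ?thesis using N by (simp add: inner_diff_left)
    qed
    then have "a \<in> lattice_box N" using that(1) by (simp add: lattice_box_def mem_cube)
    then show False using that(2) by blast
  qed
  have "oint F = (\<Sum>\<^sub>\<infinity>a\<in>lattice_box N. oterm F a)"
    unfolding oint_def by (rule infsum_cong_neutral) (auto simp: t out lattice_box_def)
  also have "\<dots> = (\<Sum>a\<in>lattice_box N. integral UNIV (\<lambda>z. tile (z - a) *\<^sub>C (osc z *\<^sub>C F z)))"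
    by (simp add: t)
  also have "\<dots> = integral UNIV (\<lambda>z. \<Sum>a\<in>lattice_box N. tile (z - a) *\<^sub>C (osc z *\<^sub>C F z))"
  proof (rule integral_sum[symmetric, OF finite_lattice_box])
    fix a :: "'a \<times> 'a"
    have "loc_bdd osc" using osc_loc_bdd[of 0] by simp
    then have "loc_bdd (\<lambda>z. osc z *\<^sub>C F z)"
      by (rule loc_bdd_bilinear[OF bounded_bilinear_scaleC _ bdd_smooth_loc_bdd[OF F]])
    moreover have so: "supp_cube R (\<lambda>z. osc z *\<^sub>C F z)"
      using s by (simp add: supp_cube_def scaleC.zero_right)
    ultimately have "(\<lambda>z. osc z *\<^sub>C F z) \<in> bdd_smooth" by (rule loc_bdd_supp_cube)
    then have "(\<lambda>z. tile (z + - a) *\<^sub>C (osc z *\<^sub>C F z)) \<in> bdd_smooth"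
      by (rule bdd_smooth_scaleC[OF bdd_smooth_translate[OF tile_bdd_smooth]])
    moreover have "supp_cube R (\<lambda>z. tile (z + - a) *\<^sub>C (osc z *\<^sub>C F z))"
      using so by (simp add: supp_cube_def scaleC.zero_right)
    ultimately have "(\<lambda>z. tile (z + - a) *\<^sub>C (osc z *\<^sub>C F z)) integrable_on UNIV"
      by (intro integrable_supp_cube bdd_smooth_continuous_on)
    then show "(\<lambda>z. tile (z - a) *\<^sub>C (osc z *\<^sub>C F z)) integrable_on UNIV" by simp
  qed
  also have "(\<lambda>z. \<Sum>a\<in>lattice_box N. tile (z - a) *\<^sub>C (osc z *\<^sub>C F z)) = (\<lambda>z. osc z *\<^sub>C F z)"
  proof
    fix z
    show "(\<Sum>a\<in>lattice_box N. tile (z - a) *\<^sub>C (osc z *\<^sub>C F z)) = osc z *\<^sub>C F z"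
    proof (cases "z \<in> cube R")
      case True
      then have "z \<in> cube (real N)" using cube_mono[of R "real N"] N by auto
      from sum_tile_lattice_box[OF this] show ?thesis by (simp flip: scaleC.sum_left)
    qed (simp add: supp_cubeD[OF s] scaleC.zero_right)
  qed
  finally show ?thesis .
qed

text \<open>Any compactly supported functions tending to 1 in the sense of \<open>sconv\<close>
  compute \<open>oint F\<close>. This contains the independence of the cutoff, and it allows windows
  to be translated or reflected.\<close>

lemma oint_limit:
  assumes \<Phi>: "sconv \<Phi> (\<lambda>_. 1)" and R: "\<And>k. supp_cube (R k) (\<Phi> k)" and F: "F \<in> bdd_smooth"
  shows "(\<lambda>k. integral UNIV (\<lambda>z. osc z *\<^sub>C (\<Phi> k z *\<^sub>C F z))) \<longlonglongrightarrow> oint F"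
proof -
  have s: "sconv (\<lambda>k z. \<Phi> k z *\<^sub>C F z) (\<lambda>z. 1 *\<^sub>C F z)"
    by (rule sconv_bilinear[OF bounded_bilinear_scaleC \<Phi> sconv_const[OF F]])
  have "supp_cube (R k) (\<lambda>z. \<Phi> k z *\<^sub>C F z)" for k
    using R[of k] by (simp add: supp_cube_def scaleC.zero_left)
  then have "oint (\<lambda>z. \<Phi> k z *\<^sub>C F z) = integral UNIV (\<lambda>z. osc z *\<^sub>C (\<Phi> k z *\<^sub>C F z))" for k
    by (rule oint_compact[OF sconv_bdd_smooth[OF s]])
  then show ?thesis using oint_sconv[OF s] F by simp
qed

section \<open>Identification with Rieffel's oscillatory integral\<close>

lemma partial_derivs_supp_cube: "supp_cube R f \<Longrightarrow> supp_cube R (partial_derivs bs f)"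
  by (induction bs) (simp_all add: pd_supp_cube[unfolded pd_def[abs_def]])

lemma smooth_supp_cube_bdd_smooth:
  assumes "smooth f" "supp_cube R f"
  shows "f \<in> bdd_smooth"
  unfolding bdd_smooth_def
proof (intro CollectI conjI allI impI assms(1))
  fix bs :: "'a list" assume "set bs \<subseteq> Basis"
  then have "continuous_on (cube R) (partial_derivs bs f)"
    using assms(1) differentiable_imp_continuous_on continuous_on_subset unfolding smooth_def by blast
  then have "bounded (partial_derivs bs f ` cube R)"
    using compact_cube compact_continuous_image compact_imp_bounded by blast
  then have "bounded (insert 0 (partial_derivs bs f ` cube R))" by simp
  moreover have "range (partial_derivs bs f) \<subseteq> insert 0 (partial_derivs bs f ` cube R)"
    using supp_cubeD[OF partial_derivs_supp_cube[OF assms(2)]] by blast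
  ultimately show "bounded (range (partial_derivs bs f))" by (rule bounded_subset)
qed

text \<open>Rescaling by \<open>k \<ge> 1\<close> does not increase derivatives. At
  \<open>k = 0\<close> the convention for division gives the constant \<open>\<phi> 0\<close>, which
  has the bounds but in general no compact support; hence the restriction to
  \<open>0 < k\<close>.\<close>

lemma cutoff_sconv:
  fixes \<phi> :: "'a::euclidean_space \<Rightarrow> complex"
  assumes "cutoff \<phi>"
  obtains R where "sconv (\<lambda>k z. \<phi> (z /\<^sub>R real k)) (\<lambda>_. 1)" "\<And>k. 0 < k \<Longrightarrow> supp_cube (R k) (\<lambda>z. \<phi> (z /\<^sub>R real k))"
proof -
  have sm: "smooth \<phi>" and cp: "compact (closure {z. \<phi> z \<noteq> 0})" and ev: "\<forall>\<^sub>F z in nhds 0. \<phi> z = 1"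
    using assms by (auto simp: cutoff_def)
  obtain n :: nat where n: "closure {z. \<phi> z \<noteq> 0} \<subseteq> cube (real n)"
    using compact_subset_cube[OF compact_imp_bounded[OF cp]] .
  then have s: "supp_cube (real n) \<phi>" using closure_subset[of "{z. \<phi> z \<noteq> 0}"] unfolding supp_cube_def by blast
  note \<phi> = smooth_supp_cube_bdd_smooth[OF sm s]
  have "\<exists>M. \<forall>k. bder UNIV m M (\<lambda>z. \<phi> (z /\<^sub>R real k))" for m
  proof -
    obtain M where M: "bder UNIV m M \<phi>" using \<phi> by (rule bdd_smoothE)
    have "bder UNIV m (1 ^ m * M) (\<lambda>z. \<phi> (0 + z /\<^sub>R real k))" for k :: nat
    proof (rule bder_affine[OF _ _ _ M])
      show "linear (\<lambda>z::'a. z /\<^sub>R real k)" by (simp add: linear_iff scaleR_right_distrib)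
      fix b :: 'a assume b: "b \<in> Basis"
      have "(\<Sum>c\<in>Basis. \<bar>(b /\<^sub>R real k) \<bullet> c\<bar>) = (\<Sum>c\<in>Basis. if c = b then inverse (real k) else 0)"
        using b by (intro sum.cong) (auto simp: inner_Basis)
      also have "\<dots> \<le> 1" using b by (cases "k = 0") (auto simp: sum.delta inverse_le_1_iff)
      finally show "(\<Sum>c\<in>Basis. \<bar>(b /\<^sub>R real k) \<bullet> c\<bar>) \<le> 1" .
    qed auto
    then show ?thesis by auto
  qed
  moreover have "(\<lambda>k. \<phi> (z /\<^sub>R real k)) \<longlonglongrightarrow> 1" for z
  proof (rule tendsto_eventually)
    have "(\<lambda>k. inverse (real k) *\<^sub>R z) \<longlonglongrightarrow> 0 *\<^sub>R z"
      by (intro tendsto_scaleR tendsto_const LIMSEQ_inverse_real_of_nat[THEN filterlim_sequentially_Suc[THEN iffD1]])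
    then have "filterlim (\<lambda>k. z /\<^sub>R real k) (nhds 0) sequentially" by simp
    then show "\<forall>\<^sub>F k in sequentially. \<phi> (z /\<^sub>R real k) = 1"
      using ev unfolding filterlim_iff by blast
  qed
  ultimately have "sconv (\<lambda>k z. \<phi> (z /\<^sub>R real k)) (\<lambda>_. 1)" unfolding sconv_def by blast
  moreover have "supp_cube (real k * real n) (\<lambda>z. \<phi> (z /\<^sub>R real k))" if "0 < k" for k
    unfolding supp_cube_def
  proof (intro allI impI)
    fix z :: 'a assume "z \<notin> cube (real k * real n)"
    then obtain b where b: "b \<in> Basis" "real k * real n < \<bar>z \<bullet> b\<bar>" by (auto simp: mem_cube not_le)
    then have "real n < \<bar>(z /\<^sub>R real k) \<bullet> b\<bar>" using that by (simp add: abs_mult field_simps)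
    then have "z /\<^sub>R real k \<notin> cube (real n)" using b(1) by (force simp: mem_cube not_le)
    then show "\<phi> (z /\<^sub>R real k) = 0" by (rule supp_cubeD[OF s])
  qed
  ultimately show ?thesis by (rule that[where R = "\<lambda>k. real k * real n"])
qed

text \<open>Existence of a cutoff is what makes the oscillatory integral unique: without one,
  \<open>has_osc_integral\<close> would hold vacuously for every value.\<close>

lemma window_cutoff: "cutoff window"
  unfolding cutoff_def
proof (intro conjI)
  show "smooth window" using window_bdd_smooth unfolding bdd_smooth_def by blast
  have "closure {z. window z \<noteq> (0::complex)} \<subseteq> (cube 2 :: 'a set)"
    using window_outside by (intro closure_minimal compact_imp_closed compact_cube) blast
  then show "compact (closure {z::'a. window z \<noteq> 0})"
    by (metis bounded_subset closed_closure compact_cube compact_eq_bounded_closed)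
  have "ball 0 1 \<subseteq> (cube 1 :: 'a set)"
    unfolding subset_iff mem_cube mem_ball_0 by (meson Basis_le_norm less_imp_le order_trans)
  then have "window z = 1" if "z \<in> ball 0 1" for z :: 'a
    using that by (intro window_eq_1) blast
  then show "\<forall>\<^sub>F z::'a in nhds 0. window z = 1"
    unfolding eventually_nhds by (intro exI[of _ "ball 0 1"]) auto
qed

lemma has_osc_integral_oint:
  fixes F :: "'a::euclidean_space \<Rightarrow> 'a \<Rightarrow> 'c::cstar_algebra"
  assumes F: "(\<lambda>z. F (fst z) (snd z)) \<in> bdd_smooth"
  shows "has_osc_integral F (oint (\<lambda>z. F (fst z) (snd z)))"
  unfolding has_osc_integral_def
proof (intro allI impI)
  fix \<phi> :: "'a \<times> 'a \<Rightarrow> complex" assume "cutoff \<phi>"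
  then obtain R where sc: "sconv (\<lambda>k z. \<phi> (z /\<^sub>R real k)) (\<lambda>_. 1)"
    and R: "\<And>k. 0 < k \<Longrightarrow> supp_cube (R k) (\<lambda>z. \<phi> (z /\<^sub>R real k))"
    by (rule cutoff_sconv) blast
  define f where "f = (\<lambda>z. F (fst z) (snd z))"
  define H where "H k z = osc z *\<^sub>C (\<phi> (z /\<^sub>R real k) *\<^sub>C f z)" for k z
  \<comment> \<open>The index is shifted by one to avoid the degenerate cutoff at
    \<open>k = 0\<close>.\<close>
  have sc': "sconv (\<lambda>k z. \<phi> (z /\<^sub>R real (Suc k))) (\<lambda>_. 1)"
    using sc unfolding sconv_def using LIMSEQ_Suc by blast
  have Rs: "supp_cube (R (Suc k)) (\<lambda>z. \<phi> (z /\<^sub>R real (Suc k)))" for k by (rule R) simp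
  have "(\<lambda>k. integral UNIV (H (Suc k))) \<longlonglongrightarrow> oint f"
    unfolding H_def f_def by (rule oint_limit[OF sc' Rs F])
  then have lim: "(\<lambda>k. integral UNIV (H k)) \<longlonglongrightarrow> oint f"
    by (rule LIMSEQ_imp_Suc)
  \<comment> \<open>Iterated integral and integral over pairs agree, because both reduce to a cube
    on which the integrand is continuous.\<close>
  have eq: "integral UNIV (\<lambda>u. integral UNIV (\<lambda>v. (\<phi> (u /\<^sub>R real k, v /\<^sub>R real k) * exp (2 * pi * \<i> * (u \<bullet> v))) *\<^sub>C F u v))
      = integral UNIV (H k)" if k: "0 < k" for k
  proof -
    have H: "H k (u, v) = (\<phi> (u /\<^sub>R real k, v /\<^sub>R real k) * exp (2 * pi * \<i> * (u \<bullet> v))) *\<^sub>C F u v" for u v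
      by (simp add: H_def f_def osc_def scaleC_scaleC mult.commute)
    define l h where "l = - (R k *\<^sub>R (\<Sum>Basis::'a))" and "h = R k *\<^sub>R (\<Sum>Basis::'a)"
    have cb: "cbox l h = cube (R k)" by (simp add: cube_def l_def h_def)
    have z: "H k (u, v) = 0" if "u \<notin> cube (R k) \<or> v \<notin> cube (R k)" for u v
      using supp_cubeD[OF R[OF k], of "(u, v)"] that
      by (simp add: H_def mem_cube_Pair scaleC.zero_left scaleC.zero_right)
    have "loc_bdd osc" using osc_loc_bdd[of 0] by simp
    moreover have "(\<lambda>z. \<phi> (z /\<^sub>R real k) *\<^sub>C f z) \<in> bdd_smooth"
      using bdd_smooth_scaleC[OF sconv_bdd_smooth[OF sc] F, of k] by (simp add: f_def)
    ultimately have "loc_bdd (H k)"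
      unfolding H_def by (rule loc_bdd_bilinear[OF bounded_bilinear_scaleC _ bdd_smooth_loc_bdd])
    then obtain M where "bder (cube (R k)) 0 M (H k)" by (rule loc_bddE)
    then have cont: "continuous_on S (H k)" for S by (rule bder_continuous_on)
    have "integral UNIV (H k) = integral (cbox (l, l) (h, h)) (H k)"
    proof (rule integral_UNIV_cbox)
      fix w assume "w \<notin> cbox (l, l) (h, h)"
      then have "fst w \<notin> cube (R k) \<or> snd w \<notin> cube (R k)"
        unfolding cb[symmetric] cbox_Pair_eq by (cases w) auto
      then show "H k w = 0" using z[of "fst w" "snd w"] by simp
    qed
    also have "\<dots> = integral (cbox l h) (\<lambda>u. integral (cbox l h) (\<lambda>v. H k (u, v)))"
      by (rule integral_prod_continuous[OF cont])
    also have "\<dots> = integral UNIV (\<lambda>u. integral (cbox l h) (\<lambda>v. H k (u, v)))"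
      by (rule integral_UNIV_cbox[symmetric]) (simp add: z cb)
    also have "\<dots> = integral UNIV (\<lambda>u. integral UNIV (\<lambda>v. H k (u, v)))"
    proof -
      have "integral UNIV (\<lambda>v. H k (u, v)) = integral (cbox l h) (\<lambda>v. H k (u, v))" for u
        by (rule integral_UNIV_cbox) (simp add: z cb)
      then show ?thesis by simp
    qed
    finally show ?thesis unfolding H by simp
  qed
  show "(\<lambda>m. integral UNIV (\<lambda>u. integral UNIV (\<lambda>v. (\<phi> (u /\<^sub>R real m, v /\<^sub>R real m) * exp (2 * pi * \<i> * (u \<bullet> v))) *\<^sub>C F u v)))
      \<longlonglongrightarrow> oint (\<lambda>z. F (fst z) (snd z))"
    unfolding f_def[symmetric]
    by (rule Lim_transform_eventually[OF lim]) (use eq in \<open>auto intro!: eventually_sequentiallyI[of 1]\<close>)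
qed

lemma osc_integral_eq_oint:
  assumes "(\<lambda>z. F (fst z) (snd z)) \<in> bdd_smooth"
  shows "osc_integral F = oint (\<lambda>z. F (fst z) (snd z))"
  unfolding osc_integral_def
proof (rule the_equality)
  show "has_osc_integral F (oint (\<lambda>z. F (fst z) (snd z)))" by (rule has_osc_integral_oint[OF assms])
  fix I assume "has_osc_integral F I"
  with has_osc_integral_oint[OF assms] window_cutoff show "I = oint (\<lambda>z. F (fst z) (snd z))"
    unfolding has_osc_integral_def by (meson LIMSEQ_unique)
qed

subsection \<open>Symmetries of the oscillatory integral\<close>

lemma window_sconv:
  obtains R where "sconv (\<lambda>k z. window (z /\<^sub>R real (Suc k))) (\<lambda>_::'a::euclidean_space. 1)"
    "\<And>k. supp_cube (R k) (\<lambda>z::'a. window (z /\<^sub>R real (Suc k)))"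
proof -
  obtain R where sc: "sconv (\<lambda>k z. window (z /\<^sub>R real k)) (\<lambda>_::'a. 1)"
    and R: "\<And>k. 0 < k \<Longrightarrow> supp_cube (R k) (\<lambda>z::'a. window (z /\<^sub>R real k))"
    by (rule cutoff_sconv[OF window_cutoff]) blast
  have sc': "sconv (\<lambda>k z. window (z /\<^sub>R real (Suc k))) (\<lambda>_::'a. 1)"
    using sc unfolding sconv_def using LIMSEQ_Suc by blast
  have Rs: "supp_cube (R (Suc k)) (\<lambda>z::'a. window (z /\<^sub>R real (Suc k)))" for k by (rule R) simp
  show ?thesis by (rule that[OF sc' Rs])
qed

text \<open>A change of variables in the cutoff integrals; the translated windows still tend to 1.
  The quotient of the oscillating factors is absorbed into \<open>G\<close>, which has to stay
  bounded smooth.\<close>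

lemma oint_translate:
  fixes F :: "'a::euclidean_space \<times> 'a \<Rightarrow> 'c::cstar_algebra"
  assumes F: "F \<in> bdd_smooth" and G: "G \<in> bdd_smooth"
    and eq: "\<And>z. osc (z - p) *\<^sub>C F z = osc z *\<^sub>C G z"
  shows "oint (\<lambda>z. F (z + p)) = oint G"
proof -
  define W where "W k z = window (z /\<^sub>R real (Suc k))" for k and z :: "'a \<times> 'a"
  obtain R where W: "sconv W (\<lambda>_. 1)" "\<And>k. supp_cube (R k) (W k)"
    unfolding W_def by (rule window_sconv) blast
  have lim1: "(\<lambda>k. integral UNIV (\<lambda>z. osc z *\<^sub>C (W k z *\<^sub>C F (z + p)))) \<longlonglongrightarrow> oint (\<lambda>z. F (z + p))"
    by (rule oint_limit[OF W bdd_smooth_translate[OF F]])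
  have W': "sconv (\<lambda>k z. W k (z + - p)) (\<lambda>_. 1)"
    using sconv_affine[OF linear_id W(1), of "- p"] by (simp add: add.commute)
  have "\<exists>R'. supp_cube R' (\<lambda>z. W k (z + - p))" for k
    by (rule supp_cube_translate[OF W(2)]) blast
  then obtain R' where R': "\<And>k. supp_cube (R' k) (\<lambda>z. W k (z + - p))" by metis
  have lim2: "(\<lambda>k. integral UNIV (\<lambda>z. osc z *\<^sub>C (W k (z + - p) *\<^sub>C G z))) \<longlonglongrightarrow> oint G"
    by (rule oint_limit[OF W' R' G])
  have e: "integral UNIV (\<lambda>z. osc z *\<^sub>C (W k z *\<^sub>C F (z + p))) = integral UNIV (\<lambda>z. osc z *\<^sub>C (W k (z + - p) *\<^sub>C G z))" for k
  proof -
    have "supp_cube (R k) (\<lambda>z. osc z *\<^sub>C (W k z *\<^sub>C F (z + p)))"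
      using W(2)[of k] by (simp add: supp_cube_def scaleC.zero_left scaleC.zero_right)
    from integral_UNIV_translate[OF this, of "- p"]
    have e: "integral UNIV (\<lambda>z. osc z *\<^sub>C (W k z *\<^sub>C F (z + p))) = integral UNIV (\<lambda>z. osc (z - p) *\<^sub>C (W k (z - p) *\<^sub>C F z))"
      by simp
    also have "(\<lambda>z. osc (z - p) *\<^sub>C (W k (z - p) *\<^sub>C F z)) = (\<lambda>z. osc z *\<^sub>C (W k (z - p) *\<^sub>C G z))"
    proof
      fix z
      have "osc (z - p) *\<^sub>C (W k (z - p) *\<^sub>C F z) = W k (z - p) *\<^sub>C (osc (z - p) *\<^sub>C F z)"
        by (simp only: scaleC_scaleC mult.commute)
      also have "\<dots> = W k (z - p) *\<^sub>C (osc z *\<^sub>C G z)" by (simp only: eq)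
      also have "\<dots> = osc z *\<^sub>C (W k (z - p) *\<^sub>C G z)"
        by (simp only: scaleC_scaleC mult.commute)
      finally show "osc (z - p) *\<^sub>C (W k (z - p) *\<^sub>C F z) = osc z *\<^sub>C (W k (z - p) *\<^sub>C G z)" .
    qed
    finally show ?thesis by simp
  qed
  from LIMSEQ_unique[OF lim1[unfolded e] lim2] show ?thesis .
qed

lemma linear_fst_snd: "linear fst" "linear snd"
  by (simp_all add: linear_iff)

lemma bdd_smooth_pw_comp: "linear A \<Longrightarrow> (\<lambda>z. pw p (A z)) \<in> bdd_smooth"
  by (rule bdd_smooth_linear[OF _ bdd_smooth_pw])

lemma osc_shift: "osc (z - (s, t)) = osc z * pw (- s) (snd z) * pw (- t) (fst z) * pw s t"
  unfolding osc_cis pw_def cis_mult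
  by (rule arg_cong[where f = cis]) (simp add: inner_diff_left inner_diff_right algebra_simps inner_commute)

text \<open>By \<open>osc_shift\<close>, translating the first variable multiplies the oscillating
  factor by a plane wave in the second.\<close>

lemma oint_shift_fst:
  assumes F: "F \<in> bdd_smooth"
  shows "oint (\<lambda>z. F (z + (s, 0))) = oint (\<lambda>z. pw (- s) (snd z) *\<^sub>C F z)"
  by (rule oint_translate[OF F])
    (auto simp: scaleC_scaleC osc_shift intro!: bdd_smooth_scaleC bdd_smooth_pw_comp linear_fst_snd F)

lemma oint_shift_snd:
  assumes F: "F \<in> bdd_smooth"
  shows "oint (\<lambda>z. F (z + (0, t))) = oint (\<lambda>z. pw (- t) (fst z) *\<^sub>C F z)"
  by (rule oint_translate[OF F])
    (auto simp: scaleC_scaleC osc_shift intro!: bdd_smooth_scaleC bdd_smooth_pw_comp linear_fst_snd F)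

lemma mem_cube_reflect: "(- fst z, snd z) \<in> cube R \<longleftrightarrow> z \<in> cube R"
proof -
  have "- u \<in> cube R \<longleftrightarrow> u \<in> cube R" for u :: 'a by (simp add: mem_cube)
  then show ?thesis by (cases z) (simp add: mem_cube_Pair)
qed

lemma integral_reflect_fst:
  fixes G :: "'a::euclidean_space \<times> 'a \<Rightarrow> 'b::banach"
  assumes "continuous_on UNIV G" "supp_cube R G"
  shows "integral UNIV (\<lambda>z. G (- fst z, snd z)) = integral UNIV G"
proof -
  define h where "h = R *\<^sub>R (\<Sum>Basis::'a)"
  have cb: "cbox (- h, - h) (h, h) = cube R"
    unfolding set_eq_iff split_paired_All mem_cube_Pair cbox_Pair_eq by (simp add: cube_def h_def)
  have s: "supp_cube R (\<lambda>z. G (- fst z, snd z))"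
    unfolding supp_cube_def
  proof (intro allI impI)
    fix z :: "'a \<times> 'a" assume "z \<notin> cube R"
    then have "(- fst z, snd z) \<notin> cube R" by (simp add: mem_cube_reflect)
    then show "G (- fst z, snd z) = 0" by (rule supp_cubeD[OF assms(2)])
  qed
  have c: "continuous_on UNIV (\<lambda>z. G (- fst z, snd z))"
    by (rule continuous_on_compose2[OF assms(1)]) (auto intro!: continuous_intros)
  have "integral UNIV (\<lambda>z. G (- fst z, snd z)) = integral (cbox (- h, - h) (h, h)) (\<lambda>z. G (- fst z, snd z))"
    unfolding cb by (rule integral_UNIV_cube[OF s])
  also have "\<dots> = integral (cbox (- h) h) (\<lambda>u. integral (cbox (- h) h) (\<lambda>v. G (- u, v)))"
    by (subst integral_prod_continuous) (auto intro: continuous_on_subset[OF c])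
  also have "\<dots> = integral (cbox (- h) h) (\<lambda>u. integral (cbox (- h) h) (\<lambda>v. G (u, v)))"
    using integral_reflect[of h "- h" "\<lambda>u. integral (cbox (- h) h) (\<lambda>v. G (u, v))"] by simp
  also have "\<dots> = integral (cbox (- h, - h) (h, h)) G"
    by (rule integral_prod_continuous[symmetric]) (rule continuous_on_subset[OF assms(1) subset_UNIV])
  also have "\<dots> = integral UNIV G"
    unfolding cb by (rule integral_UNIV_cube[OF assms(2), symmetric])
  finally show ?thesis .
qed

text \<open>The involution conjugates the oscillating factor; reflecting the first variable undoes
  this and preserves the integrals.\<close>

lemma star_oint:
  fixes F :: "'a::euclidean_space \<times> 'a \<Rightarrow> 'c::cstar_algebra"
  assumes F: "F \<in> bdd_smooth"
  shows "star (oint F) = oint (\<lambda>z. star (F (- fst z, snd z)))"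
proof -
  define r where "r = (\<lambda>z::'a \<times> 'a. (- fst z, snd z))"
  have lr: "linear r" by (simp add: linear_iff r_def)
  define W where "W k z = window (z /\<^sub>R real (Suc k))" for k and z :: "'a \<times> 'a"
  obtain R where W: "sconv W (\<lambda>_. 1)" "\<And>k. supp_cube (R k) (W k)"
    unfolding W_def by (rule window_sconv) blast
  have lim1: "(\<lambda>k. star (integral UNIV (\<lambda>z. osc z *\<^sub>C (W k z *\<^sub>C F z)))) \<longlonglongrightarrow> star (oint F)"
    by (rule bounded_linear.tendsto[OF bounded_linear_star oint_limit[OF W F]])
  have sF: "(\<lambda>z. star (F (r z))) \<in> bdd_smooth"
    by (intro bdd_smooth_bounded_linear[OF bounded_linear_star] bdd_smooth_linear[OF lr] F)
  have "sconv (\<lambda>k z. W k (r z)) (\<lambda>_. 1)" using sconv_affine[OF lr W(1), of 0] by simp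
  from sconv_bilinear[OF bounded_bilinear_scaleR sconv_const[OF bdd_smooth_const[of 1]] this]
  have sc: "sconv (\<lambda>k z. W k (r z)) (\<lambda>_. 1)" by simp
  have cW: "W k z = cnj (W k z)" for k z
    by (simp add: W_def window_def)
  have sW: "supp_cube (R k) (\<lambda>z. W k (r z))" for k
    unfolding supp_cube_def
  proof (intro allI impI)
    fix z :: "'a \<times> 'a" assume "z \<notin> cube (R k)"
    then have "r z \<notin> cube (R k)" by (simp add: r_def mem_cube_reflect)
    then show "W k (r z) = 0" by (rule supp_cubeD[OF W(2)])
  qed
  have lim2: "(\<lambda>k. integral UNIV (\<lambda>z. osc z *\<^sub>C (W k (r z) *\<^sub>C star (F (r z))))) \<longlonglongrightarrow> oint (\<lambda>z. star (F (r z)))"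
    by (rule oint_limit[OF sc sW sF])
  have e: "star (integral UNIV (\<lambda>z. osc z *\<^sub>C (W k z *\<^sub>C F z))) = integral UNIV (\<lambda>z. osc z *\<^sub>C (W k (r z) *\<^sub>C star (F (r z))))" for k
  proof -
    define G where "G z = osc z *\<^sub>C (W k z *\<^sub>C F z)" for z
    have s: "supp_cube (R k) G" "supp_cube (R k) (\<lambda>z. star (G z))"
      using W(2)[of k] linear_0[OF bounded_linear.linear[OF bounded_linear_star]]
      by (auto simp: supp_cube_def G_def scaleC.zero_left scaleC.zero_right)
    have "loc_bdd osc" using osc_loc_bdd[of 0] by simp
    then have "loc_bdd G"
      unfolding G_def
      by (rule loc_bdd_bilinear[OF bounded_bilinear_scaleC _
            bdd_smooth_loc_bdd[OF bdd_smooth_scaleC[OF sconv_bdd_smooth[OF W(1)] F]]])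
    then have G: "G \<in> bdd_smooth" by (rule loc_bdd_supp_cube[OF _ s(1)])
    have cs: "continuous_on UNIV (\<lambda>z. star (G z))"
      by (rule bdd_smooth_continuous_on[OF bdd_smooth_bounded_linear[OF bounded_linear_star G]])
    have "star (integral UNIV G) = integral UNIV (\<lambda>z. star (G z))"
      using integral_linear[OF integrable_supp_cube[OF bdd_smooth_continuous_on[OF G] s(1)] bounded_linear_star]
      by (simp add: o_def)
    also have "\<dots> = integral UNIV (\<lambda>z. star (G (r z)))"
      using integral_reflect_fst[OF cs s(2)] by (simp add: r_def)
    also have "(\<lambda>z. star (G (r z))) = (\<lambda>z. osc z *\<^sub>C (W k (r z) *\<^sub>C star (F (r z))))"
    proof
      fix z
      have "cnj (osc (r z)) = osc z" by (simp add: osc_cis r_def cis_cnj)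
      then show "star (G (r z)) = osc z *\<^sub>C (W k (r z) *\<^sub>C star (F (r z)))"
        by (simp only: G_def star_scaleC cW[of k "r z", symmetric])
    qed
    finally show ?thesis by (simp add: G_def)
  qed
  from LIMSEQ_unique[OF lim1[unfolded e] lim2] show ?thesis by (simp add: r_def)
qed

section \<open>The deformed product\<close>

definition tens :: "('a \<Rightarrow> 'c::times) \<Rightarrow> ('b \<Rightarrow> 'c) \<Rightarrow> 'a \<times> 'b \<Rightarrow> 'c"
  where "tens f g z = f (fst z) * g (snd z)"

lemma sum_abs_Basis:
  assumes "b \<in> Basis" shows "(\<Sum>c\<in>Basis. \<bar>b \<bullet> c\<bar>) = (1::real)"
proof -
  have "(\<Sum>c\<in>Basis. \<bar>b \<bullet> c\<bar>) = (\<Sum>c\<in>Basis. if c = b then 1 else 0)"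
    using assms by (intro sum.cong) (auto simp: inner_Basis)
  then show ?thesis using assms by (simp add: sum.delta)
qed

lemma bder_fst_snd:
  fixes f :: "'a::euclidean_space \<Rightarrow> 'b::real_normed_vector"
  assumes "bder UNIV m M f"
  shows "bder UNIV m M (\<lambda>z::'a \<times> 'a. f (fst z))" "bder UNIV m M (\<lambda>z::'a \<times> 'a. f (snd z))"
proof -
  have 1: "(\<Sum>c\<in>Basis. \<bar>fst b \<bullet> c\<bar>) \<le> 1" if "b \<in> Basis" for b :: "'a \<times> 'a"
    using that by (auto simp: Basis_prod_def sum_abs_Basis)
  have 2: "(\<Sum>c\<in>Basis. \<bar>snd b \<bullet> c\<bar>) \<le> 1" if "b \<in> Basis" for b :: "'a \<times> 'a"
    using that by (auto simp: Basis_prod_def sum_abs_Basis)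
  show "bder UNIV m M (\<lambda>z::'a \<times> 'a. f (fst z))" "bder UNIV m M (\<lambda>z::'a \<times> 'a. f (snd z))"
    using bder_affine[OF linear_fst_snd(1) 1 order_refl assms, of UNIV 0]
      bder_affine[OF linear_fst_snd(2) 2 order_refl assms, of UNIV 0] by simp_all
qed

lemma bder_tens:
  fixes f g :: "'a::euclidean_space \<Rightarrow> 'c::real_normed_algebra"
  assumes "bder UNIV m M f" "bder UNIV m M' g"
  shows "bder UNIV m (2 ^ m * M * M') (tens f g)"
  unfolding tens_def[abs_def]
  by (rule bder_algebra_mult[OF bder_fst_snd(1)[OF assms(1)] bder_fst_snd(2)[OF assms(2)]])

lemma bdd_smooth_tens:
  fixes f g :: "'a::euclidean_space \<Rightarrow> 'c::real_normed_algebra"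
  assumes "f \<in> bdd_smooth" "g \<in> bdd_smooth"
  shows "tens f g \<in> bdd_smooth"
  by (rule bdd_smooth_compose2[OF assms]) (rule bder_tens)

lemma oint_zero: "oint (\<lambda>_. 0) = 0"
  by (simp add: oint_def oterm_def scaleC.zero_right)

locale linear_map =
  fixes J :: "'a::euclidean_space \<Rightarrow> 'a"
  assumes linear: "linear J"
begin

definition JL :: "'a \<times> 'a \<Rightarrow> 'a \<times> 'a"
  where "JL z = (J (fst z), snd z)"

lemma linear_JL: "linear JL"
  using linear by (simp add: linear_iff JL_def)

text \<open>The function \<open>tens f g\<close> of two variables does not involve \<open>x\<close>;
  both \<open>x\<close> and \<open>J\<close> enter through an affine substitution, so that bounds
  uniform in \<open>x\<close>, limits and derivatives come from the affine lemmas.\<close>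

definition tp :: "('a \<Rightarrow> 'c::cstar_algebra) \<Rightarrow> ('a \<Rightarrow> 'c) \<Rightarrow> 'a \<Rightarrow> 'c"
  where "tp f g x = oint (\<lambda>z. tens f g ((x, x) + JL z))"

lemma tp_eq: "tp f g x = oint (\<lambda>z. f (x + J (fst z)) * g (x + snd z))"
  by (simp add: tp_def tens_def JL_def)

lemma bdd_smooth_tp_integrand:
  "F \<in> bdd_smooth \<Longrightarrow> (\<lambda>z. F ((x, x) + JL z)) \<in> bdd_smooth"
  by (rule bdd_smooth_affine[OF linear_JL])

lemma rieffel_prod_eq:
  assumes "f \<in> bdd_smooth" "g \<in> bdd_smooth"
  shows "rieffel_prod J f g = tp f g"
proof
  fix x
  show "rieffel_prod J f g x = tp f g x"
    using bdd_smooth_tp_integrand[OF bdd_smooth_tens[OF assms], of x]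
    unfolding rieffel_prod_def tp_eq
    by (intro osc_integral_eq_oint) (simp add: tens_def JL_def)
qed

text \<open>If \<open>g\<close> lives in a cube around \<open>a\<close>, the second integration
  variable is confined to a cube around \<open>a - x\<close>; this is the situation of
  \<open>oint_bound_local\<close>.\<close>

lemma tp_bound_local:
  obtains C where "0 \<le> C"
    "\<And>(f :: 'a \<Rightarrow> 'c::cstar_algebra) g M M' a x. \<lbrakk>f \<in> bdd_smooth; g \<in> bdd_smooth;
      bder UNIV (8 * DIM('a)) M f; bder UNIV (8 * DIM('a)) M' g; \<And>y. y - a \<notin> cube c \<Longrightarrow> g y = 0\<rbrakk>
      \<Longrightarrow> norm (tp f g x) \<le> C * M * M' * wt (a - x)"
    "\<And>(f :: 'a \<Rightarrow> 'c::cstar_algebra) g M M' x. \<lbrakk>f \<in> bdd_smooth; g \<in> bdd_smooth;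
      bder UNIV (8 * DIM('a)) M f; bder UNIV (8 * DIM('a)) M' g\<rbrakk>
      \<Longrightarrow> norm (tp f g x) \<le> C * M * M'"
proof -
  let ?K = "8 * DIM('a)"
  obtain C1 where C1: "0 \<le> C1" "\<And>(F :: 'a \<times> 'a \<Rightarrow> 'c) M v0. \<lbrakk>F \<in> bdd_smooth;
      bder UNIV ?K M F; \<And>u v. v - v0 \<notin> cube c \<Longrightarrow> F (u, v) = 0\<rbrakk> \<Longrightarrow> norm (oint F) \<le> C1 * M * wt v0"
    by (rule oint_bound_local[where ?'a = 'a and ?'c = 'c and c = c]) blast
  obtain C2 where C2: "0 \<le> C2" "\<And>(F :: 'a \<times> 'a \<Rightarrow> 'c) M. \<lbrakk>F \<in> bdd_smooth;
      bder UNIV ?K M F\<rbrakk> \<Longrightarrow> norm (oint F) \<le> C2 * M"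
    by (rule oint_bound[where ?'a = 'a and ?'c = 'c]) blast
  obtain R where R: "1 \<le> R" "\<And>b. b \<in> Basis \<Longrightarrow> (\<Sum>c\<in>Basis. \<bar>JL b \<bullet> c\<bar>) \<le> R"
    by (rule linear_Basis_bound[where A = JL]) blast
  define D where "D = R ^ ?K * 2 ^ ?K"
  have D: "0 \<le> D" using R(1) by (simp add: D_def)
  have b: "bder UNIV ?K (D * M * M') (\<lambda>z. tens f g ((x, x) + JL z))"
    if "bder UNIV ?K M f" "bder UNIV ?K M' g" for f g :: "'a \<Rightarrow> 'c" and M M' x
    using bder_affine[OF linear_JL R(2,1) bder_tens[OF that], of UNIV "(x, x)"]
    by (simp add: D_def mult.assoc)
  show ?thesis
  proof (rule that[of "max C1 C2 * D"])
    show "0 \<le> max C1 C2 * D" using C1(1) D by simp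
    fix f g :: "'a \<Rightarrow> 'c" and M M' a x
    assume f: "f \<in> bdd_smooth" "g \<in> bdd_smooth" "bder UNIV ?K M f" "bder UNIV ?K M' g"
    have F: "(\<lambda>z. tens f g ((x, x) + JL z)) \<in> bdd_smooth"
      by (rule bdd_smooth_tp_integrand[OF bdd_smooth_tens[OF f(1,2)]])
    have M: "0 \<le> M" "0 \<le> M'" using bder_nonneg f(3,4) by auto
    have "norm (tp f g x) \<le> C2 * (D * M * M')"
      unfolding tp_def by (rule C2(2)[OF F b[OF f(3,4)]])
    also have "\<dots> \<le> max C1 C2 * (D * M * M')" using D M by (intro mult_right_mono) auto
    finally show "norm (tp f g x) \<le> max C1 C2 * D * M * M'" by (simp add: mult_ac)
    show "norm (tp f g x) \<le> max C1 C2 * D * M * M' * wt (a - x)"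
      if s: "\<And>y. y - a \<notin> cube c \<Longrightarrow> g y = 0"
    proof -
      have "norm (tp f g x) \<le> C1 * (D * M * M') * wt (a - x)"
        unfolding tp_def
      proof (rule C1(2)[OF F b[OF f(3,4)]])
        fix u v :: 'a assume "v - (a - x) \<notin> cube c"
        then have "g (x + v) = 0" by (intro s) (simp add: algebra_simps)
        then show "tens f g ((x, x) + JL (u, v)) = 0" by (simp add: tens_def JL_def)
      qed
      also have "\<dots> \<le> max C1 C2 * (D * M * M') * wt (a - x)" using D M by (intro mult_right_mono) auto
      finally show ?thesis by (simp add: mult_ac)
    qed
  qed
qed

section \<open>Differentiation under the oscillatory integral\<close>

lemma tens_has_derivative:
  fixes f g :: "'a \<Rightarrow> 'c::cstar_algebra"
  assumes f: "f \<in> bdd_smooth" and g: "g \<in> bdd_smooth"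
  shows "(tens f g has_derivative (\<lambda>h. f (fst w) * (\<Sum>b\<in>Basis. (snd h \<bullet> b) *\<^sub>R pd b g (snd w)) +
    (\<Sum>b\<in>Basis. (fst h \<bullet> b) *\<^sub>R pd b f (fst w)) * g (snd w))) (at w)"
proof -
  have hf: "(f has_derivative (\<lambda>h. \<Sum>b\<in>Basis. (h \<bullet> b) *\<^sub>R pd b f (fst w))) (at (fst w))"
    by (rule bdd_smoothE[OF f]) (rule bder_has_derivative)
  have hg: "(g has_derivative (\<lambda>h. \<Sum>b\<in>Basis. (h \<bullet> b) *\<^sub>R pd b g (snd w))) (at (snd w))"
    by (rule bdd_smoothE[OF g]) (rule bder_has_derivative)
  show ?thesis unfolding tens_def[abs_def]
    by (rule has_derivative_mult[OF has_derivative_compose[OF has_derivative_fst[OF has_derivative_ident] hf]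
          has_derivative_compose[OF has_derivative_snd[OF has_derivative_ident] hg]])
qed

text \<open>The remainder of the first-order expansion, divided by \<open>norm (h k)\<close>, is the
  oscillatory integral of \<open>G k\<close> after the affine substitution. The functions
  \<open>G k\<close> tend to 0 in the sense of \<open>sconv\<close>, their bounds coming from
  \<open>bder_increment\<close>, so \<open>oint_sconv\<close> applies.\<close>

lemma tp_has_derivative:
  fixes f g :: "'a \<Rightarrow> 'c::cstar_algebra"
  assumes f: "f \<in> bdd_smooth" and g: "g \<in> bdd_smooth"
  shows "(tp f g has_derivative (\<lambda>h. \<Sum>b\<in>Basis. (h \<bullet> b) *\<^sub>R (tp (pd b f) g x + tp f (pd b g) x))) (at x)"
proof -
  define D where "D b = (\<lambda>w. tens (pd b f) g w + tens f (pd b g) w)" for b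
  let ?F = "tens f g"
  have F: "?F \<in> bdd_smooth" by (rule bdd_smooth_tens[OF f g])
  have D: "D b \<in> bdd_smooth" if "b \<in> Basis" for b
    unfolding D_def by (intro bdd_smooth_add bdd_smooth_tens f g bdd_smooth_pd that)
  have oD: "oint (\<lambda>z. D b ((x, x) + JL z)) = tp (pd b f) g x + tp f (pd b g) x" if "b \<in> Basis" for b
    unfolding D_def tp_def
    by (rule oint_add; rule bdd_smooth_tp_integrand; rule bdd_smooth_tens; (rule f g bdd_smooth_pd that)+)
  let ?T = "\<lambda>h. \<Sum>b\<in>Basis. (h \<bullet> b) *\<^sub>R (tp (pd b f) g x + tp f (pd b g) x)"
  have "((\<lambda>h. norm (tp f g (x + h) - tp f g x - ?T h) / norm h) \<longlongrightarrow> 0) (at 0)"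
    unfolding tendsto_at_iff_sequentially comp_def
  proof (intro allI impI)
    fix h :: "nat \<Rightarrow> 'a" assume h0: "\<forall>i. h i \<in> UNIV - {0}" and h: "h \<longlonglongrightarrow> 0"
    \<comment> \<open>Moving \<open>x\<close> by \<open>h k\<close> moves both arguments of
      \<open>tens f g\<close>, whence the diagonal increment.\<close>
    define G where "G k w = (1 / norm (h k)) *\<^sub>R (?F (w + (h k, h k)) - ?F w - (\<Sum>b\<in>Basis. (h k \<bullet> b) *\<^sub>R D b w))" for k w
    have hn: "norm (h k) > 0" for k using h0 by auto
    have hb: "\<bar>1 / norm (h k)\<bar> * \<bar>h k \<bullet> b\<bar> \<le> 1" if "b \<in> Basis" for k b
      using Basis_le_norm[OF that, of "h k"] hn[of k] by (simp add: divide_le_eq)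
    have "sconv G (\<lambda>_. 0)"
      unfolding sconv_def
    proof (intro conjI allI)
      fix m
      obtain M where M: "bder UNIV (Suc m) M ?F" using F by (rule bdd_smoothE)
      have "\<exists>N. \<forall>b\<in>Basis. bder UNIV m (N b) (D b)"
        using D bdd_smooth_iff by (intro bchoice ballI) blast
      then obtain N where N: "\<And>b. b \<in> Basis \<Longrightarrow> bder UNIV m (N b) (D b)" by blast
      have "bder UNIV m (real DIM('a \<times> 'a) * M * 2 + (\<Sum>b\<in>Basis. N b)) (G k)" for k
      proof -
        have 1: "bder UNIV m (\<bar>1 / norm (h k)\<bar> * (real DIM('a \<times> 'a) * M * norm (h k, h k)))
            (\<lambda>w. (1 / norm (h k)) *\<^sub>R (?F (w + (h k, h k)) - ?F w))"
          by (rule bder_scaleR[OF bder_increment[OF M]])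
        have "norm (h k, h k) \<le> 2 * norm (h k)"
          using norm_Pair_le[of "h k" "h k"] by simp
        then have "\<bar>1 / norm (h k)\<bar> * (real DIM('a \<times> 'a) * M * norm (h k, h k)) \<le>
            \<bar>1 / norm (h k)\<bar> * (real DIM('a \<times> 'a) * M * (2 * norm (h k)))"
          using bder_nonneg[OF M] by (intro mult_left_mono) auto
        also have "\<dots> = real DIM('a \<times> 'a) * M * 2" using hn[of k] by simp
        finally have 2: "bder UNIV m (real DIM('a \<times> 'a) * M * 2) (\<lambda>w. (1 / norm (h k)) *\<^sub>R (?F (w + (h k, h k)) - ?F w))"
          using bder_le[OF 1] by blast
        have 3: "bder UNIV m (\<Sum>b\<in>Basis. N b) (\<lambda>w. \<Sum>b\<in>Basis. (1 / norm (h k)) *\<^sub>R (h k \<bullet> b) *\<^sub>R D b w)"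
        proof (rule bder_sum)
          fix b :: 'a assume b: "b \<in> Basis"
          have "bder UNIV m (\<bar>1 / norm (h k) * (h k \<bullet> b)\<bar> * N b) (\<lambda>w. (1 / norm (h k) * (h k \<bullet> b)) *\<^sub>R D b w)"
            by (rule bder_scaleR[OF N[OF b]])
          moreover have "\<bar>1 / norm (h k) * (h k \<bullet> b)\<bar> * N b \<le> 1 * N b"
            using hb[OF b, of k] bder_nonneg[OF N[OF b]] unfolding abs_mult by (intro mult_right_mono) auto
          ultimately have "bder UNIV m (1 * N b) (\<lambda>w. (1 / norm (h k) * (h k \<bullet> b)) *\<^sub>R D b w)" by (rule bder_le)
          then show "bder UNIV m (N b) (\<lambda>w. (1 / norm (h k)) *\<^sub>R (h k \<bullet> b) *\<^sub>R D b w)" by simp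
        qed simp
        show ?thesis using bder_diff[OF 2 3] by (simp add: G_def[abs_def] scaleR_diff_right scaleR_sum_right)
      qed
      then show "\<exists>M. \<forall>k. bder UNIV m M (G k)" by blast
    next
      fix w :: "'a \<times> 'a"
      have "(\<lambda>k. (h k, h k)) \<longlonglongrightarrow> (0, 0)" by (intro tendsto_Pair h)
      then have H: "(\<lambda>k. (h k, h k)) \<longlonglongrightarrow> 0" by (simp add: zero_prod_def)
      have Hn: "(h k, h k) \<noteq> 0" for k using h0 by (auto simp: zero_prod_def)
      have e: "f (fst w) * (\<Sum>b\<in>Basis. (snd (h k, h k) \<bullet> b) *\<^sub>R pd b g (snd w)) +
          (\<Sum>b\<in>Basis. (fst (h k, h k) \<bullet> b) *\<^sub>R pd b f (fst w)) * g (snd w) = (\<Sum>b\<in>Basis. (h k \<bullet> b) *\<^sub>R D b w)" for k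
        by (simp add: D_def tens_def sum_distrib_left sum_distrib_right scaleR_add_right sum.distrib)
      have l: "(\<lambda>k. norm (?F (w + (h k, h k)) - ?F w - (\<Sum>b\<in>Basis. (h k \<bullet> b) *\<^sub>R D b w)) / norm (h k, h k)) \<longlonglongrightarrow> 0"
        using has_derivative_sequentially[OF tens_has_derivative[OF f g] H Hn, of w] unfolding e .
      have "norm (h k, h k) = sqrt 2 * norm (h k)" for k
        by (simp add: norm_Pair real_sqrt_mult flip: mult_2)
      then have "norm (?F (w + (h k, h k)) - ?F w - (\<Sum>b\<in>Basis. (h k \<bullet> b) *\<^sub>R D b w)) / norm (h k, h k) * sqrt 2 = norm (G k w)" for k
        using hn[of k] by (simp add: G_def divide_inverse)
      with tendsto_mult_right[OF l, of "sqrt 2"] have "(\<lambda>k. norm (G k w)) \<longlonglongrightarrow> 0" by simp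
      then show "(\<lambda>k. G k w) \<longlonglongrightarrow> 0" by (rule tendsto_norm_zero_cancel)
    qed
    from sconv_affine[OF linear_JL this, of "(x, x)"]
    have "(\<lambda>k. oint (\<lambda>z. G k ((x, x) + JL z))) \<longlonglongrightarrow> oint (\<lambda>_::'a \<times> 'a. 0::'c)"
      by (rule oint_sconv[OF _ bdd_smooth_const])
    then have "(\<lambda>k. norm (oint (\<lambda>z. G k ((x, x) + JL z)))) \<longlonglongrightarrow> norm (oint (\<lambda>_::'a \<times> 'a. 0::'c))"
      by (rule tendsto_norm)
    moreover have "oint (\<lambda>_::'a \<times> 'a. 0::'c) = 0" by (rule oint_zero)
    moreover have "norm (oint (\<lambda>z. G k ((x, x) + JL z))) = norm (tp f g (x + h k) - tp f g x - ?T (h k)) / norm (h k)" for k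
    proof -
      have sh: "(\<lambda>z. ?F ((x, x) + JL z + (h k, h k))) = (\<lambda>z. ?F ((x + h k, x + h k) + JL z))"
        by (simp add: JL_def add_ac)
      have F1: "(\<lambda>z. ?F ((y, y) + JL z)) \<in> bdd_smooth" for y by (rule bdd_smooth_tp_integrand[OF F])
      have lin: "bounded_linear (\<lambda>y::'c. c *\<^sub>R y)" "c *\<^sub>R (d *\<^sub>C y) = d *\<^sub>C (c *\<^sub>R y)" for c d and y :: 'c
        by (auto simp: bounded_linear_scaleR_right scaleC.scaleR_right)
      have Db: "(\<lambda>z. (h k \<bullet> b) *\<^sub>R D b ((x, x) + JL z)) \<in> bdd_smooth" if "b \<in> Basis" for b
        by (rule bdd_smooth_bounded_linear[OF lin(1) bdd_smooth_tp_integrand[OF D[OF that]]])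
      have "oint (\<lambda>z. G k ((x, x) + JL z)) = (1 / norm (h k)) *\<^sub>R oint (\<lambda>z. ?F ((x + h k, x + h k) + JL z) -
          ?F ((x, x) + JL z) - (\<Sum>b\<in>Basis. (h k \<bullet> b) *\<^sub>R D b ((x, x) + JL z)))"
        unfolding G_def sh[unfolded fun_eq_iff, rule_format]
        by (rule oint_linear[OF lin]) (intro bdd_smooth_diff F1 bdd_smooth_sum Db)
      also have "oint (\<lambda>z. ?F ((x + h k, x + h k) + JL z) -
          ?F ((x, x) + JL z) - (\<Sum>b\<in>Basis. (h k \<bullet> b) *\<^sub>R D b ((x, x) + JL z))) =
          oint (\<lambda>z. ?F ((x + h k, x + h k) + JL z)) - oint (\<lambda>z. ?F ((x, x) + JL z)) -
          (\<Sum>b\<in>Basis. oint (\<lambda>z. (h k \<bullet> b) *\<^sub>R D b ((x, x) + JL z)))"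
        using F1 Db by (simp add: oint_diff oint_sum bdd_smooth_diff bdd_smooth_sum)
      also have "\<dots> = tp f g (x + h k) - tp f g x - ?T (h k)"
      proof -
        have "oint (\<lambda>z. (h k \<bullet> b) *\<^sub>R D b ((x, x) + JL z)) = (h k \<bullet> b) *\<^sub>R (tp (pd b f) g x + tp f (pd b g) x)"
          if "b \<in> Basis" for b
          using oint_linear[OF lin bdd_smooth_tp_integrand[OF D[OF that]]] oD[OF that] by simp
        then show ?thesis by (simp add: tp_def)
      qed
      finally show ?thesis by simp
    qed
    ultimately show "(\<lambda>k. norm (tp f g (x + h k) - tp f g x - ?T (h k)) / norm (h k)) \<longlonglongrightarrow> 0"
      by simp
  qed
  moreover have "bounded_linear ?T"
    by (intro bounded_linear_sum bounded_linear_scaleR_const bounded_linear_inner_left)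
  ultimately show ?thesis by (simp add: has_derivative_at)
qed

lemma pd_tp:
  assumes "f \<in> bdd_smooth" "g \<in> bdd_smooth" "b \<in> Basis"
  shows "pd b (tp f g) = (\<lambda>x. tp (pd b f) g x + tp f (pd b g) x)"
proof
  fix x
  have "pd b (tp f g) x = (\<Sum>c\<in>Basis. (b \<bullet> c) *\<^sub>R (tp (pd c f) g x + tp f (pd c g) x))"
    by (rule pd_eqI[OF tp_has_derivative[OF assms(1,2)]])
  also have "\<dots> = (\<Sum>c\<in>Basis. if c = b then tp (pd b f) g x + tp f (pd b g) x else 0)"
    using assms(3) by (intro sum.cong) (auto simp: inner_Basis)
  also have "\<dots> = tp (pd b f) g x + tp f (pd b g) x" using assms(3) by (simp add: sum.delta)
  finally show "pd b (tp f g) x = tp (pd b f) g x + tp f (pd b g) x" .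
qed

lemma supp_shift_pd:
  fixes g :: "'a \<Rightarrow> 'b::real_normed_vector"
  assumes "bder UNIV m M g" "\<And>y. y - a \<notin> cube c \<Longrightarrow> g y = 0" "y - a \<notin> cube c"
  shows "pd b g y = 0"
proof -
  have "supp_cube c (\<lambda>z. g (z + a))" using assms(2) by (simp add: supp_cube_def)
  from supp_cubeD[OF pd_supp_cube[OF this] assms(3), of b] show ?thesis
    unfolding pd_translate[OF assms(1)] by simp
qed

text \<open>Partial derivatives are derivations of the product, so each order doubles the number of
  terms while the derivatives fall on the factors. Supports pass to derivatives, and one
  \<open>C\<close> serves for all \<open>m\<close>.\<close>

lemma tp_bder:
  obtains C where "0 \<le> C"
    "\<And>(f :: 'a \<Rightarrow> 'c::cstar_algebra) g M M' a x m. \<lbrakk>f \<in> bdd_smooth; g \<in> bdd_smooth;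
      bder UNIV (m + 8 * DIM('a)) M f; bder UNIV (m + 8 * DIM('a)) M' g; \<And>y. y - a \<notin> cube c \<Longrightarrow> g y = 0\<rbrakk>
      \<Longrightarrow> bder {x} m (2 ^ m * (C * M * M' * wt (a - x))) (tp f g)"
    "\<And>(f :: 'a \<Rightarrow> 'c::cstar_algebra) g M M' m. \<lbrakk>f \<in> bdd_smooth; g \<in> bdd_smooth;
      bder UNIV (m + 8 * DIM('a)) M f; bder UNIV (m + 8 * DIM('a)) M' g\<rbrakk>
      \<Longrightarrow> bder UNIV m (2 ^ m * (C * M * M')) (tp f g)"
proof -
  let ?K = "8 * DIM('a)"
  obtain C where C: "0 \<le> C"
    and loc: "\<And>(f :: 'a \<Rightarrow> 'c) g M M' a x. \<lbrakk>f \<in> bdd_smooth; g \<in> bdd_smooth;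
      bder UNIV ?K M f; bder UNIV ?K M' g; \<And>y. y - a \<notin> cube c \<Longrightarrow> g y = 0\<rbrakk>
      \<Longrightarrow> norm (tp f g x) \<le> C * M * M' * wt (a - x)"
    and glob: "\<And>(f :: 'a \<Rightarrow> 'c) g M M' x. \<lbrakk>f \<in> bdd_smooth; g \<in> bdd_smooth;
      bder UNIV ?K M f; bder UNIV ?K M' g\<rbrakk> \<Longrightarrow> norm (tp f g x) \<le> C * M * M'"
    by (rule tp_bound_local[where ?'c = 'c and c = c]) blast
  have d: "tp f g differentiable at x" if "f \<in> bdd_smooth" "g \<in> bdd_smooth" for f g :: "'a \<Rightarrow> 'c" and x
    by (rule differentiableI[OF tp_has_derivative[OF that]])
  show ?thesis
  proof (rule that[OF C])
    fix f g :: "'a \<Rightarrow> 'c" and M M' a x m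
    assume "f \<in> bdd_smooth" "g \<in> bdd_smooth" "bder UNIV (m + ?K) M f" "bder UNIV (m + ?K) M' g"
      "\<And>y. y - a \<notin> cube c \<Longrightarrow> g y = 0"
    then show "bder {x} m (2 ^ m * (C * M * M' * wt (a - x))) (tp f g)"
    proof (induction m arbitrary: f g)
      case 0
      then show ?case using d loc by simp
    next
      case (Suc m)
      let ?B = "C * M * M' * wt (a - x)"
      have B0: "0 \<le> ?B"
        using C bder_nonneg[OF Suc.prems(3)] bder_nonneg[OF Suc.prems(4)] by simp
      note f' = bder_less[OF Suc.prems(3), of "m + ?K"] and g' = bder_less[OF Suc.prems(4), of "m + ?K"]
      note f0 = bder_less[OF Suc.prems(3), of "?K"] and g0 = bder_less[OF Suc.prems(4), of "?K"]
      show ?case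
      proof (rule bder_SucI)
        show "tp f g differentiable at y" for y by (rule d[OF Suc.prems(1,2)])
        have "norm (tp f g x) \<le> ?B" using loc[OF Suc.prems(1,2) f0 g0 Suc.prems(5)] by simp
        also have "\<dots> \<le> 2 ^ Suc m * ?B"
          using mult_right_mono[OF one_le_power[of "2::real" "Suc m"] B0] by simp
        finally show "norm (tp f g y) \<le> 2 ^ Suc m * ?B" if "y \<in> {x}" for y using that by simp
        fix b :: 'a assume b: "b \<in> Basis"
        have "bder {x} m (2 ^ m * ?B) (tp (pd b f) g)"
          using Suc.prems b g' by (intro Suc.IH bdd_smooth_pd) auto
        moreover have "bder {x} m (2 ^ m * ?B) (tp f (pd b g))"
        proof (rule Suc.IH[OF Suc.prems(1) bdd_smooth_pd[OF Suc.prems(2) b]])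
          show "bder UNIV (m + ?K) M f" using f' by simp
          show "bder UNIV (m + ?K) M' (pd b g)" using Suc.prems(4) b by simp
          show "pd b g y = 0" if "y - a \<notin> cube c" for y
            by (rule supp_shift_pd[OF Suc.prems(4) Suc.prems(5) that])
        qed
        ultimately have "bder {x} m (2 ^ m * ?B + 2 ^ m * ?B) (pd b (tp f g))"
          unfolding pd_tp[OF Suc.prems(1,2) b] by (rule bder_add)
        moreover have "2 ^ m * ?B + 2 ^ m * ?B = 2 ^ Suc m * ?B" by simp
        ultimately show "bder {x} m (2 ^ Suc m * ?B) (pd b (tp f g))" by (simp only:)
      qed
    qed
  next
    fix f g :: "'a \<Rightarrow> 'c" and M M' m
    assume "f \<in> bdd_smooth" "g \<in> bdd_smooth" "bder UNIV (m + ?K) M f" "bder UNIV (m + ?K) M' g"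
    then show "bder UNIV m (2 ^ m * (C * M * M')) (tp f g)"
    proof (induction m arbitrary: f g)
      case 0
      then show ?case using d glob by simp
    next
      case (Suc m)
      let ?B = "C * M * M'"
      have B0: "0 \<le> ?B"
        using C bder_nonneg[OF Suc.prems(3)] bder_nonneg[OF Suc.prems(4)] by simp
      note f' = bder_less[OF Suc.prems(3), of "m + ?K"] and g' = bder_less[OF Suc.prems(4), of "m + ?K"]
      note f0 = bder_less[OF Suc.prems(3), of "?K"] and g0 = bder_less[OF Suc.prems(4), of "?K"]
      show ?case
      proof (rule bder_SucI)
        show "tp f g differentiable at y" for y by (rule d[OF Suc.prems(1,2)])
        fix x
        have "norm (tp f g x) \<le> ?B" using glob[OF Suc.prems(1,2) f0 g0] by simp
        also have "\<dots> \<le> 2 ^ Suc m * ?B"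
          using mult_right_mono[OF one_le_power[of "2::real" "Suc m"] B0] by simp
        finally show "norm (tp f g x) \<le> 2 ^ Suc m * ?B" .
      next
        fix b :: 'a assume b: "b \<in> Basis"
        have "bder UNIV m (2 ^ m * ?B) (tp (pd b f) g)"
          using Suc.prems b g' by (intro Suc.IH bdd_smooth_pd) auto
        moreover have "bder UNIV m (2 ^ m * ?B) (tp f (pd b g))"
          using Suc.prems b f' by (intro Suc.IH bdd_smooth_pd) auto
        ultimately have "bder UNIV m (2 ^ m * ?B + 2 ^ m * ?B) (pd b (tp f g))"
          unfolding pd_tp[OF Suc.prems(1,2) b] by (rule bder_add)
        moreover have "2 ^ m * ?B + 2 ^ m * ?B = 2 ^ Suc m * ?B" by simp
        ultimately show "bder UNIV m (2 ^ Suc m * ?B) (pd b (tp f g))" by (simp only:)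
      qed
    qed
  qed
qed

lemma tp_bdd_smooth:
  fixes f g :: "'a \<Rightarrow> 'c::cstar_algebra"
  assumes "f \<in> bdd_smooth" "g \<in> bdd_smooth"
  shows "tp f g \<in> bdd_smooth"
  unfolding bdd_smooth_iff
proof
  fix m
  obtain C where C: "\<And>(f :: 'a \<Rightarrow> 'c) g M M' m. \<lbrakk>f \<in> bdd_smooth; g \<in> bdd_smooth;
      bder UNIV (m + 8 * DIM('a)) M f; bder UNIV (m + 8 * DIM('a)) M' g\<rbrakk>
      \<Longrightarrow> bder UNIV m (2 ^ m * (C * M * M')) (tp f g)"
    by (rule tp_bder[where ?'c = 'c]) blast
  obtain M M' where "bder UNIV (m + 8 * DIM('a)) M f" "bder UNIV (m + 8 * DIM('a)) M' g"
    using assms by (auto elim!: bdd_smoothE)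
  from C[OF assms this] show "\<exists>M. bder UNIV m M (tp f g)" ..
qed

lemma tp_sconv:
  fixes f g :: "'a \<Rightarrow> 'c::cstar_algebra"
  assumes fn: "sconv fn f" and gn: "sconv gn g" and f: "f \<in> bdd_smooth" and g: "g \<in> bdd_smooth"
  shows "sconv (\<lambda>k. tp (fn k) (gn k)) (tp f g)"
  unfolding sconv_def
proof (intro conjI allI)
  fix m
  obtain C where C: "\<And>(f :: 'a \<Rightarrow> 'c) g M M' m. \<lbrakk>f \<in> bdd_smooth; g \<in> bdd_smooth;
      bder UNIV (m + 8 * DIM('a)) M f; bder UNIV (m + 8 * DIM('a)) M' g\<rbrakk>
      \<Longrightarrow> bder UNIV m (2 ^ m * (C * M * M')) (tp f g)"
    by (rule tp_bder[where ?'c = 'c]) blast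
  obtain M M' where "\<And>k. bder UNIV (m + 8 * DIM('a)) M (fn k)" "\<And>k. bder UNIV (m + 8 * DIM('a)) M' (gn k)"
    using sconvE[OF fn] sconvE[OF gn] by metis
  from C[OF sconv_bdd_smooth[OF fn] sconv_bdd_smooth[OF gn] this]
  show "\<exists>M. \<forall>k. bder UNIV m M (tp (fn k) (gn k))" by blast
next
  fix x
  have "sconv (\<lambda>k. tens (fn k) (gn k)) (tens f g)"
    unfolding tens_def[abs_def]
    using sconv_bilinear[OF bounded_bilinear_mult sconv_affine[OF linear_fst_snd(1) fn, of 0]
        sconv_affine[OF linear_fst_snd(2) gn, of 0]] by simp
  from sconv_affine[OF linear_JL this, of "(x, x)"]
  show "(\<lambda>k. tp (fn k) (gn k) x) \<longlonglongrightarrow> tp f g x"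
    unfolding tp_def by (rule oint_sconv[OF _ bdd_smooth_tp_integrand[OF bdd_smooth_tens[OF f g]]])
qed

section \<open>Linearity of the product and its behaviour on plane waves\<close>

lemma tp_add_left:
  assumes "f \<in> bdd_smooth" "f' \<in> bdd_smooth" "g \<in> bdd_smooth"
  shows "tp (\<lambda>x. f x + f' x) g = (\<lambda>x. tp f g x + tp f' g x)"
  using oint_add[OF bdd_smooth_tp_integrand[OF bdd_smooth_tens[OF assms(1,3)]]
      bdd_smooth_tp_integrand[OF bdd_smooth_tens[OF assms(2,3)]]]
  by (auto simp: tp_def tens_def distrib_right)

lemma tp_add_right:
  assumes "f \<in> bdd_smooth" "g \<in> bdd_smooth" "g' \<in> bdd_smooth"
  shows "tp f (\<lambda>x. g x + g' x) = (\<lambda>x. tp f g x + tp f g' x)"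
  using oint_add[OF bdd_smooth_tp_integrand[OF bdd_smooth_tens[OF assms(1,2)]]
      bdd_smooth_tp_integrand[OF bdd_smooth_tens[OF assms(1,3)]]]
  by (auto simp: tp_def tens_def distrib_left)

lemma tp_scaleC_left:
  assumes "f \<in> bdd_smooth" "g \<in> bdd_smooth"
  shows "tp (\<lambda>x. c *\<^sub>C f x) g = (\<lambda>x. c *\<^sub>C tp f g x)"
  using oint_scaleC[OF bdd_smooth_tp_integrand[OF bdd_smooth_tens[OF assms]]]
  by (simp add: tp_def[abs_def] tens_def scaleC_mult_left)

lemma tp_scaleC_right:
  assumes "f \<in> bdd_smooth" "g \<in> bdd_smooth"
  shows "tp f (\<lambda>x. c *\<^sub>C g x) = (\<lambda>x. c *\<^sub>C tp f g x)"
  using oint_scaleC[OF bdd_smooth_tp_integrand[OF bdd_smooth_tens[OF assms]]]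
  by (simp add: tp_def[abs_def] tens_def scaleC_mult_right)

lemma tp_zero: "tp (\<lambda>_. 0) g = (\<lambda>_. 0)" "tp f (\<lambda>_. 0) = (\<lambda>_. 0)"
  by (simp_all add: tp_def[abs_def] tens_def oint_zero)

lemma tp_sum_left:
  assumes "\<And>i. i \<in> I \<Longrightarrow> f i \<in> bdd_smooth" "g \<in> bdd_smooth"
  shows "tp (\<lambda>x. \<Sum>i\<in>I. f i x) g = (\<lambda>x. \<Sum>i\<in>I. tp (f i) g x)"
  using assms
  by (induction I rule: infinite_finite_induct) (simp_all add: tp_zero tp_add_left bdd_smooth_sum)

lemma tp_sum_right:
  assumes "f \<in> bdd_smooth" "\<And>i. i \<in> I \<Longrightarrow> g i \<in> bdd_smooth"
  shows "tp f (\<lambda>x. \<Sum>i\<in>I. g i x) = (\<lambda>x. \<Sum>i\<in>I. tp f (g i) x)"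
  using assms
  by (induction I rule: infinite_finite_induct) (simp_all add: tp_zero tp_add_right bdd_smooth_sum)

lemma tp_translate: "tp (\<lambda>y. f (y + p)) (\<lambda>y. g (y + p)) x = tp f g (x + p)"
  by (simp add: tp_eq add_ac)

text \<open>The wave in the right factor is a wave in the second integration variable, which amounts
  to translating the first variable by \<open>- p\<close>, that is, \<open>f\<close> by
  \<open>- J p\<close>. Frequencies of the right factor thus cost no derivatives.\<close>

lemma tp_pw_right:
  assumes f: "f \<in> bdd_smooth" and g: "g \<in> bdd_smooth"
  shows "tp f (\<lambda>y. pw p y *\<^sub>C g y) = (\<lambda>x. pw p x *\<^sub>C tp (\<lambda>y. f (y - J p)) g x)"
proof
  fix x
  have F: "(\<lambda>z. f (x + J (fst z)) * g (x + snd z)) \<in> bdd_smooth"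
    using bdd_smooth_tp_integrand[OF bdd_smooth_tens[OF f g], of x] by (simp add: tens_def JL_def)
  have G: "(\<lambda>z. pw p (snd z) *\<^sub>C (f (x + J (fst z)) * g (x + snd z))) \<in> bdd_smooth"
    by (intro bdd_smooth_scaleC bdd_smooth_pw_comp linear_fst_snd F)
  have "tp f (\<lambda>y. pw p y *\<^sub>C g y) x = oint (\<lambda>z. pw p x *\<^sub>C (pw p (snd z) *\<^sub>C (f (x + J (fst z)) * g (x + snd z))))"
    by (simp add: tp_eq pw_add scaleC_mult_right scaleC_scaleC)
  also have "\<dots> = pw p x *\<^sub>C oint (\<lambda>z. pw p (snd z) *\<^sub>C (f (x + J (fst z)) * g (x + snd z)))"
    by (rule oint_scaleC[OF G])
  also have "oint (\<lambda>z. pw p (snd z) *\<^sub>C (f (x + J (fst z)) * g (x + snd z))) = tp (\<lambda>y. f (y - J p)) g x"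
    using oint_shift_fst[OF F, of "- p"]
    by (simp add: tp_eq linear_add[OF linear] linear_neg[OF linear] linear_diff[OF linear] algebra_simps)
  finally show "tp f (\<lambda>y. pw p y *\<^sub>C g y) x = pw p x *\<^sub>C tp (\<lambda>y. f (y - J p)) g x" .
qed

end

locale skew_map = linear_map +
  assumes skew: "J x \<bullet> y = - (x \<bullet> J y)"
begin

text \<open>Skew symmetry turns \<open>pw q (J u)\<close> into the wave of frequency
  \<open>- J q\<close> in \<open>u\<close>, which amounts to a translation of the second
  variable.\<close>

lemma tp_pw_left:
  assumes f: "f \<in> bdd_smooth" and g: "g \<in> bdd_smooth"
  shows "tp (\<lambda>y. pw q y *\<^sub>C f y) g = (\<lambda>x. pw q x *\<^sub>C tp f (\<lambda>y. g (y + J q)) x)"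
proof
  fix x
  have F: "(\<lambda>z. f (x + J (fst z)) * g (x + snd z)) \<in> bdd_smooth"
    using bdd_smooth_tp_integrand[OF bdd_smooth_tens[OF f g], of x] by (simp add: tens_def JL_def)
  have G: "(\<lambda>z. pw (- J q) (fst z) *\<^sub>C (f (x + J (fst z)) * g (x + snd z))) \<in> bdd_smooth"
    by (intro bdd_smooth_scaleC bdd_smooth_pw_comp linear_fst_snd F)
  have "pw q (J u) = pw (- J q) u" for u by (simp add: pw_def skew)
  then have "tp (\<lambda>y. pw q y *\<^sub>C f y) g x = oint (\<lambda>z. pw q x *\<^sub>C (pw (- J q) (fst z) *\<^sub>C (f (x + J (fst z)) * g (x + snd z))))"
    by (simp add: tp_eq pw_add scaleC_mult_left scaleC_scaleC)
  also have "\<dots> = pw q x *\<^sub>C oint (\<lambda>z. pw (- J q) (fst z) *\<^sub>C (f (x + J (fst z)) * g (x + snd z)))"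
    by (rule oint_scaleC[OF G])
  also have "oint (\<lambda>z. pw (- J q) (fst z) *\<^sub>C (f (x + J (fst z)) * g (x + snd z))) = tp f (\<lambda>y. g (y + J q)) x"
    using oint_shift_snd[OF F, of "J q"] by (simp add: tp_eq add_ac)
  finally show "tp (\<lambda>y. pw q y *\<^sub>C f y) g x = pw q x *\<^sub>C tp f (\<lambda>y. g (y + J q)) x" .
qed

text \<open>The product of plane waves involves \<open>kap c\<close>, the oscillatory integral of the constant function
  with value \<open>c\<close>. It equals \<open>c\<close>, but only the following module properties are needed.\<close>

definition kap :: "'c::cstar_algebra \<Rightarrow> 'c"
  where "kap c = oint (\<lambda>_::'a \<times> 'a. c)"

lemma kap_mult: "kap (c * d) = kap c * d" "kap (c * d) = c * kap d"
  unfolding kap_def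
  using oint_linear[OF bounded_linear_mult_left[of d] _ bdd_smooth_const[of c]]
    oint_linear[OF bounded_linear_mult_right[of c] _ bdd_smooth_const[of d]]
  by (simp_all add: scaleC_mult_left scaleC_mult_right)

lemma star_kap: "star (kap c) = kap (star c)"
  unfolding kap_def by (rule star_oint[OF bdd_smooth_const])

lemma bdd_smooth_wave: "(\<lambda>x. pw p x *\<^sub>C c) \<in> bdd_smooth"
  by (intro bdd_smooth_scaleC bdd_smooth_pw bdd_smooth_const)

text \<open>Plane waves multiply as in a noncommutative torus: frequencies add, and a phase bilinear
  in the two frequencies appears.\<close>

lemma tp_wave:
  "tp (\<lambda>x. pw p x *\<^sub>C c) (\<lambda>x. pw q x *\<^sub>C d) = (\<lambda>x. pw (p + q) x *\<^sub>C (cnj (pw p (J q)) *\<^sub>C kap (c * d)))"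
proof -
  have k: "tp (\<lambda>x. c) (\<lambda>x. d) = (\<lambda>x. kap (c * d))" by (simp add: tp_eq[abs_def] kap_def)
  have "tp (\<lambda>x. pw p x *\<^sub>C c) (\<lambda>x. pw q x *\<^sub>C d) = (\<lambda>x. pw q x *\<^sub>C tp (\<lambda>y. pw p (y - J q) *\<^sub>C c) (\<lambda>x. d) x)"
    by (rule tp_pw_right[OF bdd_smooth_wave bdd_smooth_const])
  also have "(\<lambda>y. pw p (y - J q) *\<^sub>C c) = (\<lambda>y. pw p y *\<^sub>C (cnj (pw p (J q)) *\<^sub>C c))"
    by (simp add: pw_diff scaleC_scaleC)
  also have "tp \<dots> (\<lambda>x. d) = (\<lambda>x. pw p x *\<^sub>C tp (\<lambda>x. cnj (pw p (J q)) *\<^sub>C c) (\<lambda>x. d) x)"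
    by (rule tp_pw_left[OF bdd_smooth_const bdd_smooth_const])
  also have "tp (\<lambda>x. cnj (pw p (J q)) *\<^sub>C c) (\<lambda>x. d) = (\<lambda>x. cnj (pw p (J q)) *\<^sub>C kap (c * d))"
    by (subst tp_scaleC_left[OF bdd_smooth_const bdd_smooth_const]) (simp add: k)
  finally show ?thesis by (simp add: scaleC_scaleC pw_add mult_ac)
qed

end

section \<open>Fourier series on the cube of side 4\<close>

text \<open>The frequencies of the characters of \<open>cube 2\<close>, which has side 4 and
  contains the support of \<open>window\<close>.\<close>

abbreviation quart :: "'a::real_vector \<Rightarrow> 'a"
  where "quart k \<equiv> (1 / 4) *\<^sub>R k"

lemma wt_quart: "wt (quart k) \<le> 16 ^ DIM('a) * wt (k :: 'a::euclidean_space)"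
proof -
  have "(\<Prod>b\<in>Basis. 1 / (1 + (quart k \<bullet> b)\<^sup>2)) \<le> (\<Prod>b\<in>(Basis::'a set). 16 * (1 / (1 + (k \<bullet> b)\<^sup>2)))"
  proof (rule prod_mono, intro conjI)
    fix b :: 'a
    have "1 + (k \<bullet> b)\<^sup>2 \<le> 16 * (1 + (quart k \<bullet> b)\<^sup>2)" by (simp add: power_divide power2_eq_square)
    then show "1 / (1 + (quart k \<bullet> b)\<^sup>2) \<le> 16 * (1 / (1 + (k \<bullet> b)\<^sup>2))"
      by (simp add: divide_le_eq le_divide_eq add_pos_nonneg pos_divide_le_eq)
  qed simp
  also have "\<dots> = 16 ^ DIM('a) * wt k" unfolding wt_def prod.distrib by simp
  finally show ?thesis by (simp add: wt_def)
qed

lemma phase_deriv_pw: "phase_deriv (\<lambda>_. 0) s (pw s)"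
  unfolding phase_deriv_def
proof (intro conjI allI)
  fix z
  from pw_has_derivative[of s z]
  show "(pw s has_derivative (\<lambda>h. 2 * pi * \<i> * of_real ((s + 0) \<bullet> h) * pw s z)) (at z)" by simp
qed simp

lemma fourier_decay:
  fixes \<sigma> :: "'a::euclidean_space \<Rightarrow> complex"
  assumes "\<sigma> \<in> bdd_smooth" "supp_cube 2 \<sigma>"
  obtains C where "0 \<le> C"
    "\<And>(F :: 'a \<Rightarrow> 'c::cstar_algebra) M k. \<lbrakk>F \<in> bdd_smooth; 0 \<le> M; bder (cube 2) (2 * (j * DIM('a))) M F\<rbrakk>
      \<Longrightarrow> norm (integral UNIV (\<lambda>z. (\<sigma> z * pw (quart k) z) *\<^sub>C F z)) \<le> C * M * wt k ^ j"
proof -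
  have l0: "linear (\<lambda>_::'a. 0::'a)" by (simp add: linear_iff)
  obtain C where C: "0 \<le> C" "\<And>(F :: 'a \<Rightarrow> 'c) M s E. \<lbrakk>F \<in> bdd_smooth; 0 \<le> M; bder (cube 2) (2 * (j * DIM('a))) M F;
      phase_deriv (\<lambda>_. 0) s E\<rbrakk> \<Longrightarrow> norm (integral UNIV (\<lambda>z. (\<sigma> z * E z) *\<^sub>C F z)) \<le> C * M * wt s ^ j"
    by (rule ibp_decay[OF l0 assms, where j = j and ?'c = 'c]) blast
  show ?thesis
  proof (rule that[of "C * (16 ^ DIM('a)) ^ j"])
    fix F :: "'a \<Rightarrow> 'c" and M k
    assume *: "F \<in> bdd_smooth" "0 \<le> M" "bder (cube 2) (2 * (j * DIM('a))) M F"
    have "norm (integral UNIV (\<lambda>z. (\<sigma> z * pw (quart k) z) *\<^sub>C F z)) \<le> C * M * wt (quart k) ^ j"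
      by (rule C(2)[OF * phase_deriv_pw])
    also have "\<dots> \<le> C * M * (16 ^ DIM('a) * wt k) ^ j"
      using C(1) *(2) wt_quart by (intro mult_left_mono power_mono) auto
    finally show "norm (integral UNIV (\<lambda>z. (\<sigma> z * pw (quart k) z) *\<^sub>C F z)) \<le> C * (16 ^ DIM('a)) ^ j * M * wt k ^ j"
      by (simp add: power_mult_distrib mult_ac)
  qed (use C in simp)
qed

subsection \<open>Orthogonality of the characters\<close>

text \<open>The box from \<open>l\<close> to \<open>h + t *\<^sub>R b\<close> is cut in two ways,
  each leaving one of the boxes to be compared and a slab of thickness \<open>t\<close>. The two
  slabs are translates of each other by the period.\<close>

lemma integral_periodic_shift:
  fixes f :: "'a::euclidean_space \<Rightarrow> 'b::banach"
  assumes cont: "continuous_on UNIV f" and per: "\<And>x. f (x + p *\<^sub>R b) = f x"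
    and b: "b \<in> Basis" and lh: "h \<bullet> b = l \<bullet> b + p" and t: "0 \<le> t" "t \<le> p"
  shows "integral (cbox (l + t *\<^sub>R b) (h + t *\<^sub>R b)) f = integral (cbox l h) f"
proof -
  let ?B = "cbox l (h + t *\<^sub>R b)"
  have int: "f integrable_on ?B" by (rule integrable_continuous[OF continuous_on_subset[OF cont subset_UNIV]])
  have bi: "b \<bullet> i = (if i = b then 1 else 0)" if "i \<in> Basis" for i using b that by (simp add: inner_Basis)
  have box: "x \<in> cbox l' h' \<longleftrightarrow> (l' \<bullet> b \<le> x \<bullet> b \<and> x \<bullet> b \<le> h' \<bullet> b) \<and>
      (\<forall>i\<in>Basis - {b}. l' \<bullet> i \<le> x \<bullet> i \<and> x \<bullet> i \<le> h' \<bullet> i)" for x l' h'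
    unfolding mem_box using b by blast
  have other: "(y + s *\<^sub>R b) \<bullet> i = y \<bullet> i" if "i \<in> Basis - {b}" for y s i
    using that bi[of i] by (simp add: inner_add_left)
  have bb: "(y + s *\<^sub>R b) \<bullet> b = y \<bullet> b + s" for y s using bi[OF b] by (simp add: inner_add_left)
  have s1: "?B \<inter> {x. x \<bullet> b \<le> h \<bullet> b} = cbox l h"
    "?B \<inter> {x. x \<bullet> b \<ge> h \<bullet> b} = cbox (l + p *\<^sub>R b) (h + t *\<^sub>R b)"
    "?B \<inter> {x. x \<bullet> b \<le> l \<bullet> b + t} = cbox l (h + (t - p) *\<^sub>R b)"
    "?B \<inter> {x. x \<bullet> b \<ge> l \<bullet> b + t} = cbox (l + t *\<^sub>R b) (h + t *\<^sub>R b)"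
    unfolding set_eq_iff Int_iff mem_Collect_eq box using lh t by (auto simp: bb other)
  have "integral (cbox l h) f + integral (cbox (l + p *\<^sub>R b) (h + t *\<^sub>R b)) f = integral ?B f"
    using integral_split[OF int b, of "h \<bullet> b"] by (simp add: s1)
  moreover have "integral (cbox l (h + (t - p) *\<^sub>R b)) f + integral (cbox (l + t *\<^sub>R b) (h + t *\<^sub>R b)) f = integral ?B f"
    using integral_split[OF int b, of "l \<bullet> b + t"] by (simp add: s1)
  moreover have "integral (cbox (l + p *\<^sub>R b) (h + t *\<^sub>R b)) f = integral (cbox l (h + (t - p) *\<^sub>R b)) f"
    using integral_shift_cbox[of "l + p *\<^sub>R b" "p *\<^sub>R b" "h + t *\<^sub>R b" f]
    by (simp add: per algebra_simps)
  ultimately show ?thesis by (metis add.commute add_right_imp_eq)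
qed

lemma pw_quart_periodic:
  assumes "k \<in> lattice" "b \<in> Basis"
  shows "pw (quart k) (x + 4 *\<^sub>R b) = pw (quart k) x"
proof -
  obtain n where n: "k \<bullet> b = of_int n" using assms by (auto simp: lattice_def Ints_def)
  have "pw (quart k) (4 *\<^sub>R b) = 1"
    using n by (simp add: pw_def cis_multiple_2pi[of "of_int n"])
  then show ?thesis by (simp add: pw_add)
qed

lemma continuous_on_pw: "continuous_on S (pw p)"
  by (rule bdd_smooth_continuous_on[OF bdd_smooth_pw])

lemma integral_pw_quart:
  assumes k: "k \<in> lattice" "k \<noteq> (0::'a::euclidean_space)"
  shows "integral (cube 2) (pw (quart k)) = 0"
proof -
  obtain b :: 'a where b: "b \<in> Basis" "k \<bullet> b \<noteq> 0" using k(2) euclidean_all_zero_iff by blast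
  obtain n where n: "k \<bullet> b = of_int n" using k(1) b by (auto simp: lattice_def Ints_def)
  have n0: "n \<noteq> 0" using b(2) n by auto
  then have "1 \<le> \<bar>n\<bar>" by linarith
  then have n1: "1 \<le> real_of_int \<bar>n\<bar>" by (simp only: of_int_1_le_iff)
  \<comment> \<open>Half a period of the character in direction \<open>b\<close>: translation by it
    changes the sign, so the integral equals its negative.\<close>
  define t where "t = 2 / real_of_int \<bar>n\<bar>"
  have t: "0 \<le> t" "t \<le> 4" using n1 by (auto simp: t_def divide_le_eq)
  have "quart k \<bullet> (t *\<^sub>R b) = t * real_of_int n / 4" using n by simp
  then have "pw (quart k) (t *\<^sub>R b) = cis (2 * pi * (t * real_of_int n / 4))" by (simp only: pw_def)
  also have "\<dots> = - 1"
  proof (cases "0 < n")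
    case True
    then have "2 * pi * (t * real_of_int n / 4) = pi" using n1 by (simp add: t_def)
    then show ?thesis by simp
  next
    case False
    then have "2 * pi * (t * real_of_int n / 4) = - pi" using n0 by (simp add: t_def)
    then show ?thesis by (simp add: complex_eq_iff)
  qed
  finally have m: "pw (quart k) (x + t *\<^sub>R b) = - pw (quart k) x" for x by (simp add: pw_add)
  define l h where "l = - (2 *\<^sub>R (\<Sum>Basis::'a))" and "h = 2 *\<^sub>R (\<Sum>Basis::'a)"
  have c: "cube 2 = cbox l h" by (simp add: cube_def l_def h_def)
  have lh: "h \<bullet> b = l \<bullet> b + 4" using b by (simp add: l_def h_def)
  have "integral (cbox l h) (pw (quart k)) = integral (cbox (l + t *\<^sub>R b) (h + t *\<^sub>R b)) (pw (quart k))"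
    by (rule integral_periodic_shift[OF continuous_on_pw pw_quart_periodic[OF k(1) b(1)] b(1) lh t, symmetric])
  also have "\<dots> = integral (cbox l h) (\<lambda>x. pw (quart k) (x + t *\<^sub>R b))"
    using integral_shift_cbox[of "l + t *\<^sub>R b" "t *\<^sub>R b" "h + t *\<^sub>R b" "pw (quart k)"] by simp
  also have "\<dots> = - integral (cbox l h) (pw (quart k))" by (simp add: m)
  finally show ?thesis by (simp add: c)
qed

lemma measure_cube: "measure lborel (cube 2 :: 'a::euclidean_space set) = 4 ^ DIM('a)"
proof -
  have "measure lborel (cbox (- (2 *\<^sub>R (\<Sum>Basis::'a))) (2 *\<^sub>R (\<Sum>Basis::'a))) = (\<Prod>b\<in>(Basis::'a set). 4)"
    by (subst content_cbox) (auto intro!: prod.cong)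
  then show ?thesis by (simp add: cube_def)
qed

lemma integral_cube_const: "integral (cube 2) (\<lambda>_::'a::euclidean_space. c) = (4 ^ DIM('a)) *\<^sub>R c"
  using measure_cube[where 'a = 'a] by (simp add: cube_def)

subsection \<open>Trigonometric polynomials\<close>

definition trig :: "('a::euclidean_space \<Rightarrow> complex) \<Rightarrow> bool"
  where "trig f \<longleftrightarrow> (\<exists>T a. finite T \<and> T \<subseteq> lattice \<and> f = (\<lambda>x. \<Sum>k\<in>T. a k * pw (quart k) x))"

text \<open>Frequencies may repeat here, as they do when products are expanded; equal ones are
  collected.\<close>

lemma trig_family:
  assumes "finite I" "\<And>i. i \<in> I \<Longrightarrow> \<kappa> i \<in> lattice"
  shows "trig (\<lambda>x. \<Sum>i\<in>I. c i * pw (quart (\<kappa> i)) x)"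
proof -
  have "(\<Sum>i\<in>I. c i * pw (quart (\<kappa> i)) x) = (\<Sum>k\<in>\<kappa> ` I. (\<Sum>i | i \<in> I \<and> \<kappa> i = k. c i) * pw (quart k) x)" for x
    using sum.image_gen[OF assms(1), of "\<lambda>i. c i * pw (quart (\<kappa> i)) x" \<kappa>]
    by (simp add: sum_distrib_right)
  then show ?thesis unfolding trig_def using assms
    by (intro exI[of _ "\<kappa> ` I"] exI[of _ "\<lambda>k. \<Sum>i | i \<in> I \<and> \<kappa> i = k. c i"]) auto
qed

lemma trig_mult: "trig f \<Longrightarrow> trig g \<Longrightarrow> trig (\<lambda>x. f x * g x)"
proof -
  assume f: "trig f" and g: "trig g"
  from f obtain T a where T: "finite T" "T \<subseteq> lattice" "f = (\<lambda>x. \<Sum>k\<in>T. a k * pw (quart k) x)"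
    unfolding trig_def by blast
  from g obtain U b where U: "finite U" "U \<subseteq> lattice" "g = (\<lambda>x. \<Sum>k\<in>U. b k * pw (quart k) x)"
    unfolding trig_def by blast
  have e: "f x * g x = (\<Sum>i\<in>T \<times> U. (a (fst i) * b (snd i)) * pw (quart (fst i + snd i)) x)" for x
    unfolding T(3) U(3) sum_product sum.cartesian_product
    by (intro sum.cong refl) (simp add: pw_add scaleR_add_right split_beta)
  show ?thesis unfolding e
  proof (rule trig_family)
    show "finite (T \<times> U)" using T(1) U(1) by simp
    show "fst i + snd i \<in> lattice" if "i \<in> T \<times> U" for i
      using that T(2) U(2) by (intro lattice_add) auto
  qed
qed

lemma trig_one: "trig (\<lambda>_. 1)"
  using trig_family[of "{0::nat}" "\<lambda>_. 0" "\<lambda>_. 1"] by simp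

lemma trig_prod: "(\<And>i. i \<in> I \<Longrightarrow> trig (f i)) \<Longrightarrow> trig (\<lambda>x. \<Prod>i\<in>I. f i x)"
  by (induction I rule: infinite_finite_induct) (simp_all add: trig_one trig_mult)

lemma trig_power: "trig f \<Longrightarrow> trig (\<lambda>x. f x ^ n)"
  by (induction n) (simp_all add: trig_one trig_mult)

text \<open>The kernels \<open>bumpker x ^ N\<close>, divided by \<open>kermass N\<close>, form an approximate identity consisting
  of nonnegative trigonometric polynomials.\<close>

definition bumpker :: "'a::euclidean_space \<Rightarrow> real"
  where "bumpker x = (\<Prod>b\<in>Basis. (cos (pi * (x \<bullet> b) / 4))\<^sup>2)"

definition kermass :: "'a::euclidean_space itself \<Rightarrow> nat \<Rightarrow> real"
  where "kermass _ N = integral (cube 2) (\<lambda>x::'a. bumpker x ^ N)"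

lemma bumpker_bounds: "0 \<le> bumpker x" "bumpker x \<le> 1"
proof -
  show "0 \<le> bumpker x" unfolding bumpker_def by (rule prod_nonneg) simp
  show "bumpker x \<le> 1" unfolding bumpker_def
    by (rule prod_le_1) (simp add: abs_square_le_1)
qed

lemma bumpker_0 [simp]: "bumpker 0 = 1"
  by (simp add: bumpker_def)

lemma bumpker_minus [simp]: "bumpker (- x) = bumpker x"
  by (simp add: bumpker_def)

text \<open>The function has period 4 in every coordinate and maxima exactly at the points of this
  period lattice. A point of \<open>cube 1\<close> and a point of \<open>cube 2\<close> differ by an
  element of \<open>cube 3\<close>, which contains no such point besides 0.\<close>

lemma bumpker_lt_1:
  assumes "x \<in> cube 3" "x \<noteq> 0"
  shows "bumpker x < 1"
proof -
  obtain b where b: "b \<in> Basis" "x \<bullet> b \<noteq> 0" using assms(2) euclidean_all_zero_iff by blast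
  have "\<bar>x \<bullet> b\<bar> \<le> 3" using assms(1) b(1) by (simp add: mem_cube)
  define t where "t = pi * (x \<bullet> b) / 4"
  have t: "t \<noteq> 0" "\<bar>t\<bar> < pi" using b(2) \<open>\<bar>x \<bullet> b\<bar> \<le> 3\<close> by (auto simp: t_def abs_mult)
  have "sin t \<noteq> 0"
  proof
    assume "sin t = 0"
    then have "sin \<bar>t\<bar> = 0" by (simp add: abs_if)
    moreover have "0 < sin \<bar>t\<bar>" using t by (intro sin_gt_zero) auto
    ultimately show False by simp
  qed
  then have "0 < (sin t)\<^sup>2" by simp
  then have c: "(cos t)\<^sup>2 < 1" using sin_cos_squared_add[of t] by linarith
  have "bumpker x = (cos t)\<^sup>2 * (\<Prod>b\<in>Basis - {b}. (cos (pi * (x \<bullet> b) / 4))\<^sup>2)"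
    unfolding bumpker_def t_def using b(1) by (subst prod.remove[of _ b]) auto
  also have "\<dots> \<le> (cos t)\<^sup>2 * 1"
    by (intro mult_left_mono prod_le_1) (auto simp: abs_square_le_1)
  finally show ?thesis using c by simp
qed

lemma continuous_on_bumpker: "continuous_on S bumpker"
  unfolding bumpker_def[abs_def] by (intro continuous_intros) simp

lemma bumpker_trig: "trig (\<lambda>x. of_real (bumpker x ^ N))"
proof -
  have "trig (\<lambda>x::'a. of_real ((cos (pi * (x \<bullet> b) / 4))\<^sup>2))" if b: "b \<in> Basis" for b :: 'a
  proof -
    have bl: "b \<in> lattice" "- b \<in> lattice" using b by (auto simp: lattice_def inner_Basis)
    define \<kappa> :: "nat \<Rightarrow> 'a" where "\<kappa> i = (if i = 0 then 0 else if i = 1 then b else - b)" for i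
    define c :: "nat \<Rightarrow> complex" where "c i = (if i = 0 then 1 / 2 else 1 / 4)" for i
    have "of_real ((cos (pi * (x \<bullet> b) / 4))\<^sup>2) = (\<Sum>i\<in>{0,1,2}. c i * pw (quart (\<kappa> i)) x)" for x
    proof -
      define t where "t = pi * (x \<bullet> b) / 4"
      have "pw (quart b) x = cis (2 * t)" "pw (quart (- b)) x = cis (- (2 * t))"
        by (simp_all add: pw_def t_def inner_commute)
      moreover have "of_real ((cos t)\<^sup>2) = 1 / 2 + 1 / 4 * cis (2 * t) + 1 / 4 * cis (- (2 * t))"
        by (simp add: complex_eq_iff cos_double_cos) (simp add: field_simps)
      ultimately show ?thesis by (simp add: c_def \<kappa>_def t_def add_ac)
    qed
    then show ?thesis using trig_family[of "{0,1,2}" \<kappa> c] bl by (simp add: \<kappa>_def)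
  qed
  then have "trig (\<lambda>x::'a. (\<Prod>b\<in>Basis. of_real ((cos (pi * (x \<bullet> b) / 4))\<^sup>2)) ^ N)"
    by (intro trig_power trig_prod)
  then show ?thesis by (simp add: bumpker_def)
qed

definition kercoeff :: "nat \<Rightarrow> 'a::euclidean_space \<Rightarrow> complex"
  where "kercoeff N k = integral (cube 2) (\<lambda>x. of_real (bumpker x ^ N) * pw (- quart k) x) / 4 ^ DIM('a)"

lemma continuous_on_kernel:
  "continuous_on S (\<lambda>x. bumpker x ^ N)" "continuous_on S (\<lambda>x. bumpker (y - x) ^ N)"
proof -
  show "continuous_on S (\<lambda>x. bumpker x ^ N)" by (intro continuous_intros continuous_on_bumpker)
  have "continuous_on S (\<lambda>x. bumpker (y - x))"
    by (rule continuous_on_compose2[OF continuous_on_bumpker]) (auto intro!: continuous_intros)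
  then show "continuous_on S (\<lambda>x. bumpker (y - x) ^ N)" by (intro continuous_intros)
qed

text \<open>Orthogonality of the characters identifies the coefficients with the integrals
  \<open>kercoeff\<close>. Since these vanish on the rest of the lattice, expansions over different
  finite sets can be compared.\<close>

lemma kernel_expansion:
  obtains T where "finite T" "T \<subseteq> lattice"
    "\<And>x::'a::euclidean_space. of_real (bumpker x ^ N) = (\<Sum>k\<in>T. kercoeff N k * pw (quart k) x)"
    "\<And>k. k \<in> lattice - T \<Longrightarrow> kercoeff N k = 0"
proof -
  obtain T a where T: "finite T" "T \<subseteq> lattice"
    and e: "(\<lambda>x::'a. of_real (bumpker x ^ N)) = (\<lambda>x. \<Sum>k\<in>T. a k * pw (quart k) x)"
    using bumpker_trig[where 'a = 'a, of N] unfolding trig_def by blast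
  have c: "kercoeff N k = (if k \<in> T then a k else 0)" if k: "k \<in> lattice" for k
  proof -
    have "integral (cube 2) (\<lambda>x. of_real (bumpker x ^ N) * pw (- quart k) x) =
        integral (cube 2) (\<lambda>x. \<Sum>j\<in>T. a j * pw (quart (j - k)) x)"
      using e by (simp add: fun_eq_iff sum_distrib_right scaleR_diff_right pw_diff pw_minus mult.assoc)
    also have "\<dots> = (\<Sum>j\<in>T. integral (cube 2) (\<lambda>x. a j * pw (quart (j - k)) x))"
      by (rule integral_sum[OF T(1)]) (intro integrable_cube continuous_intros continuous_on_pw)
    also have "\<dots> = (\<Sum>j\<in>T. if j = k then a k * 4 ^ DIM('a) else 0)"
    proof (rule sum.cong[OF refl])
      fix j assume j: "j \<in> T"
      show "integral (cube 2) (\<lambda>x. a j * pw (quart (j - k)) x) = (if j = k then a k * 4 ^ DIM('a) else 0)"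
      proof (cases "j = k")
        case True
        then show ?thesis using integral_cube_const[of "a k", where 'a = 'a]
          by (simp add: scaleR_conv_of_real)
      next
        case False
        have "integral (cube 2) (pw (quart (j - k))) = 0"
          using j T(2) k False by (intro integral_pw_quart lattice_diff) auto
        then show ?thesis using False by simp
      qed
    qed
    also have "\<dots> = (if k \<in> T then a k * 4 ^ DIM('a) else 0)" using T(1) by (simp add: sum.delta)
    finally show ?thesis by (simp add: kercoeff_def)
  qed
  show ?thesis
  proof (rule that[OF T])
    show "of_real (bumpker x ^ N) = (\<Sum>k\<in>T. kercoeff N k * pw (quart k) x)" for x :: 'a
      using fun_cong[OF e, of x] T(2) c by (simp add: subset_iff cong: sum.cong)
    show "kercoeff N k = 0" if "k \<in> lattice - T" for k using c that by simp
  qed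
qed

lemma kercoeff_0: "kercoeff N (0::'a::euclidean_space) = of_real (kermass TYPE('a) N) / 4 ^ DIM('a)"
proof -
  have "integral (cube 2) (\<lambda>x::'a. complex_of_real (bumpker x ^ N)) = of_real (kermass TYPE('a) N)"
  proof -
    have ik: "(\<lambda>x::'a. bumpker x ^ N) integrable_on cube 2" by (rule integrable_cube[OF continuous_on_kernel(1)])
    from integral_linear[OF ik, of complex_of_real] show ?thesis
      by (simp add: o_def bounded_linear_of_real kermass_def)
  qed
  then show ?thesis by (simp add: kercoeff_def)
qed

text \<open>In the expansion of the kernel only the trivial character has a nonzero integral, and it
  does not see the translation.\<close>

lemma integral_kernel_shift:
  fixes x :: "'a::euclidean_space"
  shows "integral (cube 2) (\<lambda>w. bumpker (x - w) ^ N) = kermass TYPE('a) N"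
proof -
  obtain T where T: "finite T" "T \<subseteq> lattice"
    and e: "\<And>x::'a. of_real (bumpker x ^ N) = (\<Sum>k\<in>T. kercoeff N k * pw (quart k) x)"
    and z: "\<And>k::'a. k \<in> lattice - T \<Longrightarrow> kercoeff N k = 0"
    by (rule kernel_expansion[where 'a = 'a and N = N]) blast
  have "complex_of_real (integral (cube 2) (\<lambda>w. bumpker (x - w) ^ N)) = integral (cube 2) (\<lambda>w. of_real (bumpker (x - w) ^ N))"
  proof -
    have ik: "(\<lambda>w. bumpker (x - w) ^ N) integrable_on cube 2" by (rule integrable_cube[OF continuous_on_kernel(2)])
    from integral_linear[OF ik, of complex_of_real] show ?thesis
      by (simp add: o_def bounded_linear_of_real)
  qed
  also have "\<dots> = integral (cube 2) (\<lambda>w. \<Sum>k\<in>T. (kercoeff N k * pw (quart k) x) * pw (quart (- k)) w)"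
    unfolding e by (simp add: pw_diff pw_minus mult.assoc)
  also have "\<dots> = (\<Sum>k\<in>T. integral (cube 2) (\<lambda>w. (kercoeff N k * pw (quart k) x) * pw (quart (- k)) w))"
    by (rule integral_sum[OF T(1)]) (intro integrable_cube continuous_intros continuous_on_pw)
  also have "\<dots> = (\<Sum>k\<in>T. if k = 0 then of_real (kermass TYPE('a) N) else 0)"
  proof (rule sum.cong[OF refl])
    fix k assume k: "k \<in> T"
    show "integral (cube 2) (\<lambda>w. (kercoeff N k * pw (quart k) x) * pw (quart (- k)) w) =
        (if k = 0 then of_real (kermass TYPE('a) N) else 0)"
    proof (cases "k = 0")
      case True
      then show ?thesis using integral_cube_const[of "kercoeff N (0::'a)", where 'a = 'a]
        by (simp add: scaleR_conv_of_real kercoeff_0)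
    next
      case False
      have "- k \<in> lattice" using k T(2) lattice_diff[OF lattice_0, of k] by auto
      then have "integral (cube 2) (pw (quart (- k))) = 0" using False by (intro integral_pw_quart) auto
      then show ?thesis using False by simp
    qed
  qed
  also have "\<dots> = of_real (kermass TYPE('a) N)"
    using T(1) z[of 0] kercoeff_0[where 'a = 'a, of N] by (auto simp: sum.delta)
  finally show ?thesis by (simp only: of_real_eq_iff)
qed

text \<open>Laplace's method: away from the diagonal the kernel is at most
  \<open>\<eta> ^ N\<close>, while its mass is at least \<open>\<eta>' ^ N * v\<close> with
  \<open>\<eta> < \<eta>'\<close>. The outer part is thus negligible against the mass, uniformly in
  \<open>x\<close>; near the diagonal \<open>G\<close> varies by less than
  \<open>e / 2\<close>.\<close>

lemma kernel_concentration:
  fixes G :: "'a::euclidean_space \<Rightarrow> 'b::banach"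
  assumes G: "continuous_on (cube 2) G" and e: "0 < e"
  obtains N0 where "\<And>N x. N0 \<le> N \<Longrightarrow> x \<in> cube 1 \<Longrightarrow>
    norm (integral (cube 2) (\<lambda>w. bumpker (x - w) ^ N *\<^sub>R G w) - kermass TYPE('a) N *\<^sub>R G x) \<le> e * kermass TYPE('a) N"
    "\<And>N. 0 < kermass TYPE('a) N"
proof -
  have "bounded (G ` cube 2)" by (rule compact_imp_bounded[OF compact_continuous_image[OF G compact_cube]])
  then obtain B where B: "\<And>w. w \<in> cube 2 \<Longrightarrow> norm (G w) \<le> B" "0 < B" unfolding bounded_pos by blast
  obtain d where d: "0 < d" "\<And>x w. x \<in> cube 2 \<Longrightarrow> w \<in> cube 2 \<Longrightarrow> dist w x < d \<Longrightarrow> dist (G w) (G x) < e / 2"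
    using compact_uniformly_continuous[OF G compact_cube] e unfolding uniformly_continuous_on_def
    by (meson half_gt_zero)
  define S where "S = cube 3 - ball (0::'a) d"
  have "compact S" unfolding S_def by (intro compact_diff compact_cube open_ball)
  obtain \<eta> where \<eta>: "0 \<le> \<eta>" "\<eta> < 1" "\<And>y. y \<in> S \<Longrightarrow> bumpker y \<le> \<eta>"
  proof (cases "S = {}")
    case True
    then show ?thesis using that[of 0] by simp
  next
    case False
    obtain y0 where y0: "y0 \<in> S" "\<And>y. y \<in> S \<Longrightarrow> bumpker y \<le> bumpker y0"
      using continuous_attains_sup[OF \<open>compact S\<close> False continuous_on_bumpker] by blast
    have "bumpker y0 < 1" using y0(1) d(1) by (intro bumpker_lt_1) (auto simp: S_def)
    then show ?thesis using that[of "bumpker y0"] y0(2) bumpker_bounds(1) by blast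
  qed
  \<comment> \<open>Any number strictly between \<open>\<eta>\<close> and the maximum 1 would do;
    \<open>bumpker\<close> stays above it near 0, which bounds the mass from below.\<close>
  define \<eta>' where "\<eta>' = (1 + \<eta>) / 2"
  have \<eta>': "\<eta> < \<eta>'" "0 < \<eta>'" "\<eta>' < 1" using \<eta> by (auto simp: \<eta>'_def)
  have ic: "isCont bumpker (0::'a)"
    by (metis UNIV_I continuous_on_bumpker continuous_on_eq_continuous_at open_UNIV)
  have "0 < 1 - \<eta>'" using \<eta>'(3) by simp
  from mp[OF spec[OF ic[unfolded continuous_at_eps_delta], of "1 - \<eta>'"] this]
  have "\<exists>r>0. \<forall>y::'a. dist y 0 < r \<longrightarrow> dist (bumpker y) (bumpker (0::'a)) < 1 - \<eta>'" .
  then obtain r where r: "0 < r" "\<forall>y::'a. dist y 0 < r \<longrightarrow> dist (bumpker y) (bumpker (0::'a)) < 1 - \<eta>'"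
    by (elim exE conjE)
  define Q where "Q = cube 2 \<inter> (cball 0 (r / 2) :: 'a set)"
  obtain p q :: 'a where pq: "cbox p q \<subseteq> Q" "0 < measure lborel (cbox p q)"
  proof -
    \<comment> \<open>Points of \<open>cube s\<close> have norm at most \<open>s * DIM('a)\<close>,
      so this half-width fits the cube into both sets that form \<open>Q\<close>.\<close>
    define s where "s = min 2 (r / 2) / real DIM('a)"
    define m where "m = min 2 (r / 2)"
    have m: "0 < m" "m \<le> 2" "m \<le> r / 2" using r(1) by (auto simp: m_def)
    have D: "1 \<le> real DIM('a)" using DIM_ge_Suc0[where 'a = 'a] by simp
    have "m / real DIM('a) \<le> m / 1" using D m(1) by (intro divide_left_mono) auto
    moreover have "s = m / real DIM('a)" by (simp add: s_def m_def)
    ultimately have s: "0 < s" "s \<le> 2" "s * real DIM('a) \<le> r / 2"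
      using m D by auto
    have "cube s \<subseteq> Q"
    proof
      fix y :: 'a assume y: "y \<in> cube s"
      have "norm y \<le> (\<Sum>b\<in>Basis. \<bar>y \<bullet> b\<bar>)" by (rule norm_le_l1)
      also have "\<dots> \<le> (\<Sum>b\<in>(Basis::'a set). s)" using y by (intro sum_mono) (simp add: mem_cube)
      also have "\<dots> \<le> r / 2" using s(3) by (simp add: mult.commute)
      finally show "y \<in> Q" using cube_mono[OF s(2)] y by (auto simp: Q_def)
    qed
    moreover have "0 < measure lborel (cube s :: 'a set)"
      unfolding cube_def using s(1) by (subst content_pos_lt_eq) auto
    ultimately show ?thesis using that unfolding cube_def by blast
  qed
  define v where "v = measure lborel (cbox p q)"
  have v: "0 < v" using pq(2) by (simp add: v_def)
  have ik: "(\<lambda>w::'a. bumpker (x - w) ^ N) integrable_on cube 2" for x N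
    by (rule integrable_cube[OF continuous_on_kernel(2)])
  have Z: "\<eta>' ^ N * v \<le> kermass TYPE('a) N" for N
  proof -
    have "\<eta>' ^ N * v = integral (cbox p q) (\<lambda>_. \<eta>' ^ N)" by (simp add: v_def mult.commute)
    also have "\<dots> \<le> integral (cbox p q) (\<lambda>x. bumpker x ^ N)"
    proof (rule integral_le)
      show "(\<lambda>x. bumpker x ^ N) integrable_on cbox p q" by (rule integrable_continuous[OF continuous_on_kernel(1)])
      fix x assume "x \<in> cbox p q"
      then have "dist x 0 < r" using pq(1) r(1) by (auto simp: Q_def)
      then have "dist (bumpker x) (bumpker (0::'a)) < 1 - \<eta>'" using r(2) by blast
      then have "\<eta>' \<le> bumpker x" unfolding bumpker_0 dist_real_def by linarith
      then show "\<eta>' ^ N \<le> bumpker x ^ N" using \<eta>'(2) by (intro power_mono) auto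
    qed (rule integrable_const)
    also have "\<dots> \<le> kermass TYPE('a) N" unfolding kermass_def
    proof (rule integral_subset_le)
      show "cbox p q \<subseteq> cube 2" using pq(1) by (auto simp: Q_def)
      show "(\<lambda>x. bumpker x ^ N) integrable_on cbox p q" by (rule integrable_continuous[OF continuous_on_kernel(1)])
      show "(\<lambda>x::'a. bumpker x ^ N) integrable_on cube 2" by (rule integrable_cube[OF continuous_on_kernel(1)])
    qed (simp add: bumpker_bounds)
    finally show ?thesis .
  qed
  have Zp: "0 < kermass TYPE('a) N" for N
    using Z[of N] v \<eta>'(2) by (meson less_le_trans mult_pos_pos zero_less_power)
  have "(\<lambda>N. 2 * B * 4 ^ DIM('a) * (\<eta> / \<eta>') ^ N) \<longlonglongrightarrow> 2 * B * 4 ^ DIM('a) * 0"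
    by (intro tendsto_mult tendsto_const LIMSEQ_power_zero) (use \<eta> \<eta>' in simp)
  then have "\<forall>\<^sub>F N in sequentially. 2 * B * 4 ^ DIM('a) * (\<eta> / \<eta>') ^ N < e / 2 * v"
    using e v by (intro order_tendstoD(2)) auto
  then obtain N0 where N0: "\<And>N. N0 \<le> N \<Longrightarrow> 2 * B * 4 ^ DIM('a) * (\<eta> / \<eta>') ^ N < e / 2 * v"
    unfolding eventually_sequentially by blast
  show ?thesis
  proof (rule that[OF _ Zp])
    fix N and x :: 'a assume N: "N0 \<le> N" and x: "x \<in> cube 1"
    have x2: "x \<in> cube 2" using x cube_mono[of 1 2] by auto
    let ?k = "\<lambda>w. bumpker (x - w) ^ N"
    have cG: "continuous_on (cube 2) (\<lambda>w. ?k w *\<^sub>R G w)" "continuous_on (cube 2) (\<lambda>w. ?k w *\<^sub>R G x)"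
      by (intro continuous_intros continuous_on_kernel(2) G)+
    have "kermass TYPE('a) N *\<^sub>R G x = integral (cube 2) (\<lambda>w. ?k w *\<^sub>R G x)"
      using integral_linear[OF ik bounded_linear_scaleR_left[of "G x"], of x N]
      by (simp add: o_def integral_kernel_shift)
    then have "integral (cube 2) (\<lambda>w. ?k w *\<^sub>R G w) - kermass TYPE('a) N *\<^sub>R G x =
        integral (cube 2) (\<lambda>w. ?k w *\<^sub>R (G w - G x))"
      using integral_diff[OF integrable_cube[OF cG(1)] integrable_cube[OF cG(2)]]
      by (simp add: scaleR_diff_right)
    also have "norm \<dots> \<le> integral (cube 2) (\<lambda>w. ?k w * (e / 2) + 2 * B * \<eta> ^ N)"
    proof (rule integral_norm_bound_integral)
      show "(\<lambda>w. ?k w *\<^sub>R (G w - G x)) integrable_on cube 2"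
        by (intro integrable_cube continuous_intros continuous_on_kernel(2) G)
      show "(\<lambda>w. ?k w * (e / 2) + 2 * B * \<eta> ^ N) integrable_on cube 2"
        by (intro integrable_cube continuous_intros continuous_on_kernel(2))
      fix w :: 'a assume w: "w \<in> cube 2"
      have k0: "0 \<le> ?k w" by (simp add: bumpker_bounds)
      show "norm (?k w *\<^sub>R (G w - G x)) \<le> ?k w * (e / 2) + 2 * B * \<eta> ^ N"
      proof (cases "dist w x < d")
        case True
        then have "norm (G w - G x) \<le> e / 2" using d(2)[OF x2 w] by (simp add: dist_norm)
        then have "?k w * norm (G w - G x) \<le> ?k w * (e / 2)" by (rule mult_left_mono[OF _ k0])
        moreover have "0 \<le> 2 * B * \<eta> ^ N" using B(2) \<eta>(1) by simp
        ultimately show ?thesis using k0 by simp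
      next
        case False
        have "\<bar>(x - w) \<bullet> b\<bar> \<le> 3" if "b \<in> Basis" for b
        proof -
          have "\<bar>x \<bullet> b\<bar> \<le> 1" "\<bar>w \<bullet> b\<bar> \<le> 2" using x w that by (auto simp: mem_cube)
          then show ?thesis by (simp add: inner_diff_left)
        qed
        then have "x - w \<in> S" using False by (simp add: S_def mem_cube dist_norm norm_minus_commute)
        then have "?k w \<le> \<eta> ^ N" using \<eta>(3) bumpker_bounds(1) by (intro power_mono) auto
        moreover have "norm (G w - G x) \<le> 2 * B"
          using norm_triangle_ineq4[of "G w" "G x"] B(1)[OF w] B(1)[OF x2] by linarith
        ultimately have "?k w * norm (G w - G x) \<le> \<eta> ^ N * (2 * B)"
          using k0 \<eta>(1) by (intro mult_mono) auto
        moreover have "0 \<le> ?k w * (e / 2)" using k0 e by simp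
        ultimately show ?thesis using k0 by (simp add: mult_ac)
      qed
    qed
    also have "\<dots> = kermass TYPE('a) N * (e / 2) + 2 * B * \<eta> ^ N * 4 ^ DIM('a)"
    proof -
      have "integral (cube 2) (\<lambda>w. ?k w * (e / 2) + 2 * B * \<eta> ^ N) =
          integral (cube 2) (\<lambda>w. ?k w * (e / 2)) + integral (cube 2) (\<lambda>_::'a. 2 * B * \<eta> ^ N)"
        by (intro integral_add integrable_cube continuous_intros continuous_on_kernel(2))
      then show ?thesis using integral_cube_const[of "2 * B * \<eta> ^ N", where 'a = 'a]
        by (simp add: integral_kernel_shift mult.commute)
    qed
    also have "2 * B * \<eta> ^ N * 4 ^ DIM('a) \<le> kermass TYPE('a) N * (e / 2)"
    proof -
      have "2 * B * \<eta> ^ N * 4 ^ DIM('a) = 2 * B * 4 ^ DIM('a) * (\<eta> / \<eta>') ^ N * \<eta>' ^ N"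
        using \<eta>'(2) by (simp add: power_divide)
      also have "\<dots> \<le> e / 2 * v * \<eta>' ^ N"
        using N0[OF N] \<eta>'(2) by (intro mult_right_mono) auto
      also have "\<dots> = \<eta>' ^ N * v * (e / 2)" by simp
      also have "\<dots> \<le> kermass TYPE('a) N * (e / 2)" using Z e by (intro mult_right_mono) auto
      finally show ?thesis .
    qed
    finally show "norm (integral (cube 2) (\<lambda>w. ?k w *\<^sub>R G w) - kermass TYPE('a) N *\<^sub>R G x) \<le> e * kermass TYPE('a) N"
      by (simp add: algebra_simps)
  qed
qed

subsection \<open>Fourier inversion and density of trigonometric polynomials\<close>

definition fourier :: "('a::euclidean_space \<Rightarrow> 'c::cstar_algebra) \<Rightarrow> 'a \<Rightarrow> 'c"
  where "fourier G k = integral (cube 2) (\<lambda>w. pw (- quart k) w *\<^sub>C G w)"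

text \<open>A Fejer type mean. The kernel is nonnegative and normalised on \<open>cube 2\<close>, so
  bounds on \<open>G\<close> are preserved, and its expansion makes the mean a trigonometric
  polynomial.\<close>

definition kermean :: "nat \<Rightarrow> ('a::euclidean_space \<Rightarrow> 'c::cstar_algebra) \<Rightarrow> 'a \<Rightarrow> 'c"
  where "kermean N G x = (1 / kermass TYPE('a) N) *\<^sub>R integral (cube 2) (\<lambda>w. bumpker (x - w) ^ N *\<^sub>R G w)"

lemma kermass_pos: "0 < kermass TYPE('a::euclidean_space) N"
proof -
  have "continuous_on (cube 2) (\<lambda>_::'a. 0::real)" by (rule continuous_on_const)
  then show ?thesis by (rule kernel_concentration[OF _ zero_less_one, where 'a = 'a]) blast
qed

lemma kermean_expansion:
  fixes G :: "'a::euclidean_space \<Rightarrow> 'c::cstar_algebra"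
  assumes G: "continuous_on (cube 2) G"
  obtains T where "finite T" "T \<subseteq> lattice" "\<And>k. k \<in> lattice - T \<Longrightarrow> kercoeff N k = 0"
    "\<And>x. kermean N G x = (\<Sum>k\<in>T. (kercoeff N k / kermass TYPE('a) N * pw (quart k) x) *\<^sub>C fourier G k)"
proof -
  obtain T where T: "finite T" "T \<subseteq> lattice"
    and e: "\<And>x::'a. of_real (bumpker x ^ N) = (\<Sum>k\<in>T. kercoeff N k * pw (quart k) x)"
    and z: "\<And>k::'a. k \<in> lattice - T \<Longrightarrow> kercoeff N k = 0"
    by (rule kernel_expansion[where 'a = 'a and N = N]) blast
  have int: "(\<lambda>w. pw (- quart k) w *\<^sub>C G w) integrable_on cube 2" for k
    by (intro integrable_cube bounded_bilinear.continuous_on[OF bounded_bilinear_scaleC] continuous_on_pw G)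
  have "kermean N G x = (\<Sum>k\<in>T. (kercoeff N k / kermass TYPE('a) N * pw (quart k) x) *\<^sub>C fourier G k)" for x
  proof -
    have "bumpker (x - w) ^ N *\<^sub>R G w = (\<Sum>k\<in>T. (kercoeff N k * pw (quart k) x) *\<^sub>C (pw (- quart k) w *\<^sub>C G w))" for w
    proof -
      have "bumpker (x - w) ^ N *\<^sub>R G w = of_real (bumpker (x - w) ^ N) *\<^sub>C G w" by (simp only: scaleC_of_real)
      also have "\<dots> = (\<Sum>k\<in>T. kercoeff N k * pw (quart k) (x - w)) *\<^sub>C G w" by (simp only: e)
      also have "\<dots> = (\<Sum>k\<in>T. (kercoeff N k * pw (quart k) (x - w)) *\<^sub>C G w)" by (rule scaleC.sum_left)
      finally show ?thesis by (simp add: pw_diff pw_minus scaleC_scaleC mult.assoc)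
    qed
    then have "integral (cube 2) (\<lambda>w. bumpker (x - w) ^ N *\<^sub>R G w) =
        integral (cube 2) (\<lambda>w. \<Sum>k\<in>T. (kercoeff N k * pw (quart k) x) *\<^sub>C (pw (- quart k) w *\<^sub>C G w))" by simp
    also have "\<dots> = (\<Sum>k\<in>T. integral (cube 2) (\<lambda>w. (kercoeff N k * pw (quart k) x) *\<^sub>C (pw (- quart k) w *\<^sub>C G w)))"
      using integrable_linear[OF int scaleC.bounded_linear_right]
      by (intro integral_sum[OF T(1)]) (simp add: o_def)
    also have "\<dots> = (\<Sum>k\<in>T. (kercoeff N k * pw (quart k) x) *\<^sub>C fourier G k)"
      using integral_linear[OF int scaleC.bounded_linear_right] by (simp add: o_def fourier_def)
    finally have "kermean N G x = of_real (1 / kermass TYPE('a) N) *\<^sub>C (\<Sum>k\<in>T. (kercoeff N k * pw (quart k) x) *\<^sub>C fourier G k)"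
      by (simp only: kermean_def scaleC_of_real)
    then show ?thesis by (simp add: scaleC.sum_right scaleC_scaleC)
  qed
  then show ?thesis using T z that by blast
qed

lemma kermean_norm_le:
  fixes G :: "'a::euclidean_space \<Rightarrow> 'c::cstar_algebra"
  assumes G: "continuous_on (cube 2) G" and M: "\<And>w. w \<in> cube 2 \<Longrightarrow> norm (G w) \<le> M"
  shows "norm (kermean N G x) \<le> M"
proof -
  note Z = kermass_pos[where 'a = 'a, of N]
  have "norm (integral (cube 2) (\<lambda>w. bumpker (x - w) ^ N *\<^sub>R G w)) \<le> integral (cube 2) (\<lambda>w. bumpker (x - w) ^ N * M)"
  proof (rule integral_norm_bound_integral)
    show "(\<lambda>w. bumpker (x - w) ^ N *\<^sub>R G w) integrable_on cube 2" "(\<lambda>w. bumpker (x - w) ^ N * M) integrable_on cube 2"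
      by (intro integrable_cube continuous_intros continuous_on_kernel(2) G)+
    show "norm (bumpker (x - w) ^ N *\<^sub>R G w) \<le> bumpker (x - w) ^ N * M" if "w \<in> cube 2" for w
      using M[OF that] bumpker_bounds(1)[of "x - w"] by (simp add: mult_left_mono)
  qed
  also have "\<dots> = kermass TYPE('a) N * M" by (simp add: integral_kernel_shift)
  finally show ?thesis using Z by (simp add: kermean_def field_simps)
qed

lemma kermean_converges:
  fixes G :: "'a::euclidean_space \<Rightarrow> 'c::cstar_algebra"
  assumes G: "continuous_on (cube 2) G" and e: "0 < e"
  obtains N0 where "\<And>N x. N0 \<le> N \<Longrightarrow> x \<in> cube 1 \<Longrightarrow> norm (kermean N G x - G x) \<le> e"
proof -
  obtain N0 where N0: "\<And>N x. N0 \<le> N \<Longrightarrow> x \<in> cube 1 \<Longrightarrow>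
    norm (integral (cube 2) (\<lambda>w. bumpker (x - w) ^ N *\<^sub>R G w) - kermass TYPE('a) N *\<^sub>R G x) \<le> e * kermass TYPE('a) N"
    by (rule kernel_concentration[OF G e]) blast
  have "norm (kermean N G x - G x) \<le> e" if "N0 \<le> N" "x \<in> cube 1" for N x
  proof -
    note Z = kermass_pos[where 'a = 'a, of N]
    have "kermean N G x - G x = (1 / kermass TYPE('a) N) *\<^sub>R
        (integral (cube 2) (\<lambda>w. bumpker (x - w) ^ N *\<^sub>R G w) - kermass TYPE('a) N *\<^sub>R G x)"
      using Z by (simp add: kermean_def scaleR_diff_right)
    then have "norm (kermean N G x - G x) = (1 / kermass TYPE('a) N) *
        norm (integral (cube 2) (\<lambda>w. bumpker (x - w) ^ N *\<^sub>R G w) - kermass TYPE('a) N *\<^sub>R G x)"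
      using Z by simp
    also have "\<dots> \<le> (1 / kermass TYPE('a) N) * (e * kermass TYPE('a) N)"
      using N0[OF that] Z by (intro mult_left_mono) auto
    finally show ?thesis using Z by simp
  qed
  then show ?thesis by (rule that)
qed

lemma kercoeff_bound:
  fixes k :: "'a::euclidean_space"
  shows "cmod (kercoeff N k / kermass TYPE('a) N) \<le> 1 / 4 ^ DIM('a)"
proof -
  have "cmod (integral (cube 2) (\<lambda>x. of_real (bumpker x ^ N) * pw (- quart k) x)) \<le> integral (cube 2) (\<lambda>x::'a. bumpker x ^ N)"
  proof (rule integral_norm_bound_integral)
    show "(\<lambda>x. complex_of_real (bumpker x ^ N) * pw (- quart k) x) integrable_on cube 2"
      by (intro integrable_cube continuous_intros continuous_on_kernel(1) continuous_on_pw)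
    show "(\<lambda>x::'a. bumpker x ^ N) integrable_on cube 2" by (rule integrable_cube[OF continuous_on_kernel(1)])
  qed (simp add: norm_mult norm_power bumpker_bounds)
  then have "cmod (integral (cube 2) (\<lambda>x. of_real (bumpker x ^ N) * pw (- quart k) x)) \<le> kermass TYPE('a) N"
    by (simp add: kermass_def)
  then have I: "cmod (integral (cube 2) (\<lambda>x. of_real (bumpker x ^ N) * pw (- quart k) x)) / 4 ^ DIM('a) / kermass TYPE('a) N
      \<le> kermass TYPE('a) N / 4 ^ DIM('a) / kermass TYPE('a) N"
    using kermass_pos[where 'a = 'a, of N] by (intro divide_right_mono) auto
  then show ?thesis using kermass_pos[where 'a = 'a, of N]
    unfolding kercoeff_def norm_divide norm_power norm_of_real by simp
qed

text \<open>The defining integral is that of the kernel against a character; relative to the mass it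
  concentrates to the value 1 of the character at 0.\<close>

lemma kercoeff_tendsto:
  fixes k :: "'a::euclidean_space"
  shows "(\<lambda>N. kercoeff N k / kermass TYPE('a) N) \<longlonglongrightarrow> 1 / 4 ^ DIM('a)"
proof (rule LIMSEQ_I)
  fix r :: real assume r: "0 < r"
  have c: "continuous_on (cube 2) (pw (- quart k))" by (rule continuous_on_pw)
  have r2: "0 < r / 2" using r by simp
  obtain N0 where N0: "\<And>N x. N0 \<le> N \<Longrightarrow> x \<in> cube 1 \<Longrightarrow>
    norm (integral (cube 2) (\<lambda>w. bumpker (x - w) ^ N *\<^sub>R pw (- quart k) w) - kermass TYPE('a) N *\<^sub>R pw (- quart k) x) \<le> r / 2 * kermass TYPE('a) N"
    by (rule kernel_concentration[OF c r2]) blast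
  show "\<exists>N0. \<forall>N\<ge>N0. norm (kercoeff N k / kermass TYPE('a) N - 1 / 4 ^ DIM('a)) < r"
  proof (intro exI allI impI)
    fix N assume N: "N0 \<le> N"
    note Z = kermass_pos[where 'a = 'a, of N]
    define I where "I = integral (cube 2) (\<lambda>x. of_real (bumpker x ^ N) * pw (- quart k) x)"
    have A: "norm (I - of_real (kermass TYPE('a) N)) \<le> r / 2 * kermass TYPE('a) N"
      using N0[OF N, of 0] by (simp add: I_def scaleR_conv_of_real mem_cube)
    have eq: "kercoeff N k / kermass TYPE('a) N - 1 / 4 ^ DIM('a) =
        (I - of_real (kermass TYPE('a) N)) / (of_real (kermass TYPE('a) N) * 4 ^ DIM('a))"
      using Z by (simp add: kercoeff_def I_def field_simps)
    have "norm (kercoeff N k / kermass TYPE('a) N - 1 / 4 ^ DIM('a)) =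
        norm (I - of_real (kermass TYPE('a) N)) / (kermass TYPE('a) N * 4 ^ DIM('a))"
      unfolding eq norm_divide norm_mult norm_power using Z by simp
    also have "\<dots> \<le> (r / 2 * kermass TYPE('a) N) / (kermass TYPE('a) N * 4 ^ DIM('a))"
      by (rule divide_right_mono[OF A]) (use Z in simp)
    also have "\<dots> = r / 2 / 4 ^ DIM('a)" using Z by simp
    also have "\<dots> \<le> r / 2 / 1" using r by (intro divide_left_mono) auto
    finally show "norm (kercoeff N k / kermass TYPE('a) N - 1 / 4 ^ DIM('a)) < r" using r by simp
  qed
qed

text \<open>The means at \<open>x\<close> tend to \<open>G x\<close> by concentration and to the
  Fourier series by dominated convergence, because the multipliers are at most 1 and tend to
  \<open>1 / 4 ^ DIM('a)\<close>. The coefficients \<open>fourier\<close> are not normalised, hence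
  the factor \<open>4 ^ DIM('a)\<close>.\<close>

lemma fourier_inversion:
  fixes G :: "'a::euclidean_space \<Rightarrow> 'c::cstar_algebra"
  assumes G: "continuous_on (cube 2) G" and s: "(\<lambda>k. norm (fourier G k)) summable_on lattice" and x: "x \<in> cube 1"
  shows "((\<lambda>k. pw (quart k) x *\<^sub>C fourier G k) has_sum (4 ^ DIM('a) *\<^sub>R G x)) lattice"
proof -
  define c where "c N k = kercoeff N k / kermass TYPE('a) N" for N and k :: 'a
  have km: "kermean N G x = (\<Sum>\<^sub>\<infinity>k\<in>lattice. (c N k * pw (quart k) x) *\<^sub>C fourier G k)" for N
  proof -
    obtain T where T: "finite T" "T \<subseteq> lattice" "\<And>k. k \<in> lattice - T \<Longrightarrow> kercoeff N k = 0"
      "\<And>x. kermean N G x = (\<Sum>k\<in>T. (kercoeff N k / kermass TYPE('a) N * pw (quart k) x) *\<^sub>C fourier G k)"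
      by (rule kermean_expansion[OF G, of N]) blast
    have "(\<Sum>\<^sub>\<infinity>k\<in>lattice. (c N k * pw (quart k) x) *\<^sub>C fourier G k) = (\<Sum>\<^sub>\<infinity>k\<in>T. (c N k * pw (quart k) x) *\<^sub>C fourier G k)"
      by (rule infsum_cong_neutral) (use T(2,3) in \<open>auto simp: c_def scaleC.zero_left\<close>)
    then show ?thesis using T(1,4) by (simp add: c_def)
  qed
  have "(\<lambda>N. \<Sum>\<^sub>\<infinity>k\<in>lattice. (c N k * pw (quart k) x) *\<^sub>C fourier G k) \<longlonglongrightarrow>
      (\<Sum>\<^sub>\<infinity>k\<in>lattice. (1 / 4 ^ DIM('a) * pw (quart k) x) *\<^sub>C fourier G k)"
  proof (rule infsum_tendsto_dominated[OF s])
    fix N and k :: 'a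
    have "cmod (c N k) \<le> 1"
      using kercoeff_bound[of N k] by (simp add: c_def) (smt (verit) divide_le_eq_1 one_le_power)
    then show "norm ((c N k * pw (quart k) x) *\<^sub>C fourier G k) \<le> norm (fourier G k)"
      by (simp add: norm_scaleC norm_mult mult_left_le_one_le)
  next
    fix k :: 'a
    show "(\<lambda>N. (c N k * pw (quart k) x) *\<^sub>C fourier G k) \<longlonglongrightarrow> (1 / 4 ^ DIM('a) * pw (quart k) x) *\<^sub>C fourier G k"
      unfolding c_def by (intro scaleC.tendsto tendsto_mult tendsto_const kercoeff_tendsto)
  qed
  then have l1: "(\<lambda>N. kermean N G x) \<longlonglongrightarrow> (\<Sum>\<^sub>\<infinity>k\<in>lattice. (1 / 4 ^ DIM('a) * pw (quart k) x) *\<^sub>C fourier G k)"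
    by (simp only: km)
  have l2: "(\<lambda>N. kermean N G x) \<longlonglongrightarrow> G x"
  proof (rule LIMSEQ_I)
    fix r :: real assume r: "0 < r"
    obtain N0 where "\<And>N x. N0 \<le> N \<Longrightarrow> x \<in> cube 1 \<Longrightarrow> norm (kermean N G x - G x) \<le> r / 2"
      by (rule kermean_converges[OF G half_gt_zero[OF r]]) blast
    then show "\<exists>N0. \<forall>N\<ge>N0. norm (kermean N G x - G x) < r" using r x by (intro exI[of _ N0]) force
  qed
  have sm: "(\<lambda>k. pw (quart k) x *\<^sub>C fourier G k) summable_on lattice"
    by (rule abs_summable_summable) (use s in \<open>simp add: norm_scaleC\<close>)
  have "G x = (\<Sum>\<^sub>\<infinity>k\<in>lattice. (1 / 4 ^ DIM('a)) *\<^sub>C (pw (quart k) x *\<^sub>C fourier G k))"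
    using LIMSEQ_unique[OF l2 l1] by (simp add: scaleC_scaleC)
  also have "\<dots> = (1 / 4 ^ DIM('a)) *\<^sub>C (\<Sum>\<^sub>\<infinity>k\<in>lattice. pw (quart k) x *\<^sub>C fourier G k)"
    using has_sum_bounded_linear[OF scaleC.bounded_linear_right has_sum_infsum[OF sm]]
    by (simp add: o_def infsumI)
  finally have "4 ^ DIM('a) *\<^sub>R G x = of_real (4 ^ DIM('a)) *\<^sub>C (1 / 4 ^ DIM('a)) *\<^sub>C (\<Sum>\<^sub>\<infinity>k\<in>lattice. pw (quart k) x *\<^sub>C fourier G k)"
    by (simp only: scaleC_of_real)
  then have "4 ^ DIM('a) *\<^sub>R G x = (\<Sum>\<^sub>\<infinity>k\<in>lattice. pw (quart k) x *\<^sub>C fourier G k)"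
    by (simp add: scaleC_scaleC)
  then show ?thesis using has_sum_infsum[OF sm] by simp
qed

lemma fourier_pd:
  fixes G :: "'a::euclidean_space \<Rightarrow> 'c::cstar_algebra"
  assumes G: "G \<in> bdd_smooth" "supp_cube 2 G" and b: "b \<in> Basis"
  shows "fourier (pd b G) k = (2 * pi * \<i> * (quart k \<bullet> b)) *\<^sub>C fourier G k"
proof -
  define H where "H w = pw (- quart k) w *\<^sub>C G w" for w
  define c where "c = 2 * pi * \<i> * (quart k \<bullet> b)"
  have pG: "pd b G \<in> bdd_smooth" "supp_cube 2 (pd b G)" using bdd_smooth_pd[OF G(1) b] pd_supp_cube[OF G(2)] by auto
  have H: "H \<in> bdd_smooth" "supp_cube 2 H"
    using bdd_smooth_scaleC[OF bdd_smooth_pw G(1)] G(2) by (auto simp: H_def[abs_def] supp_cube_def scaleC.zero_right)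
  have H': "(\<lambda>w. pw (- quart k) w *\<^sub>C pd b G w) \<in> bdd_smooth" "supp_cube 2 (\<lambda>w. pw (- quart k) w *\<^sub>C pd b G w)"
    using bdd_smooth_scaleC[OF bdd_smooth_pw pG(1)] pG(2) by (auto simp: supp_cube_def scaleC.zero_right)
  have "pd b H w = pw (- quart k) w *\<^sub>C pd b G w - c *\<^sub>C H w" for w
    unfolding H_def
    using pd_bilinear[OF bounded_bilinear_scaleC bdd_smooth_differentiable[OF bdd_smooth_pw] bdd_smooth_differentiable[OF G(1)], of b "- quart k" w]
    by (simp add: pd_pw c_def scaleC_scaleC scaleC.minus_left)
  then have "pd b H = (\<lambda>w. pw (- quart k) w *\<^sub>C pd b G w - c *\<^sub>C H w)" by (rule ext)
  then have "0 = integral UNIV (\<lambda>w. pw (- quart k) w *\<^sub>C pd b G w - c *\<^sub>C H w)"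
    using integral_pd_eq_0[OF H b] by simp
  also have "\<dots> = integral UNIV (\<lambda>w. pw (- quart k) w *\<^sub>C pd b G w) - c *\<^sub>C integral UNIV H"
  proof -
    have i: "H integrable_on UNIV" by (rule integrable_supp_cube[OF bdd_smooth_continuous_on[OF H(1)] H(2)])
    have i': "(\<lambda>w. pw (- quart k) w *\<^sub>C pd b G w) integrable_on UNIV"
      by (rule integrable_supp_cube[OF bdd_smooth_continuous_on[OF H'(1)] H'(2)])
    show ?thesis
      using integral_diff[OF i' integrable_linear[OF i scaleC.bounded_linear_right, of c]]
        integral_linear[OF i scaleC.bounded_linear_right, of c] by (simp add: o_def)
  qed
  finally show ?thesis
    using integral_UNIV_cube[OF H(2)] integral_UNIV_cube[OF H'(2)]
    by (simp add: fourier_def H_def[abs_def] c_def)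
qed

lemma trigpoly_has_derivative:
  "((\<lambda>x. \<Sum>k\<in>T. (a k * pw (p k) x) *\<^sub>C v k) has_derivative
    (\<lambda>h. \<Sum>k\<in>T. (a k * (2 * pi * \<i> * (p k \<bullet> h) * pw (p k) x)) *\<^sub>C v k)) (at x)"
  by (intro has_derivative_sum bounded_linear.has_derivative[OF scaleC.bounded_linear_left]
      bounded_linear.has_derivative[OF bounded_linear_mult_right] pw_has_derivative)

text \<open>On the Fourier side differentiation is multiplication by
  \<open>2 * pi * \<i> * (quart k \<bullet> b)\<close>, whether it precedes or follows the
  averaging.\<close>

lemma kermean_pd:
  fixes G :: "'a::euclidean_space \<Rightarrow> 'c::cstar_algebra"
  assumes G: "G \<in> bdd_smooth" "supp_cube 2 G"
  shows "kermean N G differentiable at x" "b \<in> Basis \<Longrightarrow> pd b (kermean N G) = kermean N (pd b G)"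
proof -
  obtain T where T: "finite T" "T \<subseteq> lattice"
    and e: "\<And>x::'a. of_real (bumpker x ^ N) = (\<Sum>k\<in>T. kercoeff N k * pw (quart k) x)"
    by (rule kernel_expansion[where 'a = 'a and N = N]) blast
  obtain T1 where T1: "finite T1" "T1 \<subseteq> lattice" "\<And>k. k \<in> lattice - T1 \<Longrightarrow> kercoeff N k = 0"
    "\<And>x. kermean N G x = (\<Sum>k\<in>T1. (kercoeff N k / kermass TYPE('a) N * pw (quart k) x) *\<^sub>C fourier G k)"
    by (rule kermean_expansion[OF bdd_smooth_continuous_on[OF G(1)], of N]) blast
  have km: "kermean N G = (\<lambda>x. \<Sum>k\<in>T1. (kercoeff N k / kermass TYPE('a) N * pw (quart k) x) *\<^sub>C fourier G k)"
    using T1(4) by (rule ext)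
  show "kermean N G differentiable at x"
    unfolding km by (rule differentiableI[OF trigpoly_has_derivative])
  assume b: "b \<in> Basis"
  obtain T2 where T2: "finite T2" "T2 \<subseteq> lattice" "\<And>k. k \<in> lattice - T2 \<Longrightarrow> kercoeff N k = 0"
    "\<And>x. kermean N (pd b G) x = (\<Sum>k\<in>T2. (kercoeff N k / kermass TYPE('a) N * pw (quart k) x) *\<^sub>C fourier (pd b G) k)"
    by (rule kermean_expansion[OF bdd_smooth_continuous_on[OF bdd_smooth_pd[OF G(1) b]], of N]) blast
  show "pd b (kermean N G) = kermean N (pd b G)"
  proof
    fix x
    let ?t = "\<lambda>k. (kercoeff N k / kermass TYPE('a) N * pw (quart k) x) *\<^sub>C fourier (pd b G) k"
    have "pd b (kermean N G) x = (\<Sum>k\<in>T1. ?t k)"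
      unfolding km pd_eqI[OF trigpoly_has_derivative]
      by (intro sum.cong refl) (simp add: fourier_pd[OF G b] scaleC_scaleC mult_ac)
    \<comment> \<open>The two expansions may use different index sets; outside either of them the
      kernel coefficients vanish.\<close>
    also have "\<dots> = (\<Sum>k\<in>T1 \<union> T2. ?t k)"
      by (rule sum.mono_neutral_left) (use T1 T2 in \<open>auto simp: scaleC.zero_left\<close>)
    also have "\<dots> = (\<Sum>k\<in>T2. ?t k)"
      by (rule sum.mono_neutral_right) (use T1 T2 in \<open>auto simp: scaleC.zero_left\<close>)
    finally show "pd b (kermean N G) x = kermean N (pd b G) x" by (simp add: T2(4))
  qed
qed

section \<open>Dilation and density\<close>

definition dilmean :: "real \<Rightarrow> nat \<Rightarrow> ('a::euclidean_space \<Rightarrow> 'c::cstar_algebra) \<Rightarrow> 'a \<Rightarrow> 'c"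
  where "dilmean R N g x = kermean N (\<lambda>y. g (R *\<^sub>R y)) ((1 / R) *\<^sub>R x)"

lemma linear_scaleR_const: "linear (\<lambda>x::'a::euclidean_space. c *\<^sub>R x)"
  by (simp add: linear_iff scaleR_right_distrib mult.commute)

lemma pd_dilate:
  assumes "\<And>x. f differentiable at x"
  shows "pd b (\<lambda>x. f (c *\<^sub>R x)) = (\<lambda>x. c *\<^sub>R pd b f (c *\<^sub>R x))"
    and "(\<lambda>x. f (c *\<^sub>R x)) differentiable at x"
proof -
  have d: "((\<lambda>x. f (c *\<^sub>R x)) has_derivative (\<lambda>h. frechet_derivative f (at (c *\<^sub>R x)) (c *\<^sub>R h))) (at x)" for x
    by (rule has_derivative_compose[OF linear_imp_has_derivative[OF linear_scaleR_const] assms[unfolded frechet_derivative_works]])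
  show "(\<lambda>x. f (c *\<^sub>R x)) differentiable at x" by (rule differentiableI[OF d])
  have "frechet_derivative f (at y) (c *\<^sub>R b) = c *\<^sub>R frechet_derivative f (at y) b" for y
    by (rule linear_scale[OF has_derivative_linear[OF assms[unfolded frechet_derivative_works]]])
  then show "pd b (\<lambda>x. f (c *\<^sub>R x)) = (\<lambda>x. c *\<^sub>R pd b f (c *\<^sub>R x))"
    using pd_eqI[OF d] by (simp add: pd_def fun_eq_iff)
qed

lemma supp_cube_dilate:
  fixes g :: "'a::euclidean_space \<Rightarrow> 'b::zero"
  assumes "supp_cube (2 * R) g" "0 < R"
  shows "supp_cube 2 (\<lambda>y. g (R *\<^sub>R y))"
  unfolding supp_cube_def
proof (intro allI impI)
  fix y :: 'a assume "y \<notin> cube 2"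
  then obtain b where "b \<in> Basis" "2 < \<bar>y \<bullet> b\<bar>" by (auto simp: mem_cube not_le)
  then have "R *\<^sub>R y \<notin> cube (2 * R)" using assms(2) by (auto simp: mem_cube not_le abs_mult intro!: bexI[of _ b])
  then show "g (R *\<^sub>R y) = 0" by (rule supp_cubeD[OF assms(1)])
qed

text \<open>Averaging commutes with partial derivatives, so dilating a large cube to the standard one,
  averaging, and dilating back does not increase the bounds on any derivative.\<close>

lemma bder_dilmean:
  fixes g :: "'a::euclidean_space \<Rightarrow> 'c::cstar_algebra"
  assumes "g \<in> bdd_smooth" "supp_cube (2 * R) g" "0 < R" "bder UNIV m M g"
  shows "bder UNIV m M (dilmean R N g)"
  using assms(1,2,4)
proof (induction m arbitrary: g)
  case (0 g)
  define G where "G = (\<lambda>y. g (R *\<^sub>R y))"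
  have G: "G \<in> bdd_smooth" "supp_cube 2 G"
    unfolding G_def using bdd_smooth_linear[OF linear_scaleR_const 0(1)] supp_cube_dilate[OF 0(2) assms(3)] by auto
  show ?case
    using pd_dilate(2)[OF kermean_pd(1)[OF G]] kermean_norm_le[OF bdd_smooth_continuous_on[OF G(1)], of M] 0(3)
    by (simp add: dilmean_def[abs_def] G_def[symmetric]) (simp add: G_def)
next
  case (Suc m g)
  define G where "G = (\<lambda>y. g (R *\<^sub>R y))"
  have G: "G \<in> bdd_smooth" "supp_cube 2 G"
    unfolding G_def using bdd_smooth_linear[OF linear_scaleR_const Suc.prems(1)] supp_cube_dilate[OF Suc.prems(2) assms(3)] by auto
  have M: "norm (G w) \<le> M" for w using bder_bound[OF Suc.prems(3)] by (simp add: G_def)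
  have dm: "dilmean R N g = (\<lambda>x. kermean N G ((1 / R) *\<^sub>R x))" by (simp add: dilmean_def[abs_def] G_def)
  show ?case
  proof (rule bder_SucI)
    show "dilmean R N g differentiable at x" for x
      unfolding dm by (rule pd_dilate(2)[OF kermean_pd(1)[OF G]])
    show "norm (dilmean R N g x) \<le> M" for x
      unfolding dm by (rule kermean_norm_le[OF bdd_smooth_continuous_on[OF G(1)] M])
    fix b :: 'a assume b: "b \<in> Basis"
    have "pd b G = (\<lambda>y. R *\<^sub>R pd b g (R *\<^sub>R y))"
      unfolding G_def by (rule pd_dilate(1)[OF bdd_smooth_differentiable[OF Suc.prems(1)]])
    then have "kermean N (pd b G) y = R *\<^sub>R kermean N (\<lambda>y. pd b g (R *\<^sub>R y)) y" for y
    proof -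
      have e: "(\<lambda>w. bumpker (y - w) ^ N *\<^sub>R pd b G w) = (\<lambda>w. R *\<^sub>R (bumpker (y - w) ^ N *\<^sub>R pd b g (R *\<^sub>R w)))"
        using \<open>pd b G = _\<close> by (simp add: mult.commute)
      show ?thesis unfolding kermean_def e integral_cmul by (simp add: mult.commute)
    qed
    then have "pd b (dilmean R N g) = dilmean R N (pd b g)"
      unfolding dm pd_dilate(1)[OF kermean_pd(1)[OF G]] kermean_pd(2)[OF G b]
      using assms(3) by (simp add: dilmean_def[abs_def])
    then show "bder UNIV m M (pd b (dilmean R N g))"
      using Suc.IH[OF bdd_smooth_pd[OF Suc.prems(1) b] pd_supp_cube[OF Suc.prems(2)] bder_pd[OF Suc.prems(3) b]] by simp
  qed
qed

text \<open>The frequencies are arbitrary vectors, since the approximants of one function use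
  lattices of different mesh; \<open>T\<close> is merely an index set.\<close>

definition trigpoly :: "('a::euclidean_space \<Rightarrow> 'c::cstar_algebra) \<Rightarrow> bool"
  where "trigpoly f \<longleftrightarrow> (\<exists>(T :: 'a set) p c. finite T \<and> f = (\<lambda>x. \<Sum>k\<in>T. pw (p k) x *\<^sub>C c k))"

text \<open>\<open>f\<close> is cut off at scale \<open>R n\<close>, the cube of side
  \<open>4 * R n\<close> is shrunk to \<open>cube 2\<close>, a kernel mean is taken and dilated
  back. A given point lies in the region of good approximation once \<open>n\<close> exceeds its
  norm.\<close>

lemma trigpoly_dense:
  fixes f :: "'a::euclidean_space \<Rightarrow> 'c::cstar_algebra"
  assumes f: "f \<in> bdd_smooth"
  obtains fn where "sconv fn f" "\<And>n. trigpoly (fn n)"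
proof -
  define R where "R n = real (Suc n)" for n
  have R: "0 < R n" "1 \<le> R n" for n by (simp_all add: R_def)
  define g where "g n x = window (x /\<^sub>R R n) *\<^sub>C f x" for n x
  obtain Rw where w: "sconv (\<lambda>k z. window (z /\<^sub>R real (Suc k))) (\<lambda>_::'a. 1)"
    by (rule window_sconv) blast
  have sg: "sconv g (\<lambda>x. 1 *\<^sub>C f x)"
    unfolding g_def R_def by (rule sconv_bilinear[OF bounded_bilinear_scaleC w sconv_const[OF f]])
  have gb: "g n \<in> bdd_smooth" for n by (rule sconv_bdd_smooth[OF sg])
  have gs: "supp_cube (2 * R n) (g n)" for n
    unfolding supp_cube_def
  proof (intro allI impI)
    fix x :: 'a assume "x \<notin> cube (2 * R n)"
    then obtain b where b: "b \<in> Basis" "2 * R n < \<bar>x \<bullet> b\<bar>" by (auto simp: mem_cube not_le)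
    then have "2 \<le> \<bar>(x /\<^sub>R R n) \<bullet> b\<bar>" using R[of n] by (simp add: abs_mult field_simps)
    then show "g n x = 0" using window_eq_0[OF b(1)] by (simp add: g_def scaleC.zero_left)
  qed
  define G where "G n = (\<lambda>y. g n (R n *\<^sub>R y))" for n
  have G: "continuous_on (cube 2) (G n)" for n
    unfolding G_def by (rule bdd_smooth_continuous_on[OF bdd_smooth_linear[OF linear_scaleR_const gb]])
  \<comment> \<open>For each \<open>n\<close> the order of the kernel is chosen so large that the
    error on \<open>cube 1\<close> is at most \<open>1 / R n\<close>.\<close>
  have "\<exists>N. \<forall>x\<in>cube 1. norm (kermean N (G n) x - G n x) \<le> 1 / R n" for n
    by (rule kermean_converges[OF G, of "1 / R n" n]) (use R[of n] in auto)
  then obtain N where N: "\<And>n x. x \<in> cube 1 \<Longrightarrow> norm (kermean (N n) (G n) x - G n x) \<le> 1 / R n" by metis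
  define fn where "fn n = dilmean (R n) (N n) (g n)" for n
  have "sconv fn f"
    unfolding sconv_def
  proof (intro conjI allI)
    fix m
    obtain M where M: "\<And>k. bder UNIV m M (g k)" using sconvE[OF sg, of m] by blast
    then show "\<exists>M. \<forall>k. bder UNIV m M (fn k)"
      unfolding fn_def using bder_dilmean[OF gb gs R(1)] by blast
  next
    fix x :: 'a
    obtain n0 :: nat where n0: "norm x \<le> real n0" using real_arch_simple by blast
    have b: "norm (fn n x - f x) \<le> 1 / R n" if n: "n0 \<le> n" for n
    proof -
      have c: "(1 / R n) *\<^sub>R x \<in> cube 1"
        unfolding mem_cube
      proof
        fix b :: 'a assume "b \<in> Basis"
        then have "\<bar>x \<bullet> b\<bar> \<le> R n" using Basis_le_norm[of b x] n0 n by (simp add: R_def)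
        then show "\<bar>((1 / R n) *\<^sub>R x) \<bullet> b\<bar> \<le> 1" using R[of n] by (simp add: abs_mult)
      qed
      have "window ((1 / R n) *\<^sub>R x) = 1" by (rule window_eq_1[OF c])
      then have "G n ((1 / R n) *\<^sub>R x) = f x" using R(1)[of n] by (simp add: G_def g_def)
      with N[OF c, of n] show ?thesis by (simp add: fn_def dilmean_def G_def)
    qed
    have "(\<lambda>n. 1 / R n) \<longlonglongrightarrow> 0"
      unfolding R_def divide_inverse mult_1 by (rule LIMSEQ_inverse_real_of_nat)
    then have "(\<lambda>n. fn n x - f x) \<longlonglongrightarrow> 0"
      by (rule Lim_null_comparison[rotated]) (use b in \<open>auto intro!: eventually_sequentiallyI[of n0]\<close>)
    then show "(\<lambda>n. fn n x) \<longlonglongrightarrow> f x" by (rule LIM_zero_cancel)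
  qed
  moreover have "trigpoly (fn n)" for n
  proof -
    obtain T where T: "finite T" "\<And>x. kermean (N n) (G n) x = (\<Sum>k\<in>T. (kercoeff (N n) k / kermass TYPE('a) (N n) * pw (quart k) x) *\<^sub>C fourier (G n) k)"
      by (rule kermean_expansion[OF G, of "N n" n]) blast
    have "fn n = (\<lambda>x. \<Sum>k\<in>T. pw ((1 / R n) *\<^sub>R quart k) x *\<^sub>C ((kercoeff (N n) k / kermass TYPE('a) (N n)) *\<^sub>C fourier (G n) k))"
      unfolding fn_def dilmean_def[abs_def] G_def[symmetric] T(2)
      by (simp add: pw_def scaleC_scaleC mult.commute)
    with T(1) show ?thesis unfolding trigpoly_def
      by (intro exI[of _ T] exI[of _ "\<lambda>k. (1 / R n) *\<^sub>R quart k"]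
          exI[of _ "\<lambda>k. (kercoeff (N n) k / kermass TYPE('a) (N n)) *\<^sub>C fourier (G n) k"] conjI)
  qed
  ultimately show ?thesis by (rule that)
qed

section \<open>Associativity and involution\<close>

context skew_map
begin

lemma kap_scaleC: "kap (k *\<^sub>C c) = k *\<^sub>C kap c"
  unfolding kap_def by (rule oint_scaleC[OF bdd_smooth_const])

text \<open>The phase \<open>pw p (J q)\<close> is multiplicative in \<open>p\<close> and in
  \<open>q\<close>, so both bracketings collect the same phases; the module properties let
  \<open>kap\<close> move past the neighbouring factors.\<close>

lemma tp_assoc_wave:
  fixes c d e :: "'c::cstar_algebra"
  shows "tp (tp (\<lambda>x. pw p x *\<^sub>C c) (\<lambda>x. pw q x *\<^sub>C d)) (\<lambda>x. pw r x *\<^sub>C e) =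
    tp (\<lambda>x. pw p x *\<^sub>C c) (tp (\<lambda>x. pw q x *\<^sub>C d) (\<lambda>x. pw r x *\<^sub>C e))"
proof -
  have 1: "kap (kap (c * d) * e) = kap (c * kap (d * e))"
    by (simp add: kap_mult(1)[symmetric] kap_mult(2)[symmetric] mult.assoc)
  show ?thesis
    unfolding tp_wave
    unfolding scaleC_mult_left scaleC_mult_right kap_scaleC 1 scaleC_scaleC
    by (simp add: pw_add linear_add[OF linear] mult_ac add_ac)
qed

lemma tp_assoc_trigpoly:
  fixes f g h :: "'a \<Rightarrow> 'c::cstar_algebra"
  assumes "trigpoly f" "trigpoly g" "trigpoly h"
  shows "tp (tp f g) h = tp f (tp g h)"
proof -
  obtain S :: "'a set" and p c where f: "f = (\<lambda>x. \<Sum>k\<in>S. pw (p k) x *\<^sub>C c k)" using assms(1) unfolding trigpoly_def by blast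
  obtain T :: "'a set" and q d where g: "g = (\<lambda>x. \<Sum>k\<in>T. pw (q k) x *\<^sub>C d k)" using assms(2) unfolding trigpoly_def by blast
  obtain U :: "'a set" and r e where h: "h = (\<lambda>x. \<Sum>k\<in>U. pw (r k) x *\<^sub>C e k)" using assms(3) unfolding trigpoly_def by blast
  note w = bdd_smooth_wave and t = tp_bdd_smooth and s = bdd_smooth_sum
  show ?thesis
    unfolding f g h by (simp add: tp_sum_left tp_sum_right w t s tp_assoc_wave)
qed

lemma tp_assoc:
  fixes f g h :: "'a \<Rightarrow> 'c::cstar_algebra"
  assumes f: "f \<in> bdd_smooth" and g: "g \<in> bdd_smooth" and h: "h \<in> bdd_smooth"
  shows "tp (tp f g) h = tp f (tp g h)"
proof
  fix x
  obtain fn where fn: "sconv fn f" "\<And>n. trigpoly (fn n)" by (rule trigpoly_dense[OF f]) blast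
  obtain gn where gn: "sconv gn g" "\<And>n. trigpoly (gn n)" by (rule trigpoly_dense[OF g]) blast
  obtain hn where hn: "sconv hn h" "\<And>n. trigpoly (hn n)" by (rule trigpoly_dense[OF h]) blast
  have 1: "sconv (\<lambda>n. tp (tp (fn n) (gn n)) (hn n)) (tp (tp f g) h)"
    by (intro tp_sconv tp_bdd_smooth fn gn hn f g h)
  have 2: "sconv (\<lambda>n. tp (fn n) (tp (gn n) (hn n))) (tp f (tp g h))"
    by (intro tp_sconv tp_bdd_smooth fn gn hn f g h)
  show "tp (tp f g) h x = tp f (tp g h) x"
    using LIMSEQ_unique[OF sconvD[OF 1, of x, unfolded tp_assoc_trigpoly[OF fn(2) gn(2) hn(2)]] sconvD[OF 2]] .
qed

lemma sconv_star: "sconv fn f \<Longrightarrow> sconv (\<lambda>n x. star (fn n x)) (\<lambda>x. star (f x :: 'c::cstar_algebra))"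
  unfolding sconv_def
  using bder_star bounded_linear.tendsto[OF bounded_linear_star] by blast

lemma bdd_smooth_star: "f \<in> bdd_smooth \<Longrightarrow> (\<lambda>x. star (f x :: 'c::cstar_algebra)) \<in> bdd_smooth"
  by (rule bdd_smooth_bounded_linear[OF bounded_linear_star])

lemma star_sum: "star (\<Sum>i\<in>I. f i) = (\<Sum>i\<in>I. star (f i :: 'c::cstar_algebra))"
  by (rule linear_sum[OF bounded_linear.linear[OF bounded_linear_star]])

text \<open>By skew symmetry, exchanging the two frequencies conjugates the phase, just as the
  involution does.\<close>

lemma star_tp_wave:
  fixes c d :: "'c::cstar_algebra"
  shows "star (tp (\<lambda>x. pw p x *\<^sub>C c) (\<lambda>x. pw q x *\<^sub>C d) x) =
    tp (\<lambda>x. star (pw q x *\<^sub>C d)) (\<lambda>x. star (pw p x *\<^sub>C c)) x"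
proof -
  have "pw q (J p) = cnj (pw p (J q))"
    using skew[of q p] by (simp add: pw_def inner_commute cis_cnj)
  then show ?thesis
    unfolding star_scaleC pw_minus(1)[symmetric] tp_wave star_kap star_mult
    by (simp add: pw_minus linear_neg[OF linear] add.commute)
qed

lemma star_tp:
  fixes f g :: "'a \<Rightarrow> 'c::cstar_algebra"
  assumes f: "f \<in> bdd_smooth" and g: "g \<in> bdd_smooth"
  shows "(\<lambda>x. star (tp f g x)) = tp (\<lambda>x. star (g x)) (\<lambda>x. star (f x))"
proof
  fix x
  obtain fn where fn: "sconv fn f" "\<And>n. trigpoly (fn n)" by (rule trigpoly_dense[OF f]) blast
  obtain gn where gn: "sconv gn g" "\<And>n. trigpoly (gn n)" by (rule trigpoly_dense[OF g]) blast
  have e: "star (tp (fn n) (gn n) x) = tp (\<lambda>x. star (gn n x)) (\<lambda>x. star (fn n x)) x" for n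
  proof -
    obtain S :: "'a set" and p c where f: "fn n = (\<lambda>x. \<Sum>k\<in>S. pw (p k) x *\<^sub>C c k)" using fn(2)[of n] unfolding trigpoly_def by blast
    obtain T :: "'a set" and q d where g: "gn n = (\<lambda>x. \<Sum>k\<in>T. pw (q k) x *\<^sub>C d k)" using gn(2)[of n] unfolding trigpoly_def by blast
    note w = bdd_smooth_wave and s = bdd_smooth_sum and ws = bdd_smooth_star[OF bdd_smooth_wave]
    have "star (tp (fn n) (gn n) x) = (\<Sum>i\<in>S. \<Sum>j\<in>T. star (tp (\<lambda>x. pw (p i) x *\<^sub>C c i) (\<lambda>x. pw (q j) x *\<^sub>C d j) x))"
      unfolding f g by (simp add: tp_sum_left tp_sum_right w s star_sum)
    also have "\<dots> = (\<Sum>j\<in>T. \<Sum>i\<in>S. tp (\<lambda>x. star (pw (q j) x *\<^sub>C d j)) (\<lambda>x. star (pw (p i) x *\<^sub>C c i)) x)"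
      unfolding star_tp_wave by (rule sum.swap)
    also have "\<dots> = tp (\<lambda>x. star (gn n x)) (\<lambda>x. star (fn n x)) x"
      unfolding f g star_sum by (simp add: tp_sum_left tp_sum_right ws s)
    finally show ?thesis .
  qed
  have 1: "(\<lambda>n. star (tp (fn n) (gn n) x)) \<longlonglongrightarrow> star (tp f g x)"
    by (rule bounded_linear.tendsto[OF bounded_linear_star sconvD[OF tp_sconv[OF fn(1) gn(1) f g]]])
  have 2: "sconv (\<lambda>n. tp (\<lambda>x. star (gn n x)) (\<lambda>x. star (fn n x))) (tp (\<lambda>x. star (g x)) (\<lambda>x. star (f x)))"
    by (intro tp_sconv sconv_star bdd_smooth_star fn gn f g)
  show "star (tp f g x) = tp (\<lambda>x. star (g x)) (\<lambda>x. star (f x)) x"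
    using LIMSEQ_unique[OF 1[unfolded e] sconvD[OF 2]] .
qed

end

section \<open>A norm defined by local Fourier coefficients\<close>

text \<open>The norm is that of the Wiener amalgam space \<open>W(F L\<^sup>1, L\<^sup>\<infinity>)\<close>: left multiplication by a bounded
  smooth function acts on the coefficients through a matrix with fast off-diagonal decay.\<close>

definition lcoef :: "('a::euclidean_space \<Rightarrow> 'c::cstar_algebra) \<Rightarrow> 'a \<Rightarrow> 'a \<Rightarrow> 'c"
  where "lcoef h y k = fourier (\<lambda>w. window w *\<^sub>C h (y + w)) k"

lemma window_supp: "supp_cube 2 window"
  by (simp add: supp_cube_def window_outside)

lemma lcoef_eq:
  "lcoef h y k = integral (cube 2) (\<lambda>w. (window w * pw (quart (- k)) w) *\<^sub>C h (y + w))"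
  by (simp add: lcoef_def fourier_def scaleC_scaleC mult.commute)

lemma lcoef_integrable:
  assumes "h \<in> bdd_smooth"
  shows "(\<lambda>w. (window w * pw p w) *\<^sub>C h (y + w)) integrable_on cube 2"
    "(\<lambda>w. (window w * pw p w) *\<^sub>C h (y + w)) \<in> bdd_smooth"
    "supp_cube 2 (\<lambda>w. (window w * pw p w) *\<^sub>C h (y + w))"
proof -
  show b: "(\<lambda>w. (window w * pw p w) *\<^sub>C h (y + w)) \<in> bdd_smooth"
    by (rule bdd_smooth_scaleC[OF bdd_smooth_mult[OF window_bdd_smooth bdd_smooth_pw] bdd_smooth_shift[OF assms]])
  show "(\<lambda>w. (window w * pw p w) *\<^sub>C h (y + w)) integrable_on cube 2"
    by (rule integrable_cube[OF bdd_smooth_continuous_on[OF b]])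
  show "supp_cube 2 (\<lambda>w. (window w * pw p w) *\<^sub>C h (y + w))"
    by (simp add: supp_cube_def window_outside scaleC.zero_left)
qed

lemma lcoef_decay:
  obtains C where "0 \<le> C"
    "\<And>(h :: 'a::euclidean_space \<Rightarrow> 'c::cstar_algebra) M y k. \<lbrakk>h \<in> bdd_smooth; bder UNIV (2 * (j * DIM('a))) M h\<rbrakk>
      \<Longrightarrow> norm (lcoef h y k) \<le> C * M * wt k ^ j"
proof -
  obtain C where C: "0 \<le> C"
    "\<And>(F :: 'a \<Rightarrow> 'c) M k. \<lbrakk>F \<in> bdd_smooth; 0 \<le> M; bder (cube 2) (2 * (j * DIM('a))) M F\<rbrakk>
      \<Longrightarrow> norm (integral UNIV (\<lambda>z. (window z * pw (quart k) z) *\<^sub>C F z)) \<le> C * M * wt k ^ j"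
    by (rule fourier_decay[OF window_bdd_smooth window_supp, where j = j and ?'c = 'c]) blast
  show ?thesis
  proof (rule that[OF C(1)])
    fix h :: "'a \<Rightarrow> 'c" and M y k
    assume h: "h \<in> bdd_smooth" "bder UNIV (2 * (j * DIM('a))) M h"
    have "bder (cube 2) (2 * (j * DIM('a))) M (\<lambda>w. h (w + y))"
      by (rule bder_translate[OF h(2)]) simp
    then have "bder (cube 2) (2 * (j * DIM('a))) M (\<lambda>w. h (y + w))" by (simp add: add.commute)
    from C(2)[OF bdd_smooth_shift[OF h(1)] bder_nonneg[OF h(2)] this, of "- k"]
    show "norm (lcoef h y k) \<le> C * M * wt k ^ j"
      unfolding lcoef_eq integral_UNIV_cube[OF lcoef_integrable(3)[OF h(1)], symmetric] wt_minus .
  qed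
qed

lemma lcoef_sum:
  assumes "\<And>i. i \<in> I \<Longrightarrow> F i \<in> bdd_smooth" "finite I"
  shows "lcoef (\<lambda>x. \<Sum>i\<in>I. F i x) y k = (\<Sum>i\<in>I. lcoef (F i) y k)"
  unfolding lcoef_eq scaleC.sum_right
  by (rule integral_sum[OF assms(2) lcoef_integrable(1)[OF assms(1)]])

lemma lcoef_add:
  assumes "f \<in> bdd_smooth" "g \<in> bdd_smooth"
  shows "lcoef (\<lambda>x. f x + g x) y k = lcoef f y k + lcoef g y k"
  unfolding lcoef_eq scaleC.add_right
  by (rule integral_add[OF lcoef_integrable(1)[OF assms(1)] lcoef_integrable(1)[OF assms(2)]])

lemma lcoef_scaleC:
  assumes "f \<in> bdd_smooth"
  shows "lcoef (\<lambda>x. c *\<^sub>C f x) y k = c *\<^sub>C lcoef f y k"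
proof -
  have "(\<lambda>w. (window w * pw (quart (- k)) w) *\<^sub>C (c *\<^sub>C f (y + w))) = (\<lambda>w. c *\<^sub>C ((window w * pw (quart (- k)) w) *\<^sub>C f (y + w)))"
    by (simp only: scaleC_scaleC mult.commute)
  then show ?thesis
    using integral_linear[OF lcoef_integrable(1)[OF assms, of "quart (- k)" y] scaleC.bounded_linear_right, of c]
    unfolding lcoef_eq by (simp add: o_def)
qed

lemma lcoef_tendsto:
  assumes s: "sconv hn h" and h: "h \<in> bdd_smooth"
  shows "(\<lambda>n. lcoef (hn n) y k) \<longlonglongrightarrow> lcoef h y k"
  unfolding lcoef_eq
proof (rule tendsto_integral_cube)
  have "sconv (\<lambda>n w. hn n (y + w)) (\<lambda>w. h (y + w))"
    using sconv_affine[OF linear_id s, of y] by simp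
  from sconv_bilinear[OF bounded_bilinear_scaleC
      sconv_const[OF bdd_smooth_mult[OF window_bdd_smooth bdd_smooth_pw[of "quart (- k)"]]] this]
  show "uniform_limit (cube 2) (\<lambda>n w. (window w * pw (quart (- k)) w) *\<^sub>C hn n (y + w))
      (\<lambda>w. (window w * pw (quart (- k)) w) *\<^sub>C h (y + w)) sequentially"
    by (rule sconv_uniform_limit[OF _ compact_cube])
  show "continuous_on (cube 2) (\<lambda>w. (window w * pw (quart (- k)) w) *\<^sub>C hn n (y + w))" for n
    by (rule bdd_smooth_continuous_on[OF lcoef_integrable(2)[OF sconv_bdd_smooth[OF s]]])
qed

text \<open>\<open>window\<close> is 1 on \<open>cube 1\<close>, so the Fourier series of the
  windowed piece returns \<open>h\<close> itself there; smoothness makes its coefficients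
  summable.\<close>

lemma lcoef_inversion:
  fixes h :: "'a::euclidean_space \<Rightarrow> 'c::cstar_algebra"
  assumes h: "h \<in> bdd_smooth" and x: "x \<in> cube 1"
  shows "((\<lambda>k. pw (quart k) x *\<^sub>C lcoef h y k) has_sum (4 ^ DIM('a) *\<^sub>R h (y + x))) lattice"
proof -
  obtain C where C: "0 \<le> C" "\<And>(h :: 'a \<Rightarrow> 'c) M y k. \<lbrakk>h \<in> bdd_smooth; bder UNIV (2 * (1 * DIM('a))) M h\<rbrakk>
      \<Longrightarrow> norm (lcoef h y k) \<le> C * M * wt k ^ 1"
    by (rule lcoef_decay[where j = 1 and ?'a = 'a and ?'c = 'c]) blast
  obtain M where M: "bder UNIV (2 * (1 * DIM('a))) M h" using h by (rule bdd_smoothE)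
  have "(\<lambda>k. norm (lcoef h y k)) summable_on lattice"
    by (rule summable_on_comparison_test[OF summable_on_cmult_right[OF wt_summable, of "C * M"]])
      (use C(2)[OF h M] in auto)
  then have s: "(\<lambda>k. norm (fourier (\<lambda>w. window w *\<^sub>C h (y + w)) k)) summable_on lattice"
    by (simp add: lcoef_def)
  have c: "continuous_on (cube 2) (\<lambda>w. window w *\<^sub>C h (y + w))"
    by (rule bdd_smooth_continuous_on[OF bdd_smooth_scaleC[OF window_bdd_smooth bdd_smooth_shift[OF h]]])
  from fourier_inversion[OF c s x] show ?thesis
    using window_eq_1[OF x] by (simp add: lcoef_def)
qed

text \<open>Finite sums stand for the l^1 norm over the frequencies. The centre \<open>y\<close>
  runs through all points, not only lattice points, so that the norm is invariant under
  translations.\<close>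

definition NN :: "('a::euclidean_space \<Rightarrow> 'c::cstar_algebra) \<Rightarrow> real"
  where "NN h = Sup {\<Sum>k\<in>T. norm (lcoef h y k) | y T. finite T \<and> T \<subseteq> lattice}"

lemma NN_least:
  assumes "\<And>y T. finite T \<Longrightarrow> T \<subseteq> lattice \<Longrightarrow> (\<Sum>k\<in>T. norm (lcoef h y k)) \<le> B"
  shows "NN h \<le> B"
  unfolding NN_def
proof (rule cSup_least)
  show "{\<Sum>k\<in>T. norm (lcoef h y k) | y T. finite T \<and> T \<subseteq> lattice} \<noteq> {}" by blast
qed (use assms in blast)

lemma lcoef_sum_bound:
  obtains C where "0 \<le> C"
    "\<And>(h :: 'a::euclidean_space \<Rightarrow> 'c::cstar_algebra) M y T. \<lbrakk>h \<in> bdd_smooth; bder UNIV (2 * DIM('a)) M h;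
      finite T; T \<subseteq> lattice\<rbrakk> \<Longrightarrow> (\<Sum>k\<in>T. norm (lcoef h y k)) \<le> C * M"
proof -
  obtain C where C: "0 \<le> C" "\<And>(h :: 'a \<Rightarrow> 'c) M y k. \<lbrakk>h \<in> bdd_smooth; bder UNIV (2 * (1 * DIM('a))) M h\<rbrakk>
      \<Longrightarrow> norm (lcoef h y k) \<le> C * M * wt k ^ 1"
    by (rule lcoef_decay[where j = 1 and ?'a = 'a and ?'c = 'c]) blast
  show ?thesis
  proof (rule that[of "C * 5 ^ DIM('a)"])
    fix h :: "'a \<Rightarrow> 'c" and M y and T :: "'a set"
    assume h: "h \<in> bdd_smooth" "bder UNIV (2 * DIM('a)) M h" and T: "finite T" "T \<subseteq> lattice"
    have "norm (lcoef h y k) \<le> C * M * wt k" for k using C(2)[of h M y k] h by simp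
    then have "(\<Sum>k\<in>T. norm (lcoef h y k)) \<le> (\<Sum>k\<in>T. C * M * wt k)" by (rule sum_mono)
    also have "\<dots> = C * M * (\<Sum>k\<in>T. wt k)" by (simp add: sum_distrib_left)
    also have "\<dots> \<le> C * M * 5 ^ DIM('a)"
      using C(1) bder_nonneg[OF h(2)] by (intro mult_left_mono sum_wt_lattice T) auto
    finally show "(\<Sum>k\<in>T. norm (lcoef h y k)) \<le> C * 5 ^ DIM('a) * M" by (simp add: mult_ac)
  qed (use C in simp)
qed

lemma NN_upper:
  fixes h :: "'a::euclidean_space \<Rightarrow> 'c::cstar_algebra"
  assumes h: "h \<in> bdd_smooth" and T: "finite T" "T \<subseteq> lattice"
  shows "(\<Sum>k\<in>T. norm (lcoef h y k)) \<le> NN h"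
  unfolding NN_def
proof (rule cSup_upper)
  obtain M where M: "bder UNIV (2 * DIM('a)) M h" using h by (rule bdd_smoothE)
  obtain C where "\<And>y T. \<lbrakk>finite T; T \<subseteq> lattice\<rbrakk> \<Longrightarrow> (\<Sum>k\<in>T. norm (lcoef h y k)) \<le> C * M"
    by (rule lcoef_sum_bound[where ?'a = 'a and ?'c = 'c]) (use h M in blast)
  then show "bdd_above {\<Sum>k\<in>T. norm (lcoef h y k) | y T. finite T \<and> T \<subseteq> lattice}"
    by (intro bdd_aboveI[of _ "C * M"]) blast
qed (use T in blast)

lemma NN_bound:
  obtains C where "0 \<le> C" "\<And>(h :: 'a::euclidean_space \<Rightarrow> 'c::cstar_algebra) M. \<lbrakk>h \<in> bdd_smooth; bder UNIV (2 * DIM('a)) M h\<rbrakk>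
    \<Longrightarrow> NN h \<le> C * M"
proof -
  obtain C where C: "0 \<le> C" "\<And>(h :: 'a \<Rightarrow> 'c) M y T. \<lbrakk>h \<in> bdd_smooth; bder UNIV (2 * DIM('a)) M h;
      finite T; T \<subseteq> lattice\<rbrakk> \<Longrightarrow> (\<Sum>k\<in>T. norm (lcoef h y k)) \<le> C * M"
    by (rule lcoef_sum_bound[where ?'a = 'a and ?'c = 'c]) blast
  show ?thesis by (rule that[OF C(1)]) (rule NN_least, rule C(2))
qed

lemma NN_nonneg: "h \<in> bdd_smooth \<Longrightarrow> 0 \<le> NN h"
  using NN_upper[of h "{}"] by simp

text \<open>At the centre of the window all characters are 1, so inversion writes a multiple of
  \<open>h y\<close> as the sum of the local coefficients at \<open>y\<close>.\<close>

lemma norm_le_NN: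
  fixes h :: "'a::euclidean_space \<Rightarrow> 'c::cstar_algebra"
  assumes h: "h \<in> bdd_smooth"
  shows "norm (h y) \<le> NN h"
proof -
  have "((\<lambda>k. lcoef h y k) has_sum (4 ^ DIM('a) *\<^sub>R h y)) lattice"
    using lcoef_inversion[OF h, of 0 y] by (simp add: mem_cube)
  then have "((\<lambda>T. \<Sum>k\<in>T. lcoef h y k) \<longlongrightarrow> 4 ^ DIM('a) *\<^sub>R h y) (finite_subsets_at_top lattice)"
    by (simp add: has_sum_def)
  then have "((\<lambda>T. norm (\<Sum>k\<in>T. lcoef h y k)) \<longlongrightarrow> norm (4 ^ DIM('a) *\<^sub>R h y)) (finite_subsets_at_top lattice)"
    by (rule tendsto_norm)
  moreover have "\<forall>\<^sub>F T in finite_subsets_at_top lattice. norm (\<Sum>k\<in>T. lcoef h y k) \<le> NN h"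
    using order_trans[OF norm_sum NN_upper[OF h]]
    by (intro eventually_finite_subsets_at_top_weakI) blast
  ultimately have "norm (4 ^ DIM('a) *\<^sub>R h y) \<le> NN h"
    by (intro tendsto_upperbound[OF _ _ finite_subsets_at_top_neq_bot])
  moreover have "1 * norm (h y) \<le> 4 ^ DIM('a) * norm (h y)" by (intro mult_right_mono one_le_power) auto
  ultimately show ?thesis by simp
qed

lemma NN_add:
  assumes "f \<in> bdd_smooth" "g \<in> bdd_smooth"
  shows "NN (\<lambda>x. f x + g x) \<le> NN f + NN g"
proof (rule NN_least)
  fix y and T :: "'a set" assume T: "finite T" "T \<subseteq> lattice"
  have "(\<Sum>k\<in>T. norm (lcoef (\<lambda>x. f x + g x) y k)) \<le> (\<Sum>k\<in>T. norm (lcoef f y k) + norm (lcoef g y k))"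
    unfolding lcoef_add[OF assms] by (intro sum_mono norm_triangle_ineq)
  also have "\<dots> \<le> NN f + NN g"
    unfolding sum.distrib by (intro add_mono NN_upper assms T)
  finally show "(\<Sum>k\<in>T. norm (lcoef (\<lambda>x. f x + g x) y k)) \<le> NN f + NN g" .
qed

lemma NN_scaleC_le:
  assumes "f \<in> bdd_smooth"
  shows "NN (\<lambda>x. c *\<^sub>C f x) \<le> cmod c * NN f"
proof (rule NN_least)
  fix y and T :: "'a set" assume T: "finite T" "T \<subseteq> lattice"
  have "(\<Sum>k\<in>T. norm (lcoef (\<lambda>x. c *\<^sub>C f x) y k)) = cmod c * (\<Sum>k\<in>T. norm (lcoef f y k))"
    unfolding lcoef_scaleC[OF assms] norm_scaleC by (simp add: sum_distrib_left)
  also have "\<dots> \<le> cmod c * NN f" by (intro mult_left_mono NN_upper assms T) simp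
  finally show "(\<Sum>k\<in>T. norm (lcoef (\<lambda>x. c *\<^sub>C f x) y k)) \<le> cmod c * NN f" .
qed

lemma lattice_box_subset: "lattice_box R \<subseteq> lattice"
  unfolding lattice_box_def by (rule Int_lower1)

lemma bder_outside_supp:
  assumes "bder UNIV m M f" "supp_cube R f" "x \<notin> cube R"
  shows "bder {x} m 0 f"
  using assms(1,2)
proof (induction m arbitrary: f)
  case 0
  then show ?case using supp_cubeD[OF 0(2) assms(3)] by simp
next
  case (Suc m)
  show ?case
  proof (rule bder_SucI)
    show "f differentiable at y" for y by (rule bder_differentiable[OF Suc.prems(1)])
    show "norm (f y) \<le> 0" if "y \<in> {x}" for y using supp_cubeD[OF Suc.prems(2) assms(3)] that by simp
    show "bder {x} m 0 (pd b f)" if "b \<in> Basis" for b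
      by (rule Suc.IH[OF bder_pd[OF Suc.prems(1) that] pd_supp_cube[OF Suc.prems(2)]])
  qed
qed

lemma wt_ge_on_cube:
  fixes x :: "'a::euclidean_space"
  assumes "x \<in> cube 1" shows "1 \<le> 4 ^ DIM('a) * wt x"
proof -
  have "- x \<in> cube 1" using assms by (simp add: mem_cube)
  from wt_shift[OF this, of x] show ?thesis by (simp add: wt_def)
qed

text \<open>Compact support is recorded as a factor \<open>wt (x - a)\<close>, in which form the
  translates to lattice points can be summed by \<open>sum_wt_lattice_shift\<close>.\<close>

lemma bder_supp_wt:
  fixes f :: "'a::euclidean_space \<Rightarrow> 'b::real_normed_vector"
  assumes f: "bder UNIV m M f" and s: "supp_cube 1 f"
  shows "bder {x} m (M * 4 ^ DIM('a) * wt (x - a)) (\<lambda>z. f (z - a))"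
proof -
  note M = bder_nonneg[OF f]
  have "bder {x - a} m (M * 4 ^ DIM('a) * wt (x - a)) f"
  proof (cases "x - a \<in> cube 1")
    case True
    have "M * 1 \<le> M * (4 ^ DIM('a) * wt (x - a))"
      by (rule mult_left_mono[OF wt_ge_on_cube[OF True] M])
    then show ?thesis using bder_mono[OF f, of "{x - a}" m] by (simp add: mult.assoc)
  next
    case False
    show ?thesis by (rule bder_le[OF bder_outside_supp[OF f s False]]) (simp add: M)
  qed
  from bder_translate[OF this, of "{x}" "- a"] show ?thesis by simp
qed

text \<open>Each derivative of a plane wave produces a factor of the size of its frequency; one
  power of \<open>wt k\<close> pays for it.\<close>

lemma norm_wt_le:
  fixes k :: "'a::euclidean_space"
  shows "norm k * wt k \<le> real DIM('a)"
proof -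
  have "\<bar>k \<bullet> b\<bar> * wt k \<le> 1" if b: "b \<in> Basis" for b
  proof -
    have "wt k = 1 / (1 + (k \<bullet> b)\<^sup>2) * (\<Prod>c\<in>Basis - {b}. 1 / (1 + (k \<bullet> c)\<^sup>2))"
      unfolding wt_def using b by (subst prod.remove[of _ b]) auto
    also have "\<dots> \<le> 1 / (1 + (k \<bullet> b)\<^sup>2) * 1"
      by (intro mult_left_mono prod_le_1) (auto simp: add_pos_nonneg)
    finally have "\<bar>k \<bullet> b\<bar> * wt k \<le> \<bar>k \<bullet> b\<bar> * (1 / (1 + (k \<bullet> b)\<^sup>2))"
      by (intro mult_left_mono) auto
    also have "\<dots> \<le> 1"
    proof -
      have "0 \<le> (\<bar>k \<bullet> b\<bar> - 1)\<^sup>2" by simp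
      then have "2 * \<bar>k \<bullet> b\<bar> \<le> 1 + (k \<bullet> b)\<^sup>2" by (simp add: power2_diff)
      then have "\<bar>k \<bullet> b\<bar> \<le> 1 + (k \<bullet> b)\<^sup>2" using abs_ge_zero[of "k \<bullet> b"] by linarith
      then show ?thesis by (simp add: divide_le_eq add_pos_nonneg)
    qed
    finally show ?thesis .
  qed
  then have "(\<Sum>b\<in>Basis. \<bar>k \<bullet> b\<bar> * wt k) \<le> (\<Sum>b\<in>(Basis::'a set). 1)" by (rule sum_mono)
  moreover have "norm k * wt k \<le> (\<Sum>b\<in>Basis. \<bar>k \<bullet> b\<bar>) * wt k"
    by (intro mult_right_mono norm_le_l1) simp
  ultimately show ?thesis by (simp add: sum_distrib_right)
qed

text \<open>Every finite part of the lattice lies in all sufficiently large boxes, so the boxes may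
  replace the net of finite subsets.\<close>

lemma has_sum_lattice_box:
  fixes f :: "'a::euclidean_space \<Rightarrow> 'b::real_normed_vector"
  assumes "(f has_sum S) lattice"
  shows "(\<lambda>R. \<Sum>k\<in>lattice_box R. f k) \<longlonglongrightarrow> S"
proof -
  have "filterlim (lattice_box :: nat \<Rightarrow> 'a set) (finite_subsets_at_top lattice) sequentially"
    unfolding filterlim_iff eventually_finite_subsets_at_top
  proof (intro allI impI)
    fix P :: "'a set \<Rightarrow> bool"
    assume "\<exists>X. finite X \<and> X \<subseteq> lattice \<and> (\<forall>Y. finite Y \<and> X \<subseteq> Y \<and> Y \<subseteq> lattice \<longrightarrow> P Y)"
    then obtain X where X: "finite X" "X \<subseteq> lattice" "\<forall>Y. finite Y \<and> X \<subseteq> Y \<and> Y \<subseteq> lattice \<longrightarrow> P Y"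
      by (elim exE conjE)
    obtain R where R: "X \<subseteq> lattice_box R" by (rule lattice_finite_subset_box[OF X(1,2)])
    have "P (lattice_box n)" if "R \<le> n" for n
    proof (rule mp[OF spec[OF X(3)]], intro conjI)
      show "X \<subseteq> lattice_box n" using R lattice_box_mono[OF that] by (rule subset_trans)
      show "lattice_box n \<subseteq> lattice" unfolding lattice_box_def by (rule Int_lower1)
    qed simp
    then show "\<forall>\<^sub>F n in sequentially. P (lattice_box n)" by (rule eventually_sequentiallyI)
  qed
  from filterlim_compose[OF assms[unfolded has_sum_def] this] show ?thesis .
qed

subsection \<open>Synthesis from the local coefficients\<close>

text \<open>Around each lattice point \<open>a\<close> the function is resynthesised from its local
  Fourier series, and the pieces are glued by the tiles. Positions and frequencies are both
  truncated to a box, and \<open>1 / 4 ^ DIM('a)\<close> is the normalisation from the inversion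
  formula.\<close>

definition gabor :: "nat \<Rightarrow> ('a::euclidean_space \<Rightarrow> 'c::cstar_algebra) \<Rightarrow> 'a \<Rightarrow> 'c"
  where "gabor R h x = (\<Sum>a\<in>lattice_box R. tile (x - a) *\<^sub>C
    (\<Sum>k\<in>lattice_box R. pw (quart k) (x - a) *\<^sub>C ((1 / 4 ^ DIM('a)) *\<^sub>C lcoef h a k)))"

lemma gabor_sconv:
  fixes h :: "'a::euclidean_space \<Rightarrow> 'c::cstar_algebra"
  assumes h: "h \<in> bdd_smooth"
  shows "sconv (\<lambda>R. gabor R h) h"
  unfolding sconv_def
proof (intro conjI allI)
  fix m
  \<comment> \<open>Of the \<open>m + 1\<close> powers of \<open>wt k\<close>, \<open>m\<close>
    absorb the derivatives of the plane waves and the last one makes the sum over the frequencies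
    converge.\<close>
  obtain C where C: "0 \<le> C" "\<And>(h :: 'a \<Rightarrow> 'c) M y k. \<lbrakk>h \<in> bdd_smooth; bder UNIV (2 * ((m + 1) * DIM('a))) M h\<rbrakk>
      \<Longrightarrow> norm (lcoef h y k) \<le> C * M * wt k ^ (m + 1)"
    by (rule lcoef_decay[where j = "m + 1" and ?'a = 'a and ?'c = 'c]) blast
  obtain M where M: "bder UNIV (2 * ((m + 1) * DIM('a))) M h" using h by (rule bdd_smoothE)
  note M0 = bder_nonneg[OF M]
  \<comment> \<open>Dominates \<open>(1 + 2 * pi * norm (quart k)) * wt k\<close>, by
    \<open>norm_wt_le\<close>.\<close>
  define D where "D = 1 + pi * real DIM('a)"
  define B where "B = D ^ m * (C * M) * 5 ^ DIM('a)"
  define Q where "Q a R = (\<lambda>w. \<Sum>k\<in>lattice_box R. pw (quart k) w *\<^sub>C ((1 / 4 ^ DIM('a)) *\<^sub>C lcoef h a k))" for a R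
  obtain Mt where Mt: "bder UNIV m Mt (tile :: 'a \<Rightarrow> complex)" by (rule bdd_smoothE[OF tile_bdd_smooth])
  have bQ: "bder UNIV m B (Q a R)" for a R
  proof -
    have t: "bder UNIV m (D ^ m * (C * M) * wt k) (\<lambda>w. pw (quart k) w *\<^sub>C ((1 / 4 ^ DIM('a)) *\<^sub>C lcoef h a k))" for k
    proof -
      let ?v = "(1 / 4 ^ DIM('a)) *\<^sub>C lcoef h a k"
      have b: "bder UNIV m (norm ?v * (1 + 2 * pi * norm (quart k)) ^ m) (\<lambda>w. pw (quart k) w *\<^sub>C ?v)"
        by (rule bder_bounded_linear(1)[OF scaleC.bounded_linear_left _ _ bder_pw]) (auto simp: norm_scaleC)
      have "norm ?v \<le> 1 * norm (lcoef h a k)"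
        unfolding norm_scaleC by (intro mult_right_mono) (auto simp: norm_divide norm_power)
      also have "\<dots> \<le> C * M * wt k ^ (m + 1)" using C(2)[OF h M] by simp
      finally have "norm ?v * (1 + 2 * pi * norm (quart k)) ^ m \<le> C * M * wt k ^ (m + 1) * (1 + 2 * pi * norm (quart k)) ^ m"
        by (intro mult_right_mono) auto
      also have "\<dots> = C * M * wt k * ((1 + 2 * pi * norm (quart k)) * wt k) ^ m"
        by (simp add: power_mult_distrib mult_ac)
      also have "\<dots> \<le> C * M * wt k * D ^ m"
      proof (intro mult_left_mono power_mono)
        have "(1 + 2 * pi * norm (quart k)) * wt k = wt k + pi / 2 * (norm k * wt k)" by (simp add: algebra_simps)
        also have "\<dots> \<le> 1 + pi / 2 * real DIM('a)"
          by (intro add_mono wt_le_1 mult_left_mono norm_wt_le) simp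
        also have "\<dots> \<le> D" using pi_ge_zero by (simp add: D_def mult_right_mono)
        finally show "(1 + 2 * pi * norm (quart k)) * wt k \<le> D" .
      qed (use C(1) M0 in auto)
      finally show ?thesis using bder_le[OF b] by (simp add: mult_ac)
    qed
    have "bder UNIV m (\<Sum>k\<in>(lattice_box R :: 'a set). D ^ m * (C * M) * wt k) (Q a R)"
      unfolding Q_def by (rule bder_sum[OF finite_lattice_box t])
    moreover have "(\<Sum>k\<in>(lattice_box R :: 'a set). D ^ m * (C * M) * wt k) \<le> B"
    proof -
      have "0 \<le> D ^ m * (C * M)" using C(1) M0 pi_ge_zero by (simp add: D_def)
      moreover have "(\<Sum>k\<in>(lattice_box R :: 'a set). wt k) \<le> 5 ^ DIM('a)"
        by (rule sum_wt_lattice[OF finite_lattice_box lattice_box_subset])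
      ultimately show ?thesis unfolding B_def sum_distrib_left[symmetric] by (rule mult_left_mono[rotated])
    qed
    ultimately show ?thesis by (rule bder_le)
  qed
  define A where "A = 2 ^ m * Mt * B * 4 ^ DIM('a)"
  have "bder UNIV m (A * 20 ^ DIM('a)) (gabor R h)" for R
    unfolding bder_pointwise
  proof
    fix x :: 'a
    have g: "gabor R h = (\<lambda>z. \<Sum>a\<in>lattice_box R. (\<lambda>w. tile w *\<^sub>C Q a R w) (z - a))"
      by (simp add: gabor_def[abs_def] Q_def)
    have "bder {x} m (\<Sum>a\<in>lattice_box R. A * wt (x - a)) (gabor R h)"
      unfolding g
    proof (rule bder_sum[OF finite_lattice_box])
      fix a :: 'a
      have "supp_cube 1 (\<lambda>w. tile w *\<^sub>C Q a R w)" by (simp add: supp_cube_def tile_eq_0 scaleC.zero_left)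
      from bder_supp_wt[OF bder_scaleC[OF Mt bQ] this, of x a]
      show "bder {x} m (A * wt (x - a)) (\<lambda>z. (\<lambda>w. tile w *\<^sub>C Q a R w) (z - a))" by (simp add: A_def)
    qed
    moreover have "(\<Sum>a\<in>lattice_box R. A * wt (x - a)) \<le> A * 20 ^ DIM('a)"
    proof -
      have "wt (x - a) = wt (a + - x)" for a using wt_minus[of "a + - x"] by simp
      then have "(\<Sum>a\<in>lattice_box R. wt (x - a)) \<le> 20 ^ DIM('a)"
        using sum_wt_lattice_shift[OF finite_lattice_box lattice_box_subset, of "- x" R] by simp
      moreover have "0 \<le> A" using bder_nonneg[OF Mt] bder_nonneg[OF bQ] by (simp add: A_def)
      ultimately show ?thesis unfolding sum_distrib_left[symmetric] by (rule mult_left_mono)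
    qed
    ultimately show "bder {x} m (A * 20 ^ DIM('a)) (gabor R h)" by (rule bder_le)
  qed
  then show "\<exists>M. \<forall>R. bder UNIV m M (gabor R h)" by blast
next
  fix x :: 'a
  obtain N :: nat where N: "norm x + 1 \<le> real N" using real_arch_simple by blast
  have in_box: "a \<in> lattice_box N" if "a \<in> lattice" "x - a \<in> cube 1" for a
  proof -
    have "\<bar>a \<bullet> b\<bar> \<le> N" if b: "b \<in> Basis" for b
    proof -
      have "\<bar>x \<bullet> b - a \<bullet> b\<bar> \<le> 1" using \<open>x - a \<in> cube 1\<close> b by (simp add: mem_cube inner_diff_left)
      then show ?thesis using Basis_le_norm[OF b, of x] N by linarith
    qed
    then show ?thesis using that(1) by (simp add: lattice_box_def mem_cube)
  qed
  have xN: "x \<in> cube (real N)" unfolding mem_cube using N by (meson Basis_le_norm add_increasing2 order_trans zero_le_one)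
  define q where "q a R = (\<Sum>k\<in>lattice_box R. pw (quart k) (x - a) *\<^sub>C ((1 / 4 ^ DIM('a)) *\<^sub>C lcoef h a k))" for a R
  have q: "(\<lambda>R. tile (x - a) *\<^sub>C q a R) \<longlonglongrightarrow> tile (x - a) *\<^sub>C h x" for a
  proof (cases "x - a \<in> cube 1")
    case True
    have "(\<lambda>R. \<Sum>k\<in>lattice_box R. pw (quart k) (x - a) *\<^sub>C lcoef h a k) \<longlonglongrightarrow> 4 ^ DIM('a) *\<^sub>R h (a + (x - a))"
      by (rule has_sum_lattice_box[OF lcoef_inversion[OF h True]])
    then have "(\<lambda>R. (1 / 4 ^ DIM('a)) *\<^sub>C (\<Sum>k\<in>lattice_box R. pw (quart k) (x - a) *\<^sub>C lcoef h a k)) \<longlonglongrightarrow>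
        (1 / 4 ^ DIM('a)) *\<^sub>C (4 ^ DIM('a) *\<^sub>R h x)"
      by (intro scaleC.tendsto tendsto_const) simp
    moreover have "(1 / 4 ^ DIM('a)) *\<^sub>C (\<Sum>k\<in>lattice_box R. pw (quart k) (x - a) *\<^sub>C lcoef h a k) = q a R" for R
      unfolding q_def scaleC.sum_right by (simp add: scaleC_scaleC mult.commute)
    moreover have "(1 / 4 ^ DIM('a)) *\<^sub>C (4 ^ DIM('a) *\<^sub>R h x) = h x"
    proof -
      have "4 ^ DIM('a) *\<^sub>R h x = complex_of_real (4 ^ DIM('a)) *\<^sub>C h x" by (simp only: scaleC_of_real)
      then show ?thesis by (simp add: scaleC_scaleC)
    qed
    ultimately show ?thesis by (intro scaleC.tendsto tendsto_const) simp
  next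
    case False
    then show ?thesis by (simp add: tile_eq_0 scaleC.zero_left)
  qed
  \<comment> \<open>Only finitely many tiles reach \<open>x\<close>, so the limit in the frequencies
    can be taken term by term.\<close>
  have "gabor R h x = (\<Sum>a\<in>lattice_box N. tile (x - a) *\<^sub>C q a R)" if "N \<le> R" for R
  proof -
    have "(\<Sum>a\<in>lattice_box R. tile (x - a) *\<^sub>C q a R) = (\<Sum>a\<in>lattice_box N. tile (x - a) *\<^sub>C q a R)"
    proof (rule sum.mono_neutral_right[OF finite_lattice_box lattice_box_mono[OF that]], rule ballI)
      fix a :: 'a assume "a \<in> lattice_box R - lattice_box N"
      then have "x - a \<notin> cube 1" using in_box[of a] by (auto simp: lattice_box_def)
      then show "tile (x - a) *\<^sub>C q a R = 0" by (simp add: tile_eq_0 scaleC.zero_left)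
    qed
    then show ?thesis by (simp add: gabor_def q_def)
  qed
  then have "\<forall>\<^sub>F R in sequentially. (\<Sum>a\<in>lattice_box N. tile (x - a) *\<^sub>C q a R) = gabor R h x"
    by (intro eventually_sequentiallyI[of N]) simp
  moreover have "(\<lambda>R. \<Sum>a\<in>lattice_box N. tile (x - a) *\<^sub>C q a R) \<longlonglongrightarrow> (\<Sum>a\<in>lattice_box N. tile (x - a) *\<^sub>C h x)"
    by (intro tendsto_sum q)
  moreover have "(\<Sum>a\<in>lattice_box N. tile (x - a) *\<^sub>C h x) = h x"
    unfolding scaleC.sum_left[symmetric] sum_tile_lattice_box[OF xN] by simp
  ultimately show "(\<lambda>R. gabor R h x) \<longlonglongrightarrow> h x" using Lim_transform_eventually by fastforce
qed

context linear_map
begin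

text \<open>The product with a single atom of the synthesis has coefficients decaying both in the position
  and in the frequency relative to those of the atom.\<close>

lemma lcoef_tp_atom:
  obtains C where "0 \<le> C"
    "\<And>(f :: 'a \<Rightarrow> 'c::cstar_algebra) M a k l v. \<lbrakk>f \<in> bdd_smooth; bder UNIV (10 * DIM('a)) M f\<rbrakk> \<Longrightarrow>
      norm (lcoef (tp f (\<lambda>x. tile (x - a) *\<^sub>C (pw (quart k) (x - a) *\<^sub>C v))) 0 l) \<le> C * M * norm v * wt a * wt (k - l)"
proof -
  \<comment> \<open>This many derivatives of the product yield one power of \<open>wt\<close> in the
    frequency; with the \<open>8 * DIM('a)\<close> spent by the product estimate they make up the
    order \<open>10 * DIM('a)\<close> asked of \<open>f\<close>.\<close>
  let ?m = "2 * (1 * DIM('a))"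
  obtain C1 where C1: "0 \<le> C1"
    "\<And>(f :: 'a \<Rightarrow> 'c) g M M' a x m. \<lbrakk>f \<in> bdd_smooth; g \<in> bdd_smooth;
      bder UNIV (m + 8 * DIM('a)) M f; bder UNIV (m + 8 * DIM('a)) M' g; \<And>y. y - a \<notin> cube 1 \<Longrightarrow> g y = 0\<rbrakk>
      \<Longrightarrow> bder {x} m (2 ^ m * (C1 * M * M' * wt (a - x))) (tp f g)"
    by (rule tp_bder[where ?'c = 'c and c = 1]) blast
  obtain C2 where C2: "0 \<le> C2"
    "\<And>(F :: 'a \<Rightarrow> 'c) M k. \<lbrakk>F \<in> bdd_smooth; 0 \<le> M; bder (cube 2) (2 * (1 * DIM('a))) M F\<rbrakk>
      \<Longrightarrow> norm (integral UNIV (\<lambda>z. (window z * pw (quart k) z) *\<^sub>C F z)) \<le> C2 * M * wt k ^ 1"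
    by (rule fourier_decay[OF window_bdd_smooth window_supp, where j = 1 and ?'c = 'c]) blast
  obtain Mt where Mt: "bder UNIV (?m + 8 * DIM('a)) Mt (tile :: 'a \<Rightarrow> complex)" by (rule bdd_smoothE[OF tile_bdd_smooth])
  define K where "K = 2 ^ ?m * (C1 * Mt * 10 ^ DIM('a))"
  have K: "0 \<le> K" using C1(1) bder_nonneg[OF Mt] by (simp add: K_def)
  show ?thesis
  proof (rule that[of "C2 * K"])
    show "0 \<le> C2 * K" using C2(1) K by simp
    fix f :: "'a \<Rightarrow> 'c" and M and a k l :: 'a and v :: 'c
    assume f: "f \<in> bdd_smooth" and M: "bder UNIV (10 * DIM('a)) M f"
    note M0 = bder_nonneg[OF M]
    \<comment> \<open>The wave centred at \<open>a\<close> differs from the wave centred at 0 by a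
      constant of modulus 1, which is moved into the coefficient.\<close>
    define v' where "v' = cnj (pw (quart k) a) *\<^sub>C v"
    have nv: "norm v' = norm v" by (simp add: v'_def norm_scaleC)
    define g where "g = (\<lambda>x. tile (x - a) *\<^sub>C v')"
    \<comment> \<open>All that the wave does to the product besides modulating it is to translate
      \<open>f\<close>, under which \<open>M\<close> remains a bound. The estimates of
      \<open>G\<close> below are therefore independent of \<open>k\<close>, and the modulation
      changes the frequency of the coefficient integral to \<open>k - l\<close>.\<close>
    define f' where "f' = (\<lambda>y. f (y - J (quart k)))"
    have g: "g \<in> bdd_smooth"
      unfolding g_def using bdd_smooth_scaleC[OF bdd_smooth_translate[OF tile_bdd_smooth, of "- a"] bdd_smooth_const] by simp
    have f': "f' \<in> bdd_smooth"
      unfolding f'_def using bdd_smooth_translate[OF f, of "- J (quart k)"] by simp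
    have bf: "bder UNIV (?m + 8 * DIM('a)) M f'"
      unfolding f'_def using bder_translate[OF M, of UNIV "- J (quart k)"] by simp
    have bg: "bder UNIV (?m + 8 * DIM('a)) (norm v * Mt) g"
      unfolding g_def using bder_bounded_linear(1)[OF scaleC.bounded_linear_left[of v'] _ _ bder_translate[OF Mt, of UNIV "- a"], of "norm v"]
      by (simp add: norm_scaleC nv mult.commute)
    have sg: "g y = 0" if "y - a \<notin> cube 1" for y using tile_eq_0[OF that] by (simp add: g_def scaleC.zero_left)
    define G where "G = tp f' g"
    have G: "G \<in> bdd_smooth" unfolding G_def by (rule tp_bdd_smooth[OF f' g])
    have bG: "bder (cube 2) ?m (K * M * norm v * wt a) G"
    proof -
      have "bder {x} ?m (K * M * norm v * wt a) G" if x: "x \<in> cube 2" for x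
      proof -
        have "bder {x} ?m (2 ^ ?m * (C1 * M * (norm v * Mt) * wt (a - x))) G"
          unfolding G_def by (rule C1(2)[OF f' g bf bg sg])
        moreover have "2 ^ ?m * (C1 * M * (norm v * Mt) * wt (a - x)) \<le> K * M * norm v * wt a"
        proof -
          have "- x \<in> cube 2" using x by (simp add: mem_cube)
          from wt_shift[OF this, of a] have w: "wt (a - x) \<le> 10 ^ DIM('a) * wt a" by simp
          have "2 ^ ?m * (C1 * M * (norm v * Mt) * wt (a - x)) \<le> 2 ^ ?m * (C1 * M * (norm v * Mt) * (10 ^ DIM('a) * wt a))"
            using C1(1) M0 bder_nonneg[OF Mt] by (intro mult_left_mono w) auto
          then show ?thesis by (simp add: K_def mult_ac)
        qed
        ultimately show ?thesis by (rule bder_le)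
      qed
      moreover have "cube 2 \<noteq> ({} :: 'a set)" using mem_cube[of 0 2] by force
      ultimately show ?thesis using bder_UN[of "cube 2" "\<lambda>x. {x}" ?m "K * M * norm v * wt a" G] by simp
    qed
    have "(\<lambda>x. tile (x - a) *\<^sub>C (pw (quart k) (x - a) *\<^sub>C v)) = (\<lambda>x. pw (quart k) x *\<^sub>C g x)"
      unfolding g_def v'_def pw_diff scaleC_scaleC by (simp only: mult_ac)
    then have t: "tp f (\<lambda>x. tile (x - a) *\<^sub>C (pw (quart k) (x - a) *\<^sub>C v)) = (\<lambda>x. pw (quart k) x *\<^sub>C G x)"
      using tp_pw_right[OF f g, of "quart k"] by (simp add: G_def f'_def)
    have s: "supp_cube 2 (\<lambda>w. (window w * pw (quart (k - l)) w) *\<^sub>C G w)"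
      by (simp add: supp_cube_def window_outside scaleC.zero_left)
    have "lcoef (\<lambda>x. pw (quart k) x *\<^sub>C G x) 0 l = integral (cube 2) (\<lambda>w. (window w * pw (quart (k - l)) w) *\<^sub>C G w)"
    proof -
      have "pw (quart (k - l)) w = pw (quart (- l)) w * pw (quart k) w" for w
        using pw_add(2)[of "quart (- l)" "quart k" w] by (simp add: scaleR_diff_right)
      then show ?thesis unfolding lcoef_eq by (simp add: scaleC_scaleC mult.assoc)
    qed
    also have "\<dots> = integral UNIV (\<lambda>w. (window w * pw (quart (k - l)) w) *\<^sub>C G w)"
      by (rule integral_UNIV_cube[OF s, symmetric])
    also have "norm \<dots> \<le> C2 * (K * M * norm v * wt a) * wt (k - l) ^ 1"
      by (rule C2(2)[OF G _ bG]) (use K M0 in simp)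
    finally show "norm (lcoef (tp f (\<lambda>x. tile (x - a) *\<^sub>C (pw (quart k) (x - a) *\<^sub>C v))) 0 l) \<le>
        C2 * K * M * norm v * wt a * wt (k - l)"
      by (simp add: t mult_ac)
  qed
qed

text \<open>A Schur test for the weights \<open>wt a * wt (k - l)\<close>: the sum over
  \<open>l\<close> costs \<open>20 ^ DIM('a)\<close>, the local coefficients at \<open>a\<close> sum
  to at most \<open>NN h\<close>, and the sum over \<open>a\<close> costs
  \<open>5 ^ DIM('a)\<close>. It is applied to the truncated syntheses; finite sums of coefficients
  then pass to the limit by \<open>gabor_sconv\<close>.\<close>

lemma NN_tp_le:
  obtains C where "0 \<le> C"
    "\<And>(f :: 'a \<Rightarrow> 'c::cstar_algebra) h M. \<lbrakk>f \<in> bdd_smooth; h \<in> bdd_smooth; bder UNIV (10 * DIM('a)) M f\<rbrakk> \<Longrightarrow>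
      NN (tp f h) \<le> C * M * NN h"
proof -
  obtain C where C: "0 \<le> C"
    "\<And>(f :: 'a \<Rightarrow> 'c) M a k l v. \<lbrakk>f \<in> bdd_smooth; bder UNIV (10 * DIM('a)) M f\<rbrakk> \<Longrightarrow>
      norm (lcoef (tp f (\<lambda>x. tile (x - a) *\<^sub>C (pw (quart k) (x - a) *\<^sub>C v))) 0 l) \<le> C * M * norm v * wt a * wt (k - l)"
    by (rule lcoef_tp_atom[where ?'c = 'c]) blast
  define D where "D = C * 20 ^ DIM('a) * 5 ^ DIM('a)"
  have main: "(\<Sum>l\<in>T. norm (lcoef (tp f h) 0 l)) \<le> D * M * NN h"
    if f: "f \<in> bdd_smooth" and h: "h \<in> bdd_smooth" and M: "bder UNIV (10 * DIM('a)) M f"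
      and T: "finite T" "T \<subseteq> lattice" for f h :: "'a \<Rightarrow> 'c" and M T
  proof -
    note M0 = bder_nonneg[OF M]
    define v where "v a k = (1 / 4 ^ DIM('a)) *\<^sub>C lcoef h a k" for a k
    have nv: "norm (v a k) \<le> norm (lcoef h a k)" for a k
      using mult_right_mono[of "cmod (1 / 4 ^ DIM('a))" 1 "norm (lcoef h a k)"]
      by (simp add: v_def norm_scaleC norm_divide norm_power)
    have bd: "(\<Sum>l\<in>T. norm (lcoef (tp f (gabor R h)) 0 l)) \<le> D * M * NN h" for R
    proof -
      define atom where "atom a k = (\<lambda>x. tile (x - a) *\<^sub>C (pw (quart k) (x - a) *\<^sub>C v a k))" for a k
      have atom: "atom a k \<in> bdd_smooth" for a k
        unfolding atom_def
        using bdd_smooth_scaleC[OF bdd_smooth_translate[OF tile_bdd_smooth, of "- a"] bdd_smooth_scaleC[OF bdd_smooth_translate[OF bdd_smooth_pw, of "quart k" "- a"] bdd_smooth_const]]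
        by simp
      have ga: "gabor R h = (\<lambda>x. \<Sum>a\<in>lattice_box R. \<Sum>k\<in>lattice_box R. atom a k x)"
        by (simp add: gabor_def[abs_def] atom_def v_def scaleC.sum_right)
      have l: "lcoef (tp f (gabor R h)) 0 l = (\<Sum>a\<in>lattice_box R. \<Sum>k\<in>lattice_box R. lcoef (tp f (atom a k)) 0 l)" for l
        unfolding ga by (simp add: tp_sum_right lcoef_sum f atom tp_bdd_smooth bdd_smooth_sum)
      have "(\<Sum>l\<in>T. norm (lcoef (tp f (gabor R h)) 0 l)) \<le>
          (\<Sum>l\<in>T. \<Sum>a\<in>lattice_box R. \<Sum>k\<in>lattice_box R. C * M * norm (lcoef h a k) * wt a * wt (k - l))"
      proof (rule sum_mono)
        fix l :: 'a
        have "norm (lcoef (tp f (atom a k)) 0 l) \<le> C * M * norm (lcoef h a k) * wt a * wt (k - l)" for a k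
        proof -
          have "norm (lcoef (tp f (atom a k)) 0 l) \<le> C * M * norm (v a k) * wt a * wt (k - l)"
            unfolding atom_def by (rule C(2)[OF f M])
          also have "\<dots> \<le> C * M * norm (lcoef h a k) * wt a * wt (k - l)"
            using C(1) M0 nv by (intro mult_right_mono mult_left_mono) auto
          finally show ?thesis .
        qed
        then show "norm (lcoef (tp f (gabor R h)) 0 l) \<le> (\<Sum>a\<in>lattice_box R. \<Sum>k\<in>lattice_box R. C * M * norm (lcoef h a k) * wt a * wt (k - l))"
          unfolding l by (intro sum_norm_le) simp
      qed
      also have "\<dots> = (\<Sum>a\<in>lattice_box R. \<Sum>k\<in>lattice_box R. \<Sum>l\<in>T. C * M * norm (lcoef h a k) * wt a * wt (k - l))"
        by (subst sum.swap, rule sum.cong[OF refl], rule sum.swap)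
      also have "\<dots> \<le> (\<Sum>a\<in>lattice_box R. \<Sum>k\<in>lattice_box R. C * M * norm (lcoef h a k) * wt a * 20 ^ DIM('a))"
      proof (intro sum_mono)
        fix a k :: 'a
        have "wt (k - l) = wt (l + - k)" for l using wt_minus[of "l + - k"] by simp
        then have "(\<Sum>l\<in>T. wt (k - l)) \<le> 20 ^ DIM('a)" using sum_wt_lattice_shift[OF T, of "- k"] by simp
        then show "(\<Sum>l\<in>T. C * M * norm (lcoef h a k) * wt a * wt (k - l)) \<le> C * M * norm (lcoef h a k) * wt a * 20 ^ DIM('a)"
          unfolding sum_distrib_left[symmetric] using C(1) M0 by (intro mult_left_mono) auto
      qed
      also have "\<dots> = (\<Sum>a\<in>lattice_box R. C * M * 20 ^ DIM('a) * wt a * (\<Sum>k\<in>lattice_box R. norm (lcoef h a k)))"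
        by (simp add: sum_distrib_left sum_distrib_right mult_ac)
      also have "\<dots> \<le> (\<Sum>a\<in>(lattice_box R :: 'a set). C * M * 20 ^ DIM('a) * wt a * NN h)"
        using C(1) M0 by (intro sum_mono mult_left_mono NN_upper[OF h] finite_lattice_box lattice_box_subset) auto
      also have "\<dots> = C * M * 20 ^ DIM('a) * NN h * (\<Sum>a\<in>(lattice_box R :: 'a set). wt a)"
        by (simp add: sum_distrib_left sum_distrib_right mult_ac)
      also have "\<dots> \<le> C * M * 20 ^ DIM('a) * NN h * 5 ^ DIM('a)"
      proof (rule mult_left_mono)
        show "(\<Sum>a\<in>(lattice_box R :: 'a set). wt a) \<le> 5 ^ DIM('a)"
          by (rule sum_wt_lattice[OF finite_lattice_box lattice_box_subset])
        show "0 \<le> C * M * 20 ^ DIM('a) * NN h" using C(1) M0 NN_nonneg[OF h] by simp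
      qed
      finally show ?thesis by (simp add: D_def mult_ac)
    qed
    have "sconv (\<lambda>R. tp f (gabor R h)) (tp f h)"
      by (rule tp_sconv[OF sconv_const[OF f] gabor_sconv[OF h] f h])
    then have "(\<lambda>R. \<Sum>l\<in>T. norm (lcoef (tp f (gabor R h)) 0 l)) \<longlonglongrightarrow> (\<Sum>l\<in>T. norm (lcoef (tp f h) 0 l))"
      by (intro tendsto_sum tendsto_norm lcoef_tendsto tp_bdd_smooth[OF f h])
    then show ?thesis by (rule LIMSEQ_le_const2) (use bd in blast)
  qed
  show ?thesis
  proof (rule that[of D])
    show "0 \<le> D" using C(1) by (simp add: D_def)
    fix f h :: "'a \<Rightarrow> 'c" and M
    assume f: "f \<in> bdd_smooth" and h: "h \<in> bdd_smooth" and M: "bder UNIV (10 * DIM('a)) M f"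
    have D0: "0 \<le> D * M" using C(1) bder_nonneg[OF M] by (simp add: D_def)
    show "NN (tp f h) \<le> D * M * NN h"
    proof (rule NN_least)
      fix y and T :: "'a set" assume T: "finite T" "T \<subseteq> lattice"
      \<comment> \<open>The product commutes with translations, which reduces coefficients at
        \<open>y\<close> to coefficients at 0.\<close>
      define f' where "f' = (\<lambda>x. f (x + y))"
      define h' where "h' = (\<lambda>x. h (x + y))"
      have b: "f' \<in> bdd_smooth" "h' \<in> bdd_smooth" "bder UNIV (10 * DIM('a)) M f'"
        unfolding f'_def h'_def using bdd_smooth_translate f h bder_translate[OF M] by auto
      have "lcoef (tp f h) y l = lcoef (tp f' h') 0 l" for l
        by (simp add: lcoef_def f'_def h'_def tp_translate add.commute)
      then have "(\<Sum>l\<in>T. norm (lcoef (tp f h) y l)) \<le> D * M * NN h'"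
        using main[OF b T] by simp
      also have "NN h' \<le> NN h"
      proof (rule NN_least)
        fix z and S :: "'a set" assume "finite S" "S \<subseteq> lattice"
        moreover have "lcoef h' z l = lcoef h (z + y) l" for l by (simp add: lcoef_def h'_def add_ac)
        ultimately show "(\<Sum>k\<in>S. norm (lcoef h' z k)) \<le> NN h" using NN_upper[OF h] by simp
      qed
      then have "D * M * NN h' \<le> D * M * NN h" by (rule mult_left_mono[OF _ D0])
      finally show "(\<Sum>l\<in>T. norm (lcoef (tp f h) y l)) \<le> D * M * NN h" .
    qed
  qed
qed

end

section \<open>Submultiplicative star-seminorms\<close>

context skew_map
begin

text \<open>The operator norm of left multiplication, enlarged by \<open>NN f\<close>: without a
  unit, the products with test functions \<open>h\<close> need not recover the size of
  \<open>f\<close>. Submultiplicativity survives, because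
  \<open>NN (tp f g) \<le> opn f * NN g\<close> and \<open>NN g \<le> opn g\<close>.\<close>

definition opn :: "('a \<Rightarrow> 'c::cstar_algebra) \<Rightarrow> real"
  where "opn f = Sup (insert (NN f) {NN (tp f h) | h. h \<in> bdd_smooth \<and> NN h \<le> 1})"

lemma NN_tp_ex:
  fixes f :: "'a \<Rightarrow> 'c::cstar_algebra"
  assumes f: "f \<in> bdd_smooth"
  obtains B where "0 \<le> B" "\<And>h :: 'a \<Rightarrow> 'c. h \<in> bdd_smooth \<Longrightarrow> NN (tp f h) \<le> B * NN h"
proof -
  obtain C where C: "0 \<le> C"
    "\<And>(f :: 'a \<Rightarrow> 'c) h M. \<lbrakk>f \<in> bdd_smooth; h \<in> bdd_smooth; bder UNIV (10 * DIM('a)) M f\<rbrakk> \<Longrightarrow>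
      NN (tp f h) \<le> C * M * NN h"
    by (rule NN_tp_le[where ?'c = 'c]) blast
  obtain M where M: "bder UNIV (10 * DIM('a)) M f" using f by (rule bdd_smoothE)
  show ?thesis
    by (rule that[of "C * M"]) (use C f M bder_nonneg[OF M] in auto)
qed

lemma opn_bdd_above:
  fixes f :: "'a \<Rightarrow> 'c::cstar_algebra"
  assumes f: "f \<in> bdd_smooth"
  shows "bdd_above (insert (NN f) {NN (tp f h) | h. h \<in> bdd_smooth \<and> NN h \<le> 1})"
proof -
  obtain B where B: "0 \<le> B" "\<And>h :: 'a \<Rightarrow> 'c. h \<in> bdd_smooth \<Longrightarrow> NN (tp f h) \<le> B * NN h"
    by (rule NN_tp_ex[OF f]) blast
  have "NN (tp f h) \<le> B" if "h \<in> bdd_smooth" "NN h \<le> 1" for h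
    using B(2)[OF that(1)] mult_left_mono[OF that(2) B(1)] by simp
  then show ?thesis by (intro bdd_aboveI[of _ "max (NN f) B"]) (auto simp: le_max_iff_disj)
qed

lemma NN_le_opn: "f \<in> bdd_smooth \<Longrightarrow> NN f \<le> opn f"
  unfolding opn_def by (rule cSup_upper[OF _ opn_bdd_above]) auto

lemma opn_least:
  fixes f :: "'a \<Rightarrow> 'c::cstar_algebra"
  assumes "NN f \<le> B" "\<And>h :: 'a \<Rightarrow> 'c. h \<in> bdd_smooth \<Longrightarrow> NN h \<le> 1 \<Longrightarrow> NN (tp f h) \<le> B"
  shows "opn f \<le> B"
  unfolding opn_def by (rule cSup_least) (use assms in auto)

lemma NN_scaleC:
  fixes f :: "'a \<Rightarrow> 'c::cstar_algebra"
  assumes "f \<in> bdd_smooth"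
  shows "NN (\<lambda>x. c *\<^sub>C f x) = cmod c * NN f"
proof (cases "c = 0")
  case True
  have "NN (\<lambda>x. 0 *\<^sub>C f x) \<le> 0" using NN_scaleC_le[OF assms, of 0] by simp
  moreover have "0 \<le> NN (\<lambda>x. 0 *\<^sub>C f x)"
    using NN_nonneg[OF bdd_smooth_const[of 0]] by (simp add: scaleC.zero_left)
  ultimately show ?thesis using True by simp
next
  case False
  have s: "(\<lambda>x. c *\<^sub>C f x) \<in> bdd_smooth"
    by (rule bdd_smooth_bounded_linear[OF scaleC.bounded_linear_right assms])
  have "NN (\<lambda>x. (1 / c) *\<^sub>C (c *\<^sub>C f x)) \<le> cmod (1 / c) * NN (\<lambda>x. c *\<^sub>C f x)"
    by (rule NN_scaleC_le[OF s])
  then have "cmod c * NN f \<le> NN (\<lambda>x. c *\<^sub>C f x)"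
    using False by (simp add: scaleC_scaleC norm_divide field_simps)
  then show ?thesis using NN_scaleC_le[OF assms, of c] by simp
qed

lemma NN_tp_le_opn:
  fixes f h :: "'a \<Rightarrow> 'c::cstar_algebra"
  assumes f: "f \<in> bdd_smooth" and h: "h \<in> bdd_smooth"
  shows "NN (tp f h) \<le> opn f * NN h"
\<comment> \<open>Scaling to the unit ball is impossible only here, and then \<open>h\<close>
  vanishes since \<open>NN\<close> dominates the supremum norm.\<close>
proof (cases "NN h = 0")
  case True
  have "h x = 0" for x using norm_le_NN[OF h, of x] True by simp
  then have "h = (\<lambda>_. 0)" by (rule ext)
  then show ?thesis using True by (simp add: tp_zero)
next
  case False
  then have p: "0 < NN h" using NN_nonneg[OF h] by simp
  define c where "c = complex_of_real (1 / NN h)"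
  have c: "cmod c = 1 / NN h" using p by (simp add: c_def norm_divide)
  have ch: "(\<lambda>x. c *\<^sub>C h x) \<in> bdd_smooth"
    by (rule bdd_smooth_bounded_linear[OF scaleC.bounded_linear_right h])
  have "NN (\<lambda>x. c *\<^sub>C h x) \<le> 1" using p by (simp add: NN_scaleC[OF h] c)
  then have "NN (tp f (\<lambda>x. c *\<^sub>C h x)) \<le> opn f"
    unfolding opn_def by (intro cSup_upper[OF _ opn_bdd_above[OF f]]) (use ch in blast)
  then have "(1 / NN h) * NN (tp f h) \<le> opn f"
    using NN_scaleC[OF tp_bdd_smooth[OF f h], of c] by (simp add: tp_scaleC_right[OF f h] c)
  then show ?thesis using p by (simp add: field_simps)
qed

lemma opn_nonneg: "f \<in> bdd_smooth \<Longrightarrow> 0 \<le> opn f"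
  using NN_nonneg NN_le_opn order_trans by blast

lemma opn_tp:
  fixes f g :: "'a \<Rightarrow> 'c::cstar_algebra"
  assumes f: "f \<in> bdd_smooth" and g: "g \<in> bdd_smooth"
  shows "opn (tp f g) \<le> opn f * opn g"
proof (rule opn_least)
  have "NN (tp f g) \<le> opn f * NN g" by (rule NN_tp_le_opn[OF f g])
  also have "\<dots> \<le> opn f * opn g" by (intro mult_left_mono NN_le_opn g opn_nonneg f)
  finally show "NN (tp f g) \<le> opn f * opn g" .
  fix h :: "'a \<Rightarrow> 'c" assume h: "h \<in> bdd_smooth" "NN h \<le> 1"
  have "NN (tp (tp f g) h) = NN (tp f (tp g h))" using tp_assoc[OF f g h(1)] by simp
  also have "\<dots> \<le> opn f * NN (tp g h)" by (rule NN_tp_le_opn[OF f tp_bdd_smooth[OF g h(1)]])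
  also have "NN (tp g h) \<le> opn g * NN h" by (rule NN_tp_le_opn[OF g h(1)])
  also have "opn g * NN h \<le> opn g * 1" by (intro mult_left_mono h opn_nonneg g)
  finally show "NN (tp (tp f g) h) \<le> opn f * opn g" using opn_nonneg[OF f] by (simp add: mult_left_mono)
qed

lemma opn_add:
  fixes f g :: "'a \<Rightarrow> 'c::cstar_algebra"
  assumes f: "f \<in> bdd_smooth" and g: "g \<in> bdd_smooth"
  shows "opn (\<lambda>x. f x + g x) \<le> opn f + opn g"
proof (rule opn_least)
  show "NN (\<lambda>x. f x + g x) \<le> opn f + opn g"
    using NN_add[OF f g] NN_le_opn[OF f] NN_le_opn[OF g] by linarith
  fix h :: "'a \<Rightarrow> 'c" assume h: "h \<in> bdd_smooth" "NN h \<le> 1"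
  have 1: "NN (tp f h) \<le> opn f" "NN (tp g h) \<le> opn g"
    unfolding opn_def by (intro cSup_upper[OF _ opn_bdd_above[OF f]] cSup_upper[OF _ opn_bdd_above[OF g]]; use h in blast)+
  have "NN (tp (\<lambda>x. f x + g x) h) = NN (\<lambda>x. tp f h x + tp g h x)"
    by (simp add: tp_add_left[OF f g h(1)])
  also have "\<dots> \<le> NN (tp f h) + NN (tp g h)"
    by (rule NN_add[OF tp_bdd_smooth[OF f h(1)] tp_bdd_smooth[OF g h(1)]])
  finally show "NN (tp (\<lambda>x. f x + g x) h) \<le> opn f + opn g" using 1 by linarith
qed

lemma opn_scaleC_le:
  fixes f :: "'a \<Rightarrow> 'c::cstar_algebra"
  assumes f: "f \<in> bdd_smooth"
  shows "opn (\<lambda>x. c *\<^sub>C f x) \<le> cmod c * opn f"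
proof (rule opn_least)
  show "NN (\<lambda>x. c *\<^sub>C f x) \<le> cmod c * opn f"
    unfolding NN_scaleC[OF f] by (intro mult_left_mono NN_le_opn f) simp
  fix h :: "'a \<Rightarrow> 'c" assume h: "h \<in> bdd_smooth" "NN h \<le> 1"
  have "NN (tp (\<lambda>x. c *\<^sub>C f x) h) = cmod c * NN (tp f h)"
    by (simp add: tp_scaleC_left[OF f h(1)] NN_scaleC[OF tp_bdd_smooth[OF f h(1)]])
  also have "NN (tp f h) \<le> opn f"
    unfolding opn_def by (rule cSup_upper[OF _ opn_bdd_above[OF f]]) (use h in blast)
  finally show "NN (tp (\<lambda>x. c *\<^sub>C f x) h) \<le> cmod c * opn f" by (simp add: mult_left_mono)
qed

text \<open>What remains of the construction only uses the following package of properties, which is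
  inherited by \<open>p f + (\<Sum>b\<in>Basis. p (pd b f))\<close> because partial derivatives are derivations.\<close>

definition good :: "(('a \<Rightarrow> 'c::cstar_algebra) \<Rightarrow> real) \<Rightarrow> bool"
  where "good p \<longleftrightarrow>
    (\<forall>f\<in>bdd_smooth. 0 \<le> p f) \<and>
    (\<forall>f\<in>bdd_smooth. \<forall>g\<in>bdd_smooth. p (\<lambda>x. f x + g x) \<le> p f + p g) \<and>
    (\<forall>c. \<forall>f\<in>bdd_smooth. p (\<lambda>x. c *\<^sub>C f x) \<le> cmod c * p f) \<and>
    (\<forall>f\<in>bdd_smooth. \<forall>g\<in>bdd_smooth. p (tp f g) \<le> p f * p g) \<and>
    (\<forall>f\<in>bdd_smooth. p (\<lambda>x. star (f x)) = p f)"

definition opn_star :: "('a \<Rightarrow> 'c::cstar_algebra) \<Rightarrow> real"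
  where "opn_star f = max (opn f) (opn (\<lambda>x. star (f x)))"

lemma good_opn_star: "good (opn_star :: ('a \<Rightarrow> 'c::cstar_algebra) \<Rightarrow> real)"
  unfolding good_def
proof (intro conjI ballI allI)
  fix f g :: "'a \<Rightarrow> 'c" and c
  assume f: "f \<in> bdd_smooth"
  note sf = bdd_smooth_star[OF f]
  show "0 \<le> opn_star f" using opn_nonneg[OF f] by (simp add: opn_star_def)
  show "opn_star (\<lambda>x. c *\<^sub>C f x) \<le> cmod c * opn_star f"
    using opn_scaleC_le[OF f, of c] opn_scaleC_le[OF sf, of "cnj c"]
      mult_left_mono[of "opn f" "opn_star f" "cmod c"] mult_left_mono[of "opn (\<lambda>x. star (f x))" "opn_star f" "cmod c"]
    by (simp add: opn_star_def star_scaleC)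
  show "opn_star (\<lambda>x. star (f x)) = opn_star f" by (simp add: opn_star_def star_star max.commute)
  assume g: "g \<in> bdd_smooth"
  note sg = bdd_smooth_star[OF g]
  have m: "opn f \<le> opn_star f" "opn (\<lambda>x. star (f x)) \<le> opn_star f" "opn g \<le> opn_star g" "opn (\<lambda>x. star (g x)) \<le> opn_star g"
    by (simp_all add: opn_star_def)
  have "opn (\<lambda>x. f x + g x) \<le> opn_star f + opn_star g" using opn_add[OF f g] m by linarith
  moreover have "opn (\<lambda>x. star (f x) + star (g x)) \<le> opn_star f + opn_star g"
    using opn_add[OF sf sg] m by linarith
  ultimately show "opn_star (\<lambda>x. f x + g x) \<le> opn_star f + opn_star g"
    unfolding opn_star_def[of "\<lambda>x. f x + g x"] star_add by simp
  have "opn (tp f g) \<le> opn_star f * opn_star g"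
    using opn_tp[OF f g] mult_mono[OF m(1,3)] opn_nonneg[OF f] opn_nonneg[OF g] m by fastforce
  \<comment> \<open>The involution reverses the product, so the factors appear in the opposite
    order; their real bounds commute.\<close>
  moreover have "opn (\<lambda>x. star (tp f g x)) \<le> opn_star f * opn_star g"
    using opn_tp[OF sg sf] mult_mono[OF m(4,2)] opn_nonneg[OF sf] opn_nonneg[OF sg] m
    unfolding star_tp[OF f g] by (fastforce simp: mult.commute)
  ultimately show "opn_star (tp f g) \<le> opn_star f * opn_star g" by (simp add: opn_star_def)
qed

definition dseminorm :: "(('a \<Rightarrow> 'c::cstar_algebra) \<Rightarrow> real) \<Rightarrow> ('a \<Rightarrow> 'c) \<Rightarrow> real"
  where "dseminorm p f = p f + (\<Sum>b\<in>Basis. p (pd b f))"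

lemma pd_bdd_smooth_add:
  "f \<in> bdd_smooth \<Longrightarrow> g \<in> bdd_smooth \<Longrightarrow> pd b (\<lambda>x. f x + g x) = (\<lambda>x. pd b f x + pd b g x)"
  using pd_add[OF bdd_smooth_differentiable bdd_smooth_differentiable] by (intro ext)

lemma pd_bdd_smooth_scaleC:
  "f \<in> bdd_smooth \<Longrightarrow> pd b (\<lambda>x. c *\<^sub>C f x) = (\<lambda>x. c *\<^sub>C pd b f x)"
  by (erule bdd_smoothE[of f 0]) (rule pd_scaleC_const)

lemma pd_bdd_smooth_star:
  fixes f :: "'a \<Rightarrow> 'c::cstar_algebra"
  assumes "f \<in> bdd_smooth"
  shows "pd b (\<lambda>x. star (f x)) = (\<lambda>x. star (pd b f x))"
proof -
  obtain M where M: "bder UNIV 0 M f" using assms by (rule bdd_smoothE)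
  show ?thesis by (rule bder_bounded_linear(2)[OF bounded_linear_star, of 1, OF _ _ M]) simp_all
qed

lemma good_dseminorm:
  fixes p :: "('a \<Rightarrow> 'c::cstar_algebra) \<Rightarrow> real"
  assumes "good p" shows "good (dseminorm p)"
proof -
  have p0: "\<And>f. f \<in> bdd_smooth \<Longrightarrow> 0 \<le> p f"
    and pa: "\<And>f g. f \<in> bdd_smooth \<Longrightarrow> g \<in> bdd_smooth \<Longrightarrow> p (\<lambda>x. f x + g x) \<le> p f + p g"
    and pc: "\<And>c f. f \<in> bdd_smooth \<Longrightarrow> p (\<lambda>x. c *\<^sub>C f x) \<le> cmod c * p f"
    and pm: "\<And>f g. f \<in> bdd_smooth \<Longrightarrow> g \<in> bdd_smooth \<Longrightarrow> p (tp f g) \<le> p f * p g"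
    and ps: "\<And>f. f \<in> bdd_smooth \<Longrightarrow> p (\<lambda>x. star (f x)) = p f"
    using assms unfolding good_def by blast+
  note d = bdd_smooth_pd
  show ?thesis unfolding good_def
  proof (intro conjI ballI allI)
    fix f g :: "'a \<Rightarrow> 'c" and c
    assume f: "f \<in> bdd_smooth"
    show "0 \<le> dseminorm p f"
      unfolding dseminorm_def by (intro add_nonneg_nonneg sum_nonneg p0 f d)
    have "(\<Sum>b\<in>Basis. p (pd b (\<lambda>x. c *\<^sub>C f x))) \<le> (\<Sum>b\<in>Basis. cmod c * p (pd b f))"
      unfolding pd_bdd_smooth_scaleC[OF f] by (intro sum_mono pc d f)
    then show "dseminorm p (\<lambda>x. c *\<^sub>C f x) \<le> cmod c * dseminorm p f"
      using pc[OF f, of c] by (simp add: dseminorm_def distrib_left sum_distrib_left)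
    show "dseminorm p (\<lambda>x. star (f x)) = dseminorm p f"
      unfolding dseminorm_def pd_bdd_smooth_star[OF f] using ps[OF f] ps[OF d[OF f]] by simp
    assume g: "g \<in> bdd_smooth"
    have "(\<Sum>b\<in>Basis. p (pd b (\<lambda>x. f x + g x))) \<le> (\<Sum>b\<in>Basis. p (pd b f) + p (pd b g))"
      unfolding pd_bdd_smooth_add[OF f g] by (intro sum_mono pa d f g)
    then show "dseminorm p (\<lambda>x. f x + g x) \<le> dseminorm p f + dseminorm p g"
      using pa[OF f g] by (simp add: dseminorm_def sum.distrib)
    have "p (pd b (tp f g)) \<le> p (pd b f) * p g + p f * p (pd b g)" if b: "b \<in> Basis" for b
    proof -
      have "p (pd b (tp f g)) \<le> p (tp (pd b f) g) + p (tp f (pd b g))"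
        unfolding pd_tp[OF f g b] by (rule pa[OF tp_bdd_smooth[OF d[OF f b] g] tp_bdd_smooth[OF f d[OF g b]]])
      then show ?thesis using pm[OF d[OF f b] g] pm[OF f d[OF g b]] by linarith
    qed
    then have "(\<Sum>b\<in>Basis. p (pd b (tp f g))) \<le> (\<Sum>b\<in>Basis. p (pd b f) * p g + p f * p (pd b g))"
      by (rule sum_mono)
    also have "\<dots> = (\<Sum>b\<in>Basis. p (pd b f)) * p g + p f * (\<Sum>b\<in>Basis. p (pd b g))"
      by (simp add: sum.distrib sum_distrib_left sum_distrib_right)
    finally have "dseminorm p (tp f g) \<le> p f * p g + ((\<Sum>b\<in>Basis. p (pd b f)) * p g + p f * (\<Sum>b\<in>Basis. p (pd b g)))"
      using pm[OF f g] by (simp add: dseminorm_def)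
    moreover have "0 \<le> (\<Sum>b\<in>Basis. p (pd b f)) * (\<Sum>b\<in>Basis. p (pd b g))"
      by (intro mult_nonneg_nonneg sum_nonneg p0 d f g)
    ultimately show "dseminorm p (tp f g) \<le> dseminorm p f * dseminorm p g"
      by (simp add: dseminorm_def algebra_simps)
  qed
qed

text \<open>Expanded, \<open>amnorm m f\<close> is a sum of the values of \<open>opn_star\<close> on
  the partial derivatives of \<open>f\<close> up to order \<open>m\<close>, with binomial
  coefficients as multiplicities. In iterated form it inherits its properties one step at a
  time.\<close>

definition amnorm :: "nat \<Rightarrow> ('a \<Rightarrow> 'c::cstar_algebra) \<Rightarrow> real"
  where "amnorm m = (dseminorm ^^ m) opn_star"

lemma amnorm_Suc: "amnorm (Suc m) f = amnorm m f + (\<Sum>b\<in>Basis. amnorm m (pd b f))"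
  by (simp add: amnorm_def dseminorm_def)

lemma good_amnorm: "good (amnorm m :: ('a \<Rightarrow> 'c::cstar_algebra) \<Rightarrow> real)"
  unfolding amnorm_def by (induction m) (simp_all add: good_opn_star good_dseminorm)

lemma good_scaleC:
  fixes p :: "('a \<Rightarrow> 'c::cstar_algebra) \<Rightarrow> real"
  assumes p: "good p" and f: "f \<in> bdd_smooth"
  shows "p (\<lambda>x. c *\<^sub>C f x) = cmod c * p f"
proof -
  have pc: "p (\<lambda>x. c *\<^sub>C f x) \<le> cmod c * p f" if "f \<in> bdd_smooth" for c f
    using p that unfolding good_def by blast
  have p0: "0 \<le> p f" if "f \<in> bdd_smooth" for f using p that unfolding good_def by blast
  have s: "(\<lambda>x. c *\<^sub>C f x) \<in> bdd_smooth"
    by (rule bdd_smooth_bounded_linear[OF scaleC.bounded_linear_right f])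
  show ?thesis
  proof (cases "c = 0")
    case True
    then show ?thesis using pc[OF f, of c] p0[OF s] by simp
  next
    case False
    have "p (\<lambda>x. (1 / c) *\<^sub>C (c *\<^sub>C f x)) \<le> cmod (1 / c) * p (\<lambda>x. c *\<^sub>C f x)" by (rule pc[OF s])
    then have "cmod c * p f \<le> p (\<lambda>x. c *\<^sub>C f x)"
      using False by (simp add: scaleC_scaleC norm_divide field_simps)
    then show ?thesis using pc[OF f, of c] by simp
  qed
qed

text \<open>\<open>opn_star\<close> dominates the supremum norm through \<open>NN\<close>, and every
  application of \<open>dseminorm\<close> adds control of one more order.\<close>

lemma amnorm_ge:
  fixes f :: "'a \<Rightarrow> 'c::cstar_algebra"
  assumes f: "f \<in> bdd_smooth"
  shows "bder UNIV m (amnorm m f) f"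
  using f
proof (induction m arbitrary: f)
  case 0
  have "norm (f x) \<le> amnorm 0 f" for x
    using norm_le_NN[OF 0, of x] NN_le_opn[OF 0] by (simp add: amnorm_def opn_star_def)
  then show ?case using bdd_smooth_differentiable[OF 0] by simp
next
  case (Suc m)
  have nn: "0 \<le> amnorm m g" if "g \<in> bdd_smooth" for g :: "'a \<Rightarrow> 'c"
    using good_amnorm[of m] that unfolding good_def by blast
  have le: "amnorm m (pd b f) \<le> (\<Sum>b\<in>Basis. amnorm m (pd b f))" if "b \<in> Basis" for b
    using that by (intro member_le_sum nn bdd_smooth_pd Suc.prems) auto
  show ?case
  proof (rule bder_SucI)
    show "f differentiable at x" for x by (rule bdd_smooth_differentiable[OF Suc.prems])
    have "0 \<le> (\<Sum>b\<in>Basis. amnorm m (pd b f))" by (intro sum_nonneg nn bdd_smooth_pd Suc.prems)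
    then show "norm (f x) \<le> amnorm (Suc m) f" for x
      using bder_bound[OF Suc.IH[OF Suc.prems], of x] by (simp add: amnorm_Suc)
    show "bder UNIV m (amnorm (Suc m) f) (pd b f)" if b: "b \<in> Basis" for b
      by (rule bder_le[OF Suc.IH[OF bdd_smooth_pd[OF Suc.prems b]]])
        (use le[OF b] nn[OF Suc.prems] in \<open>simp add: amnorm_Suc\<close>)
  qed
qed

text \<open>The loss of \<open>10 * DIM('a)\<close> derivatives occurs in the base case only, where
  left multiplication is bounded by \<open>NN_tp_le\<close>; it does not grow with
  \<open>m\<close>.\<close>

lemma amnorm_le:
  obtains C where "0 \<le> C" "\<And>(f :: 'a \<Rightarrow> 'c::cstar_algebra) M. \<lbrakk>f \<in> bdd_smooth; bder UNIV (m + 10 * DIM('a)) M f\<rbrakk>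
    \<Longrightarrow> amnorm m f \<le> C * M"
proof -
  have "\<exists>C\<ge>0. \<forall>(f :: 'a \<Rightarrow> 'c) M. f \<in> bdd_smooth \<and> bder UNIV (m + 10 * DIM('a)) M f \<longrightarrow> amnorm m f \<le> C * M"
  proof (induction m)
    case 0
    obtain C1 where C1: "0 \<le> C1" "\<And>(f :: 'a \<Rightarrow> 'c) h M. \<lbrakk>f \<in> bdd_smooth; h \<in> bdd_smooth; bder UNIV (10 * DIM('a)) M f\<rbrakk> \<Longrightarrow>
      NN (tp f h) \<le> C1 * M * NN h"
      by (rule NN_tp_le[where ?'c = 'c]) blast
    obtain C2 where C2: "0 \<le> C2" "\<And>(h :: 'a \<Rightarrow> 'c) M. \<lbrakk>h \<in> bdd_smooth; bder UNIV (2 * DIM('a)) M h\<rbrakk> \<Longrightarrow> NN h \<le> C2 * M"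
      by (rule NN_bound[where ?'a = 'a and ?'c = 'c]) blast
    have o: "opn f \<le> (C1 + C2) * M" if f: "f \<in> bdd_smooth" and M: "bder UNIV (10 * DIM('a)) M f" for f :: "'a \<Rightarrow> 'c" and M
    proof (rule opn_least)
      note M0 = bder_nonneg[OF M]
      have "NN f \<le> C2 * M" using C2(2)[OF f bder_less[OF M]] by simp
      then show "NN f \<le> (C1 + C2) * M" using mult_nonneg_nonneg[OF C1(1) M0] by (simp add: distrib_right)
      fix h :: "'a \<Rightarrow> 'c" assume h: "h \<in> bdd_smooth" "NN h \<le> 1"
      have "NN (tp f h) \<le> C1 * M * NN h" by (rule C1(2)[OF f h(1) M])
      also have "\<dots> \<le> C1 * M * 1" by (rule mult_left_mono[OF h(2)]) (simp add: C1(1) M0)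
      finally show "NN (tp f h) \<le> (C1 + C2) * M" using mult_nonneg_nonneg[OF C2(1) M0] by (simp add: distrib_right)
    qed
    have "amnorm 0 f \<le> (C1 + C2) * M" if "f \<in> bdd_smooth" "bder UNIV (10 * DIM('a)) M f" for f :: "'a \<Rightarrow> 'c" and M
      using o[OF that] o[OF bdd_smooth_star[OF that(1)] bder_star[OF that(2)]] by (simp add: amnorm_def opn_star_def)
    then show ?case using C1(1) C2(1) by (intro exI[of _ "C1 + C2"]) simp
  next
    case (Suc m)
    then obtain C where C: "0 \<le> C" "\<And>(f :: 'a \<Rightarrow> 'c) M. f \<in> bdd_smooth \<Longrightarrow> bder UNIV (m + 10 * DIM('a)) M f \<Longrightarrow> amnorm m f \<le> C * M"
      by blast
    have "amnorm (Suc m) f \<le> (C + real DIM('a) * C) * M"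
      if f: "f \<in> bdd_smooth" and M: "bder UNIV (Suc m + 10 * DIM('a)) M f" for f :: "'a \<Rightarrow> 'c" and M
    proof -
      have "amnorm m f \<le> C * M" by (rule C(2)[OF f bder_less[OF M]]) simp
      moreover have "(\<Sum>b\<in>Basis. amnorm m (pd b f)) \<le> (\<Sum>b\<in>(Basis::'a set). C * M)"
        using M by (intro sum_mono C(2) bdd_smooth_pd f) auto
      ultimately show ?thesis by (simp add: amnorm_Suc algebra_simps)
    qed
    then show ?case using C(1) by (intro exI[of _ "C + real DIM('a) * C"]) simp
  qed
  then show ?thesis using that by blast
qed

end

section \<open>The topology of the space of bounded smooth functions\<close>

text \<open>Increasing sequences of seminorms in the abstract, so that the given Frechet norms and
  the submultiplicative ones are treated alike and can be compared.\<close>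

definition grading :: "(nat \<Rightarrow> ('a::euclidean_space \<Rightarrow> 'c::cstar_algebra) \<Rightarrow> real) \<Rightarrow> bool"
  where "grading p \<longleftrightarrow>
    (\<forall>m. \<forall>f\<in>bdd_smooth. 0 \<le> p m f \<and> p m f \<le> p (Suc m) f) \<and>
    (\<forall>m. \<forall>f\<in>bdd_smooth. \<forall>g\<in>bdd_smooth. p m (\<lambda>x. f x + g x) \<le> p m f + p m g) \<and>
    (\<forall>m c. \<forall>f\<in>bdd_smooth. p m (\<lambda>x. c *\<^sub>C f x) \<le> cmod c * p m f)"

abbreviation fn_topology :: "(nat \<Rightarrow> ('a::euclidean_space \<Rightarrow> 'c::cstar_algebra) \<Rightarrow> real) \<Rightarrow> ('a \<Rightarrow> 'c) topology"
  where "fn_topology p \<equiv>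
    seminorm_topology bdd_smooth (\<lambda>f g x. f x + g x) (\<lambda>c f x. c *\<^sub>C f x) (range p)"

definition fball :: "(nat \<Rightarrow> ('a::euclidean_space \<Rightarrow> 'c::cstar_algebra) \<Rightarrow> real) \<Rightarrow> nat \<Rightarrow> ('a \<Rightarrow> 'c) \<Rightarrow> real \<Rightarrow> ('a \<Rightarrow> 'c) set"
  where "fball p m f e = {g \<in> bdd_smooth. p m (\<lambda>x. g x - f x) < e}"

context
  fixes p :: "nat \<Rightarrow> ('a::euclidean_space \<Rightarrow> 'c::cstar_algebra) \<Rightarrow> real"
  assumes p: "grading p"
begin

lemma grading_nonneg: "f \<in> bdd_smooth \<Longrightarrow> 0 \<le> p m f"
  and grading_add: "f \<in> bdd_smooth \<Longrightarrow> g \<in> bdd_smooth \<Longrightarrow> p m (\<lambda>x. f x + g x) \<le> p m f + p m g"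
  and grading_scaleC: "f \<in> bdd_smooth \<Longrightarrow> p m (\<lambda>x. c *\<^sub>C f x) \<le> cmod c * p m f"
  using p unfolding grading_def by blast+

lemma grading_mono: "f \<in> bdd_smooth \<Longrightarrow> m \<le> n \<Longrightarrow> p m f \<le> p n f"
  using lift_Suc_mono_le[of "\<lambda>m. p m f" m n] p unfolding grading_def by blast

lemma grading_zero: "p m (\<lambda>x. 0) = 0"
  using grading_scaleC[OF bdd_smooth_const, of m 0 0] grading_nonneg[OF bdd_smooth_const, of m 0]
  by (simp add: scaleC.zero_right)

lemma grading_diff_commute:
  assumes "f \<in> bdd_smooth" "g \<in> bdd_smooth"
  shows "p m (\<lambda>x. f x - g x) = p m (\<lambda>x. g x - f x)"
  using grading_scaleC[OF bdd_smooth_diff[OF assms], of m "-1"]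
    grading_scaleC[OF bdd_smooth_diff[OF assms(2,1)], of m "-1"]
  by (simp add: scaleC_uminus_one)

lemma grading_diff_triangle:
  assumes "f \<in> bdd_smooth" "g \<in> bdd_smooth" "h \<in> bdd_smooth"
  shows "p m (\<lambda>x. f x - h x) \<le> p m (\<lambda>x. f x - g x) + p m (\<lambda>x. g x - h x)"
  using grading_add[OF bdd_smooth_diff[OF assms(1,2)] bdd_smooth_diff[OF assms(2,3)], of m] by simp

lemma fball_subset: "fball p m f e \<subseteq> bdd_smooth"
  by (auto simp: fball_def)

lemma fball_mono: "f \<in> bdd_smooth \<Longrightarrow> m \<le> n \<Longrightarrow> e \<le> d \<Longrightarrow> fball p n f e \<subseteq> fball p m f d"
  unfolding fball_def
  by (auto intro: le_less_trans[OF grading_mono[OF bdd_smooth_diff[of _ f]]] less_le_trans)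

lemma centre_in_fball: "f \<in> bdd_smooth \<Longrightarrow> 0 < e \<Longrightarrow> f \<in> fball p m f e"
  by (simp add: fball_def grading_zero)

lemma fball_in_fball:
  assumes f: "f \<in> bdd_smooth" and g: "g \<in> fball p m f e"
  obtains d where "0 < d" "fball p m g d \<subseteq> fball p m f e"
proof
  have gs: "g \<in> bdd_smooth" using g by (simp add: fball_def)
  show "0 < e - p m (\<lambda>x. g x - f x)" using g by (simp add: fball_def)
  show "fball p m g (e - p m (\<lambda>x. g x - f x)) \<subseteq> fball p m f e"
    using grading_diff_triangle[OF _ gs f, of _ m] by (fastforce simp: fball_def)
qed

text \<open>Since the seminorms increase, the intersection of two balls around \<open>f\<close>
  contains the ball with the larger index and the smaller radius; the subbasis of the definition
  thus gives a neighbourhood basis of single balls.\<close>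

lemma openin_fn_topology:
  "openin (fn_topology p) U \<longleftrightarrow> U \<subseteq> bdd_smooth \<and> (\<forall>f\<in>U. \<exists>m. \<exists>e>0. fball p m f e \<subseteq> U)"
proof -
  define S where "S = insert bdd_smooth {fball p m f e | m f e. f \<in> bdd_smooth \<and> 0 < e}"
  have T: "fn_topology p = topology_generated_by S"
    unfolding seminorm_topology_def S_def fball_def scaleC_uminus_one add_uminus_conv_diff
    by (intro arg_cong[where f = topology_generated_by] arg_cong[where f = "insert bdd_smooth"] Collect_cong) blast
  show ?thesis unfolding T openin_topology_generated_by_iff
  proof safe
    assume "generate_topology_on S U"
    then have "U \<subseteq> bdd_smooth \<and> (\<forall>f\<in>U. \<exists>m. \<exists>e>0. fball p m f e \<subseteq> U)"
    proof induction
      case (Int U V)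
      have "\<exists>m. \<exists>e>0. fball p m f e \<subseteq> U \<inter> V" if f: "f \<in> U" "f \<in> V" for f
      proof -
        obtain m d where 1: "0 < d" "fball p m f d \<subseteq> U" using Int.IH(1) f by blast
        obtain n e where 2: "0 < e" "fball p n f e \<subseteq> V" using Int.IH(2) f by blast
        have fs: "f \<in> bdd_smooth" using Int.IH(1) f by blast
        have "fball p (max m n) f (min d e) \<subseteq> U \<inter> V"
          using 1(2) 2(2) fball_mono[OF fs, of m "max m n" "min d e" d]
            fball_mono[OF fs, of n "max m n" "min d e" e] by auto
        then show ?thesis using 1(1) 2(1) by (intro exI[of _ "max m n"] exI[of _ "min d e"]) simp
      qed
      then show ?case using Int.IH by blast
    next
      case (UN K)
      then show ?case by (meson Union_iff Union_least Union_upper subset_trans)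
    next
      case (Basis U)
      then consider "U = bdd_smooth" | m f e where "f \<in> bdd_smooth" "U = fball p m f e" unfolding S_def by blast
      then show ?case
      proof cases
        case 1
        then show ?thesis using fball_subset by (auto intro!: exI[of _ "1::real"])
      next
        case 2
        have "\<exists>m. \<exists>d>0. fball p m g d \<subseteq> U" if "g \<in> U" for g
          using fball_in_fball[OF 2(1), of g m e] that 2(2) by metis
        then show ?thesis using 2 fball_subset by blast
      qed
    qed simp
    then show "\<And>f. f \<in> U \<Longrightarrow> f \<in> bdd_smooth" "\<And>f. f \<in> U \<Longrightarrow> \<exists>m. \<exists>e>0. fball p m f e \<subseteq> U" by blast+
  next
    assume U: "U \<subseteq> bdd_smooth" and "\<forall>f\<in>U. \<exists>m. \<exists>e>0. fball p m f e \<subseteq> U"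
    then obtain m e where me: "\<And>f. f \<in> U \<Longrightarrow> 0 < e f \<and> fball p (m f) f (e f) \<subseteq> U" by metis
    have "f \<in> fball p (m f) f (e f)" if "f \<in> U" for f
      using centre_in_fball U me that by blast
    then have "U = \<Union>((\<lambda>f. fball p (m f) f (e f)) ` U)" using me by blast
    moreover have "generate_topology_on S (\<Union>((\<lambda>f. fball p (m f) f (e f)) ` U))"
    proof (rule generate_topology_on.UN)
      fix k assume "k \<in> (\<lambda>f. fball p (m f) f (e f)) ` U"
      then show "generate_topology_on S k"
        using me U unfolding S_def by (intro generate_topology_on.Basis) blast
    qed
    ultimately show "generate_topology_on S U" by simp
  qed
qed

lemma openin_fball: "f \<in> bdd_smooth \<Longrightarrow> openin (fn_topology p) (fball p m f e)"
  unfolding openin_fn_topology using fball_in_fball fball_subset by metis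

lemma topspace_fn_topology: "topspace (fn_topology p) = bdd_smooth"
proof
  show "topspace (fn_topology p) \<subseteq> bdd_smooth" using openin_fn_topology openin_topspace by metis
  have "openin (fn_topology p) bdd_smooth"
    unfolding openin_fn_topology using fball_subset by (auto intro!: exI[of _ "1::real"])
  then show "bdd_smooth \<subseteq> topspace (fn_topology p)" by (rule openin_subset)
qed

lemma continuous_map_fn_topology:
  assumes h: "\<And>x. x \<in> topspace X \<Longrightarrow> h x \<in> bdd_smooth"
    and loc: "\<And>x m e. x \<in> topspace X \<Longrightarrow> 0 < e \<Longrightarrow>
      \<exists>W. openin X W \<and> x \<in> W \<and> (\<forall>y\<in>W. p m (\<lambda>t. h y t - h x t) < e)"
  shows "continuous_map X (fn_topology p) h"
  unfolding continuous_map_def topspace_fn_topology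
proof (intro conjI allI impI)
  show "h \<in> topspace X \<rightarrow> bdd_smooth" using h by blast
  fix U assume U: "openin (fn_topology p) U"
  show "openin X {x \<in> topspace X. h x \<in> U}"
    unfolding openin_subopen[of X "{x \<in> topspace X. h x \<in> U}"]
  proof
    fix x assume "x \<in> {x \<in> topspace X. h x \<in> U}"
    then have x: "x \<in> topspace X" "h x \<in> U" by auto
    obtain m e where e: "0 < e" "fball p m (h x) e \<subseteq> U" using U x(2) unfolding openin_fn_topology by blast
    obtain W where W: "openin X W" "x \<in> W" "\<And>y. y \<in> W \<Longrightarrow> p m (\<lambda>t. h y t - h x t) < e"
      using loc[OF x(1) e(1), of m] by blast
    have "W \<subseteq> {x \<in> topspace X. h x \<in> U}"
    proof
      fix y assume y: "y \<in> W"
      then have ys: "y \<in> topspace X" using openin_subset[OF W(1)] by blast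
      have "h y \<in> fball p m (h x) e" using W(3)[OF y] h[OF ys] by (simp add: fball_def)
      then show "y \<in> {x \<in> topspace X. h x \<in> U}" using e(2) ys by blast
    qed
    then show "\<exists>T. openin X T \<and> x \<in> T \<and> T \<subseteq> {x \<in> topspace X. h x \<in> U}" using W by blast
  qed
qed

lemma continuous_map_fn_topology_prod:
  assumes h: "\<And>f g. f \<in> bdd_smooth \<Longrightarrow> g \<in> bdd_smooth \<Longrightarrow> h f g \<in> bdd_smooth"
    and loc: "\<And>f g m e. \<lbrakk>f \<in> bdd_smooth; g \<in> bdd_smooth; 0 < e\<rbrakk> \<Longrightarrow> \<exists>k. \<exists>d>0. \<forall>f'\<in>bdd_smooth. \<forall>g'\<in>bdd_smooth.
      p k (\<lambda>t. f' t - f t) < d \<longrightarrow> p k (\<lambda>t. g' t - g t) < d \<longrightarrow> p m (\<lambda>t. h f' g' t - h f g t) < e"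
  shows "continuous_map (prod_topology (fn_topology p) (fn_topology p)) (fn_topology p) (\<lambda>(f, g). h f g)"
proof (rule continuous_map_fn_topology)
  fix x :: "('a \<Rightarrow> 'c) \<times> ('a \<Rightarrow> 'c)" and m and e :: real
  assume x: "x \<in> topspace (prod_topology (fn_topology p) (fn_topology p))"
  then show "(case x of (f, g) \<Rightarrow> h f g) \<in> bdd_smooth" using h by (auto simp: topspace_fn_topology)
  assume e: "0 < e"
  obtain f g where fg: "x = (f, g)" "f \<in> bdd_smooth" "g \<in> bdd_smooth" using x by (auto simp: topspace_fn_topology)
  obtain k d where d: "0 < d" "\<And>f' g'. \<lbrakk>f'\<in>bdd_smooth; g'\<in>bdd_smooth;
      p k (\<lambda>t. f' t - f t) < d; p k (\<lambda>t. g' t - g t) < d\<rbrakk> \<Longrightarrow> p m (\<lambda>t. h f' g' t - h f g t) < e"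
    using loc[OF fg(2,3) e, of m] by blast
  show "\<exists>W. openin (prod_topology (fn_topology p) (fn_topology p)) W \<and> x \<in> W \<and>
      (\<forall>y\<in>W. p m (\<lambda>t. (case y of (f, g) \<Rightarrow> h f g) t - (case x of (f, g) \<Rightarrow> h f g) t) < e)"
    by (rule exI[of _ "fball p k f d \<times> fball p k g d"])
      (use d fg in \<open>auto simp: openin_prod_Times_iff openin_fball centre_in_fball\<close>, auto simp: fball_def d)
qed

lemma continuous_map_fn_topology_scaleC:
  "continuous_map (prod_topology euclidean (fn_topology p)) (fn_topology p) (\<lambda>(c, f) x. c *\<^sub>C f x)"
proof (rule continuous_map_fn_topology)
  fix x :: "complex \<times> ('a \<Rightarrow> 'c)" and m and e :: real
  assume x: "x \<in> topspace (prod_topology euclidean (fn_topology p))"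
  then show "(case x of (c, f) \<Rightarrow> \<lambda>x. c *\<^sub>C f x) \<in> bdd_smooth"
    by (auto simp: topspace_fn_topology intro: bdd_smooth_bounded_linear[OF scaleC.bounded_linear_right])
  assume e: "0 < e"
  obtain c f where fg: "x = (c, f)" and f: "f \<in> bdd_smooth" using x by (auto simp: topspace_fn_topology)
  \<comment> \<open>The splitting \<open>c' f' - c f = c' (f' - f) + (c' - c) f\<close>, with
    \<open>cmod c' \<le> cmod c + 1\<close>, bounds the difference by \<open>d * s\<close>.\<close>
  define s where "s = cmod c + 1 + p m f"
  define d where "d = min 1 (e / (s + 1))"
  have s: "0 < s + 1" using grading_nonneg[OF f, of m] norm_ge_zero[of c] unfolding s_def by linarith
  have d: "0 < d" "d \<le> 1" "d * s < e"
  proof -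
    show "0 < d" "d \<le> 1" using s e by (simp_all add: d_def)
    have "d \<le> e / (s + 1)" by (simp add: d_def)
    then have "d * (s + 1) \<le> e" using s by (simp add: field_simps)
    then show "d * s < e" using \<open>0 < d\<close> by (simp add: distrib_left)
  qed
  have "p m (\<lambda>t. c' *\<^sub>C f' t - c *\<^sub>C f t) < e" if c': "dist c c' < d" and f': "f' \<in> fball p m f d" for c' f'
  proof -
    have f's: "f' \<in> bdd_smooth" and fd: "p m (\<lambda>t. f' t - f t) < d" using f' by (simp_all add: fball_def)
    note ds = bdd_smooth_diff[OF f's f]
    have sm: "(\<lambda>x. z *\<^sub>C g x) \<in> bdd_smooth" if "g \<in> bdd_smooth" for z and g :: "'a \<Rightarrow> 'c"
      using that by (rule bdd_smooth_bounded_linear[OF scaleC.bounded_linear_right])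
    have eq: "(\<lambda>t. c' *\<^sub>C f' t - c *\<^sub>C f t) = (\<lambda>t. c' *\<^sub>C (f' t - f t) + (c' - c) *\<^sub>C f t)"
      by (simp add: scaleC.diff_left scaleC.diff_right)
    have cc: "cmod (c' - c) < d" using c' by (simp add: dist_norm norm_minus_commute)
    have cn: "cmod c' \<le> cmod c + 1" using norm_triangle_sub[of c' c] cc d(2) by linarith
    have "p m (\<lambda>t. c' *\<^sub>C f' t - c *\<^sub>C f t) \<le> cmod c' * p m (\<lambda>t. f' t - f t) + cmod (c' - c) * p m f"
      unfolding eq using grading_add[OF sm[OF ds, of c'] sm[OF f, of "c' - c"], of m]
        grading_scaleC[OF ds, of m c'] grading_scaleC[OF f, of m "c' - c"] by linarith
    also have "cmod c' * p m (\<lambda>t. f' t - f t) \<le> (cmod c + 1) * d"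
      using fd by (intro mult_mono cn) (auto intro: grading_nonneg ds)
    also have "cmod (c' - c) * p m f \<le> d * p m f"
      using cc by (intro mult_right_mono grading_nonneg f) simp
    finally show ?thesis using d(3) by (simp add: s_def algebra_simps)
  qed
  then show "\<exists>W. openin (prod_topology euclidean (fn_topology p)) W \<and> x \<in> W \<and>
      (\<forall>y\<in>W. p m (\<lambda>t. (case y of (c, f) \<Rightarrow> \<lambda>x. c *\<^sub>C f x) t - (case x of (c, f) \<Rightarrow> \<lambda>x. c *\<^sub>C f x) t) < e)"
    by (intro exI[of _ "ball c d \<times> fball p m f d"])
      (use d(1) f fg in \<open>auto simp: openin_prod_Times_iff openin_fball centre_in_fball\<close>)
qed

text \<open>The metric is a supremum of seminorms truncated at \<open>1 / (m + 1)\<close>. For a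
  given radius the truncation disposes of all but finitely many of them, and monotonicity controls
  those by the last one.\<close>

lemma metrizable_fn_topology:
  assumes sep: "\<And>f. f \<in> bdd_smooth \<Longrightarrow> (\<And>m. p m f = 0) \<Longrightarrow> f = (\<lambda>x. 0)"
  shows "metrizable_space (fn_topology p)"
proof -
  define D where "D f g = (SUP m. min (p m (\<lambda>x. f x - g x)) (1 / (real m + 1)))" for f g
  have ba: "bdd_above (range (\<lambda>m. min (p m (\<lambda>x. f x - g x)) (1 / (real m + 1))))" for f g
    by (rule bdd_aboveI[of _ 1]) (auto simp: min_le_iff_disj)
  have up: "min (p m (\<lambda>x. f x - g x)) (1 / (real m + 1)) \<le> D f g" for m f g
    unfolding D_def by (rule cSUP_upper[OF _ ba]) simp
  have D0: "0 \<le> D f g" if "f \<in> bdd_smooth" "g \<in> bdd_smooth" for f g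
    using order_trans[OF _ up[of 0 f g], of 0] grading_nonneg[OF bdd_smooth_diff[OF that], of 0] by simp
  \<comment> \<open>Nonnegativity and symmetry are demanded of arbitrary arguments, hence the value
    0 off the carrier.\<close>
  interpret Metric_space bdd_smooth "\<lambda>f g. if f \<in> bdd_smooth \<and> g \<in> bdd_smooth then D f g else 0"
  proof
    fix f g h :: "'a \<Rightarrow> 'c"
    show "0 \<le> (if f \<in> bdd_smooth \<and> g \<in> bdd_smooth then D f g else 0)" using D0 by simp
    show "(if f \<in> bdd_smooth \<and> g \<in> bdd_smooth then D f g else 0) = (if g \<in> bdd_smooth \<and> f \<in> bdd_smooth then D g f else 0)"
      using grading_diff_commute[of f g] by (simp add: D_def)
    assume f: "f \<in> bdd_smooth" and g: "g \<in> bdd_smooth"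
    have "f = g" if "D f g = 0"
    proof -
      have "p m (\<lambda>x. f x - g x) = 0" for m
        using up[of m f g] that grading_nonneg[OF bdd_smooth_diff[OF f g], of m]
        by (simp add: min_le_iff_disj field_simps)
      from sep[OF bdd_smooth_diff[OF f g] this] have "f x - g x = 0" for x by meson
      then show ?thesis by auto
    qed
    moreover have "D f f = 0" by (simp add: D_def grading_zero)
    ultimately show "(if f \<in> bdd_smooth \<and> g \<in> bdd_smooth then D f g else 0) = 0 \<longleftrightarrow> f = g"
      using f g by auto
    assume h: "h \<in> bdd_smooth"
    have "D f h \<le> D f g + D g h"
      unfolding D_def[of f h]
    proof (rule cSUP_least)
      fix m
      define c where "c = 1 / (real m + 1)"
      have c: "0 \<le> c" by (simp add: c_def)
      show "min (p m (\<lambda>x. f x - h x)) (1 / (real m + 1)) \<le> D f g + D g h"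
        using c grading_diff_triangle[OF f g h, of m] up[of m f g] up[of m g h]
          grading_nonneg[OF bdd_smooth_diff[OF f g], of m] grading_nonneg[OF bdd_smooth_diff[OF g h], of m]
        unfolding c_def[symmetric] by (auto simp: min_def split: if_splits)
    qed simp
    then show "(if f \<in> bdd_smooth \<and> h \<in> bdd_smooth then D f h else 0) \<le>
        (if f \<in> bdd_smooth \<and> g \<in> bdd_smooth then D f g else 0) + (if g \<in> bdd_smooth \<and> h \<in> bdd_smooth then D g h else 0)"
      using f g h by simp
  qed
  have "\<exists>m. \<exists>e>0. fball p m f e \<subseteq> mball f r" if f: "f \<in> bdd_smooth" and r: "0 < r" for f r
  proof -
    obtain m where m: "1 / (real m + 1) < r / 2" using reals_Archimedean[of "r / 2"] r
      by (auto simp: inverse_eq_divide add.commute)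
    have "D f g \<le> r / 2" if "g \<in> fball p m f (r / 2)" for g
      unfolding D_def
    proof (rule cSUP_least)
      fix k
      have g: "g \<in> bdd_smooth" "p m (\<lambda>x. f x - g x) < r / 2"
        using that grading_diff_commute[OF f, of g m] by (auto simp: fball_def)
      show "min (p k (\<lambda>x. f x - g x)) (1 / (real k + 1)) \<le> r / 2"
      proof (cases "k \<le> m")
        case True
        then show ?thesis using grading_mono[OF bdd_smooth_diff[OF f g(1)] True] g(2) by simp
      next
        case False
        then have "1 / (real k + 1) \<le> 1 / (real m + 1)" by (intro divide_left_mono) auto
        then show ?thesis using m by simp
      qed
    qed simp
    then have "fball p m f (r / 2) \<subseteq> mball f r"
      using r f by (force simp: mball_def fball_def)
    then show ?thesis using r by (intro exI[of _ m] exI[of _ "r / 2"]) simp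
  qed
  moreover have "\<exists>r>0. mball f r \<subseteq> fball p m f e" if f: "f \<in> bdd_smooth" and e: "0 < e" for f m e
  proof (intro exI conjI)
    show "0 < min e (1 / (real m + 1))" using e by simp
    show "mball f (min e (1 / (real m + 1))) \<subseteq> fball p m f e"
    proof
      fix g assume "g \<in> mball f (min e (1 / (real m + 1)))"
      then have g: "g \<in> bdd_smooth" "D f g < min e (1 / (real m + 1))" using f by (auto simp: mball_def)
      then have "p m (\<lambda>x. f x - g x) < e" using up[of m f g] by linarith
      then show "g \<in> fball p m f e" using g(1) grading_diff_commute[OF f g(1)] by (simp add: fball_def)
    qed
  qed
  ultimately have "openin (fn_topology p) U \<longleftrightarrow> openin mtopology U" for U
    unfolding openin_fn_topology openin_mtopology by (meson subset_iff subset_trans)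
  then have "fn_topology p = mtopology" by (simp add: topology_eq)
  then show ?thesis by (simp add: metrizable_space_mtopology)
qed

end

lemma fn_topology_cong:
  assumes p: "grading p" and q: "grading q"
    and pq: "\<And>m. \<exists>k C. 0 < C \<and> (\<forall>f\<in>bdd_smooth. p m f \<le> C * q k f)"
    and qp: "\<And>m. \<exists>k C. 0 < C \<and> (\<forall>f\<in>bdd_smooth. q m f \<le> C * p k f)"
  shows "fn_topology p = fn_topology q"
proof -
  have "\<exists>k. \<exists>d>0. fball q k f d \<subseteq> fball p m f e"
    if pq: "\<And>m. \<exists>k C. 0 < C \<and> (\<forall>f\<in>bdd_smooth. p m f \<le> C * q k f)" and f: "f \<in> bdd_smooth" and e: "0 < e"
    for p q :: "nat \<Rightarrow> ('a \<Rightarrow> 'b) \<Rightarrow> real" and m f and e :: real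
  proof -
    obtain k C where C: "0 < C" "\<And>f. f \<in> bdd_smooth \<Longrightarrow> p m f \<le> C * q k f" using pq[of m] by blast
    have "g \<in> fball p m f e" if g: "g \<in> fball q k f (e / C)" for g
    proof -
      have gs: "g \<in> bdd_smooth" using g by (simp add: fball_def)
      have "p m (\<lambda>x. g x - f x) \<le> C * q k (\<lambda>x. g x - f x)" by (rule C(2)[OF bdd_smooth_diff[OF gs f]])
      also have "\<dots> < e" using g C(1) by (simp add: fball_def field_simps)
      finally show ?thesis using gs by (simp add: fball_def)
    qed
    then show ?thesis using e C(1) by (intro exI[of _ k] exI[of _ "e / C"]) auto
  qed
  from this[of p q, OF pq] this[of q p, OF qp]
  show ?thesis unfolding topology_eq openin_fn_topology[OF p] openin_fn_topology[OF q]
    by (meson subset_iff subset_trans)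
qed

lemma grading_bdd_smooth_norm: "grading (bdd_smooth_norm :: nat \<Rightarrow> ('a::euclidean_space \<Rightarrow> 'c::cstar_algebra) \<Rightarrow> real)"
  unfolding grading_def
proof (intro conjI allI ballI)
  fix m c and f g :: "'a \<Rightarrow> 'c"
  assume f: "f \<in> bdd_smooth"
  have b: "bder UNIV m (bdd_smooth_norm m h) h" if "h \<in> bdd_smooth" for m and h :: "'a \<Rightarrow> 'c"
    using bder_bdd_smooth_norm[OF that, of m "bdd_smooth_norm m h"] by simp
  show "0 \<le> bdd_smooth_norm m f" by (rule bder_nonneg[OF b[OF f]])
  show "bdd_smooth_norm m f \<le> bdd_smooth_norm (Suc m) f"
    using bder_less[OF b[OF f, of "Suc m"], of m] by (simp add: bder_bdd_smooth_norm[OF f])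
  show "bdd_smooth_norm m (\<lambda>x. c *\<^sub>C f x) \<le> cmod c * bdd_smooth_norm m f"
    using bder_scaleC_const[OF b[OF f], of m c]
    by (simp add: bder_bdd_smooth_norm[OF bdd_smooth_bounded_linear[OF scaleC.bounded_linear_right f]])
  assume g: "g \<in> bdd_smooth"
  show "bdd_smooth_norm m (\<lambda>x. f x + g x) \<le> bdd_smooth_norm m f + bdd_smooth_norm m g"
    using bder_add[OF b[OF f] b[OF g], of m] by (simp add: bder_bdd_smooth_norm[OF bdd_smooth_add[OF f g]])
qed

section \<open>Completeness\<close>

lemma pd_diff:
  assumes "\<And>x. f differentiable at x" "\<And>x. g differentiable at x"
  shows "pd b (\<lambda>x. f x - g x) = (\<lambda>x. pd b f x - pd b g x)"
proof
  fix x
  have "((\<lambda>x. f x - g x) has_derivative (\<lambda>h. frechet_derivative f (at x) h - frechet_derivative g (at x) h)) (at x)"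
    by (intro has_derivative_diff frechet_derivative_works[THEN iffD1] assms)
  from pd_eqI[OF this] show "pd b (\<lambda>x. f x - g x) x = pd b f x - pd b g x" by (simp add: pd_def)
qed

text \<open>Derivatives of the limit are the limits of the derivatives, by uniform convergence of the
  latter.\<close>

lemma bdd_smooth_limit:
  fixes s :: "nat \<Rightarrow> 'a::euclidean_space \<Rightarrow> 'b::banach"
  assumes s: "\<And>k. s k \<in> bdd_smooth"
    and cauchy: "\<forall>m. \<forall>e>0. \<exists>N. \<forall>k\<ge>N. \<forall>l\<ge>N. bder UNIV m e (\<lambda>x. s k x - s l x)"
  shows "(\<lambda>k. s k x) \<longlonglongrightarrow> lim (\<lambda>k. s k x)"
    and "(\<lambda>x. lim (\<lambda>k. s k x)) differentiable at x"
    and "b \<in> Basis \<Longrightarrow> pd b (\<lambda>x. lim (\<lambda>k. s k x)) x = lim (\<lambda>k. pd b (s k) x)"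
proof -
  have pdd: "pd b (\<lambda>x. s k x - s l x) = (\<lambda>x. pd b (s k) x - pd b (s l) x)" for b k l
    by (rule pd_diff) (rule bdd_smooth_differentiable[OF s])+
  have conv: "(\<lambda>k. s k x) \<longlonglongrightarrow> lim (\<lambda>k. s k x)" if s: "\<And>e. 0 < e \<Longrightarrow> \<exists>N. \<forall>k\<ge>N. \<forall>l\<ge>N. \<forall>x. norm (s k x - s l x) \<le> e"
    for s :: "nat \<Rightarrow> 'a \<Rightarrow> 'b" and x
  proof -
    have "Cauchy (\<lambda>k. s k x)"
    proof (rule metric_CauchyI)
      fix e :: real assume "0 < e"
      then obtain N where N: "\<And>k l x. N \<le> k \<Longrightarrow> N \<le> l \<Longrightarrow> norm (s k x - s l x) \<le> e / 2"
        using s[of "e / 2"] half_gt_zero by blast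
      have "dist (s k x) (s l x) < e" if "N \<le> k" "N \<le> l" for k l
        using N[OF that, of x] \<open>0 < e\<close> by (simp add: dist_norm)
      then show "\<exists>N. \<forall>k\<ge>N. \<forall>l\<ge>N. dist (s k x) (s l x) < e" by blast
    qed
    then show ?thesis by (simp add: Cauchy_convergent_iff convergent_LIMSEQ_iff)
  qed
  have c0: "\<exists>N. \<forall>k\<ge>N. \<forall>l\<ge>N. \<forall>x. norm (s k x - s l x) \<le> e" if "0 < e" for e
  proof -
    obtain N where "\<forall>k\<ge>N. \<forall>l\<ge>N. bder UNIV 0 e (\<lambda>x. s k x - s l x)" using cauchy \<open>0 < e\<close> by blast
    then show ?thesis by (intro exI[of _ N]) simp
  qed
  have c1: "\<exists>N. \<forall>k\<ge>N. \<forall>l\<ge>N. \<forall>x. norm (pd b (s k) x - pd b (s l) x) \<le> e" if "0 < e" "b \<in> Basis" for e b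
  proof -
    obtain N where "\<forall>k\<ge>N. \<forall>l\<ge>N. bder UNIV (Suc 0) e (\<lambda>x. s k x - s l x)" using cauchy \<open>0 < e\<close> by blast
    then show ?thesis using that(2) by (intro exI[of _ N]) (simp add: pdd)
  qed
  show lim0: "(\<lambda>k. s k x) \<longlonglongrightarrow> lim (\<lambda>k. s k x)" for x by (rule conv[OF c0])
  have lim1: "(\<lambda>k. pd b (s k) x) \<longlonglongrightarrow> lim (\<lambda>k. pd b (s k) x)" if "b \<in> Basis" for b x
    by (rule conv[OF c1[OF _ that]])
  have "\<exists>g. \<forall>x\<in>UNIV. (\<lambda>k. s k x) \<longlonglongrightarrow> g x \<and>
      (g has_derivative (\<lambda>h. \<Sum>b\<in>Basis. (h \<bullet> b) *\<^sub>R lim (\<lambda>k. pd b (s k) x))) (at x within UNIV)"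
  proof (rule has_derivative_sequence[where f' = "\<lambda>k x h. \<Sum>b\<in>Basis. (h \<bullet> b) *\<^sub>R pd b (s k) x"])
    show "(s k has_derivative (\<lambda>h. \<Sum>b\<in>Basis. (h \<bullet> b) *\<^sub>R pd b (s k) x)) (at x within UNIV)" for k x
      by (rule bdd_smoothE[OF s, where m = 0]) (erule bder_has_derivative[THEN has_derivative_at_withinI])
    fix e :: real assume e: "0 < e"
    define d where "d = e / DIM('a)"
    have d: "0 < d" using e by (simp add: d_def)
    have "\<forall>\<^sub>F k in sequentially. \<forall>x. norm (pd b (s k) x - lim (\<lambda>k. pd b (s k) x)) \<le> d" if b: "b \<in> Basis" for b
    proof -
      obtain N where N: "\<And>k l x. N \<le> k \<Longrightarrow> N \<le> l \<Longrightarrow> norm (pd b (s k) x - pd b (s l) x) \<le> d"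
        using c1[OF d b] by blast
      have "norm (pd b (s k) x - lim (\<lambda>k. pd b (s k) x)) \<le> d" if "N \<le> k" for k x
        by (rule LIMSEQ_le_const2[OF tendsto_norm[OF tendsto_diff[OF tendsto_const lim1[OF b]]]]) (use N that in blast)
      then show ?thesis unfolding eventually_sequentially by blast
    qed
    then have "\<forall>\<^sub>F k in sequentially. \<forall>b\<in>Basis. \<forall>x. norm (pd b (s k) x - lim (\<lambda>k. pd b (s k) x)) \<le> d"
      by (intro eventually_ball_finite) auto
    then show "\<forall>\<^sub>F k in sequentially. \<forall>x\<in>UNIV. \<forall>h. norm ((\<Sum>b\<in>Basis. (h \<bullet> b) *\<^sub>R pd b (s k) x) -
        (\<Sum>b\<in>Basis. (h \<bullet> b) *\<^sub>R lim (\<lambda>k. pd b (s k) x))) \<le> e * norm h"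
    proof (rule eventually_mono, intro ballI allI)
      fix k x h assume *: "\<forall>b\<in>Basis. \<forall>x. norm (pd b (s k) x - lim (\<lambda>k. pd b (s k) x)) \<le> d"
      have "norm (\<Sum>b\<in>Basis. (h \<bullet> b) *\<^sub>R (pd b (s k) x - lim (\<lambda>k. pd b (s k) x))) \<le> of_nat DIM('a) * (norm h * d)"
      proof (rule sum_norm_bound)
        fix b :: 'a assume b: "b \<in> Basis"
        show "norm ((h \<bullet> b) *\<^sub>R (pd b (s k) x - lim (\<lambda>k. pd b (s k) x))) \<le> norm h * d"
          unfolding norm_scaleR using * b by (intro mult_mono) (auto simp: Basis_le_norm)
      qed
      also have "\<dots> = e * norm h" by (simp add: d_def)
      finally show "norm ((\<Sum>b\<in>Basis. (h \<bullet> b) *\<^sub>R pd b (s k) x) -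
        (\<Sum>b\<in>Basis. (h \<bullet> b) *\<^sub>R lim (\<lambda>k. pd b (s k) x))) \<le> e * norm h"
        by (simp add: scaleR_diff_right sum_subtractf)
    qed
  qed (use lim0[of 0] in auto)
  then obtain g where g: "\<And>x. (\<lambda>k. s k x) \<longlonglongrightarrow> g x"
      "\<And>x. (g has_derivative (\<lambda>h. \<Sum>b\<in>Basis. (h \<bullet> b) *\<^sub>R lim (\<lambda>k. pd b (s k) x))) (at x)" by auto
  have "g = (\<lambda>x. lim (\<lambda>k. s k x))" by (rule ext) (simp add: limI[OF g(1)])
  then have D: "((\<lambda>x. lim (\<lambda>k. s k x)) has_derivative (\<lambda>h. \<Sum>b\<in>Basis. (h \<bullet> b) *\<^sub>R lim (\<lambda>k. pd b (s k) x))) (at x)"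
    using g(2) by simp
  show "(\<lambda>x. lim (\<lambda>k. s k x)) differentiable at x" using D by (rule differentiableI)
  show "pd b (\<lambda>x. lim (\<lambda>k. s k x)) x = lim (\<lambda>k. pd b (s k) x)" if "b \<in> Basis"
    unfolding pd_eqI[OF D] using that by (simp add: inner_Basis if_distrib if_distribR cong: if_cong)
qed

lemma bdd_smooth_complete:
  fixes s :: "nat \<Rightarrow> 'a::euclidean_space \<Rightarrow> 'b::banach"
  assumes s: "\<And>k. s k \<in> bdd_smooth"
    and cauchy: "\<forall>m. \<forall>e>0. \<exists>N. \<forall>k\<ge>N. \<forall>l\<ge>N. bder UNIV m e (\<lambda>x. s k x - s l x)"
  obtains g where "g \<in> bdd_smooth" "\<And>m e. 0 < e \<Longrightarrow> \<exists>N. \<forall>k\<ge>N. bder UNIV m e (\<lambda>x. s k x - g x)"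
proof -
  \<comment> \<open>Stated for every sequence, because the induction passes to
    \<open>pd b (s k)\<close>; the Cauchy condition of order \<open>n\<close> for the derivatives is
    the one of order \<open>Suc n\<close> for \<open>s\<close>. The index \<open>N\<close> does not
    change, since non-strict bounds survive the limit.\<close>
  have bd: "bder UNIV m e (\<lambda>x. s k x - lim (\<lambda>l. s l x))"
    if "\<And>k. s k \<in> bdd_smooth" "\<forall>m. \<forall>e>0. \<exists>N. \<forall>k\<ge>N. \<forall>l\<ge>N. bder UNIV m e (\<lambda>x. s k x - s l x)"
      "\<And>l. N \<le> l \<Longrightarrow> bder UNIV m e (\<lambda>x. s k x - s l x)" for m e N k and s :: "nat \<Rightarrow> 'a \<Rightarrow> 'b"
    using that
  proof (induction m arbitrary: s)
    case (0 s)
    note L = bdd_smooth_limit[of s, OF 0(1,2)]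
    have "norm (s k x - lim (\<lambda>l. s l x)) \<le> e" for x
      by (rule LIMSEQ_le_const2[OF tendsto_norm[OF tendsto_diff[OF tendsto_const L(1)]]])
        (use bder_bound[OF 0(3)] in \<open>auto intro!: exI[of _ N]\<close>)
    then show ?case using L(2) bdd_smooth_differentiable[OF 0(1)] by simp
  next
    case (Suc m s)
    note L = bdd_smooth_limit[of s, OF Suc.prems(1,2)]
    note pdd = pd_diff[OF bdd_smooth_differentiable[OF Suc.prems(1)]]
    note pd1 = pdd[OF bdd_smooth_differentiable[OF Suc.prems(1)]]
    show ?case
    proof (rule bder_SucI)
      show "(\<lambda>x. s k x - lim (\<lambda>l. s l x)) differentiable at x" for x
        by (rule differentiable_diff[OF bdd_smooth_differentiable[OF Suc.prems(1)] L(2)])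
      show "norm (s k x - lim (\<lambda>l. s l x)) \<le> e" for x
        by (rule LIMSEQ_le_const2[OF tendsto_norm[OF tendsto_diff[OF tendsto_const L(1)]]])
          (use bder_bound[OF Suc.prems(3)] in \<open>auto intro!: exI[of _ N]\<close>)
      fix b :: 'a assume b: "b \<in> Basis"
      have "pd b (\<lambda>x. s k x - lim (\<lambda>l. s l x)) = (\<lambda>x. pd b (s k) x - lim (\<lambda>l. pd b (s l) x))"
        unfolding pdd[OF L(2)] L(3)[OF b] ..
      moreover have "bder UNIV m e (\<lambda>x. pd b (s k) x - lim (\<lambda>l. pd b (s l) x))"
      proof (rule Suc.IH)
        show "pd b (s k) \<in> bdd_smooth" for k by (rule bdd_smooth_pd[OF Suc.prems(1) b])
        show "\<forall>n. \<forall>d>0. \<exists>N. \<forall>k\<ge>N. \<forall>l\<ge>N. bder UNIV n d (\<lambda>x. pd b (s k) x - pd b (s l) x)"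
          using Suc.prems(2) bder_pd[OF _ b] unfolding pd1[symmetric] by meson
        show "bder UNIV m e (\<lambda>x. pd b (s k) x - pd b (s l) x)" if "N \<le> l" for l
          using bder_pd[OF Suc.prems(3)[OF that] b] unfolding pd1 .
      qed
      ultimately show "bder UNIV m e (pd b (\<lambda>x. s k x - lim (\<lambda>l. s l x)))" by simp
    qed
  qed
  define g where "g x = lim (\<lambda>l. s l x)" for x
  have conv: "\<exists>N. \<forall>k\<ge>N. bder UNIV m e (\<lambda>x. s k x - g x)" if e: "0 < e" for m e
  proof -
    obtain N where N: "\<And>k l. N \<le> k \<Longrightarrow> N \<le> l \<Longrightarrow> bder UNIV m e (\<lambda>x. s k x - s l x)" using cauchy e by blast
    have "bder UNIV m e (\<lambda>x. s k x - g x)" if "N \<le> k" for k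
      unfolding g_def by (rule bd[OF s cauchy N[OF that]])
    then show ?thesis by blast
  qed
  have "\<exists>M. bder UNIV m M g" for m
  proof -
    obtain N where N: "bder UNIV m 1 (\<lambda>x. s N x - g x)" using conv[of 1 m] by auto
    obtain M where M: "bder UNIV m M (s N)" using s by (rule bdd_smoothE)
    show ?thesis using bder_diff[OF M N] by auto
  qed
  then have "g \<in> bdd_smooth" by (simp add: bdd_smooth_iff)
  then show ?thesis using conv that by blast
qed

section \<open>The deformed algebra and its topology\<close>

context skew_map
begin

lemma star_algebra_bdd_smooth:
  "star_algebra (bdd_smooth :: ('a \<Rightarrow> 'c::cstar_algebra) set) (\<lambda>x. 0) (\<lambda>f g x. f x + g x) (\<lambda>c f x. c *\<^sub>C f x)
    (rieffel_prod J) (\<lambda>f x. star (f x))"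
proof
  have sm: "(\<lambda>x. c *\<^sub>C f x) \<in> bdd_smooth" if "f \<in> bdd_smooth" for c and f :: "'a \<Rightarrow> 'c"
    using that by (rule bdd_smooth_bounded_linear[OF scaleC.bounded_linear_right])
  show "(\<lambda>x. 0) \<in> (bdd_smooth :: ('a \<Rightarrow> 'c) set)" by (rule bdd_smooth_const)
  fix f g h :: "'a \<Rightarrow> 'c" and c d :: complex
  assume f: "f \<in> bdd_smooth"
  show "(\<lambda>x. c *\<^sub>C f x) \<in> bdd_smooth" by (rule sm[OF f])
  show "(\<lambda>x. star (f x)) \<in> bdd_smooth" by (rule bdd_smooth_star[OF f])
  show "(\<lambda>x. f x + 0) = f" "(\<lambda>x. 1 *\<^sub>C f x) = f" "(\<lambda>x. star (star (f x))) = f"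
    by (simp_all add: scaleC_one star_star)
  show "\<exists>y\<in>bdd_smooth. (\<lambda>x. f x + y x) = (\<lambda>x. 0)"
    using bdd_smooth_minus[OF f] by (intro bexI[of _ "\<lambda>x. - f x"]) auto
  show "(\<lambda>x. (c + d) *\<^sub>C f x) = (\<lambda>x. c *\<^sub>C f x + d *\<^sub>C f x)" by (simp add: scaleC_add_left)
  show "(\<lambda>x. c *\<^sub>C d *\<^sub>C f x) = (\<lambda>x. (c * d) *\<^sub>C f x)" by (simp add: scaleC_scaleC)
  show "(\<lambda>x. star (c *\<^sub>C f x)) = (\<lambda>x. cnj c *\<^sub>C star (f x))" by (simp add: star_scaleC)
  assume g: "g \<in> bdd_smooth"
  show "(\<lambda>x. f x + g x) \<in> bdd_smooth" by (rule bdd_smooth_add[OF f g])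
  show "rieffel_prod J f g \<in> bdd_smooth" unfolding rieffel_prod_eq[OF f g] by (rule tp_bdd_smooth[OF f g])
  show "(\<lambda>x. f x + g x) = (\<lambda>x. g x + f x)" by (simp add: add.commute)
  show "(\<lambda>x. c *\<^sub>C (f x + g x)) = (\<lambda>x. c *\<^sub>C f x + c *\<^sub>C g x)" by (simp add: scaleC_add_right)
  show "(\<lambda>x. star (f x + g x)) = (\<lambda>x. star (f x) + star (g x))" by (simp add: star_add)
  show "rieffel_prod J (\<lambda>x. c *\<^sub>C f x) g = (\<lambda>x. c *\<^sub>C rieffel_prod J f g x)"
    by (simp add: rieffel_prod_eq f g sm tp_scaleC_left)
  show "rieffel_prod J f (\<lambda>x. c *\<^sub>C g x) = (\<lambda>x. c *\<^sub>C rieffel_prod J f g x)"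
    by (simp add: rieffel_prod_eq f g sm tp_scaleC_right)
  show "(\<lambda>x. star (rieffel_prod J f g x)) = rieffel_prod J (\<lambda>x. star (g x)) (\<lambda>x. star (f x))"
    by (simp add: rieffel_prod_eq f g bdd_smooth_star star_tp)
  assume h: "h \<in> bdd_smooth"
  show "(\<lambda>x. f x + g x + h x) = (\<lambda>x. f x + (g x + h x))" by (simp add: add.assoc)
  show "rieffel_prod J (rieffel_prod J f g) h = rieffel_prod J f (rieffel_prod J g h)"
    by (simp add: rieffel_prod_eq f g h tp_bdd_smooth tp_assoc)
  show "rieffel_prod J (\<lambda>x. f x + g x) h = (\<lambda>x. rieffel_prod J f h x + rieffel_prod J g h x)"
    by (simp add: rieffel_prod_eq f g h bdd_smooth_add tp_add_left)
  show "rieffel_prod J f (\<lambda>x. g x + h x) = (\<lambda>x. rieffel_prod J f g x + rieffel_prod J f h x)"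
    by (simp add: rieffel_prod_eq f g h bdd_smooth_add tp_add_right)
qed

lemma bdd_smooth_norm_tp:
  obtains C where "0 \<le> C" "\<And>f g :: 'a \<Rightarrow> 'c::cstar_algebra. \<lbrakk>f \<in> bdd_smooth; g \<in> bdd_smooth\<rbrakk> \<Longrightarrow>
    bdd_smooth_norm m (tp f g) \<le> C * bdd_smooth_norm (m + 8 * DIM('a)) f * bdd_smooth_norm (m + 8 * DIM('a)) g"
proof -
  obtain C where C: "0 \<le> C" "\<And>(f :: 'a \<Rightarrow> 'c) g M M' m. \<lbrakk>f \<in> bdd_smooth; g \<in> bdd_smooth;
      bder UNIV (m + 8 * DIM('a)) M f; bder UNIV (m + 8 * DIM('a)) M' g\<rbrakk>
      \<Longrightarrow> bder UNIV m (2 ^ m * (C * M * M')) (tp f g)"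
    by (rule tp_bder[where ?'c = 'c]) blast
  show ?thesis
  proof (rule that)
    show "0 \<le> 2 ^ m * C" using C(1) by simp
    fix f g :: "'a \<Rightarrow> 'c" assume f: "f \<in> bdd_smooth" and g: "g \<in> bdd_smooth"
    note b = bder_bdd_smooth_norm[THEN iffD2, OF _ order_refl]
    have "bdd_smooth_norm m (tp f g) \<le>
        2 ^ m * (C * bdd_smooth_norm (m + 8 * DIM('a)) f * bdd_smooth_norm (m + 8 * DIM('a)) g)"
      unfolding bder_bdd_smooth_norm[OF tp_bdd_smooth[OF f g], symmetric] by (rule C(2)[OF f g b[OF f] b[OF g]])
    then show "bdd_smooth_norm m (tp f g) \<le>
        2 ^ m * C * bdd_smooth_norm (m + 8 * DIM('a)) f * bdd_smooth_norm (m + 8 * DIM('a)) g"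
      by (simp add: mult.assoc)
  qed
qed

lemma continuous_map_rieffel_prod:
  fixes T :: "('a \<Rightarrow> 'c::cstar_algebra) topology"
  defines "T \<equiv> fn_topology bdd_smooth_norm"
  shows "continuous_map (prod_topology T T) T (\<lambda>(f, g). rieffel_prod J f g)"
  unfolding T_def
proof (rule continuous_map_fn_topology_prod[OF grading_bdd_smooth_norm])
  note G = grading_bdd_smooth_norm[where ?'a = 'a and ?'c = 'c]
  fix f g :: "'a \<Rightarrow> 'c" and m and e :: real
  assume f: "f \<in> bdd_smooth" and g: "g \<in> bdd_smooth"
  show "rieffel_prod J f g \<in> bdd_smooth" unfolding rieffel_prod_eq[OF f g] by (rule tp_bdd_smooth[OF f g])
  assume e: "0 < e"
  define k where "k = m + 8 * DIM('a)"
  obtain C where C: "0 \<le> C" "\<And>f g :: 'a \<Rightarrow> 'c. \<lbrakk>f \<in> bdd_smooth; g \<in> bdd_smooth\<rbrakk> \<Longrightarrow>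
      bdd_smooth_norm m (tp f g) \<le> C * bdd_smooth_norm k f * bdd_smooth_norm k g"
    unfolding k_def by (rule bdd_smooth_norm_tp[where ?'c = 'c]) blast
  \<comment> \<open>From the splitting of \<open>f' g' - f g\<close> into
    \<open>(f' - f) g + f' (g' - g)\<close>; the 1 allows for the norm of \<open>f'\<close>, which
    exceeds that of \<open>f\<close> by less than \<open>d \<le> 1\<close>.\<close>
  define s where "s = C * (bdd_smooth_norm k f + 1 + bdd_smooth_norm k g)"
  define d where "d = min 1 (e / (s + 1))"
  have s: "0 \<le> s" unfolding s_def by (intro mult_nonneg_nonneg add_nonneg_nonneg C grading_nonneg[OF G] f g) simp
  have d: "0 < d" "d \<le> 1" "d * s < e"
  proof -
    show "0 < d" "d \<le> 1" using s e by (simp_all add: d_def)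
    have "d \<le> e / (s + 1)" by (simp add: d_def)
    then have "d * (s + 1) \<le> e" using s by (simp add: field_simps)
    then show "d * s < e" using \<open>0 < d\<close> by (simp add: distrib_left)
  qed
  have "bdd_smooth_norm m (\<lambda>t. rieffel_prod J f' g' t - rieffel_prod J f g t) < e"
    if f': "f' \<in> bdd_smooth" and g': "g' \<in> bdd_smooth"
      and fd: "bdd_smooth_norm k (\<lambda>t. f' t - f t) < d" and gd: "bdd_smooth_norm k (\<lambda>t. g' t - g t) < d" for f' g'
  proof -
    let ?u = "\<lambda>t. f' t - f t" and ?v = "\<lambda>t. g' t - g t"
    have u: "?u \<in> bdd_smooth" and v: "?v \<in> bdd_smooth" using bdd_smooth_diff f f' g g' by blast+
    have "tp f' g' = (\<lambda>t. tp f g t + (tp ?u g t + tp f' ?v t))"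
      using tp_add_right[OF f' g v] tp_add_left[OF f u g] by (auto simp: fun_eq_iff)
    then have eq: "(\<lambda>t. rieffel_prod J f' g' t - rieffel_prod J f g t) = (\<lambda>t. tp ?u g t + tp f' ?v t)"
      by (simp add: rieffel_prod_eq f g f' g')
    have "bdd_smooth_norm k f' \<le> bdd_smooth_norm k f + bdd_smooth_norm k ?u"
      using grading_add[OF G f u, of k] by simp
    then have n: "bdd_smooth_norm k f' \<le> bdd_smooth_norm k f + 1" using fd d(2) by linarith
    have "bdd_smooth_norm m (\<lambda>t. rieffel_prod J f' g' t - rieffel_prod J f g t) \<le>
        C * bdd_smooth_norm k ?u * bdd_smooth_norm k g + C * bdd_smooth_norm k f' * bdd_smooth_norm k ?v"
      unfolding eq using grading_add[OF G tp_bdd_smooth[OF u g] tp_bdd_smooth[OF f' v], of m] C(2)[OF u g] C(2)[OF f' v]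
      by linarith
    also have "C * bdd_smooth_norm k ?u * bdd_smooth_norm k g \<le> C * d * bdd_smooth_norm k g"
      using fd by (intro mult_right_mono mult_left_mono C grading_nonneg[OF G] g) simp
    also have "C * bdd_smooth_norm k f' * bdd_smooth_norm k ?v \<le> C * (bdd_smooth_norm k f + 1) * d"
      using gd n by (intro mult_mono C grading_nonneg[OF G] g mult_left_mono mult_nonneg_nonneg add_nonneg_nonneg f v) simp_all
    finally show ?thesis using d(3) by (simp add: s_def algebra_simps)
  qed
  then show "\<exists>k. \<exists>d>0. \<forall>f'\<in>bdd_smooth. \<forall>g'\<in>bdd_smooth. bdd_smooth_norm k (\<lambda>t. f' t - f t) < d \<longrightarrow>
      bdd_smooth_norm k (\<lambda>t. g' t - g t) < d \<longrightarrow>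
      bdd_smooth_norm m (\<lambda>t. rieffel_prod J f' g' t - rieffel_prod J f g t) < e"
    using d(1) by blast
qed

lemma frechet_star_algebra_bdd_smooth:
  "frechet_star_algebra (bdd_smooth :: ('a \<Rightarrow> 'c::cstar_algebra) set) (\<lambda>x. 0) (\<lambda>f g x. f x + g x)
    (\<lambda>c f x. c *\<^sub>C f x) (rieffel_prod J) (\<lambda>f x. star (f x)) bdd_smooth_topology"
proof -
  note G = grading_bdd_smooth_norm[where ?'a = 'a and ?'c = 'c]
  note SA = star_algebra_bdd_smooth[where ?'c = 'c]
  note b = bder_bdd_smooth_norm[THEN iffD1]
  show ?thesis unfolding bdd_smooth_topology_def
  proof (intro frechet_star_algebra.intro SA frechet_star_algebra_axioms.intro)
    show "topspace (fn_topology (bdd_smooth_norm :: nat \<Rightarrow> ('a \<Rightarrow> 'c) \<Rightarrow> real)) = bdd_smooth"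
      by (rule topspace_fn_topology[OF G])
    show "continuous_map (prod_topology euclidean (fn_topology bdd_smooth_norm)) (fn_topology bdd_smooth_norm)
        (\<lambda>(c, f :: 'a \<Rightarrow> 'c) x. c *\<^sub>C f x)" by (rule continuous_map_fn_topology_scaleC[OF G])
    show "continuous_map (prod_topology (fn_topology bdd_smooth_norm) (fn_topology bdd_smooth_norm)) (fn_topology bdd_smooth_norm)
        (\<lambda>(f, g :: 'a \<Rightarrow> 'c). rieffel_prod J f g)" by (rule continuous_map_rieffel_prod)
    show "continuous_map (prod_topology (fn_topology bdd_smooth_norm) (fn_topology bdd_smooth_norm)) (fn_topology bdd_smooth_norm)
        (\<lambda>(f, g :: 'a \<Rightarrow> 'c) x. f x + g x)"
    proof (rule continuous_map_fn_topology_prod[OF G bdd_smooth_add])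
      fix f g :: "'a \<Rightarrow> 'c" and m and e :: real
      assume f: "f \<in> bdd_smooth" and g: "g \<in> bdd_smooth" and e: "0 < e"
      have "bdd_smooth_norm m (\<lambda>t. f' t + g' t - (f t + g t)) < e"
        if f': "f' \<in> bdd_smooth" and g': "g' \<in> bdd_smooth"
          and d: "bdd_smooth_norm m (\<lambda>t. f' t - f t) < e / 2" "bdd_smooth_norm m (\<lambda>t. g' t - g t) < e / 2" for f' g'
        using grading_add[OF G bdd_smooth_diff[OF f' f] bdd_smooth_diff[OF g' g], of m] d by (simp add: algebra_simps)
      then show "\<exists>k. \<exists>d>0. \<forall>f'\<in>bdd_smooth. \<forall>g'\<in>bdd_smooth. bdd_smooth_norm k (\<lambda>t. f' t - f t) < d \<longrightarrow>
          bdd_smooth_norm k (\<lambda>t. g' t - g t) < d \<longrightarrow> bdd_smooth_norm m (\<lambda>t. f' t + g' t - (f t + g t)) < e"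
        using half_gt_zero[OF e] by blast
    qed
    show "continuous_map (fn_topology bdd_smooth_norm) (fn_topology bdd_smooth_norm) (\<lambda>(f :: 'a \<Rightarrow> 'c) x. star (f x))"
    proof (rule continuous_map_fn_topology[OF G])
      fix f :: "'a \<Rightarrow> 'c" and m and e :: real
      assume "f \<in> topspace (fn_topology bdd_smooth_norm)"
      then have f: "f \<in> bdd_smooth" by (simp add: topspace_fn_topology[OF G])
      show "(\<lambda>x. star (f x)) \<in> bdd_smooth" by (rule bdd_smooth_star[OF f])
      assume e: "0 < e"
      have "bdd_smooth_norm m (\<lambda>t. star (g t) - star (f t)) < e" if g: "g \<in> fball bdd_smooth_norm m f e" for g
      proof -
        have gs: "g \<in> bdd_smooth" and n: "bdd_smooth_norm m (\<lambda>t. g t - f t) < e" using g by (simp_all add: fball_def)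
        note ds = bdd_smooth_diff[OF gs f]
        have "bdd_smooth_norm m (\<lambda>t. star (g t - f t)) \<le> bdd_smooth_norm m (\<lambda>t. g t - f t)"
          by (rule b[OF bdd_smooth_star[OF ds] bder_star]) (simp add: bder_bdd_smooth_norm[OF ds])
        then show ?thesis using n by (simp add: linear_diff[OF bounded_linear.linear[OF bounded_linear_star]])
      qed
      then show "\<exists>W. openin (fn_topology bdd_smooth_norm) W \<and> f \<in> W \<and>
          (\<forall>g\<in>W. bdd_smooth_norm m (\<lambda>t. star (g t) - star (f t)) < e)"
        using openin_fball[OF G f] centre_in_fball[OF G f e] by blast
    qed
    show "metrizable_space (fn_topology (bdd_smooth_norm :: nat \<Rightarrow> ('a \<Rightarrow> 'c) \<Rightarrow> real))"
    proof (rule metrizable_fn_topology[OF G])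
      fix f :: "'a \<Rightarrow> 'c" assume f: "f \<in> bdd_smooth" and n: "\<And>m. bdd_smooth_norm m f = 0"
      have "bder UNIV 0 0 f" unfolding bder_bdd_smooth_norm[OF f] by (simp add: n)
      then show "f = (\<lambda>x. 0)" by auto
    qed
    fix U :: "('a \<Rightarrow> 'c) set"
    assume U: "openin (fn_topology bdd_smooth_norm) U" "(\<lambda>x. 0) \<in> U"
    obtain m e where e: "0 < e" "fball bdd_smooth_norm m (\<lambda>x. 0) e \<subseteq> U"
      using U unfolding openin_fn_topology[OF G] by blast
    have "star_algebra.convex_subset bdd_smooth (\<lambda>f g x. f x + g x) (\<lambda>c f x. c *\<^sub>C f x)
        (fball bdd_smooth_norm m (\<lambda>x. 0 :: 'c) e :: ('a \<Rightarrow> 'c) set)"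
      unfolding star_algebra.convex_subset_def[OF SA]
    proof (intro conjI ballI allI impI fball_subset[OF G])
      fix f g :: "'a \<Rightarrow> 'c" and t :: real
      assume "f \<in> fball bdd_smooth_norm m (\<lambda>x. 0) e" "g \<in> fball bdd_smooth_norm m (\<lambda>x. 0) e" and t: "0 \<le> t \<and> t \<le> 1"
      then have f: "f \<in> bdd_smooth" "bdd_smooth_norm m f < e" and g: "g \<in> bdd_smooth" "bdd_smooth_norm m g < e"
        by (simp_all add: fball_def)
      have sm: "(\<lambda>x. c *\<^sub>C f x) \<in> bdd_smooth" if "f \<in> bdd_smooth" for c and f :: "'a \<Rightarrow> 'c"
        using that by (rule bdd_smooth_bounded_linear[OF scaleC.bounded_linear_right])
      have "bdd_smooth_norm m (\<lambda>x. of_real (1 - t) *\<^sub>C f x + of_real t *\<^sub>C g x) \<le>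
          cmod (of_real (1 - t)) * bdd_smooth_norm m f + cmod (of_real t) * bdd_smooth_norm m g"
        using grading_add[OF G sm[OF f(1), of "of_real (1 - t)"] sm[OF g(1), of "of_real t"], of m]
          grading_scaleC[OF G f(1), of m "of_real (1 - t)"] grading_scaleC[OF G g(1), of m "of_real t"] by linarith
      also have "\<dots> = (1 - t) * bdd_smooth_norm m f + t * bdd_smooth_norm m g" using t by (simp del: of_real_diff)
      also have "\<dots> < e" using convex_bound_lt[OF f(2) g(2), of "1 - t" t] t by simp
      finally show "(\<lambda>x. of_real (1 - t) *\<^sub>C f x + of_real t *\<^sub>C g x) \<in> fball bdd_smooth_norm m (\<lambda>x. 0) e"
        by (simp add: fball_def bdd_smooth_add sm f g)
    qed
    then show "\<exists>V W. openin (fn_topology bdd_smooth_norm) W \<and> (\<lambda>x. 0) \<in> W \<and> W \<subseteq> V \<and> V \<subseteq> U \<and>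
        star_algebra.convex_subset bdd_smooth (\<lambda>f g x. f x + g x) (\<lambda>c f x. c *\<^sub>C f x) V"
      using openin_fball[OF G bdd_smooth_const] centre_in_fball[OF G bdd_smooth_const e(1)] e(2)
      by (intro exI[of _ "fball bdd_smooth_norm m (\<lambda>x. 0) e"] conjI subset_refl)
  next
    fix s :: "nat \<Rightarrow> 'a \<Rightarrow> 'c"
    assume s: "\<And>k. s k \<in> bdd_smooth"
      and cauchy: "\<And>U. \<lbrakk>openin (fn_topology bdd_smooth_norm) U; (\<lambda>x. 0) \<in> U\<rbrakk> \<Longrightarrow>
        \<exists>N. \<forall>k\<ge>N. \<forall>l\<ge>N. (\<lambda>x. s k x + (- 1) *\<^sub>C s l x) \<in> U"
    have "\<exists>N. \<forall>k\<ge>N. \<forall>l\<ge>N. bder UNIV m e (\<lambda>x. s k x - s l x)" if e: "0 < e" for m e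
    proof -
      have "\<exists>N. \<forall>k\<ge>N. \<forall>l\<ge>N. (\<lambda>x. s k x + (- 1) *\<^sub>C s l x) \<in> fball bdd_smooth_norm m (\<lambda>x. 0) e"
        by (rule cauchy[OF openin_fball[OF G bdd_smooth_const] centre_in_fball[OF G bdd_smooth_const e]])
      then obtain N where N: "\<forall>k\<ge>N. \<forall>l\<ge>N. (\<lambda>x. s k x + (- 1) *\<^sub>C s l x) \<in> fball bdd_smooth_norm m (\<lambda>x. 0) e" by blast
      have "bder UNIV m e (\<lambda>x. s k x - s l x)" if "N \<le> k" "N \<le> l" for k l
        using N that unfolding bder_bdd_smooth_norm[OF bdd_smooth_diff[OF s s]]
        by (auto simp: fball_def scaleC_uminus_one intro: less_imp_le)
      then show ?thesis by blast
    qed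
    then have "\<forall>m. \<forall>e>0. \<exists>N. \<forall>k\<ge>N. \<forall>l\<ge>N. bder UNIV m e (\<lambda>x. s k x - s l x)" by blast
    from bdd_smooth_complete[OF s this] obtain g where g: "g \<in> bdd_smooth"
      "\<And>m e. 0 < e \<Longrightarrow> \<exists>N. \<forall>k\<ge>N. bder UNIV m e (\<lambda>x. s k x - g x)" by metis
    have "limitin (fn_topology bdd_smooth_norm) s g sequentially"
      unfolding limitin_def topspace_fn_topology[OF G]
    proof (intro conjI allI impI g(1))
      fix U assume "openin (fn_topology bdd_smooth_norm) U \<and> g \<in> U"
      then obtain m e where e: "0 < e" "fball bdd_smooth_norm m g e \<subseteq> U"
        unfolding openin_fn_topology[OF G] by blast
      obtain N where N: "\<And>k. N \<le> k \<Longrightarrow> bder UNIV m (e / 2) (\<lambda>x. s k x - g x)"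
        using g(2)[OF half_gt_zero[OF e(1)]] by blast
      have "s k \<in> U" if "N \<le> k" for k
      proof -
        have "bdd_smooth_norm m (\<lambda>x. s k x - g x) \<le> e / 2" by (rule b[OF bdd_smooth_diff[OF s g(1)] N[OF that]])
        then have "s k \<in> fball bdd_smooth_norm m g e" using e(1) s by (simp add: fball_def)
        then show ?thesis using e(2) by blast
      qed
      then show "\<forall>\<^sub>F k in sequentially. s k \<in> U" unfolding eventually_sequentially by blast
    qed
    then show "\<exists>x\<in>bdd_smooth. limitin (fn_topology bdd_smooth_norm) s x sequentially" using g(1) by blast
  qed
qed

lemma grading_amnorm: "grading (amnorm :: nat \<Rightarrow> ('a \<Rightarrow> 'c::cstar_algebra) \<Rightarrow> real)"
  unfolding grading_def
proof (intro conjI allI ballI)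
  fix m c and f g :: "'a \<Rightarrow> 'c"
  assume f: "f \<in> bdd_smooth"
  have nn: "0 \<le> amnorm m f" if "f \<in> bdd_smooth" for m and f :: "'a \<Rightarrow> 'c"
    using good_amnorm[of m] that unfolding good_def by blast
  show "0 \<le> amnorm m f" by (rule nn[OF f])
  show "amnorm m f \<le> amnorm (Suc m) f"
    unfolding amnorm_Suc using sum_nonneg[of Basis "\<lambda>b. amnorm m (pd b f)"] nn[OF bdd_smooth_pd[OF f]] by simp
  show "amnorm m (\<lambda>x. c *\<^sub>C f x) \<le> cmod c * amnorm m f"
    using good_scaleC[OF good_amnorm f] by simp
  assume "g \<in> bdd_smooth"
  then show "amnorm m (\<lambda>x. f x + g x) \<le> amnorm m f + amnorm m g"
    using good_amnorm[of m] f unfolding good_def by blast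
qed

text \<open>The Frechet norms are dominated without loss, the new seminorms with a loss of
  \<open>10 * DIM('a)\<close> derivatives; equality of the topologies tolerates any loss that is
  finite for each \<open>m\<close>.\<close>

lemma bdd_smooth_topology_eq_amnorm:
  "(bdd_smooth_topology :: ('a \<Rightarrow> 'c::cstar_algebra) topology) = fn_topology amnorm"
  unfolding bdd_smooth_topology_def
proof (rule fn_topology_cong[OF grading_bdd_smooth_norm grading_amnorm])
  fix m
  show "\<exists>k C. 0 < C \<and> (\<forall>f\<in>bdd_smooth. bdd_smooth_norm m f \<le> C * amnorm k (f :: 'a \<Rightarrow> 'c))"
    by (intro exI[of _ m] exI[of _ 1] conjI ballI)
      (simp_all add: bder_bdd_smooth_norm[THEN iffD1, OF _ amnorm_ge])
  obtain C where C: "0 \<le> C" "\<And>(f :: 'a \<Rightarrow> 'c) M. \<lbrakk>f \<in> bdd_smooth; bder UNIV (m + 10 * DIM('a)) M f\<rbrakk>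
    \<Longrightarrow> amnorm m f \<le> C * M" by (rule amnorm_le[where ?'c = 'c]) blast
  have "amnorm m f \<le> (C + 1) * bdd_smooth_norm (m + 10 * DIM('a)) f" if f: "f \<in> bdd_smooth" for f :: "'a \<Rightarrow> 'c"
    using C(2)[OF f bder_bdd_smooth_norm[THEN iffD2, OF f order_refl]]
      grading_nonneg[OF grading_bdd_smooth_norm f, of "m + 10 * DIM('a)"] by (simp add: distrib_right)
  then show "\<exists>k C. 0 < C \<and> (\<forall>f\<in>bdd_smooth. amnorm m (f :: 'a \<Rightarrow> 'c) \<le> C * bdd_smooth_norm k f)"
    using C(1) by (intro exI[of _ "m + 10 * DIM('a)"] exI[of _ "C + 1"]) auto
qed

theorem arens_michael_star_algebra_bdd_smooth:
  "arens_michael_star_algebra (bdd_smooth :: ('a \<Rightarrow> 'c::cstar_algebra) set) (\<lambda>x. 0) (\<lambda>f g x. f x + g x)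
    (\<lambda>c f x. c *\<^sub>C f x) (rieffel_prod J) (\<lambda>f x. star (f x)) bdd_smooth_topology"
proof (intro arens_michael_star_algebra.intro arens_michael_star_algebra_axioms.intro frechet_star_algebra_bdd_smooth)
  note SA = star_algebra_bdd_smooth[where ?'c = 'c]
  have "star_algebra.is_star_seminorm bdd_smooth (\<lambda>f g x. f x + g x) (\<lambda>c f x. c *\<^sub>C f x) (\<lambda>f x. star (f x))
        (amnorm m :: ('a \<Rightarrow> 'c) \<Rightarrow> real) \<and> star_algebra.submultiplicative bdd_smooth (rieffel_prod J) (amnorm m :: ('a \<Rightarrow> 'c) \<Rightarrow> real)" for m
    unfolding star_algebra.is_star_seminorm_def[OF SA] star_algebra.is_seminorm_def[OF SA]
      star_algebra.submultiplicative_def[OF SA]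
    using good_amnorm[of m, where ?'c = 'c] good_scaleC[OF good_amnorm[of m, where ?'c = 'c]]
    by (simp add: good_def rieffel_prod_eq)
  then show "\<exists>P. (\<forall>p\<in>P. star_algebra.is_star_seminorm bdd_smooth (\<lambda>f g x. f x + g x) (\<lambda>c f x. c *\<^sub>C f x) (\<lambda>f x. star (f x)) p
      \<and> star_algebra.submultiplicative bdd_smooth (rieffel_prod J) p) \<and>
      (bdd_smooth_topology :: ('a \<Rightarrow> 'c) topology) =
        seminorm_topology bdd_smooth (\<lambda>f g x. f x + g x) (\<lambda>c f x. c *\<^sub>C f x) P"
    unfolding bdd_smooth_topology_eq_amnorm by (intro exI[of _ "range amnorm"]) auto
qed

end

theorem mainTheorem4:
  fixes J :: "real ^ 'n \<Rightarrow> real ^ 'n"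
  assumes non_unital: "\<not> (\<exists>e::'c::cstar_algebra. \<forall>a. e * a = a \<and> a * e = a)"
    and linear: "linear J"
    and skew_symmetric: "\<And>x y. J x \<bullet> y = - (x \<bullet> J y)"
  shows "arens_michael_star_algebra
    (bdd_smooth :: (real ^ 'n \<Rightarrow> 'c) set)
    (\<lambda>x. 0) (\<lambda>f g x. f x + g x) (\<lambda>c f x. c *\<^sub>C f x)
    (rieffel_prod J) (\<lambda>f x. star (f x))
    bdd_smooth_topology"
proof -
  interpret skew_map J by (intro skew_map.intro linear_map.intro skew_map_axioms.intro linear skew_symmetric)
  show ?thesis by (rule arens_michael_star_algebra_bdd_smooth)
qed

end
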